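(* Assume that $B=\sum_{k=1}^\infty b_k\langle\cdot,e_k\rangle e_k$ where, for some $N\in\mathbb{N}$, $b_k>0$ for all $k\in\{1,\dots,N\}$, and $\frac12(N+1)^2-\lambda>0$. Then for any $c\in(-1,1)$ the limit semigroup $(P^c_t)_{t\ge0}$ on $\mathrm{H}_c$ has the asymptotic strong Feller property.
   Context: Setting. $\langle\cdot,\cdot\rangle$ is the scalar product of $L^2(0,1)$. $A$ is the Laplace operator on $L^2(0,1)$ with Neumann boundary conditions, $D(A)=\{h\in W^{2,2}(0,1): h'(0)=h'(1)=0\}$, with complete orthonormal system of eigenvectors $(e_i)_{i\ge 0}$, $e_0=1$, $e_i(\theta)=\sqrt2\cos(i\pi\theta)$, and eigenvalues $\lambda_i=-(i\pi)^2$. For $\gamma\in\mathbb{R}$, $V_\gamma=D((-A)^{\gamma/2})$ (defined by interpolation/completion), and for $h=\sum_i h_ie_i$ set $\bar h=h_0$ (the average of $h$), $|h|_\gamma=\big(\sum_{i\ge1}(-\lambda_i)^\gamma h_i^2\big)^{1/2}$, $\|h\|_\gamma=(|h|_\gamma^2+\bar h^2)^{1/2}$. Put $\mathrm{H}=V_{-1}$ and, for $c\in\mathbb{R}$, $\mathrm{H}_c=\{h\in \mathrm{H}:\bar h=c\}$ with metric $|x-y|_{-1}$. $\mathcal{B}_b(\mathrm{H}_c)$ is the space of bounded Borel functions $\mathrm{H}_c\to\mathbb{R}$. Noise. $W$ is a cylindrical Wiener process on $L^2(0,1)$; $B$ is a covariance operator (nonnegative, self-adjoint; so $b_k\ge0$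 for all $k$) on $L^2(0,1)$ with $\sqrt B e_0=0$ and $\mathrm{Tr}_{-1}<+\infty$, where $\mathrm{Tr}_\gamma=\mathrm{Tr}[\sqrt B(-A)^\gamma\sqrt B^{*}]$. Approximated equation. Fix $\lambda\in\mathbb{R}$ and for $n\in\mathbb{N}$ let $f_n(u)=-2\sum_{k=0}^n\frac{u^{2k+1}}{2k+1}+\lambda u$. For $x\in \mathrm{H}$, $X^n=X^n(\cdot,x)$ is the unique solution, a.s. in $C([0,T];\mathrm{H})\cap L^{2n+2}((0,T)\times(0,1))$ for every $T>0$, of $$dX^n+\tfrac12\big(A^2X^n+Af_n(X^n)\big)dt=\sqrt B\,dW,\qquad X^n(0)=x.$$ The average of $X^n(t)$ does not depend on $t$. For $c\in\mathbb{R}$ set $P^{n,c}_t\varphi(x)=\mathbb{E}[\varphi(X^n(t,x))]$, $x\in \mathrm{H}_c$, $\varphi\in\mathcal{B}_b(\mathrm{H}_c)$. Limit semigroup. For $c\in(-1,1)$, $(P^c_t)_{t\ge0}$ denotes a transition semigroup on $\mathcal{B}_b(\mathrm{H}_c)$ obtained as limit along a subsequence $(n_k)$: $P^{n_k,c}_t\varphi(x)\to P^c_t\varphi(x)$ as $k\to\infty$ for all $\varphi\in\mathcal{B}_b(\mathrm{H}_c)$, $x\in \mathrm{H}_c$, $t\ge0$ (its existence is established in the paper). Asymptotic strong Feller property (Hairer–Mattingly). Let $E$ be a Polish space. A pseudo-metric on $E$ is a continuous symmetric function $d:E\times E\to[0,\infty)$ with $d(x,x)=0$ satisfying the triangle inequality.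 A sequence $(d_n)$ of pseudo-metrics is totally separating if it is nondecreasing in $n$ and $\lim_n d_n(x,y)=1$ for all $x\ne y$. For probability measures $\mu_1,\mu_2$ on $E$ let $\|\mu_1-\mu_2\|_{d}=\sup\{\int\varphi\,d\mu_1-\int\varphi\,d\mu_2\}$, the supremum being over $\varphi:E\to\mathbb{R}$ with $|\varphi(x)-\varphi(y)|\le d(x,y)$ for all $x,y$. A Markov semigroup $P_t$ on $E$ with transition probabilities $P_t(x,\cdot)$ is asymptotically strong Feller if for every $x\in E$ there exist a totally separating sequence of pseudo-metrics $(d_n)$ and a sequence $t_n>0$ such that $$\inf_{U}\limsup_{n\to\infty}\sup_{y\in U}\|P_{t_n}(x,\cdot)-P_{t_n}(y,\cdot)\|_{d_n}=0,$$ the infimum being over open neighbourhoods $U$ of $x$. *)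

theory Defs
  imports "HOL-Probability.Probability"
begin

section \<open>The space $L^2(0,1)$ and the Neumann Laplacian\<close>

abbreviation leb01 :: "real measure" where
  "leb01 \<equiv> restrict_space lborel {0<..<1}"

definition L2_01 :: "(real \<Rightarrow> real) set" where
  "L2_01 = {g \<in> borel_measurable leb01. integrable leb01 (\<lambda>\<theta>. (g \<theta>)\<^sup>2)}"

definition inner01 :: "(real \<Rightarrow> real) \<Rightarrow> (real \<Rightarrow> real) \<Rightarrow> real" where
  "inner01 g h = (LINT \<theta>|leb01. g \<theta> * h \<theta>)"

text \<open>
  The graph of \<open>A\<close>: \<open>h \<in> W\<^sup>2\<^sup>,\<^sup>2(0,1)\<close> with \<open>h'(0) = h'(1) = 0\<close> and \<open>h'' = g\<close>.  Membership in
  \<open>W\<^sup>2\<^sup>,\<^sup>2\<close> means that \<open>h\<close> is continuously differentiable with \<open>h'\<close> the primitive of an \<open>L\<^sup>2\<close>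
  function; on the left, \<open>h\<close> is the \<open>C\<^sup>1\<close> representative of its class.
\<close>

definition neumann_laplacian :: "(real \<Rightarrow> real) \<Rightarrow> (real \<Rightarrow> real) \<Rightarrow> bool" where
  "neumann_laplacian h g \<longleftrightarrow>
     g \<in> L2_01 \<and>
     (\<exists>h'. (\<forall>\<theta>\<in>{0..1}. (h has_real_derivative h' \<theta>) (at \<theta> within {0..1})) \<and>
           (\<forall>\<theta>\<in>{0..1}. h' \<theta> = h' 0 + (LINT s:{0..\<theta>}|lborel. g s)) \<and>
           h' 0 = 0 \<and> h' 1 = 0)"

definition eigfun :: "nat \<Rightarrow> real \<Rightarrow> real" where
  "eigfun i \<theta> = (if i = 0 then 1 else sqrt 2 * cos (real i * pi * \<theta>))"

definition eigval :: "nat \<Rightarrow> real" where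
  "eigval i = - (real i * pi)\<^sup>2"


section \<open>The scale $V_\gamma$ and the state spaces\<close>

text \<open>
  For \<open>\<gamma> < 0\<close> the elements of \<open>V\<^sub>\<gamma>\<close> are not functions, so \<open>h = (\<Sum>i. h\<^sub>i e\<^sub>i)\<close> is represented by
  its coefficient sequence, \<open>h 0\<close> being the average.
\<close>

definition V :: "real \<Rightarrow> (nat \<Rightarrow> real) set" where
  "V \<gamma> = {h. (\<lambda>i. (- eigval i) powr \<gamma> * (h i)\<^sup>2) summable_on {1..}}"

definition seminorm_V :: "real \<Rightarrow> (nat \<Rightarrow> real) \<Rightarrow> real" where
  "seminorm_V \<gamma> h = sqrt (\<Sum>\<^sub>\<infinity>i\<in>{1..}. (- eigval i) powr \<gamma> * (h i)\<^sup>2)"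

definition norm_V :: "real \<Rightarrow> (nat \<Rightarrow> real) \<Rightarrow> real" where
  "norm_V \<gamma> h = sqrt ((seminorm_V \<gamma> h)\<^sup>2 + (h 0)\<^sup>2)"

abbreviation H :: "(nat \<Rightarrow> real) set" where
  "H \<equiv> V (-1)"

definition Hc :: "real \<Rightarrow> (nat \<Rightarrow> real) set" where
  "Hc c = {h \<in> H. h 0 = c}"

definition dist_H :: "(nat \<Rightarrow> real) \<Rightarrow> (nat \<Rightarrow> real) \<Rightarrow> real" where
  "dist_H x y = norm_V (-1) (\<lambda>i. x i - y i)"

definition dist_Hc :: "(nat \<Rightarrow> real) \<Rightarrow> (nat \<Rightarrow> real) \<Rightarrow> real" where
  "dist_Hc x y = seminorm_V (-1) (\<lambda>i. x i - y i)"

definition top_H :: "(nat \<Rightarrow> real) topology" where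
  "top_H = Metric_space.mtopology H dist_H"

definition top_Hc :: "real \<Rightarrow> (nat \<Rightarrow> real) topology" where
  "top_Hc c = Metric_space.mtopology (Hc c) dist_Hc"

definition borel_of :: "'a topology \<Rightarrow> 'a measure" where
  "borel_of E = sigma (topspace E) {U. openin E U}"

definition bounded_borel :: "'a topology \<Rightarrow> ('a \<Rightarrow> real) set" where
  "bounded_borel E = {\<phi> \<in> borel_measurable (borel_of E). bounded (\<phi> ` topspace E)}"

text \<open>The duality between \<open>H\<close> and \<open>V\<^sub>1\<close>, the test function \<open>h \<in> V\<^sub>1\<close> being an actual function.\<close>

definition dual_pair :: "(nat \<Rightarrow> real) \<Rightarrow> (real \<Rightarrow> real) \<Rightarrow> real" where
  "dual_pair x h = (\<Sum>i. x i * inner01 h (eigfun i))"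


section \<open>Noise\<close>

text \<open>
  The graph of \<open>\<Sum>k\<ge>1. a\<^sub>k \<langle>\<cdot>, e\<^sub>k\<rangle> e\<^sub>k\<close>, the series converging in \<open>L\<^sup>2(0,1)\<close>.  The entry \<open>a\<^sub>0\<close> is not used.
  With \<open>B = diag_op b\<close> and \<open>b \<ge> 0\<close>, the square root of \<open>B\<close> is \<open>diag_op (\<lambda>k. sqrt (b k))\<close>; it vanishes
  on \<open>e\<^sub>0\<close>.
\<close>

definition diag_op :: "(nat \<Rightarrow> real) \<Rightarrow> (real \<Rightarrow> real) \<Rightarrow> (real \<Rightarrow> real) \<Rightarrow> bool" where
  "diag_op a h g \<longleftrightarrow>
     h \<in> L2_01 \<and> g \<in> L2_01 \<and>
     (\<lambda>m. LINT \<theta>|leb01. (g \<theta> - (\<Sum>k=1..m. a k * inner01 h (eigfun k) * eigfun k \<theta>))\<^sup>2)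
       \<longlonglongrightarrow> 0"

text \<open>\<open>Tr\<^sub>-\<^sub>1 < \<infinity>\<close>, the trace being computed in the basis \<open>(e\<^sub>i)\<close>; \<open>e\<^sub>0\<close> does not contribute.\<close>

definition finite_trace_minus1 :: "(nat \<Rightarrow> real) \<Rightarrow> bool" where
  "finite_trace_minus1 b \<longleftrightarrow> (\<lambda>k. b k * (- eigval k) powr (-1)) summable_on {1..}"

text \<open>
  A cylindrical Wiener process on \<open>L\<^sup>2(0,1)\<close> with respect to a filtration: a family of real Wiener
  processes \<open>t \<mapsto> W t g\<close> of covariance \<open>t \<parallel>g\<parallel>\<^sup>2\<close>, linear in \<open>g\<close>, where \<open>W t g\<close> stands for
  \<open>\<langle>W(t), g\<rangle>\<close>.
\<close>

definition cylindrical_wiener ::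
  "'w measure \<Rightarrow> (real \<Rightarrow> 'w measure) \<Rightarrow> (real \<Rightarrow> (real \<Rightarrow> real) \<Rightarrow> 'w \<Rightarrow> real) \<Rightarrow> bool" where
  "cylindrical_wiener M F W \<longleftrightarrow>
     (\<forall>t\<ge>0. \<forall>g\<in>L2_01. W t g \<in> borel_measurable (F t)) \<and>
     (\<forall>g\<in>L2_01. AE \<omega> in M. W 0 g \<omega> = 0) \<and>
     (\<forall>g\<in>L2_01. AE \<omega> in M. continuous_on {0..} (\<lambda>t. W t g \<omega>)) \<and>
     (\<forall>t\<ge>0. \<forall>g\<in>L2_01. \<forall>h\<in>L2_01. \<forall>\<alpha> \<beta>. AE \<omega> in M.
        W t (\<lambda>\<theta>. \<alpha> * g \<theta> + \<beta> * h \<theta>) \<omega> = \<alpha> * W t g \<omega> + \<beta> * W t h \<omega>) \<and>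
     (\<forall>t\<ge>0. \<forall>g\<in>L2_01. inner01 g g = 0 \<longrightarrow> (AE \<omega> in M. W t g \<omega> = 0)) \<and>
     (\<forall>s\<ge>0. \<forall>t>s. \<forall>g\<in>L2_01. inner01 g g > 0 \<longrightarrow>
        distributed M lborel (\<lambda>\<omega>. W t g \<omega> - W s g \<omega>)
          (normal_density 0 (sqrt ((t - s) * inner01 g g)))) \<and>
     (\<forall>s\<ge>0. \<forall>t>s. \<forall>g\<in>L2_01.
        prob_space.indep_set M (sets (F s))
          (sets (vimage_algebra (space M) (\<lambda>\<omega>. W t g \<omega> - W s g \<omega>) borel)))"

locale stochastic_basis = prob_space M + filtration "space M" F
  for M :: "'w measure" and F :: "real \<Rightarrow> 'w measure" +
  assumes filtration_sub: "\<And>t. sets (F t) \<subseteq> sets M"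


section \<open>The approximated equation\<close>

definition f_approx :: "real \<Rightarrow> nat \<Rightarrow> real \<Rightarrow> real" where
  "f_approx lam n u = - 2 * (\<Sum>k=0..n. u ^ (2 * k + 1) / real (2 * k + 1)) + lam * u"

text \<open>
  The path of coefficient sequences \<open>\<xi>\<close> is given on \<open>(0,T)\<close> by the function \<open>u\<close>, and \<open>u\<close> belongs to
  \<open>L\<^sup>p((0,T) \<times> (0,1))\<close>.
\<close>

definition path_in_Lp ::
  "nat \<Rightarrow> real \<Rightarrow> (real \<Rightarrow> nat \<Rightarrow> real) \<Rightarrow> (real \<times> real \<Rightarrow> real) \<Rightarrow> bool" where
  "path_in_Lp p T \<xi> u \<longleftrightarrow>
     u \<in> borel_measurable (restrict_space lborel ({0<..<T} \<times> {0<..<1})) \<and>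
     integrable (restrict_space lborel ({0<..<T} \<times> {0<..<1})) (\<lambda>z. \<bar>u z\<bar> ^ p) \<and>
     (AE t in lborel. 0 < t \<and> t < T \<longrightarrow> (\<forall>i. \<xi> t i = inner01 (\<lambda>\<theta>. u (t, \<theta>)) (eigfun i)))"

text \<open>
  Solutions of \<open>dX + 1/2 (A\<^sup>2 X + A f\<^sub>n(X)) dt = \<surd>B dW\<close>, \<open>X(0) = x\<close>, in the weak sense: the equation
  is tested against every \<open>h \<in> D(A\<^sup>2)\<close>, with \<open>Ah = A h\<close>, \<open>AAh = A\<^sup>2 h\<close> and \<open>\<psi> = \<surd>B h\<close>.  Under the
  integral, \<open>X(s)\<close> is the function \<open>u \<omega> (s, \<cdot>)\<close>.
\<close>

definition approx_solution ::
  "'w measure \<Rightarrow> (real \<Rightarrow> 'w measure) \<Rightarrow> (real \<Rightarrow> (real \<Rightarrow> real) \<Rightarrow> 'w \<Rightarrow> real) \<Rightarrow>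
   (nat \<Rightarrow> real) \<Rightarrow> real \<Rightarrow> nat \<Rightarrow> (nat \<Rightarrow> real) \<Rightarrow> (real \<Rightarrow> 'w \<Rightarrow> nat \<Rightarrow> real) \<Rightarrow> bool" where
  "approx_solution M F W b lam n x X \<longleftrightarrow>
     (\<forall>t\<ge>0. X t \<in> F t \<rightarrow>\<^sub>M borel_of top_H) \<and>
     (AE \<omega> in M. X 0 \<omega> = x) \<and>
     (\<exists>u. (AE \<omega> in M. \<forall>T>0.
              continuous_map (top_of_set {0..T}) top_H (\<lambda>t. X t \<omega>) \<and>
              path_in_Lp (2 * n + 2) T (\<lambda>t. X t \<omega>) (u \<omega>)) \<and>
          (\<forall>h Ah AAh \<psi>. \<forall>t\<ge>0.
              neumann_laplacian h Ah \<and> neumann_laplacian Ah AAh \<and>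
              diag_op (\<lambda>k. sqrt (b k)) h \<psi> \<longrightarrow>
              (AE \<omega> in M.
                 dual_pair (X t \<omega>) h +
                   1/2 * (LINT s:{0..t}|lborel.
                      inner01 (\<lambda>\<theta>. u \<omega> (s, \<theta>)) AAh +
                      inner01 (\<lambda>\<theta>. f_approx lam n (u \<omega> (s, \<theta>))) Ah) =
                 dual_pair x h + W t \<psi> \<omega>)))"

text \<open>
  \<open>\<phi>\<close> is only meaningful on \<open>H\<^sub>c\<close>, to which \<open>X\<^sup>n(t,x)\<close> belongs almost surely; it is extended by \<open>0\<close>.
\<close>

definition approx_semigroup ::
  "'w measure \<Rightarrow> (nat \<Rightarrow> (nat \<Rightarrow> real) \<Rightarrow> real \<Rightarrow> 'w \<Rightarrow> nat \<Rightarrow> real) \<Rightarrow> nat \<Rightarrow> real \<Rightarrow> real \<Rightarrow>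
   ((nat \<Rightarrow> real) \<Rightarrow> real) \<Rightarrow> (nat \<Rightarrow> real) \<Rightarrow> real" where
  "approx_semigroup M X n c t \<phi> x =
     (LINT \<omega>|M. (if X n x t \<omega> \<in> Hc c then \<phi> (X n x t \<omega>) else 0))"


section \<open>Markov semigroups and the asymptotic strong Feller property\<close>

definition markov_semigroup :: "'a topology \<Rightarrow> (real \<Rightarrow> 'a \<Rightarrow> 'a measure) \<Rightarrow> bool" where
  "markov_semigroup E P \<longleftrightarrow>
     (\<forall>t\<ge>0. P t \<in> borel_of E \<rightarrow>\<^sub>M prob_algebra (borel_of E)) \<and>
     (\<forall>x\<in>topspace E. P 0 x = return (borel_of E) x) \<and>
     (\<forall>s\<ge>0. \<forall>t\<ge>0. \<forall>x\<in>topspace E. P (s + t) x = P s x \<bind> P t)"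

definition limit_semigroup ::
  "'w measure \<Rightarrow> (nat \<Rightarrow> (nat \<Rightarrow> real) \<Rightarrow> real \<Rightarrow> 'w \<Rightarrow> nat \<Rightarrow> real) \<Rightarrow> real \<Rightarrow>
   (real \<Rightarrow> (nat \<Rightarrow> real) \<Rightarrow> (nat \<Rightarrow> real) measure) \<Rightarrow> bool" where
  "limit_semigroup M X c P \<longleftrightarrow>
     markov_semigroup (top_Hc c) P \<and>
     (\<exists>r :: nat \<Rightarrow> nat. strict_mono r \<and>
        (\<forall>\<phi>\<in>bounded_borel (top_Hc c). \<forall>x\<in>Hc c. \<forall>t\<ge>0.
           (\<lambda>k. approx_semigroup M X (r k) c t \<phi> x) \<longlonglongrightarrow> (LINT y|P t x. \<phi> y)))"

definition pseudo_metric :: "'a topology \<Rightarrow> ('a \<Rightarrow> 'a \<Rightarrow> real) \<Rightarrow> bool" where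
  "pseudo_metric E d \<longleftrightarrow>
     continuous_map (prod_topology E E) euclideanreal (\<lambda>(x, y). d x y) \<and>
     (\<forall>x\<in>topspace E. \<forall>y\<in>topspace E. 0 \<le> d x y \<and> d x y = d y x) \<and>
     (\<forall>x\<in>topspace E. d x x = 0) \<and>
     (\<forall>x\<in>topspace E. \<forall>y\<in>topspace E. \<forall>z\<in>topspace E. d x z \<le> d x y + d y z)"

definition totally_separating :: "'a topology \<Rightarrow> (nat \<Rightarrow> 'a \<Rightarrow> 'a \<Rightarrow> real) \<Rightarrow> bool" where
  "totally_separating E d \<longleftrightarrow>
     (\<forall>n. pseudo_metric E (d n)) \<and>
     (\<forall>x\<in>topspace E. \<forall>y\<in>topspace E. incseq (\<lambda>n. d n x y)) \<and>
     (\<forall>x\<in>topspace E. \<forall>y\<in>topspace E. x \<noteq> y \<longrightarrow> (\<lambda>n. d n x y) \<longlonglongrightarrow> 1)"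

text \<open>
  Only used for the members \<open>d\<close> of a totally separating sequence.  These are continuous and bounded
  by \<open>1\<close>, so that the functions \<open>\<phi>\<close> below are bounded and Borel.
\<close>

definition wasserstein ::
  "'a topology \<Rightarrow> ('a \<Rightarrow> 'a \<Rightarrow> real) \<Rightarrow> 'a measure \<Rightarrow> 'a measure \<Rightarrow> ereal" where
  "wasserstein E d \<mu>\<^sub>1 \<mu>\<^sub>2 =
     (SUP \<phi>\<in>{\<phi> :: 'a \<Rightarrow> real. \<forall>x\<in>topspace E. \<forall>y\<in>topspace E. \<bar>\<phi> x - \<phi> y\<bar> \<le> d x y}.
        ereal ((LINT x|\<mu>\<^sub>1. \<phi> x) - (LINT x|\<mu>\<^sub>2. \<phi> x)))"

definition asymptotically_strong_feller ::
  "'a topology \<Rightarrow> (real \<Rightarrow> 'a \<Rightarrow> 'a measure) \<Rightarrow> bool" where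
  "asymptotically_strong_feller E P \<longleftrightarrow>
     (\<forall>x\<in>topspace E. \<exists>d t. totally_separating E d \<and> (\<forall>n. t n > 0) \<and>
        (INF U\<in>{U. openin E U \<and> x \<in> U}.
           limsup (\<lambda>n :: nat. SUP y\<in>U. wasserstein E (d n) (P (t n) x) (P (t n) y))) = 0)"


section \<open>Consistency of the encoding\<close>

text \<open>\<open>(e\<^sub>i, \<lambda>\<^sub>i)\<close> are eigenpairs, and \<open>H\<close>, \<open>H\<^sub>c\<close> are metric spaces under the above distances.\<close>

lemma neumann_laplacian_eigfun: "neumann_laplacian (eigfun i) (\<lambda>\<theta>. eigval i * eigfun i \<theta>)"
proof -
  define h' where "h' = (\<lambda>\<theta>. if i = 0 then 0 else - (sqrt 2 * (real i * pi) * sin (real i * pi * \<theta>)))"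
  have cont: "continuous_on S (eigfun i)" for S
    unfolding eigfun_def by (cases "i = 0") (auto intro!: continuous_intros)
  have d0: "(eigfun i has_real_derivative h' \<theta>) (at \<theta> within S)" for \<theta> S
    unfolding h'_def eigfun_def
    by (cases "i = 0") (auto intro!: derivative_eq_intros simp: algebra_simps)
  have d1: "(h' has_real_derivative eigval i * eigfun i \<theta>) (at \<theta> within S)" for \<theta> S
    unfolding h'_def eigfun_def eigval_def
    by (cases "i = 0") (auto intro!: derivative_eq_intros simp: algebra_simps power2_eq_square)
  have "(LINT s:{0..\<theta>}|lborel. eigval i * eigfun i s) = h' \<theta> - h' 0" if "\<theta> \<ge> 0" for \<theta>
  proof -
    have "continuous_on {0..\<theta>} (\<lambda>s. eigval i * eigfun i s)"
      by (intro continuous_intros cont)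
    from integral_FTC_Icc[OF that _ this, of h'] d1 show ?thesis
      by (simp only: set_lebesgue_integral_def real_scaleR_def
            has_real_derivative_iff_has_vector_derivative)
  qed
  moreover have "(\<lambda>\<theta>. eigval i * eigfun i \<theta>) \<in> L2_01"
  proof -
    have m: "(\<lambda>\<theta>. eigval i * eigfun i \<theta>) \<in> borel_measurable borel"
      by (intro borel_measurable_continuous_onI continuous_intros cont)
    have "set_integrable lborel {0..1} (\<lambda>\<theta>. (eigval i * eigfun i \<theta>)\<^sup>2)"
      by (intro borel_integrable_atLeastAtMost' continuous_intros cont)
    then have "set_integrable lborel {0<..<1} (\<lambda>\<theta>. (eigval i * eigfun i \<theta>)\<^sup>2)"
      by (rule set_integrable_subset) auto
    then show ?thesis
      using m unfolding L2_01_def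
      by (auto simp: integrable_restrict_space set_integrable_def
               intro!: measurable_restrict_space1)
  qed
  moreover have "h' 0 = 0" "h' 1 = 0"
    by (auto simp: h'_def mult.commute)
  ultimately show ?thesis
    unfolding neumann_laplacian_def using d0 by (intro conjI exI[of _ h']) auto
qed

lemma weighted_l2_triangle:
  fixes w :: "nat \<Rightarrow> real"
  assumes w: "\<And>i. w i \<ge> 0"
    and a: "(\<lambda>i. w i * (a i)\<^sup>2) summable_on I" and b: "(\<lambda>i. w i * (b i)\<^sup>2) summable_on I"
  shows "(\<lambda>i. w i * (a i + b i)\<^sup>2) summable_on I"
    and "sqrt (\<Sum>\<^sub>\<infinity>i\<in>I. w i * (a i + b i)\<^sup>2)
           \<le> sqrt (\<Sum>\<^sub>\<infinity>i\<in>I. w i * (a i)\<^sup>2) + sqrt (\<Sum>\<^sub>\<infinity>i\<in>I. w i * (b i)\<^sup>2)"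
proof -
  let ?R = "sqrt (\<Sum>\<^sub>\<infinity>i\<in>I. w i * (a i)\<^sup>2) + sqrt (\<Sum>\<^sub>\<infinity>i\<in>I. w i * (b i)\<^sup>2)"
  have L: "L2_set (\<lambda>i. sqrt (w i) * c i) J = sqrt (\<Sum>i\<in>J. w i * (c i)\<^sup>2)"
    for c :: "nat \<Rightarrow> real" and J
    using w by (simp add: L2_set_def power_mult_distrib)
  have fin: "(\<Sum>i\<in>J. w i * (a i + b i)\<^sup>2) \<le> ?R\<^sup>2" if J: "finite J" "J \<subseteq> I" for J
  proof -
    have "sqrt (\<Sum>i\<in>J. w i * (a i + b i)\<^sup>2)
        \<le> sqrt (\<Sum>i\<in>J. w i * (a i)\<^sup>2) + sqrt (\<Sum>i\<in>J. w i * (b i)\<^sup>2)"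
      using L2_set_triangle_ineq[of "\<lambda>i. sqrt (w i) * a i" "\<lambda>i. sqrt (w i) * b i" J]
      unfolding distrib_left[symmetric] L .
    also have "\<dots> \<le> ?R"
      using w by (intro add_mono real_sqrt_le_mono finite_sum_le_infsum a b J) auto
    finally show ?thesis
      by (rule sqrt_le_D)
  qed
  show s: "(\<lambda>i. w i * (a i + b i)\<^sup>2) summable_on I"
    using w fin by (intro nonneg_bdd_above_summable_on bdd_aboveI[where M = "?R\<^sup>2"]) auto
  have "(\<Sum>\<^sub>\<infinity>i\<in>I. w i * (a i + b i)\<^sup>2) \<le> ?R\<^sup>2"
    by (rule infsum_le_finite_sums[OF s fin])
  then show "sqrt (\<Sum>\<^sub>\<infinity>i\<in>I. w i * (a i + b i)\<^sup>2) \<le> ?R"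
    using w by (intro real_le_lsqrt add_nonneg_nonneg real_sqrt_ge_zero infsum_nonneg) auto
qed

lemma
  assumes "x \<in> V \<gamma>" "y \<in> V \<gamma>"
  shows V_add: "(\<lambda>i. x i + y i) \<in> V \<gamma>"
    and seminorm_V_triangle: "seminorm_V \<gamma> (\<lambda>i. x i + y i) \<le> seminorm_V \<gamma> x + seminorm_V \<gamma> y"
  using assms weighted_l2_triangle[of "\<lambda>i. (- eigval i) powr \<gamma>" x "{1..}" y]
  by (auto simp: V_def seminorm_V_def)

lemma V_diff:
  assumes "x \<in> V \<gamma>" "y \<in> V \<gamma>"
  shows "(\<lambda>i. x i - y i) \<in> V \<gamma>"
  using V_add[of x \<gamma> "\<lambda>i. - y i"] assms by (simp add: V_def)

lemma seminorm_V_commute: "seminorm_V \<gamma> (\<lambda>i. x i - y i) = seminorm_V \<gamma> (\<lambda>i. y i - x i)"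
  by (simp add: seminorm_V_def power2_commute)

lemma seminorm_V_nonneg: "seminorm_V \<gamma> x \<ge> 0"
  by (auto simp: seminorm_V_def intro!: infsum_nonneg)

lemma seminorm_V_eq_0:
  assumes "x \<in> V \<gamma>"
  shows "seminorm_V \<gamma> x = 0 \<longleftrightarrow> (\<forall>i>0. x i = 0)"
proof
  assume "seminorm_V \<gamma> x = 0"
  then have *: "(\<Sum>\<^sub>\<infinity>i\<in>{1..}. (- eigval i) powr \<gamma> * (x i)\<^sup>2) = 0"
    by (simp add: seminorm_V_def)
  show "\<forall>i>0. x i = 0"
  proof (intro allI impI)
    fix i :: nat assume "i > 0"
    then have "(- eigval i) powr \<gamma> * (x i)\<^sup>2 = 0"
      using assms * by (intro nonneg_infsum_le_0D[where A = "{1..}" and x = i]) (auto simp: V_def)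
    then show "x i = 0"
      using \<open>i > 0\<close> by (simp add: eigval_def)
  qed
next
  assume "\<forall>i>0. x i = 0"
  then have "(\<Sum>\<^sub>\<infinity>i\<in>{1..}. (- eigval i) powr \<gamma> * (x i)\<^sup>2) = 0"
    by (intro infsum_0) auto
  then show "seminorm_V \<gamma> x = 0"
    by (simp add: seminorm_V_def)
qed

lemma Metric_space_Hc: "Metric_space (Hc c) dist_Hc"
proof
  fix x y z
  show "0 \<le> dist_Hc x y"
    by (simp add: dist_Hc_def seminorm_V_nonneg)
  show "dist_Hc x y = dist_Hc y x"
    unfolding dist_Hc_def by (rule seminorm_V_commute)
  assume xy: "x \<in> Hc c" "y \<in> Hc c"
  then have "dist_Hc x y = 0 \<longleftrightarrow> (\<forall>i>0. x i - y i = 0)"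
    unfolding dist_Hc_def by (intro seminorm_V_eq_0 V_diff) (auto simp: Hc_def)
  also have "\<dots> \<longleftrightarrow> x = y"
    using xy by (auto simp: Hc_def fun_eq_iff) (metis gr0I)
  finally show "dist_Hc x y = 0 \<longleftrightarrow> x = y" .
  assume "z \<in> Hc c"
  then show "dist_Hc x z \<le> dist_Hc x y + dist_Hc y z"
    using xy seminorm_V_triangle[of "\<lambda>i. x i - y i" "-1" "\<lambda>i. y i - z i"]
    by (auto simp: dist_Hc_def Hc_def intro: V_diff)
qed

lemma Metric_space_H: "Metric_space H dist_H"
proof
  fix x y z
  show "0 \<le> dist_H x y"
    by (simp add: dist_H_def norm_V_def)
  show "dist_H x y = dist_H y x"
    unfolding dist_H_def norm_V_def
    by (subst seminorm_V_commute) (simp add: power2_commute)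
  assume xy: "x \<in> H" "y \<in> H"
  have "dist_H x y = 0 \<longleftrightarrow> seminorm_V (-1) (\<lambda>i. x i - y i) = 0 \<and> x 0 = y 0"
    by (simp add: dist_H_def norm_V_def add_nonneg_eq_0_iff)
  also have "\<dots> \<longleftrightarrow> (\<forall>i>0. x i - y i = 0) \<and> x 0 = y 0"
    using seminorm_V_eq_0[OF V_diff[OF xy]] by simp
  also have "\<dots> \<longleftrightarrow> x = y"
    by (auto simp: fun_eq_iff) (metis gr0I)
  finally show "dist_H x y = 0 \<longleftrightarrow> x = y" .
  assume z: "z \<in> H"
  let ?s = "\<lambda>u v :: nat \<Rightarrow> real. seminorm_V (-1) (\<lambda>i. u i - v i)"
  have "?s x z \<le> ?s x y + ?s y z"
    using xy z seminorm_V_triangle[of "\<lambda>i. x i - y i" "-1" "\<lambda>i. y i - z i"]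
    by (auto intro: V_diff)
  then have "(?s x z)\<^sup>2 \<le> (?s x y + ?s y z)\<^sup>2"
    by (intro power_mono seminorm_V_nonneg)
  then have "dist_H x z \<le> sqrt ((?s x y + ?s y z)\<^sup>2 + ((x 0 - y 0) + (y 0 - z 0))\<^sup>2)"
    by (simp add: dist_H_def norm_V_def)
  also have "\<dots> \<le> dist_H x y + dist_H y z"
    unfolding dist_H_def norm_V_def by (rule real_sqrt_sum_squares_triangle_ineq)
  finally show "dist_H x z \<le> dist_H x y + dist_H y z" .
qed

end

theory Submission
  imports Defs
begin

text \<open>
  For fixed \<open>n\<close> the equation is approximated by an explicit Euler scheme for a Galerkin system whose
  nonlinearity is truncated at height \<open>R\<close> and evaluated at Fejer means. The Fejer weights keep the
  dissipativity of the drift, and since Fejer means converge in \<open>L\<^sup>2\<^sup>n\<^sup>+\<^sup>2\<close>, a Gronwall argument gives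
  pathwise convergence to \<open>X\<^sup>n\<close> as first the mesh tends to \<open>0\<close>, then \<open>R \<rightarrow> \<infinity>\<close>, then the dimension
  tends to \<open>\<infinity>\<close>.

  In the \<open>H\<^sup>-\<^sup>1\<close> metric the drift of the scheme contracts the modes above \<open>N\<close>, because
  \<open>\<mu> (\<mu> - max \<lambda> 0) > 0\<close> for the eigenvalues \<open>-\<mu>\<close> with index larger than \<open>N\<close>, and the remaining
  modes are driven by nondegenerate noise. Steering these modes by a linear feedback makes two copies
  of the chain contract exponentially; the price is the relative entropy of Gaussian shifts, which is
  quadratic in the distance. This gives an asymptotic log-Harnack inequality whose constants do not
  depend on \<open>n\<close>, \<open>R\<close>, the mesh or the dimension, and hence, for \<open>\<bar>\<phi>\<bar> \<le> 1\<close> with Lipschitz constant \<open>L\<close>,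
  the bound \<open>\<bar>P\<^sub>t \<phi> x - P\<^sub>t \<phi> y\<bar> \<le> (1 + C + \<surd>2 L exp (- \<delta> t / 2)) r\<close> whenever \<open>x\<close> and \<open>y\<close> have
  distance at most \<open>r \<le> 1\<close>. It passes to the limit semigroup and yields the claim for the pseudo-metrics
  \<open>min 1 (n d)\<close> and times proportional to \<open>n + 1\<close>.
\<close>

section \<open>The cosine basis\<close>


text \<open>Time is discretised so that no stochastic calculus is needed: each Euler step adds
  independent one-dimensional Gaussians, and a change of measure is a shift of a normal density. The
  cost C r^2 of two copies at distance r reproduces itself: contraction of r^2 by the factor a
  leaves C a r^2, and the entropy of the step adds at most C (1 - a) r^2, so nothing accumulates
  over many steps.

  A sharp cut-off of the modes would also keep monotonicity, but convergence of partial sums in L^p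
  is deep. Fejer means converge by elementary means, because their kernel is positive with mass 1;
  the price is that their weights enter the norm, see \<open>gw\<close>.

  A solution is known only through an almost sure identity for each time and test function, and the
  noise only through the scalar processes \<open>W t g\<close>. Hence the pathwise arguments use
  rational multiples of the final time, and joint laws of increments are recovered from linear
  combinations by Levy's uniqueness theorem.\<close>

definition mu :: "nat \<Rightarrow> real" where "mu i = (real i * pi)\<^sup>2"

lemma eigval_mu: "eigval i = - mu i"
  by (simp add: eigval_def mu_def)

lemma mu_pos: "i \<ge> 1 \<Longrightarrow> mu i > 0"
  by (simp add: mu_def)

lemma mu_mono: "i \<le> j \<Longrightarrow> mu i \<le> mu j"
  by (simp add: mu_def power_mono mult_right_mono)

lemma prob_space_leb01: "prob_space leb01"
  by (rule prob_spaceI) (simp add: emeasure_restrict_space space_restrict_space)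

interpretation leb01: prob_space leb01
  by (rule prob_space_leb01)

lemma prob_leb01 [simp]: "leb01.prob {0<..<1} = 1"
  using leb01.prob_space by (simp add: space_restrict_space)

lemma measurable_leb01:
  "v \<in> borel_measurable borel \<Longrightarrow> v \<in> borel_measurable leb01"
  by (simp add: measurable_restrict_space1)

lemma eigfun_measurable [measurable]: "eigfun i \<in> borel_measurable borel"
proof -
  have "continuous_on UNIV (eigfun i)"
    unfolding eigfun_def by (cases "i = 0") (auto intro!: continuous_intros)
  then show ?thesis
    by (rule borel_measurable_continuous_onI)
qed

lemma abs_eigfun_le: "\<bar>eigfun i \<theta>\<bar> \<le> sqrt 2"
proof -
  have "\<bar>sqrt 2 * cos (real i * pi * \<theta>)\<bar> \<le> sqrt 2"
    by (simp add: abs_mult)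
  then show ?thesis
    by (auto simp: eigfun_def)
qed

lemma sqrt2_le2: "sqrt 2 \<le> (2::real)"
  by (rule real_le_lsqrt) auto

lemma abs_eigfun_le2: "\<bar>eigfun i \<theta>\<bar> \<le> 2"
  using abs_eigfun_le[of i \<theta>] sqrt2_le2 by linarith

lemma leb01_AE_mem: "AE \<theta> in leb01. 0 < \<theta> \<and> \<theta> < 1"
  by (rule AE_I2) (simp add: space_restrict_space)

lemma integrable_eigfun_mult:
  assumes "integrable leb01 v"
  shows "integrable leb01 (\<lambda>\<theta>. v \<theta> * eigfun i \<theta>)"
proof (rule Bochner_Integration.integrable_bound[where f="\<lambda>\<theta>. 2 * v \<theta>"])
  have [measurable]: "v \<in> borel_measurable leb01" "eigfun i \<in> borel_measurable leb01"
    using assms by (auto intro: measurable_leb01 eigfun_measurable)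
  show "(\<lambda>\<theta>. v \<theta> * eigfun i \<theta>) \<in> borel_measurable leb01" by measurable
  have "\<bar>v \<theta>\<bar> * \<bar>eigfun i \<theta>\<bar> \<le> \<bar>v \<theta>\<bar> * 2" for \<theta>
    by (intro mult_left_mono abs_eigfun_le2) auto
  then show "AE \<theta> in leb01. norm (v \<theta> * eigfun i \<theta>) \<le> norm (2 * v \<theta>)"
    by (auto simp: abs_mult mult.commute)
qed (use assms in auto)

lemma integrable_leb01_bounded:
  assumes "v \<in> borel_measurable borel" "\<And>\<theta>. \<bar>v \<theta>\<bar> \<le> (B::real)"
  shows "integrable leb01 v"
  by (rule leb01.integrable_const_bound[where B=B]) (use assms in \<open>auto intro: measurable_leb01\<close>)

lemma integrable_eigfun: "integrable leb01 (eigfun i)"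
  by (rule integrable_leb01_bounded[OF _ abs_eigfun_le]) measurable

lemma integral_leb01_cos:
  fixes k :: int
  assumes "k \<noteq> 0"
  shows "(LINT \<theta>|leb01. cos (of_int k * pi * \<theta>)) = 0"
proof -
  let ?F = "\<lambda>\<theta>. sin (of_int k * pi * \<theta>) / (of_int k * pi)"
  have "(LINT \<theta>|leb01. cos (of_int k * pi * \<theta>))
      = (LINT \<theta>|lborel. indicator {0<..<1} \<theta> *\<^sub>R cos (of_int k * pi * \<theta>))"
    by (rule integral_restrict_space) simp
  also have "\<dots> = (LINT \<theta>|lborel. indicator {0..1} \<theta> *\<^sub>R cos (of_int k * pi * \<theta>))"
  proof (rule integral_cong_AE)
    show "AE \<theta> in lborel. indicator {0<..<1} \<theta> *\<^sub>R cos (of_int k * pi * \<theta>)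
        = indicator {0..1} \<theta> *\<^sub>R cos (of_int k * pi * \<theta>)"
      using AE_lborel_singleton[of 0] AE_lborel_singleton[of 1]
      by eventually_elim (auto simp: indicator_def)
  qed measurable
  also have "\<dots> = ?F 1 - ?F 0"
  proof (rule integral_FTC_Icc)
    fix x :: real
    show "(?F has_vector_derivative cos (of_int k * pi * x)) (at x within {0..1})"
      unfolding has_real_derivative_iff_has_vector_derivative[symmetric]
      using assms by (auto intro!: derivative_eq_intros)
  qed (auto intro!: continuous_intros)
  also have "\<dots> = 0"
    using sin_npi_int[of k] by (simp add: mult.commute)
  finally show ?thesis .
qed

text \<open>Two different points are allowed because the identity serves twice: equal points give
  orthonormality, equal indices give the Fejer kernel in terms of \<open>\<theta> - \<tau>\<close>
  and \<open>\<theta> + \<tau>\<close>.\<close>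

lemma eigfun_mult_eigfun:
  assumes "i \<ge> 1" "j \<ge> 1"
  shows "eigfun i \<theta> * eigfun j \<tau> = cos (real i * pi * \<theta> - real j * pi * \<tau>) + cos (real i * pi * \<theta> + real j * pi * \<tau>)"
proof -
  have "eigfun i \<theta> * eigfun j \<tau> = (sqrt 2 * sqrt 2) * (cos (real i * pi * \<theta>) * cos (real j * pi * \<tau>))"
    using assms by (simp add: eigfun_def)
  then show ?thesis
    by (simp add: cos_times_cos)
qed

lemma inner01_eigfun: "inner01 (eigfun i) (eigfun j) = (if i = j then 1 else 0)"
proof -
  have int: "integrable leb01 (\<lambda>\<theta>. cos (of_int k * pi * \<theta>))" for k :: int
    by (rule integrable_leb01_bounded[where B=1]) auto
  \<comment> \<open>\<open>c\<close> collects the two normalisations; with it the product-to-sum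
    formula also covers index 0, where \<open>eigfun\<close> is constant.\<close>
  define c where "c = (if i = 0 then 1 else sqrt 2) * (if j = 0 then 1 else sqrt 2 :: real)"
  have "eigfun i \<theta> * eigfun j \<theta>
     = c/2 * (cos (of_int (int i - int j) * pi * \<theta>) + cos (of_int (int i + int j) * pi * \<theta>))" for \<theta>
  proof (cases "i = 0 \<or> j = 0")
    case True
    then show ?thesis by (auto simp: eigfun_def c_def)
  next
    case False
    then show ?thesis
      using eigfun_mult_eigfun[of i j \<theta> \<theta>] by (simp add: c_def algebra_simps)
  qed
  then have "inner01 (eigfun i) (eigfun j)
     = c/2 * ((LINT \<theta>|leb01. cos (of_int (int i - int j) * pi * \<theta>))
        + (LINT \<theta>|leb01. cos (of_int (int i + int j) * pi * \<theta>)))"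
    unfolding inner01_def using int[of "int i - int j"] int[of "int i + int j"]
    by (simp only: Bochner_Integration.integral_add integral_mult_right_zero)
  also have "\<dots> = (if i = j then 1 else 0)"
  proof (cases "i = j")
    case True
    then show ?thesis
      using integral_leb01_cos[of "int i + int j"] by (cases "i = 0") (auto simp: c_def leb01.prob_space)
  next
    case False
    then show ?thesis
      using integral_leb01_cos[of "int i + int j"] integral_leb01_cos[of "int i - int j"] by auto
  qed
  finally show ?thesis .
qed

lemma integral_eigfun: "(LINT \<theta>|leb01. eigfun i \<theta>) = (if i = 0 then 1 else 0)"
  using inner01_eigfun[of i 0] by (simp add: inner01_def eigfun_def[of 0])

section \<open>Fejer means of cosine series\<close>

text \<open>Cesaro weights: for positive \<open>m\<close>, \<open>fmean m\<close> is the average of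
  the first \<open>m\<close> partial sums of the cosine series, the constant term counting as the
  first.\<close>

definition fej :: "nat \<Rightarrow> nat \<Rightarrow> real" where
  "fej m i = 1 - real i / real m"

definition fkern :: "nat \<Rightarrow> real \<Rightarrow> real \<Rightarrow> real" where
  "fkern m \<theta> \<tau> = (\<Sum>i<m. fej m i * eigfun i \<theta> * eigfun i \<tau>)"

definition fmean :: "nat \<Rightarrow> (real \<Rightarrow> real) \<Rightarrow> real \<Rightarrow> real" where
  "fmean m v \<theta> = (\<Sum>i<m. fej m i * inner01 v (eigfun i) * eigfun i \<theta>)"

section \<open>Weights and kernel: positivity and off-diagonal decay\<close>

lemma fej_bounds: "i < m \<Longrightarrow> 0 < fej m i" "fej m i \<le> 1" "0 < m \<Longrightarrow> fej m 0 = 1"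
  by (auto simp: fej_def)

text \<open>Both sides are the squared modulus of a geometric sum of powers of \<open>cis x\<close>.
  In the induction the new term of index \<open>m\<close> contributes 1 and twice its correlations
  with the earlier terms, which \<open>j \<mapsto> m - j\<close> turns into a cosine sum.\<close>

lemma fejer_square:
  "real m + 2 * (\<Sum>i=1..<m. (real m - real i) * cos (real i * x))
     = (\<Sum>j<m. cos (real j * x))\<^sup>2 + (\<Sum>j<m. sin (real j * x))\<^sup>2"
proof (induction m)
  case (Suc m)
  let ?C = "\<Sum>j<m. cos (real j * x)" and ?S = "\<Sum>j<m. sin (real j * x)"
  have shift: "(\<Sum>j<m. cos (real j * x) * cos (real m * x) + sin (real j * x) * sin (real m * x))
      = (\<Sum>i=1..m. cos (real i * x))"
  proof -
    have "(\<Sum>j<m. cos (real j * x) * cos (real m * x) + sin (real j * x) * sin (real m * x))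
        = (\<Sum>j<m. cos (real (m - j) * x))"
      by (intro sum.cong refl)
         (simp add: of_nat_diff left_diff_distrib cos_diff mult.commute[of "cos (real m * x)"] mult.commute[of "sin (real m * x)"] del: mult_minus_left)
    also have "\<dots> = (\<Sum>i=1..m. cos (real i * x))"
      by (rule sum.reindex_bij_witness[where i="\<lambda>i. m - i" and j="\<lambda>j. m - j"]) auto
    finally show ?thesis .
  qed
  have step: "(\<Sum>i=1..<Suc m. (real (Suc m) - real i) * cos (real i * x))
      = (\<Sum>i=1..<m. (real m - real i) * cos (real i * x)) + (\<Sum>i=1..m. cos (real i * x))"
  proof (cases m)
    case (Suc k)
    then show ?thesis
      by (simp add: atLeastLessThanSuc_atLeastAtMost[symmetric] sum.distrib[symmetric] algebra_simps
          sum.atLeastLessThan_Suc)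
  qed simp
  have "(?C + cos (real m * x))\<^sup>2 + (?S + sin (real m * x))\<^sup>2
     = ?C\<^sup>2 + ?S\<^sup>2 + ((cos (real m * x))\<^sup>2 + (sin (real m * x))\<^sup>2)
       + 2 * (\<Sum>j<m. cos (real j * x) * cos (real m * x) + sin (real j * x) * sin (real m * x))"
    by (simp add: power2_sum sum.distrib sum_distrib_right sum_distrib_left algebra_simps del: sin_cos_squared_add)
  then show ?case
    using Suc.IH unfolding shift step by (simp add: algebra_simps)
qed simp

text \<open>The geometric sum telescopes after multiplication by \<open>1 - cis x\<close>, whose
  squared modulus is \<open>2 - 2 * cos x\<close>; what remains has modulus at most 2.\<close>

lemma fejer_square_bound:
  "((\<Sum>j<m. cos (real j * x))\<^sup>2 + (\<Sum>j<m. sin (real j * x))\<^sup>2) * (2 - 2 * cos x) \<le> 4"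
proof -
  let ?D = "\<Sum>j<m. cis x ^ j"
  have Re: "Re ?D = (\<Sum>j<m. cos (real j * x))" and Im: "Im ?D = (\<Sum>j<m. sin (real j * x))"
    by (simp_all add: Complex.DeMoivre)
  have "norm (1 - cis x) * norm ?D = norm (1 - cis x ^ m)"
    by (subst norm_mult[symmetric], subst one_diff_power_eq) simp
  also have "\<dots> \<le> 1 + 1"
    by (rule order_trans[OF norm_triangle_ineq4]) (simp add: norm_power)
  finally have "(norm (1 - cis x) * norm ?D)\<^sup>2 \<le> 2\<^sup>2"
    by (intro power_mono) auto
  moreover have "(norm (1 - cis x))\<^sup>2 = 2 - 2 * cos x"
    by (simp add: cmod_power2 power2_diff)
  moreover have "(norm ?D)\<^sup>2 = (\<Sum>j<m. cos (real j * x))\<^sup>2 + (\<Sum>j<m. sin (real j * x))\<^sup>2"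
    by (simp only: cmod_power2 Re Im)
  ultimately show ?thesis
    by (simp add: power_mult_distrib mult.commute)
qed

text \<open>The sum of squares makes positivity visible. The terms in
  \<open>\<theta> + \<tau>\<close> come from the even reflection of the interval that belongs to
  Neumann conditions.\<close>

lemma fkern_eq:
  assumes "m \<ge> 1"
  shows "fkern m \<theta> \<tau> = 1 / (2 * real m) *
    (((\<Sum>j<m. cos (real j * (pi * (\<theta> - \<tau>))))\<^sup>2 + (\<Sum>j<m. sin (real j * (pi * (\<theta> - \<tau>))))\<^sup>2) +
     ((\<Sum>j<m. cos (real j * (pi * (\<theta> + \<tau>))))\<^sup>2 + (\<Sum>j<m. sin (real j * (pi * (\<theta> + \<tau>))))\<^sup>2))"
proof -
  have e: "eigfun i \<theta> * eigfun i \<tau> = cos (real i * (pi * (\<theta> - \<tau>))) + cos (real i * (pi * (\<theta> + \<tau>)))"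
    if "i \<ge> 1" for i
    using eigfun_mult_eigfun[OF that that, of \<theta> \<tau>] by (simp add: algebra_simps)
  have "{..<m} = insert 0 {1..<m}"
    using assms by auto
  then have "fkern m \<theta> \<tau> = 1 + (\<Sum>i=1..<m. fej m i * (eigfun i \<theta> * eigfun i \<tau>))"
    using assms by (simp add: fkern_def fej_def eigfun_def[of 0] mult.assoc)
  also have "(\<Sum>i=1..<m. fej m i * (eigfun i \<theta> * eigfun i \<tau>)) = (\<Sum>i=1..<m. (real m - real i) / real m *
      (cos (real i * (pi * (\<theta> - \<tau>))) + cos (real i * (pi * (\<theta> + \<tau>)))))"
  proof (intro sum.cong refl)
    fix i assume i: "i \<in> {1..<m}"
    then have "fej m i = (real m - real i) / real m"
      by (simp add: fej_def field_simps)
    then show "fej m i * (eigfun i \<theta> * eigfun i \<tau>) = (real m - real i) / real m *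
      (cos (real i * (pi * (\<theta> - \<tau>))) + cos (real i * (pi * (\<theta> + \<tau>))))"
      using i by (simp only: e atLeastLessThan_iff)
  qed
  also have "1 + \<dots> = 1 / (2 * real m) * ((real m + 2 * (\<Sum>i=1..<m. (real m - real i) * cos (real i * (pi * (\<theta> - \<tau>)))))
     + (real m + 2 * (\<Sum>i=1..<m. (real m - real i) * cos (real i * (pi * (\<theta> + \<tau>))))))"
  proof -
    have "(\<Sum>i=1..<m. (real m - real i) / real m *
      (cos (real i * (pi * (\<theta> - \<tau>))) + cos (real i * (pi * (\<theta> + \<tau>)))))
      = ((\<Sum>i=1..<m. (real m - real i) * cos (real i * (pi * (\<theta> - \<tau>))))
         + (\<Sum>i=1..<m. (real m - real i) * cos (real i * (pi * (\<theta> + \<tau>))))) / real m"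
      by (simp only: sum.distrib[symmetric] sum_divide_distrib add_divide_distrib distrib_left times_divide_eq_left)
    then show ?thesis
      using assms by (simp add: field_simps)
  qed
  finally show ?thesis
    unfolding fejer_square .
qed

lemma fkern_nonneg: "m \<ge> 1 \<Longrightarrow> fkern m \<theta> \<tau> \<ge> 0"
  by (simp add: fkern_eq)

text \<open>Inside the unit interval, a separation of at least \<open>\<eta>\<close> keeps
  \<open>\<theta> - \<tau>\<close> and also \<open>\<theta> + \<tau>\<close> at distance
  \<open>\<eta>\<close> from the even integers, where the squares concentrate;
  \<open>fejer_square_bound\<close> then applies to both parts.\<close>

lemma fkern_decay:
  assumes m: "m \<ge> 1" and \<eta>: "0 < \<eta>" "\<eta> \<le> 1" and t: "0 < \<theta>" "\<theta> < 1" "0 < \<tau>" "\<tau> < 1"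
    and far: "\<bar>\<theta> - \<tau>\<bar> \<ge> \<eta>"
  shows "fkern m \<theta> \<tau> \<le> 4 / (2 - 2 * cos (pi * \<eta>)) / real m"
proof -
  let ?q = "\<lambda>y. (\<Sum>j<m. cos (real j * (pi * y)))\<^sup>2 + (\<Sum>j<m. sin (real j * (pi * y)))\<^sup>2"
  let ?a = "2 - 2 * cos (pi * \<eta>)"
  have "cos (pi * \<eta>) < cos 0"
    by (rule cos_monotone_0_pi) (use \<eta> in auto)
  then have a: "?a > 0" by simp
  have *: "?q y \<le> 4 / ?a" if y: "\<eta> \<le> \<bar>y\<bar>" "\<bar>y\<bar> \<le> 2 - \<eta>" for y
  proof -
    have "cos (pi * y) = cos (pi * \<bar>y\<bar>)"
      by (cases "y \<ge> 0") (auto simp: abs_if)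
    also have "\<dots> \<le> cos (pi * \<eta>)"
    proof (cases "\<bar>y\<bar> \<le> 1")
      case True
      then show ?thesis using y \<eta> by (intro cos_monotone_0_pi_le) auto
    next
      case False
      \<comment> \<open>Reflection at pi brings arguments beyond 1 back to the range where the
        cosine decreases.\<close>
      have "cos (pi * \<bar>y\<bar>) = cos (2 * pi - pi * \<bar>y\<bar>)"
        by (simp add: cos_diff)
      also have "\<dots> = cos (pi * (2 - \<bar>y\<bar>))"
        by (simp add: algebra_simps)
      also have "\<dots> \<le> cos (pi * \<eta>)"
        using y \<eta> False by (intro cos_monotone_0_pi_le) auto
      finally show ?thesis .
    qed
    finally have "?q y * ?a \<le> ?q y * (2 - 2 * cos (pi * y))"
      by (intro mult_left_mono) auto
    also have "\<dots> \<le> 4"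
      by (rule fejer_square_bound)
    finally show ?thesis
      using a by (simp add: pos_le_divide_eq)
  qed
  have "?q (\<theta> - \<tau>) + ?q (\<theta> + \<tau>) \<le> 4 / ?a + 4 / ?a"
    using far t by (intro add_mono *) auto
  then have "fkern m \<theta> \<tau> \<le> 1 / (2 * real m) * (4 / ?a + 4 / ?a)"
    unfolding fkern_eq[OF m] by (intro mult_left_mono) auto
  also have "\<dots> = 4 / ?a / real m"
    using m by (simp add: field_simps)
  finally show ?thesis .
qed

lemma integral_fkern:
  assumes "m \<ge> 1"
  shows "(LINT \<tau>|leb01. fkern m \<theta> \<tau>) = 1"
proof -
  have "(LINT \<tau>|leb01. fkern m \<theta> \<tau>) = (\<Sum>i<m. fej m i * eigfun i \<theta> * (LINT \<tau>|leb01. eigfun i \<tau>))"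
    unfolding fkern_def by (simp add: Bochner_Integration.integral_sum integrable_eigfun)
  also have "\<dots> = (\<Sum>i<m. if i = 0 then 1 else 0)"
    using assms by (intro sum.cong refl) (auto simp: integral_eigfun fej_def eigfun_def[of 0])
  finally show ?thesis
    using assms by simp
qed

section \<open>Fejer means as averages against a probability kernel\<close>

lemma fmean_measurable [measurable]: "fmean m v \<in> borel_measurable borel"
  unfolding fmean_def[abs_def] by measurable

lemma integrable_fmean: "integrable leb01 (fmean m v)"
  unfolding fmean_def by (intro Bochner_Integration.integrable_sum integrable_mult_right integrable_eigfun)

lemma integrable_fkern_mult:
  assumes "integrable leb01 v"
  shows "integrable leb01 (\<lambda>\<tau>. fkern m \<theta> \<tau> * v \<tau>)"
proof -
  have "integrable leb01 (\<lambda>\<tau>. \<Sum>i<m. fej m i * eigfun i \<theta> * (v \<tau> * eigfun i \<tau>))"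
    by (intro Bochner_Integration.integrable_sum integrable_mult_right integrable_eigfun_mult assms)
  then show ?thesis
    by (simp add: fkern_def sum_distrib_right sum_distrib_left mult_ac)
qed

lemma fmean_eq_integral:
  assumes "integrable leb01 v"
  shows "fmean m v \<theta> = (LINT \<tau>|leb01. fkern m \<theta> \<tau> * v \<tau>)"
proof -
  have "(LINT \<tau>|leb01. fkern m \<theta> \<tau> * v \<tau>)
      = (LINT \<tau>|leb01. (\<Sum>i<m. fej m i * eigfun i \<theta> * (v \<tau> * eigfun i \<tau>)))"
    by (simp add: fkern_def sum_distrib_right sum_distrib_left mult_ac)
  also have "\<dots> = (\<Sum>i<m. fej m i * eigfun i \<theta> * (LINT \<tau>|leb01. v \<tau> * eigfun i \<tau>))"
    using integrable_eigfun_mult[OF assms] by (subst Bochner_Integration.integral_sum) auto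
  also have "\<dots> = fmean m v \<theta>"
    by (simp add: fmean_def inner01_def mult_ac)
  finally show ?thesis ..
qed

lemma fmean_diff:
  assumes "integrable leb01 v" "integrable leb01 w"
  shows "fmean m (\<lambda>\<theta>. v \<theta> - w \<theta>) \<theta> = fmean m v \<theta> - fmean m w \<theta>"
  using integrable_fkern_mult[OF assms(1)] integrable_fkern_mult[OF assms(2)]
  by (simp add: fmean_eq_integral assms right_diff_distrib)

lemma fmean_add:
  assumes "integrable leb01 v" "integrable leb01 w"
  shows "fmean m (\<lambda>\<theta>. v \<theta> + w \<theta>) \<theta> = fmean m v \<theta> + fmean m w \<theta>"
  using integrable_fkern_mult[OF assms(1)] integrable_fkern_mult[OF assms(2)]
  by (simp add: fmean_eq_integral assms distrib_left)

lemma fmean_const: "m \<ge> 1 \<Longrightarrow> fmean m (\<lambda>_. a) \<theta> = a"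
  using integral_fkern[of m \<theta>] by (simp add: fmean_eq_integral)

lemma fmean_mono:
  assumes "m \<ge> 1" "integrable leb01 v" "integrable leb01 w" "\<And>\<theta>. 0 < \<theta> \<Longrightarrow> \<theta> < 1 \<Longrightarrow> v \<theta> \<le> w \<theta>"
  shows "fmean m v \<theta> \<le> fmean m w \<theta>"
  unfolding fmean_eq_integral[OF assms(2)] fmean_eq_integral[OF assms(3)]
proof (rule integral_mono_AE)
  show "AE \<tau> in leb01. fkern m \<theta> \<tau> * v \<tau> \<le> fkern m \<theta> \<tau> * w \<tau>"
    using leb01_AE_mem by eventually_elim (intro mult_left_mono fkern_nonneg assms, auto)
qed (intro integrable_fkern_mult assms)+

lemma abs_fmean_le:
  assumes "m \<ge> 1" "integrable leb01 v"
  shows "\<bar>fmean m v \<theta>\<bar> \<le> fmean m (\<lambda>\<tau>. \<bar>v \<tau>\<bar>) \<theta>"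
proof -
  have i: "integrable leb01 (\<lambda>\<tau>. \<bar>v \<tau>\<bar>)"
    using assms by simp
  have "fmean m v \<theta> \<le> fmean m (\<lambda>\<tau>. \<bar>v \<tau>\<bar>) \<theta>"
    by (intro fmean_mono assms i) auto
  moreover have "- fmean m v \<theta> \<le> fmean m (\<lambda>\<tau>. \<bar>v \<tau>\<bar>) \<theta>"
  proof -
    have "fmean m (\<lambda>\<tau>. 0 - v \<tau>) \<theta> \<le> fmean m (\<lambda>\<tau>. \<bar>v \<tau>\<bar>) \<theta>"
      using assms by (intro fmean_mono i) auto
    moreover have "fmean m (\<lambda>\<tau>. 0 - v \<tau>) \<theta> = 0 - fmean m v \<theta>"
      using assms by (subst fmean_diff) (auto simp: fmean_const)
    ultimately show ?thesis by simp
  qed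
  ultimately show ?thesis by linarith
qed

text \<open>Only the constant mode has a nonzero integral, and its weight is 1.\<close>

lemma integral_fmean:
  assumes "m \<ge> 1"
  shows "(LINT \<theta>|leb01. fmean m v \<theta>) = (LINT \<theta>|leb01. v \<theta>)"
proof -
  have "(LINT \<theta>|leb01. fmean m v \<theta>) = (\<Sum>i<m. fej m i * inner01 v (eigfun i) * (LINT \<theta>|leb01. eigfun i \<theta>))"
    unfolding fmean_def by (simp add: Bochner_Integration.integral_sum integrable_eigfun)
  also have "\<dots> = (\<Sum>i<m. if i = 0 then inner01 v (eigfun 0) else 0)"
    by (intro sum.cong refl) (auto simp: integral_eigfun fej_def)
  also have "\<dots> = (LINT \<theta>|leb01. v \<theta>)"
    using assms by (simp add: inner01_def eigfun_def)
  finally show ?thesis .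
qed

lemma integral_abs_fmean_le:
  assumes "m \<ge> 1" "integrable leb01 v"
  shows "(LINT \<theta>|leb01. \<bar>fmean m v \<theta>\<bar>) \<le> (LINT \<theta>|leb01. \<bar>v \<theta>\<bar>)"
proof -
  have "(LINT \<theta>|leb01. \<bar>fmean m v \<theta>\<bar>) \<le> (LINT \<theta>|leb01. fmean m (\<lambda>\<tau>. \<bar>v \<tau>\<bar>) \<theta>)"
    by (intro integral_mono integrable_abs integrable_fmean abs_fmean_le assms)
  also have "\<dots> = (LINT \<theta>|leb01. \<bar>v \<theta>\<bar>)"
    by (rule integral_fmean[OF assms(1)])
  finally show ?thesis .
qed

section \<open>Convergence in L1 for every integrable function\<close>

definition l1conv :: "(real \<Rightarrow> real) \<Rightarrow> bool" where
  "l1conv v \<longleftrightarrow> (\<lambda>m. LINT \<theta>|leb01. \<bar>v \<theta> - fmean m v \<theta>\<bar>) \<longlonglongrightarrow> 0"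

text \<open>The means are L1 contractions uniformly in \<open>m\<close>, so the functions with
  convergent means form a closed set.\<close>

lemma l1conv_approx:
  assumes v: "integrable leb01 v"
    and ap: "\<And>e. e > 0 \<Longrightarrow> \<exists>w. integrable leb01 w \<and> l1conv w \<and> (LINT \<theta>|leb01. \<bar>v \<theta> - w \<theta>\<bar>) \<le> e"
  shows "l1conv v"
  unfolding l1conv_def
proof (rule LIMSEQ_I)
  fix r :: real assume r: "r > 0"
  have r4: "r/4 > 0" using r by simp
  from ap[OF r4] obtain w where w: "integrable leb01 w" "l1conv w" "(LINT \<theta>|leb01. \<bar>v \<theta> - w \<theta>\<bar>) \<le> r/4"
    by (elim exE conjE)
  obtain m0 where m0: "\<forall>m\<ge>m0. norm ((LINT \<theta>|leb01. \<bar>w \<theta> - fmean m w \<theta>\<bar>) - 0) < r/4"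
    using LIMSEQ_D[OF w(2)[unfolded l1conv_def] r4] by (rule exE)
  have "norm ((LINT \<theta>|leb01. \<bar>v \<theta> - fmean m v \<theta>\<bar>) - 0) < r" if m: "m \<ge> Suc m0" for m
  proof -
    have i: "integrable leb01 (\<lambda>\<theta>. v \<theta> - w \<theta>)" using v w by auto
    have "(LINT \<theta>|leb01. \<bar>v \<theta> - fmean m v \<theta>\<bar>) \<le>
       (LINT \<theta>|leb01. \<bar>v \<theta> - w \<theta>\<bar> + \<bar>w \<theta> - fmean m w \<theta>\<bar> + \<bar>fmean m (\<lambda>\<theta>. v \<theta> - w \<theta>) \<theta>\<bar>)"
    proof (rule integral_mono)
      show "integrable leb01 (\<lambda>\<theta>. \<bar>v \<theta> - fmean m v \<theta>\<bar>)"
        by (intro integrable_abs Bochner_Integration.integrable_diff v integrable_fmean)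
      show "integrable leb01 (\<lambda>\<theta>. \<bar>v \<theta> - w \<theta>\<bar> + \<bar>w \<theta> - fmean m w \<theta>\<bar> + \<bar>fmean m (\<lambda>\<theta>. v \<theta> - w \<theta>) \<theta>\<bar>)"
        by (intro integrable_abs Bochner_Integration.integrable_diff Bochner_Integration.integrable_add v w(1) integrable_fmean)
      show "\<bar>v \<theta> - fmean m v \<theta>\<bar> \<le> \<bar>v \<theta> - w \<theta>\<bar> + \<bar>w \<theta> - fmean m w \<theta>\<bar> + \<bar>fmean m (\<lambda>\<theta>. v \<theta> - w \<theta>) \<theta>\<bar>" for \<theta>
        unfolding fmean_diff[OF v w(1)] by arith
    qed
    also have "\<dots> = (LINT \<theta>|leb01. \<bar>v \<theta> - w \<theta>\<bar>) + (LINT \<theta>|leb01. \<bar>w \<theta> - fmean m w \<theta>\<bar>)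
         + (LINT \<theta>|leb01. \<bar>fmean m (\<lambda>\<theta>. v \<theta> - w \<theta>) \<theta>\<bar>)"
      using v w integrable_fmean by simp
    also have "\<dots> \<le> r/4 + r/4 + r/4"
      using w(3) m0[rule_format, of m] integral_abs_fmean_le[OF _ i, of m] m by simp
    also have "\<dots> < r" using r by simp
    finally show ?thesis by simp
  qed
  then show "\<exists>no. \<forall>n\<ge>no. norm ((LINT \<theta>|leb01. \<bar>v \<theta> - fmean n v \<theta>\<bar>) - 0) < r"
    by (intro exI[of _ "Suc m0"] allI impI)
qed

lemma l1conv_add:
  assumes "integrable leb01 v" "integrable leb01 w" "l1conv v" "l1conv w"
  shows "l1conv (\<lambda>\<theta>. v \<theta> + w \<theta>)"
  unfolding l1conv_def
proof (rule tendsto_sandwich[OF _ _ tendsto_const])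
  show "(\<lambda>m. (LINT \<theta>|leb01. \<bar>v \<theta> - fmean m v \<theta>\<bar>) + (LINT \<theta>|leb01. \<bar>w \<theta> - fmean m w \<theta>\<bar>)) \<longlonglongrightarrow> 0"
    using tendsto_add[OF assms(3,4)[unfolded l1conv_def]] by simp
  show "\<forall>\<^sub>F m in sequentially. (LINT \<theta>|leb01. \<bar>v \<theta> + w \<theta> - fmean m (\<lambda>\<theta>. v \<theta> + w \<theta>) \<theta>\<bar>)
     \<le> (LINT \<theta>|leb01. \<bar>v \<theta> - fmean m v \<theta>\<bar>) + (LINT \<theta>|leb01. \<bar>w \<theta> - fmean m w \<theta>\<bar>)"
  proof (intro always_eventually allI)
    fix m
    have "(LINT \<theta>|leb01. \<bar>v \<theta> + w \<theta> - fmean m (\<lambda>\<theta>. v \<theta> + w \<theta>) \<theta>\<bar>)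
       \<le> (LINT \<theta>|leb01. \<bar>v \<theta> - fmean m v \<theta>\<bar> + \<bar>w \<theta> - fmean m w \<theta>\<bar>)"
    proof (rule integral_mono)
      show "\<bar>v \<theta> + w \<theta> - fmean m (\<lambda>\<theta>. v \<theta> + w \<theta>) \<theta>\<bar> \<le> \<bar>v \<theta> - fmean m v \<theta>\<bar> + \<bar>w \<theta> - fmean m w \<theta>\<bar>" for \<theta>
        unfolding fmean_add[OF assms(1,2)] by arith
    qed (intro integrable_abs Bochner_Integration.integrable_add Bochner_Integration.integrable_diff assms(1,2) integrable_fmean)+
    then show "(LINT \<theta>|leb01. \<bar>v \<theta> + w \<theta> - fmean m (\<lambda>\<theta>. v \<theta> + w \<theta>) \<theta>\<bar>)
     \<le> (LINT \<theta>|leb01. \<bar>v \<theta> - fmean m v \<theta>\<bar>) + (LINT \<theta>|leb01. \<bar>w \<theta> - fmean m w \<theta>\<bar>)"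
      using assms(1,2) integrable_fmean by simp
  qed
  show "\<forall>\<^sub>F m in sequentially. 0 \<le> (LINT \<theta>|leb01. \<bar>v \<theta> + w \<theta> - fmean m (\<lambda>\<theta>. v \<theta> + w \<theta>) \<theta>\<bar>)"
    by (intro always_eventually allI integral_nonneg_AE AE_I2 abs_ge_zero)
qed

lemma fmean_scale: "fmean m (\<lambda>\<theta>. a * v \<theta>) \<theta> = a * fmean m v \<theta>"
  by (simp add: fmean_def inner01_def mult.assoc sum_distrib_left mult.left_commute)

lemma l1conv_scale: "l1conv v \<Longrightarrow> l1conv (\<lambda>\<theta>. a * v \<theta>)"
proof -
  assume a: "l1conv v"
  have "\<bar>a * v \<theta> - fmean m (\<lambda>\<theta>. a * v \<theta>) \<theta>\<bar> = \<bar>a\<bar> * \<bar>v \<theta> - fmean m v \<theta>\<bar>" for m \<theta>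
    by (simp add: fmean_scale right_diff_distrib[symmetric] abs_mult)
  then show ?thesis
    using tendsto_mult_left[OF a[unfolded l1conv_def], of "\<bar>a\<bar>"]
    by (simp add: l1conv_def)
qed

lemma l1conv_const: "l1conv (\<lambda>_. a)"
  unfolding l1conv_def
  by (rule tendsto_eventually, rule eventually_sequentiallyI[of 1]) (simp add: fmean_const)

lemma tendsto_zero_le_over_n:
  fixes g :: "nat \<Rightarrow> real"
  assumes "\<And>m. m \<ge> 1 \<Longrightarrow> 0 \<le> g m" "\<And>m. m \<ge> 1 \<Longrightarrow> g m \<le> B / real m"
  shows "g \<longlonglongrightarrow> 0"
proof (rule tendsto_sandwich[OF _ _ tendsto_const lim_const_over_n])
  show "\<forall>\<^sub>F m in sequentially. 0 \<le> g m"
    by (rule eventually_sequentiallyI[OF assms(1)])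
  show "\<forall>\<^sub>F m in sequentially. g m \<le> B / real m"
    by (rule eventually_sequentiallyI[OF assms(2)])
qed

text \<open>Away from the jump, the kernel mass beyond distance \<open>\<eta>\<close> is of order
  \<open>1 / m\<close>. For points of the half-line itself the complement is estimated and the total
  mass 1 is used.\<close>

lemma fmean_indicator_atMost:
  assumes t: "0 < \<theta>" "\<theta> < 1" "\<theta> \<noteq> a"
  shows "(\<lambda>m. fmean m (indicat_real {..a}) \<theta>) \<longlonglongrightarrow> indicat_real {..a} \<theta>"
proof -
  define \<eta> where "\<eta> = min 1 \<bar>\<theta> - a\<bar>"
  have \<eta>: "0 < \<eta>" "\<eta> \<le> 1" using t by (auto simp: \<eta>_def)
  define B where "B = 4 / (2 - 2 * cos (pi * \<eta>))"
  have int: "integrable leb01 (indicat_real A)" if "A \<in> sets borel" for A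
    by (rule integrable_leb01_bounded[where B=1]) (use that in \<open>auto simp: indicator_def\<close>)
  have far: "fmean m (indicat_real A) \<theta> \<le> B / real m"
    if A: "A \<in> sets borel" "\<And>\<tau>. \<tau> \<in> A \<Longrightarrow> \<bar>\<theta> - \<tau>\<bar> \<ge> \<eta>" "m \<ge> 1" for A m
  proof -
    have "fmean m (indicat_real A) \<theta> = (LINT \<tau>|leb01. fkern m \<theta> \<tau> * indicat_real A \<tau>)"
      by (rule fmean_eq_integral[OF int[OF A(1)]])
    also have "\<dots> \<le> (LINT \<tau>|leb01. B / real m)"
    proof (rule integral_mono_AE)
      have "2 - 2 * cos (pi * \<eta>) \<ge> 0" using cos_le_one[of "pi * \<eta>"] by linarith
      then have "0 \<le> B / real m" by (simp add: B_def)
      then have fk: "fkern m \<theta> x * indicat_real A x \<le> B / real m" if x: "0 < x \<and> x < 1" for x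
        using fkern_decay[OF A(3) \<eta> t(1,2), of x] A(2)[of x] x
        by (cases "x \<in> A") (auto simp: B_def)
      show "AE x in leb01. fkern m \<theta> x * indicat_real A x \<le> B / real m"
        using leb01_AE_mem by eventually_elim (rule fk)
      show "integrable leb01 (\<lambda>\<tau>. fkern m \<theta> \<tau> * indicat_real A \<tau>)"
        by (intro integrable_fkern_mult int A)
    qed simp
    also have "\<dots> = B / real m" by (simp add: leb01.prob_space)
    finally show ?thesis .
  qed
  have nn: "fmean m (indicat_real A) \<theta> \<ge> 0" if "A \<in> sets borel" "m \<ge> 1" for A m
    unfolding fmean_eq_integral[OF int[OF that(1)]]
    by (intro integral_nonneg_AE AE_I2) (auto intro!: mult_nonneg_nonneg fkern_nonneg that)
  show ?thesis
  proof (cases "\<theta> \<le> a")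
    case False
    have "(\<lambda>m. fmean m (indicat_real {..a}) \<theta>) \<longlonglongrightarrow> 0"
    proof (rule tendsto_zero_le_over_n)
      fix m :: nat assume m: "m \<ge> 1"
      show "0 \<le> fmean m (indicat_real {..a}) \<theta>" by (rule nn[OF _ m]) simp
      have "\<bar>\<theta> - \<tau>\<bar> \<ge> \<eta>" if "\<tau> \<in> {..a}" for \<tau>
        using that False by (simp add: \<eta>_def)
      then show "fmean m (indicat_real {..a}) \<theta> \<le> B / real m"
        by (intro far m) auto
    qed
    then show ?thesis using False by simp
  next
    case True
    have "(\<lambda>m. fmean m (indicat_real {a<..}) \<theta>) \<longlonglongrightarrow> 0"
    proof (rule tendsto_zero_le_over_n)
      fix m :: nat assume m: "m \<ge> 1"
      show "0 \<le> fmean m (indicat_real {a<..}) \<theta>" by (rule nn[OF _ m]) simp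
      have "\<bar>\<theta> - \<tau>\<bar> \<ge> \<eta>" if "\<tau> \<in> {a<..}" for \<tau>
        using that True t by (simp add: \<eta>_def)
      then show "fmean m (indicat_real {a<..}) \<theta> \<le> B / real m"
        by (intro far m) auto
    qed
    then have "(\<lambda>m. 1 - fmean m (indicat_real {a<..}) \<theta>) \<longlonglongrightarrow> 1 - 0"
      by (intro tendsto_intros)
    moreover have "\<forall>\<^sub>F m in sequentially. 1 - fmean m (indicat_real {a<..}) \<theta> = fmean m (indicat_real {..a}) \<theta>"
    proof (rule eventually_sequentiallyI[of 1])
      fix m :: nat assume m: "m \<ge> 1"
      have "indicat_real {..a} = (\<lambda>\<theta>. 1 - indicat_real {a<..} \<theta>)"
        by (auto simp: indicator_def fun_eq_iff)
      then have "fmean m (indicat_real {..a}) \<theta> = fmean m (\<lambda>\<theta>. 1 - indicat_real {a<..} \<theta>) \<theta>"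
        by simp
      also have "\<dots> = fmean m (\<lambda>_. 1) \<theta> - fmean m (indicat_real {a<..}) \<theta>"
        by (rule fmean_diff) (auto intro: int)
      finally show "1 - fmean m (indicat_real {a<..}) \<theta> = fmean m (indicat_real {..a}) \<theta>"
        using m by (simp add: fmean_const)
    qed
    ultimately show ?thesis
      using True by (simp add: Lim_transform_eventually)
  qed
qed

lemma abs_fmean_bounded:
  assumes "m \<ge> 1" "v \<in> borel_measurable leb01" "\<And>\<theta>. 0 < \<theta> \<Longrightarrow> \<theta> < 1 \<Longrightarrow> \<bar>v \<theta>\<bar> \<le> K"
  shows "\<bar>fmean m v \<theta>\<bar> \<le> K"
proof -
  have i: "integrable leb01 v"
    by (rule leb01.integrable_const_bound[where B=K]) (use assms in \<open>auto intro!: AE_mp[OF leb01_AE_mem] AE_I2\<close>)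
  have "\<bar>fmean m v \<theta>\<bar> \<le> fmean m (\<lambda>\<tau>. \<bar>v \<tau>\<bar>) \<theta>"
    by (rule abs_fmean_le[OF assms(1) i])
  also have "\<dots> \<le> fmean m (\<lambda>_. K) \<theta>"
    using i by (intro fmean_mono assms) auto
  also have "\<dots> = K" by (rule fmean_const[OF assms(1)])
  finally show ?thesis .
qed

lemma l1conv_indicator_atMost: "l1conv (indicat_real {..a})"
  unfolding l1conv_def
proof -
  let ?s = "\<lambda>m \<theta>. \<bar>indicat_real {..a} \<theta> - fmean m (indicat_real {..a}) \<theta>\<bar>"
  have m1: "indicat_real {..a} \<in> borel_measurable leb01"
    by (rule measurable_leb01) measurable
  \<comment> \<open>The index is shifted because the uniform bound on the means needs
    \<open>m \<ge> 1\<close>.\<close>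
  have "(\<lambda>m. LINT \<theta>|leb01. ?s (Suc m) \<theta>) \<longlonglongrightarrow> (LINT \<theta>|leb01. (0::real))"
  proof (rule integral_dominated_convergence[where w="\<lambda>_. 2"])
    have "AE \<theta> in leb01. \<theta> \<noteq> a"
      by (subst AE_restrict_space_iff) (auto intro: AE_mp[OF AE_lborel_singleton[of a]])
    then show "AE \<theta> in leb01. (\<lambda>m. ?s (Suc m) \<theta>) \<longlonglongrightarrow> 0"
      using leb01_AE_mem
    proof eventually_elim
      case (elim \<theta>)
      have "(\<lambda>m. ?s m \<theta>) \<longlonglongrightarrow> \<bar>indicat_real {..a} \<theta> - indicat_real {..a} \<theta>\<bar>"
        by (intro tendsto_intros fmean_indicator_atMost) (use elim in auto)
      then have "(\<lambda>m. ?s m \<theta>) \<longlonglongrightarrow> 0" by simp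
      then show ?case by (rule LIMSEQ_Suc)
    qed
    show "AE \<theta> in leb01. norm (?s (Suc m) \<theta>) \<le> 2" for m
    proof (rule AE_I2)
      fix \<theta>
      have "\<bar>fmean (Suc m) (indicat_real {..a}) \<theta>\<bar> \<le> 1"
        by (rule abs_fmean_bounded[OF _ m1]) (auto simp: indicator_def)
      moreover have "indicat_real {..a} \<theta> \<le> 1" "0 \<le> indicat_real {..a} \<theta>"
        by (auto simp: indicator_def)
      ultimately show "norm (?s (Suc m) \<theta>) \<le> 2"
        unfolding real_norm_def abs_abs by arith
    qed
    show "(\<lambda>\<theta>. ?s (Suc m) \<theta>) \<in> borel_measurable leb01" for m
      by (rule measurable_leb01) measurable
  qed auto
  then show "(\<lambda>m. LINT \<theta>|leb01. ?s m \<theta>) \<longlonglongrightarrow> 0"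
    unfolding Bochner_Integration.integral_zero by (rule LIMSEQ_imp_Suc)
qed

text \<open>Dynkin argument over the half-lines: complements use linearity, disjoint unions are L1
  limits of finite ones.\<close>

lemma l1conv_indicator:
  assumes "S \<in> sets borel"
  shows "l1conv (indicat_real S)"
proof -
  have int: "integrable leb01 (indicat_real A)" if "A \<in> sets borel" for A
    by (rule integrable_leb01_bounded[where B=1]) (use that in \<open>auto simp: indicator_def\<close>)
  let ?G = "range atMost :: real set set"
  have b: "sets borel = sigma_sets UNIV ?G"
    by (subst borel_eq_atMost) auto
  have "Int_stable ?G"
    by (auto simp: Int_stable_def)
  then show ?thesis
  proof (rule sigma_sets_induct_disjoint[where P="\<lambda>A. l1conv (indicat_real A)", OF _ _ assms[unfolded b]])
    fix A :: "real set" assume "A \<in> ?G"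
    then obtain a where "A = {..a}" by blast
    then show "l1conv (indicat_real A)" by (simp only: l1conv_indicator_atMost)
  next
    show "l1conv (indicat_real {})" 
    proof -
      have "indicat_real ({} :: real set) = (\<lambda>_. 0)" by (simp add: fun_eq_iff)
      then show ?thesis using l1conv_const[of 0] by (simp only:)
    qed
  next
    fix A assume compl: "A \<in> sigma_sets UNIV ?G" "l1conv (indicat_real A)"
    have A: "A \<in> sets borel" using compl b by simp
    have eq: "indicat_real (UNIV - A) = (\<lambda>\<theta>. 1 + (-1) * indicat_real A \<theta>)"
      by (auto simp: indicator_def fun_eq_iff)
    show "l1conv (indicat_real (UNIV - A))"
      unfolding eq by (rule l1conv_add[OF _ _ l1conv_const l1conv_scale[OF compl(2)]]) (simp_all add: int[OF A])
  next
    fix A :: "nat \<Rightarrow> real set"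
    assume union: "disjoint_family A" "range A \<subseteq> sigma_sets UNIV ?G" "\<And>i. l1conv (indicat_real (A i))"
    have A: "A i \<in> sets borel" for i using union(2) b by auto
    have U: "(\<Union>i. A i) \<in> sets borel" using A by auto
    have fin: "indicat_real (\<Union>i<k. A i) = (\<lambda>\<theta>. \<Sum>i<k. indicat_real (A i) \<theta>)" for k
      using union(1) by (intro ext indicator_UN_disjoint) (auto simp: disjoint_family_on_def)
    have l: "l1conv (\<lambda>\<theta>. \<Sum>i<k. indicat_real (A i) \<theta>)" for k
    proof (induction k)
      case 0 show ?case using l1conv_const[of 0] by simp
    next
      case (Suc k)
      then show ?case
        using union(3)[of k] int[OF A] by (simp add: l1conv_add)
    qed
    show "l1conv (indicat_real (\<Union>i. A i))"
    proof (rule l1conv_approx[OF int[OF U]])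
      fix e :: real assume e: "e > 0"
      have "(\<lambda>k. LINT \<theta>|leb01. \<bar>indicat_real (\<Union>i. A i) \<theta> - indicat_real (\<Union>i<k. A i) \<theta>\<bar>)
          \<longlonglongrightarrow> (LINT \<theta>|leb01. (0::real))"
      proof (rule integral_dominated_convergence[where w="\<lambda>_. 1"])
        show "AE \<theta> in leb01. (\<lambda>k. \<bar>indicat_real (\<Union>i. A i) \<theta> - indicat_real (\<Union>i<k. A i) \<theta>\<bar>) \<longlonglongrightarrow> 0"
        proof (rule AE_I2)
          fix \<theta>
          have "(\<lambda>k. \<bar>indicat_real (\<Union>i. A i) \<theta> - indicat_real (\<Union>i<k. A i) \<theta>\<bar>)
            \<longlonglongrightarrow> \<bar>indicat_real (\<Union>i. A i) \<theta> - indicat_real (\<Union>i. A i) \<theta>\<bar>"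
            by (intro tendsto_intros LIMSEQ_indicator_UN)
          then show "(\<lambda>k. \<bar>indicat_real (\<Union>i. A i) \<theta> - indicat_real (\<Union>i<k. A i) \<theta>\<bar>) \<longlonglongrightarrow> 0"
            by simp
        qed
        show "(\<lambda>\<theta>. \<bar>indicat_real (\<Union>i. A i) \<theta> - indicat_real (\<Union>i<k. A i) \<theta>\<bar>) \<in> borel_measurable leb01" for k
          using A by (intro measurable_leb01 borel_measurable_abs borel_measurable_diff borel_measurable_indicator U) auto
        have b: "\<bar>indicat_real S \<theta> - indicat_real T \<theta>\<bar> \<le> 1" for S T and \<theta> :: real
          by (simp add: indicator_def)
        show "AE \<theta> in leb01. norm \<bar>indicat_real (\<Union>i. A i) \<theta> - indicat_real (\<Union>i<k. A i) \<theta>\<bar> \<le> 1" for k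
          unfolding real_norm_def abs_abs by (intro AE_I2 b)
      qed simp_all
      from LIMSEQ_D[OF this e] obtain k where k: "\<forall>n\<ge>k.
        norm ((LINT \<theta>|leb01. \<bar>indicat_real (\<Union>i. A i) \<theta> - indicat_real (\<Union>i<n. A i) \<theta>\<bar>) - (LINT \<theta>|leb01. (0::real))) < e"
        by (rule exE)
      have "(LINT \<theta>|leb01. \<bar>indicat_real (\<Union>i. A i) \<theta> - indicat_real (\<Union>i<k. A i) \<theta>\<bar>) \<le> e"
        using k[rule_format, of k] by simp
      then show "\<exists>w. integrable leb01 w \<and> l1conv w \<and> (LINT \<theta>|leb01. \<bar>indicat_real (\<Union>i. A i) \<theta> - w \<theta>\<bar>) \<le> e"
        using l[of k] int[OF A] unfolding fin
        by (intro exI[of _ "\<lambda>\<theta>. \<Sum>i<k. indicat_real (A i) \<theta>"] conjI Bochner_Integration.integrable_sum)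
    qed
  qed auto
qed

lemma fmean_cong:
  assumes "\<And>\<theta>. 0 < \<theta> \<Longrightarrow> \<theta> < 1 \<Longrightarrow> v \<theta> = w \<theta>"
  shows "fmean m v = fmean m w"
proof -
  have "inner01 v (eigfun i) = inner01 w (eigfun i)" for i
    unfolding inner01_def
    by (rule Bochner_Integration.integral_cong) (simp_all add: assms space_restrict_space)
  then show ?thesis by (simp add: fmean_def[abs_def])
qed

text \<open>Induction over integrable functions; the limit case has approximants dominated by
  \<open>2 * \<bar>f\<bar>\<close>, which converge in L1 and so fall under
  \<open>l1conv_approx\<close>.\<close>

lemma l1conv_integrable:
  assumes "integrable leb01 v"
  shows "l1conv v"
  using assms
proof (induct rule: integrable_induct)
  case (base A c)
  obtain A' where A': "A' \<in> sets borel" "A = A' \<inter> {0<..<1}"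
    using base(1) by (auto simp: sets_restrict_space)
  have e: "indicat_real A \<theta> *\<^sub>R c = c * indicat_real A' \<theta>" if "0 < \<theta>" "\<theta> < 1" for \<theta>
    using A' that by (auto simp: indicator_def)
  have "fmean m (\<lambda>\<theta>. indicat_real A \<theta> *\<^sub>R c) = fmean m (\<lambda>\<theta>. c * indicat_real A' \<theta>)" for m
    by (rule fmean_cong) (rule e)
  moreover have "l1conv (\<lambda>\<theta>. c * indicat_real A' \<theta>)"
    by (rule l1conv_scale[OF l1conv_indicator[OF A'(1)]])
  moreover have "(LINT \<theta>|leb01. \<bar>indicat_real A \<theta> *\<^sub>R c - fmean m (\<lambda>\<theta>. c * indicat_real A' \<theta>) \<theta>\<bar>)
     = (LINT \<theta>|leb01. \<bar>c * indicat_real A' \<theta> - fmean m (\<lambda>\<theta>. c * indicat_real A' \<theta>) \<theta>\<bar>)" for m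
    by (intro Bochner_Integration.integral_cong refl) (simp add: space_restrict_space e del: real_scaleR_def)
  ultimately show ?case
    unfolding l1conv_def by simp
next
  case (add f g)
  show ?case by (rule l1conv_add[OF add(1) add(3) add(2) add(4)])
next
  case (lim f s)
  show ?case
  proof (rule l1conv_approx[OF lim(5)])
    fix e :: real assume e: "e > 0"
    have "(\<lambda>k. LINT \<theta>|leb01. \<bar>f \<theta> - s k \<theta>\<bar>) \<longlonglongrightarrow> (LINT \<theta>|leb01. (0::real))"
    proof (rule integral_dominated_convergence[where w="\<lambda>\<theta>. 3 * \<bar>f \<theta>\<bar>"])
      show "AE \<theta> in leb01. (\<lambda>k. \<bar>f \<theta> - s k \<theta>\<bar>) \<longlonglongrightarrow> 0"
      proof (rule AE_I2)
        fix \<theta> assume "\<theta> \<in> space leb01"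
        then have "(\<lambda>k. \<bar>f \<theta> - s k \<theta>\<bar>) \<longlonglongrightarrow> \<bar>f \<theta> - f \<theta>\<bar>"
          by (intro tendsto_intros lim)
        then show "(\<lambda>k. \<bar>f \<theta> - s k \<theta>\<bar>) \<longlonglongrightarrow> 0" by simp
      qed
      show "AE \<theta> in leb01. norm \<bar>f \<theta> - s k \<theta>\<bar> \<le> 3 * \<bar>f \<theta>\<bar>" for k
      proof (rule AE_I2)
        fix \<theta> assume "\<theta> \<in> space leb01"
        then have "\<bar>s k \<theta>\<bar> \<le> 2 * \<bar>f \<theta>\<bar>" using lim(4)[of \<theta> k] by simp
        then show "norm \<bar>f \<theta> - s k \<theta>\<bar> \<le> 3 * \<bar>f \<theta>\<bar>" by simp
      qed
    qed (use lim(1,5) in auto)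
    from LIMSEQ_D[OF this e] obtain k where
      k: "\<forall>n\<ge>k. norm ((LINT \<theta>|leb01. \<bar>f \<theta> - s n \<theta>\<bar>) - (LINT \<theta>|leb01. (0::real))) < e"
      by (rule exE)
    have le: "(LINT \<theta>|leb01. \<bar>f \<theta> - s k \<theta>\<bar>) \<le> e"
      using k[rule_format, of k] by simp
    show "\<exists>w. integrable leb01 w \<and> l1conv w \<and> (LINT \<theta>|leb01. \<bar>f \<theta> - w \<theta>\<bar>) \<le> e"
      by (rule exI[of _ "s k"]) (rule conjI[OF lim(1) conjI[OF lim(2) le]])
  qed
qed

section \<open>From L1 to higher powers\<close>

lemma power_tangent_le:
  fixes a b :: real
  assumes "0 \<le> a" "0 \<le> b"
  shows "a ^ Suc p + real (Suc p) * a ^ p * (b - a) \<le> b ^ Suc p"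
proof (induction p)
  case (Suc p)
  have "(b - a) * (b ^ Suc p - a ^ Suc p) \<ge> 0"
    using assms by (cases "a \<le> b")
      (auto intro!: mult_nonneg_nonneg mult_nonpos_nonpos power_mono simp: diff_le_0_iff_le simp del: power_Suc)
  then have "a * b ^ Suc p + a ^ Suc p * (b - a) \<le> b ^ Suc (Suc p)"
    by (simp add: algebra_simps)
  moreover have "a * (a ^ Suc p + real (Suc p) * a ^ p * (b - a)) \<le> a * b ^ Suc p"
    by (intro mult_left_mono Suc assms)
  ultimately show ?case
    by (simp add: algebra_simps)
qed simp

text \<open>Jensen's inequality for the probability kernel: the tangent line of
  \<open>t ^ Suc p\<close> at the mean \<open>?a\<close> of the absolute value is averaged.\<close>

lemma fmean_power_le:
  assumes m: "m \<ge> 1" and v: "integrable leb01 v" and vp: "integrable leb01 (\<lambda>\<theta>. \<bar>v \<theta>\<bar> ^ Suc p)"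
  shows "\<bar>fmean m v \<theta>\<bar> ^ Suc p \<le> fmean m (\<lambda>\<tau>. \<bar>v \<tau>\<bar> ^ Suc p) \<theta>"
proof -
  let ?a = "fmean m (\<lambda>\<tau>. \<bar>v \<tau>\<bar>) \<theta>"
  have av: "integrable leb01 (\<lambda>\<tau>. \<bar>v \<tau>\<bar>)" using v by simp
  have a0: "\<bar>fmean m v \<theta>\<bar> \<le> ?a" by (rule abs_fmean_le[OF m v])
  have lin: "integrable leb01 (\<lambda>\<tau>. real (Suc p) * ?a ^ p * \<bar>v \<tau>\<bar>)" using av by simp
  have "?a ^ Suc p = (?a ^ Suc p - real (Suc p) * ?a ^ p * ?a) + real (Suc p) * ?a ^ p * ?a"
    by simp
  also have "\<dots> = fmean m (\<lambda>\<tau>. (?a ^ Suc p - real (Suc p) * ?a ^ p * ?a) + real (Suc p) * ?a ^ p * \<bar>v \<tau>\<bar>) \<theta>"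
    using lin by (subst fmean_add) (auto simp: fmean_const[OF m] fmean_scale)
  also have "\<dots> \<le> fmean m (\<lambda>\<tau>. \<bar>v \<tau>\<bar> ^ Suc p) \<theta>"
  proof (rule fmean_mono[OF m _ vp])
    show "?a ^ Suc p - real (Suc p) * ?a ^ p * ?a + real (Suc p) * ?a ^ p * \<bar>v \<tau>\<bar> \<le> \<bar>v \<tau>\<bar> ^ Suc p" for \<tau>
    proof -
      have "0 \<le> ?a" using a0 by linarith
      from power_tangent_le[OF this abs_ge_zero, of p "v \<tau>"] show ?thesis
        by (simp only: right_diff_distrib)
    qed
  qed (use lin in auto)
  finally have "?a ^ Suc p \<le> fmean m (\<lambda>\<tau>. \<bar>v \<tau>\<bar> ^ Suc p) \<theta>" .
  moreover have "\<bar>fmean m v \<theta>\<bar> ^ Suc p \<le> ?a ^ Suc p"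
    using a0 by (intro power_mono) auto
  ultimately show ?thesis by linarith
qed

lemma power_add_le:
  fixes a b :: real
  assumes "0 \<le> a" "0 \<le> b"
  shows "(a + b) ^ p \<le> 2 ^ p * (a ^ p + b ^ p)"
proof -
  have "(a + b) ^ p \<le> (2 * max a b) ^ p"
    using assms by (intro power_mono) auto
  also have "\<dots> \<le> 2 ^ p * (a ^ p + b ^ p)"
    using assms by (auto simp: power_mult_distrib max_def)
  finally show ?thesis .
qed

lemma norm_abs_power: "norm (\<bar>x\<bar> ^ k) = \<bar>x\<bar> ^ k" for x :: real
  by (simp add: power_abs)

lemma integrable_of_power:
  fixes v :: "real \<Rightarrow> real"
  assumes v: "v \<in> borel_measurable leb01" and vp: "integrable leb01 (\<lambda>\<theta>. \<bar>v \<theta>\<bar> ^ Suc p)"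
  shows "integrable leb01 v"
proof (rule Bochner_Integration.integrable_bound[where f="\<lambda>\<theta>. 1 + \<bar>v \<theta>\<bar> ^ Suc p"])
  have "x \<le> 1 + x ^ Suc p" if "0 \<le> x" for x :: real
  proof (cases "x \<le> 1")
    case True
    then show ?thesis using that by (simp add: add_increasing2)
  next
    case False
    then have "x * 1 \<le> x * x ^ p" using that by (intro mult_left_mono one_le_power) auto
    then show ?thesis by simp
  qed
  then have "\<bar>v \<theta>\<bar> \<le> norm (1 + \<bar>v \<theta>\<bar> ^ Suc p)" for \<theta>
    using order_trans[OF _ abs_ge_self] abs_ge_zero unfolding real_norm_def by blast
  then show "AE \<theta> in leb01. norm (v \<theta>) \<le> norm (1 + \<bar>v \<theta>\<bar> ^ Suc p)"
    unfolding real_norm_def by (intro AE_I2)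
  show "integrable leb01 (\<lambda>\<theta>. 1 + \<bar>v \<theta>\<bar> ^ Suc p)"
    by (intro Bochner_Integration.integrable_add vp) simp
qed (rule v)

lemma integral_abs_fmean_diff_power_le:
  assumes m: "m \<ge> 1" and v: "v \<in> borel_measurable leb01" and vp: "integrable leb01 (\<lambda>\<theta>. \<bar>v \<theta>\<bar> ^ Suc p)"
  shows "integrable leb01 (\<lambda>\<theta>. \<bar>v \<theta> - fmean m v \<theta>\<bar> ^ Suc p)"
    and "(LINT \<theta>|leb01. \<bar>v \<theta> - fmean m v \<theta>\<bar> ^ Suc p) \<le> 2 ^ (p + 2) * (LINT \<theta>|leb01. \<bar>v \<theta>\<bar> ^ Suc p)"
proof -
  let ?B = "\<lambda>\<theta>. 2 ^ Suc p * (\<bar>v \<theta>\<bar> ^ Suc p + fmean m (\<lambda>\<tau>. \<bar>v \<tau>\<bar> ^ Suc p) \<theta>)"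
  have i: "integrable leb01 v" by (rule integrable_of_power[OF v vp])
  have le: "\<bar>v \<theta> - fmean m v \<theta>\<bar> ^ Suc p \<le> ?B \<theta>" for \<theta>
  proof -
    have "\<bar>v \<theta> - fmean m v \<theta>\<bar> ^ Suc p \<le> (\<bar>v \<theta>\<bar> + \<bar>fmean m v \<theta>\<bar>) ^ Suc p"
      by (intro power_mono) auto
    also have "\<dots> \<le> 2 ^ Suc p * (\<bar>v \<theta>\<bar> ^ Suc p + \<bar>fmean m v \<theta>\<bar> ^ Suc p)"
      by (rule power_add_le) auto
    also have "\<dots> \<le> ?B \<theta>"
      using fmean_power_le[OF m i vp, of \<theta>] by simp
    finally show ?thesis .
  qed
  have iB: "integrable leb01 ?B" using vp integrable_fmean by simp
  have [measurable]: "fmean m v \<in> borel_measurable leb01" by (rule measurable_leb01) measurable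
  show int: "integrable leb01 (\<lambda>\<theta>. \<bar>v \<theta> - fmean m v \<theta>\<bar> ^ Suc p)"
  proof (rule Bochner_Integration.integrable_bound[OF iB])
    show "(\<lambda>\<theta>. \<bar>v \<theta> - fmean m v \<theta>\<bar> ^ Suc p) \<in> borel_measurable leb01"
      using v by measurable
    have "norm (\<bar>v \<theta> - fmean m v \<theta>\<bar> ^ Suc p) \<le> norm (?B \<theta>)" for \<theta>
      unfolding norm_abs_power unfolding real_norm_def by (rule order_trans[OF le abs_ge_self])
    then show "AE \<theta> in leb01. norm (\<bar>v \<theta> - fmean m v \<theta>\<bar> ^ Suc p) \<le> norm (?B \<theta>)"
      by (intro AE_I2)
  qed
  have "(LINT \<theta>|leb01. \<bar>v \<theta> - fmean m v \<theta>\<bar> ^ Suc p) \<le> (LINT \<theta>|leb01. ?B \<theta>)"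
    by (intro integral_mono int iB le)
  also have "\<dots> = 2 ^ Suc p * ((LINT \<theta>|leb01. \<bar>v \<theta>\<bar> ^ Suc p) + (LINT \<theta>|leb01. fmean m (\<lambda>\<tau>. \<bar>v \<tau>\<bar> ^ Suc p) \<theta>))"
    by (simp only: integral_mult_right_zero Bochner_Integration.integral_add[OF vp integrable_fmean])
  also have "\<dots> = 2 ^ (p + 2) * (LINT \<theta>|leb01. \<bar>v \<theta>\<bar> ^ Suc p)"
    by (simp only: integral_fmean[OF m]) simp
  finally show "(LINT \<theta>|leb01. \<bar>v \<theta> - fmean m v \<theta>\<bar> ^ Suc p) \<le> 2 ^ (p + 2) * (LINT \<theta>|leb01. \<bar>v \<theta>\<bar> ^ Suc p)" .
qed

text \<open>Truncating \<open>v\<close> at a high level \<open>K\<close> reduces convergence in \<open>L\<^sup>p\<close> to convergence in \<open>L\<^sup>1\<close>.\<close>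

lemma fmean_tendsto_power:
  assumes v: "v \<in> borel_measurable leb01" and vp: "integrable leb01 (\<lambda>\<theta>. \<bar>v \<theta>\<bar> ^ Suc p)"
  shows "(\<lambda>m. LINT \<theta>|leb01. \<bar>v \<theta> - fmean m v \<theta>\<bar> ^ Suc p) \<longlonglongrightarrow> 0"
proof (rule LIMSEQ_I)
  fix r :: real assume r: "r > 0"
  define tr where "tr K \<theta> = max (- real K) (min (real K) (v \<theta>))" for K \<theta>
  have trm: "tr K \<in> borel_measurable leb01" for K
    unfolding tr_def[abs_def] using v by measurable
  have trb: "\<bar>tr K \<theta>\<bar> \<le> real K" for K \<theta>
    unfolding tr_def by linarith
  have trd: "\<bar>v \<theta> - tr K \<theta>\<bar> \<le> \<bar>v \<theta>\<bar>" for K \<theta>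
    unfolding tr_def by linarith
  have dm: "(\<lambda>\<theta>. v \<theta> - tr K \<theta>) \<in> borel_measurable leb01" for K
    using v trm[of K] by measurable
  have dp: "integrable leb01 (\<lambda>\<theta>. \<bar>v \<theta> - tr K \<theta>\<bar> ^ Suc p)" for K
  proof (rule Bochner_Integration.integrable_bound[OF vp])
    show "(\<lambda>\<theta>. \<bar>v \<theta> - tr K \<theta>\<bar> ^ Suc p) \<in> borel_measurable leb01" using dm[of K] by measurable
    show "AE \<theta> in leb01. norm (\<bar>v \<theta> - tr K \<theta>\<bar> ^ Suc p) \<le> norm (\<bar>v \<theta>\<bar> ^ Suc p)"
      unfolding norm_abs_power by (intro AE_I2 power_mono trd abs_ge_zero)
  qed
  have "(\<lambda>K. LINT \<theta>|leb01. \<bar>v \<theta> - tr K \<theta>\<bar> ^ Suc p) \<longlonglongrightarrow> (LINT \<theta>|leb01. (0::real))"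
  proof (rule integral_dominated_convergence[OF _ _ vp])
    show "(\<lambda>\<theta>. \<bar>v \<theta> - tr K \<theta>\<bar> ^ Suc p) \<in> borel_measurable leb01" for K using dm[of K] by measurable
    show "AE \<theta> in leb01. norm (\<bar>v \<theta> - tr K \<theta>\<bar> ^ Suc p) \<le> \<bar>v \<theta>\<bar> ^ Suc p" for K
      unfolding norm_abs_power by (intro AE_I2 power_mono trd abs_ge_zero)
    show "AE \<theta> in leb01. (\<lambda>K. \<bar>v \<theta> - tr K \<theta>\<bar> ^ Suc p) \<longlonglongrightarrow> 0"
    proof (intro AE_I2 tendsto_eventually)
      fix \<theta>
      obtain K0 :: nat where K0: "\<bar>v \<theta>\<bar> \<le> real K0" using real_arch_simple by blast
      show "\<forall>\<^sub>F K in sequentially. \<bar>v \<theta> - tr K \<theta>\<bar> ^ Suc p = 0"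
      proof (rule eventually_sequentiallyI[of K0])
        fix K assume "K \<ge> K0"
        then have "real K0 \<le> real K" by simp
        then have "tr K \<theta> = v \<theta>" using K0 unfolding tr_def by linarith
        then show "\<bar>v \<theta> - tr K \<theta>\<bar> ^ Suc p = 0" by simp
      qed
    qed
  qed simp
  \<comment> \<open>After multiplication by \<open>2 ^ Suc p * 2 ^ (p + 2)\<close>, the loss of the
    splitting and of the means, a quarter of \<open>r\<close> remains.\<close>
  moreover define r1 where "r1 = r / (4 * 2 ^ Suc p * 2 ^ (p + 2))"
  have r1: "r1 > 0" using r by (simp add: r1_def)
  ultimately obtain K where K: "\<forall>n\<ge>K. norm ((LINT \<theta>|leb01. \<bar>v \<theta> - tr n \<theta>\<bar> ^ Suc p) - (LINT \<theta>|leb01. (0::real))) < r1"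
    using LIMSEQ_D by blast
  have K': "(LINT \<theta>|leb01. \<bar>v \<theta> - tr K \<theta>\<bar> ^ Suc p) < r1"
    using K[rule_format, of K] by (simp only: Bochner_Integration.integral_zero real_norm_def order_refl diff_0_right abs_less_iff)
  define B where "B = 2 ^ Suc p * (2 * real K) ^ p"
  have tri: "integrable leb01 (tr K)"
    by (rule leb01.integrable_const_bound[where B="real K"]) (simp_all add: trb trm)
  have vi: "integrable leb01 v" by (rule integrable_of_power[OF v vp])
  have "(\<lambda>m. B * (LINT \<theta>|leb01. \<bar>tr K \<theta> - fmean m (tr K) \<theta>\<bar>)) \<longlonglongrightarrow> B * 0"
    using l1conv_integrable[OF tri] unfolding l1conv_def by (rule tendsto_mult_left)
  then have "(\<lambda>m. B * (LINT \<theta>|leb01. \<bar>tr K \<theta> - fmean m (tr K) \<theta>\<bar>)) \<longlonglongrightarrow> 0" by simp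
  moreover have r2: "r/2 > 0" using r by simp
  ultimately obtain m0 where m0: "\<forall>m\<ge>m0. norm (B * (LINT \<theta>|leb01. \<bar>tr K \<theta> - fmean m (tr K) \<theta>\<bar>) - 0) < r/2"
    using LIMSEQ_D by blast
  have "norm ((LINT \<theta>|leb01. \<bar>v \<theta> - fmean m v \<theta>\<bar> ^ Suc p) - 0) < r" if m: "m \<ge> Suc m0" for m
  proof -
    have m1: "m \<ge> 1" using m by simp
    let ?w = "\<lambda>\<theta>. v \<theta> - tr K \<theta>"
    note Lw = integral_abs_fmean_diff_power_le[OF m1 dm dp, of K]
    have it: "integrable leb01 (\<lambda>\<theta>. \<bar>tr K \<theta> - fmean m (tr K) \<theta>\<bar>)"
      by (intro integrable_abs Bochner_Integration.integrable_diff tri integrable_fmean)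
    have le: "\<bar>v \<theta> - fmean m v \<theta>\<bar> ^ Suc p
       \<le> 2 ^ Suc p * \<bar>?w \<theta> - fmean m ?w \<theta>\<bar> ^ Suc p + B * \<bar>tr K \<theta> - fmean m (tr K) \<theta>\<bar>" for \<theta>
    proof -
      let ?a = "\<bar>?w \<theta> - fmean m ?w \<theta>\<bar>" and ?b = "\<bar>tr K \<theta> - fmean m (tr K) \<theta>\<bar>"
      have "\<bar>v \<theta> - fmean m v \<theta>\<bar> \<le> ?a + ?b"
        unfolding fmean_diff[OF vi tri] by arith
      then have "\<bar>v \<theta> - fmean m v \<theta>\<bar> ^ Suc p \<le> (?a + ?b) ^ Suc p"
        by (intro power_mono abs_ge_zero)
      also have "\<dots> \<le> 2 ^ Suc p * (?a ^ Suc p + ?b ^ Suc p)"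
        by (intro power_add_le abs_ge_zero)
      \<comment> \<open>For the truncated function all powers but one are bounded by the level,
        which leaves an L1 quantity.\<close>
      also have "?b ^ Suc p \<le> (2 * real K) ^ p * ?b"
      proof -
        have "\<bar>fmean m (tr K) \<theta>\<bar> \<le> real K"
          by (rule abs_fmean_bounded[OF m1 trm trb])
        then have "?b \<le> 2 * real K" using trb[of K \<theta>] by linarith
        then have "?b ^ p \<le> (2 * real K) ^ p" by (intro power_mono abs_ge_zero)
        then show ?thesis by (simp add: mult.commute mult_left_mono)
      qed
      finally show ?thesis by (simp add: B_def algebra_simps)
    qed
    have "(LINT \<theta>|leb01. \<bar>v \<theta> - fmean m v \<theta>\<bar> ^ Suc p)
       \<le> (LINT \<theta>|leb01. 2 ^ Suc p * \<bar>?w \<theta> - fmean m ?w \<theta>\<bar> ^ Suc p + B * \<bar>tr K \<theta> - fmean m (tr K) \<theta>\<bar>)"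
      by (rule integral_mono[OF integral_abs_fmean_diff_power_le(1)[OF m1 v vp] _ le])
         (intro Bochner_Integration.integrable_add integrable_mult_right Lw(1) it)
    also have "\<dots> = 2 ^ Suc p * (LINT \<theta>|leb01. \<bar>?w \<theta> - fmean m ?w \<theta>\<bar> ^ Suc p)
        + B * (LINT \<theta>|leb01. \<bar>tr K \<theta> - fmean m (tr K) \<theta>\<bar>)"
      by (subst Bochner_Integration.integral_add[OF integrable_mult_right[OF Lw(1)] integrable_mult_right[OF it]])
         (simp only: integral_mult_right_zero)
    also have "\<dots> < 2 ^ Suc p * (2 ^ (p + 2) * r1) + r/2"
    proof (rule add_le_less_mono)
      show "2 ^ Suc p * (LINT \<theta>|leb01. \<bar>?w \<theta> - fmean m ?w \<theta>\<bar> ^ Suc p) \<le> 2 ^ Suc p * (2 ^ (p + 2) * r1)"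
        by (intro mult_left_mono order_trans[OF Lw(2)] less_imp_le[OF K']) auto
      show "B * (LINT \<theta>|leb01. \<bar>tr K \<theta> - fmean m (tr K) \<theta>\<bar>) < r/2"
        using m0[rule_format, of m] m by (simp only: real_norm_def diff_0_right abs_less_iff Suc_leD)
    qed
    also have "\<dots> \<le> r" using r by (simp add: r1_def)
    finally have "(LINT \<theta>|leb01. \<bar>v \<theta> - fmean m v \<theta>\<bar> ^ Suc p) < r" .
    moreover have "0 \<le> (LINT \<theta>|leb01. \<bar>v \<theta> - fmean m v \<theta>\<bar> ^ Suc p)"
      by (intro integral_nonneg_AE AE_I2 zero_le_power abs_ge_zero)
    ultimately show ?thesis by (simp only: real_norm_def diff_0_right abs_of_nonneg)
  qed
  then show "\<exists>no. \<forall>n\<ge>no. norm ((LINT \<theta>|leb01. \<bar>v \<theta> - fmean n v \<theta>\<bar> ^ Suc p) - 0) < r"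
    by (intro exI[of _ "Suc m0"] allI impI)
qed

section \<open>Gaussian noise on finitely many coordinates\<close>

text \<open>Modes above \<open>N\<close> may carry no noise at all; a vanishing deviation must then
  give the Dirac measure, which no density describes.\<close>

definition gauss :: "real \<Rightarrow> real measure" where
  "gauss \<sigma> = (if \<sigma> = 0 then return borel 0 else density lborel (normal_density 0 \<sigma>))"

lemma prob_space_gauss: "0 \<le> \<sigma> \<Longrightarrow> prob_space (gauss \<sigma>)"
  by (auto simp: gauss_def intro!: prob_space_return prob_space_normal_density)

lemma sets_gauss [simp, measurable_cong]: "sets (gauss \<sigma>) = sets borel"
  by (simp add: gauss_def)

lemma space_gauss [simp]: "space (gauss \<sigma>) = UNIV"
  by (simp add: gauss_def)

lemma gauss_integrable_bounded:
  fixes g :: "real \<Rightarrow> real"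
  assumes "0 \<le> \<sigma>" "g \<in> borel_measurable borel" "\<And>\<zeta>. \<bar>g \<zeta>\<bar> \<le> B"
  shows "integrable (gauss \<sigma>) g"
proof -
  interpret prob_space "gauss \<sigma>" by (rule prob_space_gauss[OF assms(1)])
  show ?thesis
    by (rule integrable_const_bound[where B=B]) (use assms in \<open>auto simp: measurable_cong_sets[OF sets_gauss refl]\<close>)
qed

text \<open>The last term is the entropy of the translated Gaussian measure relative to the original one.\<close>

lemma gauss_shift_entropy:
  fixes \<Phi> \<Psi> :: "real \<Rightarrow> real"
  assumes \<sigma>: "0 \<le> \<sigma>" "\<sigma> = 0 \<Longrightarrow> s = 0"
    and \<Phi>: "\<Phi> \<in> borel_measurable borel" "\<And>\<zeta>. \<bar>\<Phi> \<zeta>\<bar> \<le> B"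
    and \<Psi>: "\<Psi> \<in> borel_measurable borel" "\<And>\<zeta>. p \<le> \<Psi> \<zeta>" "\<And>\<zeta>. \<bar>\<Psi> \<zeta>\<bar> \<le> B" and p: "0 < p"
    and le: "\<And>\<zeta>. \<Phi> (\<zeta> + s) \<le> ln (\<Psi> \<zeta>) + c"
  shows "(LINT \<zeta>|gauss \<sigma>. \<Phi> \<zeta>) \<le> ln (LINT \<zeta>|gauss \<sigma>. \<Psi> \<zeta>) + c + s\<^sup>2 / (2 * \<sigma>\<^sup>2)"
proof (cases "\<sigma> = 0")
  case True
  then have s: "s = 0" using \<sigma> by simp
  have "(LINT \<zeta>|gauss \<sigma>. g \<zeta>) = g 0" if "g \<in> borel_measurable borel" for g :: "real \<Rightarrow> real"
    using True that by (simp add: gauss_def integral_return)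
  then show ?thesis using le[of 0] s True \<Phi>(1) \<Psi>(1) by simp
next
  case False
  then have \<sigma>0: "\<sigma> > 0" using \<sigma> by simp
  interpret G: prob_space "gauss \<sigma>" by (rule prob_space_gauss[OF \<sigma>(1)])
  let ?n = "normal_density 0 \<sigma>"
  have n0: "?n \<zeta> > 0" for \<zeta> by (rule normal_density_pos[OF \<sigma>0])
  have dens: "(LINT \<zeta>|gauss \<sigma>. g \<zeta>) = (LINT \<zeta>|lborel. ?n \<zeta> * g \<zeta>)" if "g \<in> borel_measurable borel" for g :: "real \<Rightarrow> real"
    using False that by (simp add: gauss_def integral_density)
  have densi: "integrable lborel (\<lambda>\<zeta>. ?n \<zeta> * g \<zeta>)" if "g \<in> borel_measurable borel" "\<And>\<zeta>. \<bar>g \<zeta>\<bar> \<le> C" for g :: "real \<Rightarrow> real" and C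
    using gauss_integrable_bounded[OF \<sigma>(1) that] False that by (simp add: gauss_def integrable_density)
  define A where "A = (LINT \<zeta>|gauss \<sigma>. \<Psi> \<zeta>)"
  have "p = (LINT \<zeta>|gauss \<sigma>. p)" using G.prob_space by simp
  also have "\<dots> \<le> A"
    unfolding A_def by (rule integral_mono[OF _ gauss_integrable_bounded[OF \<sigma>(1) \<Psi>(1,3)] \<Psi>(2)]) simp
  finally have A: "A > 0" using p by simp
  \<comment> \<open>The log-likelihood ratio is written in the variable \<open>\<zeta> + s\<close>,
    which is centred under the shifted density; its linear part then integrates to 0.\<close>
  have r: "ln (?n \<zeta> / ?n (\<zeta> + s)) = (2 * s * (\<zeta> + s) - s\<^sup>2) / (2 * \<sigma>\<^sup>2)" for \<zeta>
  proof -
    have "ln (?n \<zeta> / ?n (\<zeta> + s)) = - (\<zeta>)\<^sup>2 / (2 * \<sigma>\<^sup>2) - (- (\<zeta> + s)\<^sup>2 / (2 * \<sigma>\<^sup>2))"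
      using \<sigma>0 by (simp add: normal_density_def exp_diff[symmetric])
    also have "\<dots> = (2 * s * (\<zeta> + s) - s\<^sup>2) / (2 * \<sigma>\<^sup>2)"
      by (simp add: power2_eq_square algebra_simps add_divide_distrib[symmetric] diff_divide_distrib[symmetric])
    finally show ?thesis .
  qed
  \<comment> \<open>Gibbs variational principle in pointwise form: \<open>ln t \<le> t - 1\<close>,
    with \<open>t\<close> the quotient of the tilted density
    \<open>\<Psi> \<zeta> * ?n \<zeta> / A\<close> and the shifted one.\<close>
  have pw: "?n (\<zeta> + s) * \<Phi> (\<zeta> + s) \<le>
      ?n (\<zeta> + s) * (ln A + c - 1 + s\<^sup>2 / (2 * \<sigma>\<^sup>2)) - ?n (\<zeta> + s) * (\<zeta> + s) * (s / \<sigma>\<^sup>2) + ?n \<zeta> * \<Psi> \<zeta> / A" for \<zeta>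
  proof -
    have \<Psi>0: "\<Psi> \<zeta> > 0" using \<Psi>(2)[of \<zeta>] p by linarith
    let ?t = "\<Psi> \<zeta> * ?n \<zeta> / (A * ?n (\<zeta> + s))"
    have t: "?t > 0" using \<Psi>0 n0 A by simp
    have "ln ?t \<le> ?t - 1" by (rule ln_le_minus_one[OF t])
    moreover have "ln ?t = ln (\<Psi> \<zeta>) - ln A + ln (?n \<zeta> / ?n (\<zeta> + s))"
      using \<Psi>0 n0[of \<zeta>] n0[of "\<zeta> + s"] A by (simp add: ln_mult ln_div)
    ultimately have "ln (\<Psi> \<zeta>) \<le> ln A - (2 * s * (\<zeta> + s) - s\<^sup>2) / (2 * \<sigma>\<^sup>2) + ?t - 1"
      using r[of \<zeta>] by simp
    then have "\<Phi> (\<zeta> + s) \<le> ln A - (2 * s * (\<zeta> + s) - s\<^sup>2) / (2 * \<sigma>\<^sup>2) + ?t - 1 + c"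
      using le[of \<zeta>] by simp
    then have "?n (\<zeta> + s) * \<Phi> (\<zeta> + s) \<le> ?n (\<zeta> + s) * (ln A - (2 * s * (\<zeta> + s) - s\<^sup>2) / (2 * \<sigma>\<^sup>2) + ?t - 1 + c)"
      using n0[of "\<zeta> + s"] by (intro mult_left_mono) auto
    also have "\<dots> = ?n (\<zeta> + s) * (ln A + c - 1 - (2 * s * (\<zeta> + s) - s\<^sup>2) / (2 * \<sigma>\<^sup>2)) + ?n (\<zeta> + s) * ?t"
      by (simp add: algebra_simps)
    also have "?n (\<zeta> + s) * ?t = ?n \<zeta> * \<Psi> \<zeta> / A"
      using n0[of "\<zeta> + s"] A by (simp add: field_simps)
    also have "(2 * s * (\<zeta> + s) - s\<^sup>2) / (2 * \<sigma>\<^sup>2) = (\<zeta> + s) * (s / \<sigma>\<^sup>2) - s\<^sup>2 / (2 * \<sigma>\<^sup>2)"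
      using \<sigma>0 by (simp add: diff_divide_distrib mult.commute)
    also have "?n (\<zeta> + s) * (ln A + c - 1 - ((\<zeta> + s) * (s / \<sigma>\<^sup>2) - s\<^sup>2 / (2 * \<sigma>\<^sup>2)))
       = ?n (\<zeta> + s) * (ln A + c - 1 + s\<^sup>2 / (2 * \<sigma>\<^sup>2)) - ?n (\<zeta> + s) * (\<zeta> + s) * (s / \<sigma>\<^sup>2)"
      by (simp only: right_diff_distrib mult.assoc diff_add_eq diff_diff_eq2)
    finally show ?thesis .
  qed
  have shift: "(LINT \<zeta>|lborel. f (\<zeta> + s)) = (LINT \<zeta>|lborel. f \<zeta>)" for f :: "real \<Rightarrow> real"
    using lborel_integral_real_affine[of 1 f s] by (simp add: add.commute)
  have shifti: "integrable lborel (\<lambda>\<zeta>. f (\<zeta> + s))" if "integrable lborel f" for f :: "real \<Rightarrow> real"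
    using lborel_integrable_real_affine[OF that, of 1 s] by (simp add: add.commute)
  have i1: "integrable lborel ?n" using \<sigma>0 by (rule integrable_normal_density)
  have i2: "integrable lborel (\<lambda>\<zeta>. ?n \<zeta> * \<zeta>)" using integrable_normal_moment[OF \<sigma>0, of 0 1] by simp
  have e1: "(LINT \<zeta>|lborel. ?n \<zeta>) = 1" using \<sigma>0 by (rule integral_normal_density)
  have e2: "(LINT \<zeta>|lborel. ?n \<zeta> * \<zeta>) = 0" using integral_normal_moment_odd[OF \<sigma>0, of 0 0] by simp
  have i3: "integrable lborel (\<lambda>\<zeta>. ?n \<zeta> * \<Psi> \<zeta>)" by (rule densi[OF \<Psi>(1,3)])
  have e3: "(LINT \<zeta>|lborel. ?n \<zeta> * \<Psi> \<zeta>) = A" using dens[OF \<Psi>(1)] by (simp add: A_def)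
  let ?K = "ln A + c - 1 + s\<^sup>2 / (2 * \<sigma>\<^sup>2)" and ?k = "s / \<sigma>\<^sup>2"
  have "(LINT \<zeta>|gauss \<sigma>. \<Phi> \<zeta>) = (LINT \<zeta>|lborel. ?n (\<zeta> + s) * \<Phi> (\<zeta> + s))"
    using dens[OF \<Phi>(1)] shift[of "\<lambda>\<zeta>. ?n \<zeta> * \<Phi> \<zeta>"] by simp
  also have "\<dots> \<le> (LINT \<zeta>|lborel. ?n (\<zeta> + s) * ?K - ?n (\<zeta> + s) * (\<zeta> + s) * ?k + ?n \<zeta> * \<Psi> \<zeta> / A)"
  proof (rule integral_mono)
    show "integrable lborel (\<lambda>\<zeta>. ?n (\<zeta> + s) * \<Phi> (\<zeta> + s))"
      by (rule shifti[OF densi[OF \<Phi>]])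
    show "integrable lborel (\<lambda>\<zeta>. ?n (\<zeta> + s) * ?K - ?n (\<zeta> + s) * (\<zeta> + s) * ?k + ?n \<zeta> * \<Psi> \<zeta> / A)"
      using shifti[OF i1] shifti[OF i2] i3 by simp
    show "?n (\<zeta> + s) * \<Phi> (\<zeta> + s) \<le> ?n (\<zeta> + s) * ?K - ?n (\<zeta> + s) * (\<zeta> + s) * ?k + ?n \<zeta> * \<Psi> \<zeta> / A" for \<zeta>
      by (rule pw)
  qed
  also have "\<dots> = 1 * ?K - 0 * ?k + A / A"
    using shifti[OF i1] shifti[OF i2] i3 e1 e2 e3 shift[of ?n] shift[of "\<lambda>\<zeta>. ?n \<zeta> * \<zeta>"] by simp
  also have "\<dots> = ln A + c + s\<^sup>2 / (2 * \<sigma>\<^sup>2)" using A by simp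
  finally show ?thesis unfolding A_def .
qed

section \<open>Test functions and noise acting on single coordinates\<close>

definition wnorm :: "(nat \<Rightarrow> real) \<Rightarrow> nat set \<Rightarrow> (nat \<Rightarrow> real) \<Rightarrow> real" where
  "wnorm g I z = L2_set (\<lambda>i. sqrt (g i) * z i) I"

lemma wnorm_nonneg [simp]: "0 \<le> wnorm g I z"
  by (simp add: wnorm_def)

lemma wnorm_sq: "(\<And>i. i \<in> I \<Longrightarrow> 0 \<le> g i) \<Longrightarrow> (wnorm g I z)\<^sup>2 = (\<Sum>i\<in>I. g i * (z i)\<^sup>2)"
  by (simp add: wnorm_def L2_set_def sum_nonneg power_mult_distrib)

text \<open>Lipschitz for a seminorm on finitely many coordinates: such functions are defined on all
  sequences but see only finitely many modes. The constants are left open because the class serves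
  measurability and integrability.\<close>

definition blip :: "((nat \<Rightarrow> real) \<Rightarrow> real) \<Rightarrow> ((nat \<Rightarrow> real) \<Rightarrow> real) \<Rightarrow> bool" where
  "blip nrm \<phi> \<longleftrightarrow> (\<exists>B. \<forall>x. \<bar>\<phi> x\<bar> \<le> B) \<and> (\<exists>L\<ge>0. \<forall>x y. \<bar>\<phi> x - \<phi> y\<bar> \<le> L * nrm (\<lambda>i. x i - y i))"

text \<open>One coordinate at a time: product Gaussians arise by iteration, so the entropy estimate
  remains one-dimensional.\<close>

definition gop :: "(nat \<Rightarrow> real) \<Rightarrow> nat \<Rightarrow> ((nat \<Rightarrow> real) \<Rightarrow> real) \<Rightarrow> (nat \<Rightarrow> real) \<Rightarrow> real" where
  "gop \<sigma> i \<phi> x = (LINT \<zeta>|gauss (\<sigma> i). \<phi> (x(i := x i + \<zeta>)))"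

lemma wnorm_single:
  assumes "finite I"
  shows "wnorm g I (\<lambda>j. (x(i := a)) j - (x(i := b)) j) \<le> \<bar>sqrt (g i)\<bar> * \<bar>a - b\<bar>"
proof -
  have "wnorm g I (\<lambda>j. (x(i := a)) j - (x(i := b)) j) \<le> (\<Sum>j\<in>I. \<bar>sqrt (g j) * ((x(i := a)) j - (x(i := b)) j)\<bar>)"
    unfolding wnorm_def by (rule L2_set_le_sum_abs)
  also have "\<dots> = (\<Sum>j\<in>I. if j = i then \<bar>sqrt (g i) * (a - b)\<bar> else 0)"
    by (intro sum.cong refl) auto
  also have "\<dots> \<le> \<bar>sqrt (g i) * (a - b)\<bar>"
    using assms by (simp add: sum.delta)
  finally show ?thesis by (simp only: abs_mult)
qed

lemma blip_coordinate_continuous: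
  assumes "finite I" "blip (wnorm g I) \<phi>"
  shows "continuous_on UNIV (\<lambda>\<zeta>. \<phi> (x(i := x i + \<zeta>)))"
proof -
  obtain L where L: "L \<ge> 0" "\<And>x y. \<bar>\<phi> x - \<phi> y\<bar> \<le> L * wnorm g I (\<lambda>i. x i - y i)"
    using assms(2) by (auto simp: blip_def)
  have "(L * \<bar>sqrt (g i)\<bar>)-lipschitz_on UNIV (\<lambda>\<zeta>. \<phi> (x(i := x i + \<zeta>)))"
  proof (rule lipschitz_onI)
    fix a b :: real
    have "dist (\<phi> (x(i := x i + a))) (\<phi> (x(i := x i + b))) \<le> L * wnorm g I (\<lambda>j. (x(i := x i + a)) j - (x(i := x i + b)) j)"
      unfolding dist_real_def by (rule L(2))
    also have "\<dots> \<le> L * (\<bar>sqrt (g i)\<bar> * \<bar>(x i + a) - (x i + b)\<bar>)"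
      by (intro mult_left_mono wnorm_single assms L)
    finally show "dist (\<phi> (x(i := x i + a))) (\<phi> (x(i := x i + b))) \<le> L * \<bar>sqrt (g i)\<bar> * dist a b"
      by (simp add: dist_real_def mult.assoc)
  qed (use L in auto)
  then show ?thesis
    by (rule lipschitz_on_continuous_on)
qed

lemma blip_coordinate_measurable:
  assumes "finite I" "blip (wnorm g I) \<phi>"
  shows "(\<lambda>\<zeta>. \<phi> (x(i := x i + \<zeta>))) \<in> borel_measurable borel"
  by (rule borel_measurable_continuous_onI[OF blip_coordinate_continuous[OF assms]])

lemma blip_coordinate_integrable:
  assumes "finite I" "blip (wnorm g I) \<phi>" "0 \<le> s"
  shows "integrable (gauss s) (\<lambda>\<zeta>. \<phi> (x(i := x i + \<zeta>)))"
proof -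
  obtain B where "\<And>x. \<bar>\<phi> x\<bar> \<le> B" using assms(2) by (auto simp: blip_def)
  then show ?thesis
    by (intro gauss_integrable_bounded assms blip_coordinate_measurable[OF assms(1,2)])
qed

lemma gop_abs_le:
  assumes I: "finite I" "blip (wnorm g I) \<phi>" "0 \<le> \<sigma> i" and B: "\<And>x. \<bar>\<phi> x\<bar> \<le> B"
  shows "\<bar>gop \<sigma> i \<phi> x\<bar> \<le> B"
proof -
  interpret G: prob_space "gauss (\<sigma> i)" by (rule prob_space_gauss[OF I(3)])
  have "\<bar>gop \<sigma> i \<phi> x\<bar> \<le> (LINT \<zeta>|gauss (\<sigma> i). \<bar>\<phi> (x(i := x i + \<zeta>))\<bar>)"
    unfolding gop_def by (rule integral_abs_bound)
  also have "\<dots> \<le> (LINT \<zeta>|gauss (\<sigma> i). B)"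
    by (intro integral_mono integrable_abs blip_coordinate_integrable[OF I] G.integrable_const B)
  finally show ?thesis using G.prob_space by simp
qed

lemma gop_ge:
  assumes I: "finite I" "blip (wnorm g I) \<phi>" "0 \<le> \<sigma> i" and p: "\<And>x. p \<le> \<phi> x"
  shows "p \<le> gop \<sigma> i \<phi> x"
proof -
  interpret G: prob_space "gauss (\<sigma> i)" by (rule prob_space_gauss[OF I(3)])
  have "(LINT \<zeta>|gauss (\<sigma> i). p) \<le> gop \<sigma> i \<phi> x"
    unfolding gop_def by (intro integral_mono blip_coordinate_integrable[OF I] G.integrable_const p)
  then show ?thesis using G.prob_space by simp
qed

lemma blip_gop:
  assumes I: "finite I" "blip (wnorm g I) \<phi>" "0 \<le> \<sigma> i"
  shows "blip (wnorm g I) (gop \<sigma> i \<phi>)"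
proof -
  interpret G: prob_space "gauss (\<sigma> i)" by (rule prob_space_gauss[OF I(3)])
  obtain B where B: "\<And>x. \<bar>\<phi> x\<bar> \<le> B" using I(2) by (auto simp: blip_def)
  obtain L where L: "L \<ge> 0" "\<And>x y. \<bar>\<phi> x - \<phi> y\<bar> \<le> L * wnorm g I (\<lambda>i. x i - y i)"
    using I(2) by (auto simp: blip_def)
  have "\<bar>gop \<sigma> i \<phi> x - gop \<sigma> i \<phi> y\<bar> \<le> L * wnorm g I (\<lambda>i. x i - y i)" for x y
  proof -
    have e: "(\<lambda>j. (x(i := x i + \<zeta>)) j - (y(i := y i + \<zeta>)) j) = (\<lambda>j. x j - y j)" for \<zeta>
      by (auto simp: fun_eq_iff)
    have d: "\<bar>\<phi> (x(i := x i + \<zeta>)) - \<phi> (y(i := y i + \<zeta>))\<bar> \<le> L * wnorm g I (\<lambda>i. x i - y i)" for \<zeta>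
      using L(2)[of "x(i := x i + \<zeta>)" "y(i := y i + \<zeta>)"] unfolding e .
    have "gop \<sigma> i \<phi> x - gop \<sigma> i \<phi> y = (LINT \<zeta>|gauss (\<sigma> i). \<phi> (x(i := x i + \<zeta>)) - \<phi> (y(i := y i + \<zeta>)))"
      unfolding gop_def by (intro Bochner_Integration.integral_diff[symmetric] blip_coordinate_integrable[OF I])
    also have "\<bar>\<dots>\<bar> \<le> (LINT \<zeta>|gauss (\<sigma> i). \<bar>\<phi> (x(i := x i + \<zeta>)) - \<phi> (y(i := y i + \<zeta>))\<bar>)"
      by (rule integral_abs_bound)
    also have "\<dots> \<le> (LINT \<zeta>|gauss (\<sigma> i). L * wnorm g I (\<lambda>i. x i - y i))"
      by (intro integral_mono integrable_abs Bochner_Integration.integrable_diff blip_coordinate_integrable[OF I] G.integrable_const d)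
    finally show ?thesis using G.prob_space by simp
  qed
  then show ?thesis
    unfolding blip_def
  proof -
    have "\<bar>gop \<sigma> i \<phi> x\<bar> \<le> B" for x
      by (rule gop_abs_le[OF I(1)]) (rule I(2), rule I(3), rule B)
    then show "(\<exists>B. \<forall>x. \<bar>gop \<sigma> i \<phi> x\<bar> \<le> B) \<and> (\<exists>L\<ge>0. \<forall>x y. \<bar>gop \<sigma> i \<phi> x - gop \<sigma> i \<phi> y\<bar> \<le> L * wnorm g I (\<lambda>i. x i - y i))"
      using \<open>\<And>x y. \<bar>gop \<sigma> i \<phi> x - gop \<sigma> i \<phi> y\<bar> \<le> L * wnorm g I (\<lambda>i. x i - y i)\<close> L(1) by blast
  qed
qed

text \<open>The noise \<open>\<zeta>\<close> at \<open>x\<close> is compared with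
  \<open>\<zeta> + s\<close> at \<open>y\<close>. The difference of the perturbed points then does
  not depend on \<open>\<zeta>\<close> and has lost \<open>s\<close> in coordinate
  \<open>i\<close>.\<close>

lemma gop_log_harnack:
  assumes I: "finite I" "0 \<le> \<sigma> i" "\<sigma> i = 0 \<Longrightarrow> s = 0"
    and \<Phi>: "blip (wnorm g I) \<Phi>" and \<Psi>: "blip (wnorm g I) \<Psi>" "\<And>x. p \<le> \<Psi> x" "0 < p"
    and le: "\<And>x y. \<Phi> y \<le> ln (\<Psi> x) + c (\<lambda>j. x j - y j)"
  shows "gop \<sigma> i \<Phi> y \<le> ln (gop \<sigma> i \<Psi> x) + c ((\<lambda>j. x j - y j)(i := x i - y i - s)) + s\<^sup>2 / (2 * (\<sigma> i)\<^sup>2)"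
  unfolding gop_def
proof -
  obtain B1 where B1: "\<And>x. \<bar>\<Phi> x\<bar> \<le> B1" using \<Phi> by (auto simp: blip_def)
  obtain B2 where B2: "\<And>x. \<bar>\<Psi> x\<bar> \<le> B2" using \<Psi> by (auto simp: blip_def)
  show "(LINT \<zeta>|gauss (\<sigma> i). \<Phi> (y(i := y i + \<zeta>))) \<le> ln (LINT \<zeta>|gauss (\<sigma> i). \<Psi> (x(i := x i + \<zeta>)))
     + c ((\<lambda>j. x j - y j)(i := x i - y i - s)) + s\<^sup>2 / (2 * (\<sigma> i)\<^sup>2)"
  proof (rule gauss_shift_entropy[where B="max B1 B2" and p=p])
    show "\<bar>\<Phi> (y(i := y i + \<zeta>))\<bar> \<le> max B1 B2" for \<zeta> using B1 by (simp add: le_max_iff_disj)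
    show "\<bar>\<Psi> (x(i := x i + \<zeta>))\<bar> \<le> max B1 B2" for \<zeta> using B2 by (simp add: le_max_iff_disj)
    show "\<Phi> (y(i := y i + (\<zeta> + s))) \<le> ln (\<Psi> (x(i := x i + \<zeta>))) + c ((\<lambda>j. x j - y j)(i := x i - y i - s))" for \<zeta>
    proof -
      have "(\<lambda>j. (x(i := x i + \<zeta>)) j - (y(i := y i + (\<zeta> + s))) j) = (\<lambda>j. x j - y j)(i := x i - y i - s)"
        by (auto simp: fun_eq_iff)
      then show ?thesis using le[of "y(i := y i + (\<zeta> + s))" "x(i := x i + \<zeta>)"] by simp
    qed
  qed (use I \<Psi> blip_coordinate_measurable[OF I(1) \<Phi>] blip_coordinate_measurable[OF I(1) \<Psi>(1)] in auto)
qed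

definition gops :: "(nat \<Rightarrow> real) \<Rightarrow> nat list \<Rightarrow> ((nat \<Rightarrow> real) \<Rightarrow> real) \<Rightarrow> (nat \<Rightarrow> real) \<Rightarrow> real" where
  "gops \<sigma> is \<phi> = foldr (gop \<sigma>) is \<phi>"

lemma gops_simps [simp]: "gops \<sigma> [] \<phi> = \<phi>" "gops \<sigma> (i # is) \<phi> = gop \<sigma> i (gops \<sigma> is \<phi>)"
  by (simp_all add: gops_def)

lemma blip_gops:
  assumes "finite I" "blip (wnorm g I) \<phi>" "\<And>i. 0 \<le> \<sigma> i"
  shows "blip (wnorm g I) (gops \<sigma> is \<phi>)"
  by (induction "is") (auto intro!: blip_gop assms)

lemma gops_ge:
  assumes I: "finite I" "blip (wnorm g I) \<phi>" "\<And>i. 0 \<le> \<sigma> i" and p: "\<And>x. p \<le> \<phi> x"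
  shows "p \<le> gops \<sigma> is \<phi> x"
  by (induction "is" arbitrary: x) (auto intro!: gop_ge blip_gops I p)

text \<open>The shifts do not depend on the noise and no coordinate is shifted twice, so the
  entropies of the independent coordinates add up.\<close>

lemma gops_log_harnack:
  assumes I: "finite I" "\<And>i. 0 \<le> \<sigma> i" "\<And>i. \<sigma> i = 0 \<Longrightarrow> s i = 0"
    and \<Phi>: "blip (wnorm g I) \<Phi>" and \<Psi>: "blip (wnorm g I) \<Psi>" "\<And>x. p \<le> \<Psi> x" "0 < p"
    and le: "\<And>x y. \<Phi> y \<le> ln (\<Psi> x) + c (\<lambda>j. x j - y j)"
    and d: "distinct is"
  shows "gops \<sigma> is \<Phi> y \<le> ln (gops \<sigma> is \<Psi> x)
     + c (\<lambda>j. x j - y j - (if j \<in> set is then s j else 0)) + (\<Sum>i\<leftarrow>is. (s i)\<^sup>2 / (2 * (\<sigma> i)\<^sup>2))"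
  using d
proof (induction "is" arbitrary: x y)
  case Nil
  then show ?case using le by simp
next
  case (Cons i "is")
  \<comment> \<open>The error function once the remaining coordinates have been treated; coordinate
    \<open>i\<close> is the outermost integral.\<close>
  let ?c = "\<lambda>z. c (\<lambda>j. z j - (if j \<in> set is then s j else 0)) + (\<Sum>i\<leftarrow>is. (s i)\<^sup>2 / (2 * (\<sigma> i)\<^sup>2))"
  have "gop \<sigma> i (gops \<sigma> is \<Phi>) y \<le> ln (gop \<sigma> i (gops \<sigma> is \<Psi>) x)
     + ?c ((\<lambda>j. x j - y j)(i := x i - y i - s i)) + (s i)\<^sup>2 / (2 * (\<sigma> i)\<^sup>2)"
  proof (rule gop_log_harnack[where c="?c" and p=p, OF I(1,2,3)])
    show "gops \<sigma> is \<Phi> y \<le> ln (gops \<sigma> is \<Psi> x) + ?c (\<lambda>j. x j - y j)" for x y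
      using Cons by (simp add: add.assoc)
  qed (auto intro!: blip_gops gops_ge I \<Phi> \<Psi>)
  moreover have "(\<lambda>j. ((\<lambda>j. x j - y j)(i := x i - y i - s i)) j - (if j \<in> set is then s j else 0))
     = (\<lambda>j. x j - y j - (if j \<in> set (i # is) then s j else 0))"
    using Cons.prems by (auto simp: fun_eq_iff)
  ultimately show ?case by simp
qed

section \<open>Iterated Euler steps\<close>

definition qop :: "((nat \<Rightarrow> real) \<Rightarrow> nat \<Rightarrow> real) \<Rightarrow> (nat \<Rightarrow> real) \<Rightarrow> nat list \<Rightarrow> ((nat \<Rightarrow> real) \<Rightarrow> real) \<Rightarrow> (nat \<Rightarrow> real) \<Rightarrow> real" where
  "qop T \<sigma> is \<phi> x = gops \<sigma> is \<phi> (T x)"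

text \<open>For negative \<open>t\<close> the quadratic lower bound of \<open>exp (- t)\<close> is
  inverted. Any constant in front of the square would do; only the linear term has to be
  exact.\<close>

lemma exp_le_quadratic:
  assumes "\<bar>t\<bar> \<le> (1::real)"
  shows "exp t \<le> 1 + t + t\<^sup>2"
proof (cases "t \<ge> 0")
  case True
  then show ?thesis using exp_bound[of t] assms by simp
next
  case False
  have "exp (- t) \<ge> 1 + (-t) + (-t)\<^sup>2 / 2"
    using False by (intro exp_lower_Taylor_quadratic) auto
  moreover have "1 - t + t\<^sup>2 / 2 > 0" using False by (simp add: add_pos_nonneg)
  ultimately have "inverse (exp (- t)) \<le> inverse (1 - t + t\<^sup>2 / 2)"
    by (intro le_imp_inverse_le) auto
  then have "exp t \<le> 1 / (1 - t + t\<^sup>2 / 2)"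
    by (simp add: exp_minus inverse_eq_divide)
  also have "\<dots> \<le> 1 + t + t\<^sup>2"
  proof -
    have "(1 + t + t\<^sup>2) * (1 - t + t\<^sup>2 / 2) = 1 + t\<^sup>2 / 2 * (1 - t) + t^4 / 2"
      by (simp add: power2_eq_square power4_eq_xxxx field_simps)
    then have "(1 + t + t\<^sup>2) * (1 - t + t\<^sup>2 / 2) \<ge> 1" using False by simp
    moreover have "1 - t + t\<^sup>2 / 2 > 0" using False by (simp add: add_pos_nonneg)
    ultimately show ?thesis by (simp add: pos_divide_le_eq)
  qed
  finally show ?thesis .
qed

text \<open>An Euler chain \<open>x \<mapsto> T x + noise\<close>: if steering the second of two copies by \<open>s\<close> contracts the distance and
  the entropy cost of the steering is controlled by the gain in distance, then an asymptotic log-Harnack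
  inequality holds with constants that do not depend on the number of steps.\<close>

locale controlled_chain =
  fixes T :: "(nat \<Rightarrow> real) \<Rightarrow> nat \<Rightarrow> real" and \<sigma> :: "nat \<Rightarrow> real" and "is" :: "nat list"
    and g :: "nat \<Rightarrow> real" and I :: "nat set" and s :: "(nat \<Rightarrow> real) \<Rightarrow> nat \<Rightarrow> real" and a C K :: real
  assumes I: "finite I" "distinct is" "set is = I" and g: "\<And>i. i \<in> I \<Longrightarrow> 0 \<le> g i"
    and \<sigma>: "\<And>i. 0 \<le> \<sigma> i" and s0: "\<And>i z. \<sigma> i = 0 \<Longrightarrow> s z i = 0"
    and a: "0 \<le> a" "a \<le> 1" and C: "0 \<le> C" and K: "0 \<le> K"
    and lipT: "\<And>x y. wnorm g I (\<lambda>i. T x i - T y i) \<le> K * wnorm g I (\<lambda>i. x i - y i)"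
    and contr: "\<And>x y. (wnorm g I (\<lambda>i. T x i - T y i - s (\<lambda>i. x i - y i) i))\<^sup>2 \<le> a * (wnorm g I (\<lambda>i. x i - y i))\<^sup>2"
    and cost: "\<And>z. (\<Sum>i\<in>I. (s z i)\<^sup>2 / (2 * (\<sigma> i)\<^sup>2)) \<le> C * (1 - a) * (wnorm g I z)\<^sup>2"
begin

abbreviation "nrm \<equiv> wnorm g I"
abbreviation "Q \<equiv> qop T \<sigma> is"

lemma blip_Q:
  assumes "blip nrm \<phi>"
  shows "blip nrm (Q \<phi>)"
proof -
  have b: "blip nrm (gops \<sigma> is \<phi>)" by (intro blip_gops I assms \<sigma>)
  obtain L where L: "L \<ge> 0" "\<And>x y. \<bar>gops \<sigma> is \<phi> x - gops \<sigma> is \<phi> y\<bar> \<le> L * nrm (\<lambda>i. x i - y i)"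
    using b by (auto simp: blip_def)
  have "\<bar>Q \<phi> x - Q \<phi> y\<bar> \<le> (L * K) * nrm (\<lambda>i. x i - y i)" for x y
  proof -
    have "\<bar>Q \<phi> x - Q \<phi> y\<bar> \<le> L * nrm (\<lambda>i. T x i - T y i)"
      unfolding qop_def by (rule L(2))
    also have "\<dots> \<le> L * (K * nrm (\<lambda>i. x i - y i))"
      by (intro mult_left_mono lipT L)
    finally show ?thesis by (simp add: mult.assoc)
  qed
  moreover obtain B where "\<And>x. \<bar>gops \<sigma> is \<phi> x\<bar> \<le> B" using b by (auto simp: blip_def)
  ultimately show ?thesis
    unfolding blip_def using mult_nonneg_nonneg[OF L(1) K] by (auto simp: qop_def[of T \<sigma> "is" \<phi>])
qed

lemma blip_Qpow: "blip nrm \<phi> \<Longrightarrow> blip nrm ((Q ^^ j) \<phi>)"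
  by (induction j) (auto intro: blip_Q)

lemma Qpow_ge: "blip nrm \<phi> \<Longrightarrow> (\<And>x. p \<le> \<phi> x) \<Longrightarrow> p \<le> (Q ^^ j) \<phi> x"
  by (induction j arbitrary: x) (auto simp: qop_def intro!: gops_ge[OF I(1)] blip_Qpow \<sigma>)

lemma Qpow_scale: "(Q ^^ j) (\<lambda>x. r * \<phi> x) x = r * (Q ^^ j) \<phi> x"
proof -
  have 1: "gops \<sigma> l (\<lambda>x. r * \<psi> x) = (\<lambda>x. r * gops \<sigma> l \<psi> x)" for l \<psi>
    by (induction l) (auto simp: gop_def)
  have 2: "Q (\<lambda>x. r * \<psi> x) = (\<lambda>x. r * Q \<psi> x)" for \<psi>
    by (simp add: qop_def[abs_def] 1)
  have "(Q ^^ j) (\<lambda>x. r * \<phi> x) = (\<lambda>x. r * (Q ^^ j) \<phi> x)"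
    by (induction j) (auto simp: 2)
  then show ?thesis by simp
qed

lemma blip_add_const:
  assumes "blip nrm \<phi>"
  shows "blip nrm (\<lambda>x. r + \<phi> x)"
proof -
  obtain B where "\<And>x. \<bar>\<phi> x\<bar> \<le> B" using assms by (auto simp: blip_def)
  then have "\<bar>r + \<phi> x\<bar> \<le> \<bar>r\<bar> + B" for x
    by (rule order_trans[OF abs_triangle_ineq add_left_mono])
  then show ?thesis using assms unfolding blip_def by auto
qed

lemma gop_mono:
  assumes "blip nrm \<phi>" "blip nrm \<psi>" "\<And>x. \<phi> x \<le> \<psi> x"
  shows "gop \<sigma> i \<phi> x \<le> gop \<sigma> i \<psi> x"
  unfolding gop_def
  by (intro integral_mono blip_coordinate_integrable[OF I(1) assms(1) \<sigma>] blip_coordinate_integrable[OF I(1) assms(2) \<sigma>] assms(3))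

lemma Qpow_mono:
  assumes "blip nrm \<phi>" "blip nrm \<psi>" "\<And>x. \<phi> x \<le> \<psi> x"
  shows "(Q ^^ j) \<phi> x \<le> (Q ^^ j) \<psi> x"
proof (induction j arbitrary: x)
  case (Suc j)
  have "gops \<sigma> l ((Q ^^ j) \<phi>) x \<le> gops \<sigma> l ((Q ^^ j) \<psi>) x" for l x
    by (induction l arbitrary: x) (auto intro!: gop_mono blip_gops I(1) blip_Qpow assms \<sigma> Suc)
  then show ?case by (simp add: qop_def[of T \<sigma> "is" "(_ ^^ _) _"])
qed (simp add: assms)

lemma Qpow_add_const:
  assumes "blip nrm \<phi>"
  shows "(Q ^^ j) (\<lambda>x. r + \<phi> x) x = r + (Q ^^ j) \<phi> x"
proof (induction j arbitrary: x)
  case (Suc j)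
  have 1: "gop \<sigma> i (\<lambda>x. r + \<psi> x) x = r + gop \<sigma> i \<psi> x" if "blip nrm \<psi>" for i \<psi> x
  proof -
    interpret G: prob_space "gauss (\<sigma> i)" by (rule prob_space_gauss[OF \<sigma>])
    show ?thesis
      unfolding gop_def using blip_coordinate_integrable[OF I(1) that \<sigma>, where x=x and i=i] G.prob_space by simp
  qed
  have "gops \<sigma> l (\<lambda>x. r + \<psi> x) = (\<lambda>x. r + gops \<sigma> l \<psi> x)" if "blip nrm \<psi>" for l \<psi>
    by (induction l) (auto intro!: ext simp: 1 blip_gops[OF I(1) that \<sigma>])
  moreover have "(Q ^^ j) (\<lambda>x. r + \<phi> x) = (\<lambda>x. r + (Q ^^ j) \<phi> x)"
    using Suc by (intro ext)
  ultimately show ?case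
    using blip_Qpow[OF assms, of j] by (simp add: qop_def[of T \<sigma> "is" "(Q ^^ j) \<phi>"] qop_def[of T \<sigma> "is" "\<lambda>x. r + (Q ^^ j) \<phi> x"])
qed simp

text \<open>With \<open>r\<close> the distance, contraction leaves \<open>C * a * r\<^sup>2\<close>
  and the entropy of the step adds at most \<open>C * (1 - a) * r\<^sup>2\<close>, so the quadratic
  term is stationary. Only the linear term changes, by the factor \<open>sqrt a\<close> per
  step.\<close>

lemma asymptotic_log_harnack:
  assumes \<Phi>: "blip nrm \<Phi>" and \<Psi>: "blip nrm \<Psi>" "\<And>x. p \<le> \<Psi> x" "0 < p" and L: "0 \<le> L"
    and le: "\<And>x y. \<Phi> y \<le> ln (\<Psi> x) + L * nrm (\<lambda>i. x i - y i)"
  shows "(Q ^^ j) \<Phi> y \<le> ln ((Q ^^ j) \<Psi> x) + C * (nrm (\<lambda>i. x i - y i))\<^sup>2 + L * sqrt a ^ j * nrm (\<lambda>i. x i - y i)"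
proof (induction j arbitrary: x y)
  case 0
  then show ?case using le[of y x] C by (simp add: add_increasing2 add.assoc[symmetric]) 
      (smt (verit) mult_nonneg_nonneg zero_le_power2)
next
  case (Suc j)
  let ?c = "\<lambda>z. C * (nrm z)\<^sup>2 + L * sqrt a ^ j * nrm z"
  let ?z = "\<lambda>i. x i - y i"
  \<comment> \<open>The shift is computed from the difference before the step, hence it is constant
    with respect to the noise of the step.\<close>
  let ?z' = "\<lambda>i. T x i - T y i - s ?z i"
  have "gops \<sigma> is ((Q ^^ j) \<Phi>) (T y) \<le> ln (gops \<sigma> is ((Q ^^ j) \<Psi>) (T x))
     + ?c (\<lambda>i. T x i - T y i - (if i \<in> set is then s ?z i else 0)) + (\<Sum>i\<leftarrow>is. (s ?z i)\<^sup>2 / (2 * (\<sigma> i)\<^sup>2))"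
  proof (rule gops_log_harnack[where c="?c" and p=p, OF I(1) \<sigma> s0])
    show "(Q ^^ j) \<Phi> y \<le> ln ((Q ^^ j) \<Psi> x) + ?c (\<lambda>j. x j - y j)" for x y
      using Suc.IH[of y x] by simp
  qed (auto intro!: blip_Qpow Qpow_ge \<Phi> \<Psi> I)
  moreover have "nrm (\<lambda>i. T x i - T y i - (if i \<in> set is then s ?z i else 0)) = nrm ?z'"
    unfolding wnorm_def by (rule L2_set_cong) (auto simp: I)
  moreover have "(\<Sum>i\<leftarrow>is. (s ?z i)\<^sup>2 / (2 * (\<sigma> i)\<^sup>2)) = (\<Sum>i\<in>I. (s ?z i)\<^sup>2 / (2 * (\<sigma> i)\<^sup>2))"
    using I by (simp add: sum_list_distinct_conv_sum_set)
  moreover have "C * (nrm ?z')\<^sup>2 \<le> C * (a * (nrm ?z)\<^sup>2)"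
    by (intro mult_left_mono contr C)
  moreover have "nrm ?z' \<le> sqrt a * nrm ?z"
    using real_sqrt_le_mono[OF contr[of x y]] by (simp add: real_sqrt_mult)
  then have "L * sqrt a ^ j * nrm ?z' \<le> L * sqrt a ^ j * (sqrt a * nrm ?z)"
    using L a by (intro mult_left_mono) auto
  ultimately have "gops \<sigma> is ((Q ^^ j) \<Phi>) (T y) \<le> ln (gops \<sigma> is ((Q ^^ j) \<Psi>) (T x))
     + (C * (a * (nrm ?z)\<^sup>2) + L * sqrt a ^ j * (sqrt a * nrm ?z)) + C * (1 - a) * (nrm ?z)\<^sup>2"
    using cost[of ?z] by simp
  then show ?case
    by (simp add: qop_def[of T \<sigma> "is" "(_ ^^ _) _"] algebra_simps)
qed

text \<open>The estimate follows from the log-Harnack inequality for \<open>exp (\<epsilon> \<phi>)\<close> with \<open>\<epsilon>\<close> the distance of the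
  two starting points.\<close>

lemma Qpow_diff_le:
  assumes \<phi>: "\<And>x. \<bar>\<phi> x\<bar> \<le> 1" "\<And>x y. \<bar>\<phi> x - \<phi> y\<bar> \<le> L * nrm (\<lambda>i. x i - y i)" and L: "0 \<le> L"
    and d: "nrm (\<lambda>i. x i - y i) \<le> \<epsilon>" "0 < \<epsilon>" "\<epsilon> \<le> 1"
  shows "(Q ^^ j) \<phi> y - (Q ^^ j) \<phi> x \<le> (1 + C + L * sqrt a ^ j) * \<epsilon>"
proof -
  \<comment> \<open>With \<open>?\<Psi>\<close> the exponential of \<open>?\<Phi>\<close>, the
    hypothesis of the log-Harnack inequality is just the Lipschitz bound on
    \<open>?\<Phi>\<close>.\<close>
  let ?\<Phi> = "\<lambda>x. \<epsilon> * \<phi> x" and ?\<Psi> = "\<lambda>x. exp (\<epsilon> * \<phi> x)" and ?z = "nrm (\<lambda>i. x i - y i)"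
  have b\<phi>: "blip nrm \<phi>" unfolding blip_def using \<phi> L by blast
  have small: "\<bar>\<epsilon> * \<phi> x\<bar> \<le> 1" "\<bar>\<epsilon> * \<phi> x\<bar> \<le> \<epsilon>" for x
  proof -
    show "\<bar>\<epsilon> * \<phi> x\<bar> \<le> \<epsilon>" using mult_left_mono[OF \<phi>(1)[of x], of \<epsilon>] d by (simp add: abs_mult)
    then show "\<bar>\<epsilon> * \<phi> x\<bar> \<le> 1" using d by linarith
  qed
  have l: "\<bar>?\<Phi> x - ?\<Phi> y\<bar> \<le> (\<epsilon> * L) * nrm (\<lambda>i. x i - y i)" for x y
    using mult_left_mono[OF \<phi>(2)[of x y], of \<epsilon>] d by (simp add: abs_mult right_diff_distrib[symmetric] mult.assoc)
  have b\<Phi>: "blip nrm ?\<Phi>"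
    unfolding blip_def using l small(1) mult_nonneg_nonneg[of \<epsilon> L] d L by (metis less_imp_le)
  have lipexp: "\<bar>exp u - exp v\<bar> \<le> exp 1 * \<bar>u - v\<bar>" if "u \<le> 1" "v \<le> 1" for u v :: real
  proof -
    have *: "\<bar>exp u - exp v\<bar> \<le> exp 1 * \<bar>u - v\<bar>" if "v \<le> u" "u \<le> 1" for u v :: real
    proof -
      have "exp u * (1 + (v - u)) \<le> exp u * exp (v - u)"
        by (intro mult_left_mono exp_ge_add_one_self) auto
      also have "\<dots> = exp v" by (simp add: exp_diff)
      finally have "exp u - exp v \<le> exp u * (u - v)" by (simp add: algebra_simps)
      also have "\<dots> \<le> exp 1 * (u - v)" using that by (intro mult_right_mono) auto
      finally show ?thesis using that by simp
    qed
    show ?thesis using *[of u v] *[of v u] that by (cases "v \<le> u") (auto simp: abs_minus_commute)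
  qed
  have b\<Psi>: "blip nrm ?\<Psi>"
    unfolding blip_def
  proof (intro conjI exI allI)
    show "\<bar>?\<Psi> x\<bar> \<le> exp 1" for x using small(1)[of x] by simp
    show "0 \<le> exp 1 * (\<epsilon> * L)" using d L by simp
    show "\<bar>?\<Psi> x - ?\<Psi> y\<bar> \<le> exp 1 * (\<epsilon> * L) * nrm (\<lambda>i. x i - y i)" for x y
    proof -
      have "\<bar>?\<Psi> x - ?\<Psi> y\<bar> \<le> exp 1 * \<bar>?\<Phi> x - ?\<Phi> y\<bar>"
        using small(1)[of x] small(1)[of y] by (intro lipexp) auto
      also have "\<dots> \<le> exp 1 * ((\<epsilon> * L) * nrm (\<lambda>i. x i - y i))"
        by (intro mult_left_mono l) auto
      finally show ?thesis by (simp add: mult.assoc)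
    qed
  qed
  have p: "exp (-1) \<le> ?\<Psi> x" for x using small(1)[of x] by simp
  have "(Q ^^ j) ?\<Phi> y \<le> ln ((Q ^^ j) ?\<Psi> x) + C * ?z\<^sup>2 + (\<epsilon> * L) * sqrt a ^ j * ?z"
  proof (rule asymptotic_log_harnack[OF b\<Phi> b\<Psi> p])
    show "?\<Phi> y \<le> ln (?\<Psi> x) + \<epsilon> * L * nrm (\<lambda>i. x i - y i)" for x y
      using l[of x y] by simp
  qed (use d L in auto)
  moreover have "(Q ^^ j) ?\<Phi> y = \<epsilon> * (Q ^^ j) \<phi> y" for y
    by (rule Qpow_scale)
  \<comment> \<open>Second-order expansion of the cumulant: the logarithm of the mean of
    \<open>exp (\<epsilon> * \<phi> x)\<close> exceeds the mean of
    \<open>\<epsilon> * \<phi> x\<close> by at most \<open>\<epsilon>\<^sup>2\<close>.\<close>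
  moreover have "ln ((Q ^^ j) ?\<Psi> x) \<le> \<epsilon> * (Q ^^ j) \<phi> x + \<epsilon>\<^sup>2"
  proof -
    have "(Q ^^ j) ?\<Psi> x \<le> (Q ^^ j) (\<lambda>x. (1 + \<epsilon>\<^sup>2) + \<epsilon> * \<phi> x) x"
    proof (rule Qpow_mono[OF b\<Psi>])
      show "blip nrm (\<lambda>x. (1 + \<epsilon>\<^sup>2) + \<epsilon> * \<phi> x)" by (rule blip_add_const[OF b\<Phi>])
      show "?\<Psi> x \<le> 1 + \<epsilon>\<^sup>2 + \<epsilon> * \<phi> x" for x
        using exp_le_quadratic[OF small(1)[of x]] power_mono[OF small(2)[of x], of 2] by simp
    qed
    also have "\<dots> = (1 + \<epsilon>\<^sup>2) + \<epsilon> * (Q ^^ j) \<phi> x"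
      by (simp only: Qpow_add_const[OF b\<Phi>] Qpow_scale)
    finally have *: "(Q ^^ j) ?\<Psi> x \<le> 1 + \<epsilon>\<^sup>2 + \<epsilon> * (Q ^^ j) \<phi> x" .
    have "0 < exp (-1 :: real)" by simp
    then have "0 < (Q ^^ j) ?\<Psi> x" using Qpow_ge[OF b\<Psi> p, of j x] by linarith
    from ln_le_minus_one[OF this] * show ?thesis by simp
  qed
  ultimately have "\<epsilon> * (Q ^^ j) \<phi> y \<le> \<epsilon> * (Q ^^ j) \<phi> x + \<epsilon>\<^sup>2 + C * ?z\<^sup>2 + (\<epsilon> * L) * sqrt a ^ j * ?z"
    by (smt (verit))
  also have "\<dots> \<le> \<epsilon> * (Q ^^ j) \<phi> x + \<epsilon>\<^sup>2 + C * \<epsilon>\<^sup>2 + (\<epsilon> * L) * sqrt a ^ j * \<epsilon>"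
    using d L C a by (intro add_mono mult_left_mono power_mono order_refl) auto
  \<comment> \<open>All errors are of order \<open>\<epsilon>\<^sup>2\<close>, the cost because the
    starting points are at most \<open>\<epsilon>\<close> apart; one factor is cancelled.\<close>
  finally have "\<epsilon> * ((Q ^^ j) \<phi> y - (Q ^^ j) \<phi> x) \<le> \<epsilon> * ((1 + C + L * sqrt a ^ j) * \<epsilon>)"
    by (simp add: algebra_simps power2_eq_square)
  then show ?thesis using d by simp
qed

end

section \<open>Independence from characteristic functions\<close>

lemma iexp_measurable [measurable]: "iexp \<in> borel_measurable borel"
  by (rule borel_measurable_continuous_onI) (intro continuous_intros)

lemma real_distribution_gauss: "0 \<le> s \<Longrightarrow> real_distribution (gauss s)"
  unfolding real_distribution_def real_distribution_axioms_def
  by (simp add: prob_space_gauss)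

lemma char_gauss:
  assumes "0 \<le> s"
  shows "char (gauss s) t = complex_of_real (exp (- (s\<^sup>2 * t\<^sup>2) / 2))"
proof (cases "s = 0")
  case True
  then show ?thesis by (simp add: char_def gauss_def integral_return)
next
  case False
  then have s: "s > 0" using assms by simp
  have "char (gauss s) t = (CLINT x|lborel. normal_density 0 s x *\<^sub>R iexp (t * x))"
    using False by (simp add: char_def gauss_def integral_density)
  also have "\<dots> = \<bar>s\<bar> *\<^sub>R (CLINT x|lborel. normal_density 0 s (0 + s * x) *\<^sub>R iexp (t * (0 + s * x)))"
    by (rule lborel_integral_real_affine[OF False])
  also have "\<dots> = (CLINT x|lborel. \<bar>s\<bar> *\<^sub>R (normal_density 0 s (0 + s * x) *\<^sub>R iexp (t * (0 + s * x))))"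
    by (rule integral_scaleR_right[symmetric])
  also have "\<dots> = (CLINT x|lborel. std_normal_density x *\<^sub>R iexp ((t * s) * x))"
  proof (rule Bochner_Integration.integral_cong[OF refl])
    fix x :: real
    have "s * normal_density 0 s (s * x) = std_normal_density x"
      using s by (simp add: normal_density_def real_sqrt_mult power_mult_distrib)
    then show "\<bar>s\<bar> *\<^sub>R (normal_density 0 s (0 + s * x) *\<^sub>R iexp (t * (0 + s * x))) = std_normal_density x *\<^sub>R iexp ((t * s) * x)"
      using s by (simp add: mult.assoc[symmetric] del: of_real_mult)
  qed
  also have "\<dots> = char std_normal_distribution (t * s)"
    by (simp add: char_def integral_density)
  also have "\<dots> = complex_of_real (exp (- (s\<^sup>2 * t\<^sup>2) / 2))"
    by (simp add: char_std_normal_distribution power_mult_distrib mult.commute)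
  finally show ?thesis .
qed

lemma borel_measurable_list_combination:
  fixes \<Delta> :: "nat \<Rightarrow> 'a \<Rightarrow> real"
  shows "(\<And>i. i \<in> set js \<Longrightarrow> \<Delta> i \<in> borel_measurable M) \<Longrightarrow> (\<lambda>\<omega>. \<Sum>i\<leftarrow>js. c i * \<Delta> i \<omega>) \<in> borel_measurable M"
proof (induction js)
  case (Cons i js)
  then have "(\<lambda>\<omega>. c i * \<Delta> i \<omega> + (\<Sum>i\<leftarrow>js. c i * \<Delta> i \<omega>)) \<in> borel_measurable M"
    by (intro borel_measurable_add borel_measurable_times borel_measurable_const Cons) auto
  then show ?case by simp
qed simp

context prob_space
begin

text \<open>Levy's uniqueness theorem concerns probability measures, so the bounded weight is made
  positive by adding \<open>C + 1\<close> and divided by its mean. As the unweighted law of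
  \<open>A\<close> is \<open>\<nu>\<close> as well, the law of \<open>A\<close> under the resulting
  density has the characteristic function of \<open>\<nu>\<close>.\<close>

lemma char_weighted_real:
  fixes g A :: "'a \<Rightarrow> real"
  assumes gm: "g \<in> borel_measurable M" and gb: "\<And>\<omega>. \<bar>g \<omega>\<bar> \<le> C" and A: "A \<in> borel_measurable M"
    and law: "distr M borel A = \<nu>"
    and h: "\<And>s. (CLINT \<omega>|M. of_real (g \<omega>) * iexp (s * A \<omega>)) = of_real \<kappa> * char \<nu> s"
    and D: "D \<in> sets borel"
  shows "(LINT \<omega>|M. g \<omega> * indicator D (A \<omega>)) = \<kappa> * measure \<nu> D"
proof -
  have rd: "real_distribution \<nu>" unfolding law[symmetric] by (rule real_distribution_distr[OF A])
  interpret nu: real_distribution \<nu> by (rule rd)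
  have gi: "integrable M g" by (rule integrable_const_bound[where B=C]) (use gm gb in auto)
  have \<kappa>: "(LINT \<omega>|M. g \<omega>) = \<kappa>"
  proof -
    have "complex_of_real (LINT \<omega>|M. g \<omega>) = (CLINT \<omega>|M. of_real (g \<omega>) * iexp (0 * A \<omega>))" by simp
    also have "\<dots> = of_real \<kappa>" unfolding h by (simp add: nu.char_zero)
    finally show ?thesis by (simp only: of_real_eq_iff)
  qed
  have k1: "\<kappa> + C + 1 > 0"
  proof -
    have "(LINT \<omega>|M. - C) \<le> (LINT \<omega>|M. g \<omega>)"
      by (rule integral_mono[OF _ gi]) (use gb in \<open>auto simp: abs_le_iff minus_le_iff\<close>)
    then show ?thesis using \<kappa> prob_space by simp
  qed
  define w where "w \<omega> = (g \<omega> + C + 1) / (\<kappa> + C + 1)" for \<omega>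
  have w0: "0 \<le> w \<omega>" for \<omega> using gb[of \<omega>] k1 by (simp add: w_def abs_le_iff)
  have wm [measurable]: "w \<in> borel_measurable M" unfolding w_def[abs_def] using gm by measurable
  have wi: "integrable M w" unfolding w_def[abs_def] using gi by simp
  have w1: "(LINT \<omega>|M. w \<omega>) = 1" unfolding w_def using gi \<kappa> k1 prob_space by simp
  define M' where "M' = density M (\<lambda>\<omega>. ennreal (w \<omega>))"
  have "emeasure M' (space M') = 1"
  proof -
    have "emeasure M' (space M') = (\<integral>\<^sup>+\<omega>. ennreal (w \<omega>) \<partial>M)"
      unfolding M'_def space_density
      by (subst emeasure_density) (auto intro!: nn_integral_cong)
    then show ?thesis using w0 w1 wi by (simp add: nn_integral_eq_integral)
  qed
  then interpret M': prob_space M' by (rule prob_spaceI)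
  have A' [measurable]: "A \<in> borel_measurable M'" using A by (simp add: M'_def)
  have [measurable]: "A \<in> borel_measurable M" by (rule A)
  have ie: "integrable M (\<lambda>\<omega>. iexp (s * A \<omega>))" for s
    by (rule integrable_const_bound[where B=1]) (simp_all add: measurable_compose[OF _ iexp_measurable])
  have gie: "integrable M (\<lambda>\<omega>. of_real (g \<omega>) * iexp (s * A \<omega>))" for s
    by (rule integrable_const_bound[where B=C]) (use gm gb in \<open>auto simp: norm_mult\<close>)
  have c\<nu>: "char \<nu> s = (CLINT \<omega>|M. iexp (s * A \<omega>))" for s
    unfolding law[symmetric] char_def by (rule integral_distr) (use A in auto)
  have "char (distr M' borel A) = char \<nu>"
  proof (rule ext)
    fix s
    have "char (distr M' borel A) s = (CLINT \<omega>|M'. iexp (s * A \<omega>))"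
      unfolding char_def by (rule integral_distr) (use A' in auto)
    also have "\<dots> = (CLINT \<omega>|M. w \<omega> *\<^sub>R iexp (s * A \<omega>))"
      unfolding M'_def by (rule integral_density) (use w0 in auto)
    also have "\<dots> = (CLINT \<omega>|M. (of_real (g \<omega>) * iexp (s * A \<omega>) + of_real (C + 1) * iexp (s * A \<omega>)) / of_real (\<kappa> + C + 1))"
      by (intro Bochner_Integration.integral_cong refl) (simp add: w_def scaleR_conv_of_real field_simps)
    also have "\<dots> = ((CLINT \<omega>|M. of_real (g \<omega>) * iexp (s * A \<omega>)) + of_real (C + 1) * (CLINT \<omega>|M. iexp (s * A \<omega>))) / of_real (\<kappa> + C + 1)"
      by (simp only: integral_divide_zero Bochner_Integration.integral_add[OF gie integrable_mult_right[OF ie]] integral_mult_right_zero)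
    also have "\<dots> = (of_real \<kappa> * char \<nu> s + of_real (C + 1) * char \<nu> s) / of_real (\<kappa> + C + 1)"
      by (simp only: h c\<nu>[symmetric])
    also have "\<dots> = of_real (\<kappa> + C + 1) * char \<nu> s / of_real (\<kappa> + C + 1)"
      by (simp add: algebra_simps)
    also have "\<dots> = char \<nu> s"
    proof -
      have "complex_of_real (\<kappa> + C + 1) \<noteq> 0" unfolding of_real_eq_0_iff using k1 by linarith
      then show ?thesis by (rule nonzero_mult_div_cancel_left)
    qed
    finally show "char (distr M' borel A) s = char \<nu> s" .
  qed
  then have eq: "distr M' borel A = \<nu>"
    by (intro Levy_uniqueness M'.real_distribution_distr A' rd)
  have Di: "integrable M (\<lambda>\<omega>. indicat_real D (A \<omega>))"
    by (rule integrable_const_bound[where B=1]) (use D in \<open>auto simp: indicator_def\<close>)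
  have gDi: "integrable M (\<lambda>\<omega>. g \<omega> * indicat_real D (A \<omega>))"
    by (rule Bochner_Integration.integrable_bound[OF gi]) (use D gm in \<open>auto simp: indicator_def\<close>)
  have d1: "(LINT \<omega>|M. indicat_real D (A \<omega>)) = measure \<nu> D"
  proof -
    have "(LINT x|distr M borel A. indicat_real D x) = (LINT \<omega>|M. indicat_real D (A \<omega>))"
      by (rule integral_distr) (use A D in auto)
    then show ?thesis using D unfolding law by simp
  qed
  have "measure \<nu> D = (LINT \<omega>|M'. indicat_real D (A \<omega>))"
  proof -
    have "(LINT x|distr M' borel A. indicat_real D x) = (LINT \<omega>|M'. indicat_real D (A \<omega>))"
      by (rule integral_distr) (use A' D in auto)
    then show ?thesis using D unfolding eq by simp
  qed
  also have "\<dots> = (LINT \<omega>|M. w \<omega> *\<^sub>R indicat_real D (A \<omega>))"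
    unfolding M'_def by (rule integral_density) (use w0 D in auto)
  also have "\<dots> = (LINT \<omega>|M. (g \<omega> * indicat_real D (A \<omega>) + (C + 1) * indicat_real D (A \<omega>)) / (\<kappa> + C + 1))"
    by (intro Bochner_Integration.integral_cong refl) (simp add: w_def field_simps)
  also have "\<dots> = ((LINT \<omega>|M. g \<omega> * indicat_real D (A \<omega>)) + (C + 1) * measure \<nu> D) / (\<kappa> + C + 1)"
    by (simp only: integral_divide_zero Bochner_Integration.integral_add[OF gDi integrable_mult_right[OF Di]] integral_mult_right_zero d1)
  finally show ?thesis using k1 by (simp add: field_simps)
qed

text \<open>Real and imaginary parts of \<open>g\<close> are treated separately. The conjugate
  weight satisfies the same relation with \<open>cnj \<kappa>\<close>, because
  \<open>char \<nu> s\<close> is the conjugate of \<open>char \<nu> (- s)\<close>.\<close>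

lemma char_weighted:
  fixes g :: "'a \<Rightarrow> complex" and A :: "'a \<Rightarrow> real"
  assumes gm: "g \<in> borel_measurable M" and gb: "\<And>\<omega>. norm (g \<omega>) \<le> C" and A: "A \<in> borel_measurable M"
    and law: "distr M borel A = \<nu>"
    and h: "\<And>s. (CLINT \<omega>|M. g \<omega> * iexp (s * A \<omega>)) = \<kappa> * char \<nu> s"
    and D: "D \<in> sets borel"
  shows "(CLINT \<omega>|M. g \<omega> * indicator D (A \<omega>)) = \<kappa> * of_real (measure \<nu> D)"
proof -
  have [measurable]: "A \<in> borel_measurable M" "g \<in> borel_measurable M" using A gm by auto
  have gi: "integrable M (\<lambda>\<omega>. g \<omega> * iexp (s * A \<omega>))" for s
    by (rule integrable_const_bound[where B=C]) (use gb in \<open>auto simp: norm_mult\<close>)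
  have c1: "(CLINT \<omega>|M. cnj (g \<omega>) * iexp (s * A \<omega>)) = cnj \<kappa> * char \<nu> s" for s
  proof -
    have "(CLINT \<omega>|M. cnj (g \<omega>) * iexp (s * A \<omega>)) = (CLINT \<omega>|M. cnj (g \<omega> * iexp ((- s) * A \<omega>)))"
      by (intro Bochner_Integration.integral_cong refl) (simp add: exp_cnj)
    also have "\<dots> = cnj (CLINT \<omega>|M. g \<omega> * iexp ((- s) * A \<omega>))"
      by (rule Bochner_Integration.integral_cnj)
    finally have 1: "(CLINT \<omega>|M. cnj (g \<omega>) * iexp (s * A \<omega>)) = cnj (CLINT \<omega>|M. g \<omega> * iexp ((- s) * A \<omega>))" .
    have "char \<nu> s = (CLINT x|\<nu>. cnj (iexp ((- s) * x)))"
      unfolding char_def by (intro Bochner_Integration.integral_cong refl) (simp add: exp_cnj)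
    also have "\<dots> = cnj (char \<nu> (- s))"
      unfolding char_def by (rule Bochner_Integration.integral_cnj)
    finally show ?thesis unfolding 1 h by simp
  qed
  have cgi: "integrable M (\<lambda>\<omega>. cnj (g \<omega>) * iexp (s * A \<omega>))" for s
  proof -
    have "integrable M (\<lambda>\<omega>. cnj (g \<omega> * iexp ((- s) * A \<omega>)))"
      by (rule Bochner_Integration.integrable_cnj[OF gi])
    moreover have "cnj (g \<omega> * iexp ((- s) * A \<omega>)) = cnj (g \<omega>) * iexp (s * A \<omega>)" for \<omega>
      by (simp add: exp_cnj)
    ultimately show ?thesis by (simp only:)
  qed
  have R: "(CLINT \<omega>|M. of_real (Re (g \<omega>)) * iexp (s * A \<omega>)) = of_real (Re \<kappa>) * char \<nu> s" for s
  proof -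
    have "(CLINT \<omega>|M. of_real (Re (g \<omega>)) * iexp (s * A \<omega>))
        = (CLINT \<omega>|M. (g \<omega> * iexp (s * A \<omega>) + cnj (g \<omega>) * iexp (s * A \<omega>)) / 2)"
      by (intro Bochner_Integration.integral_cong refl) (simp add: complex_add_cnj distrib_right[symmetric])
    also have "\<dots> = (\<kappa> * char \<nu> s + cnj \<kappa> * char \<nu> s) / 2"
      by (simp only: integral_divide_zero Bochner_Integration.integral_add[OF gi cgi] h c1)
    finally show ?thesis by (simp add: complex_add_cnj distrib_right[symmetric])
  qed
  have I: "(CLINT \<omega>|M. of_real (Im (g \<omega>)) * iexp (s * A \<omega>)) = of_real (Im \<kappa>) * char \<nu> s" for s
  proof -
    have "(CLINT \<omega>|M. of_real (Im (g \<omega>)) * iexp (s * A \<omega>))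
        = (CLINT \<omega>|M. (g \<omega> * iexp (s * A \<omega>) - cnj (g \<omega>) * iexp (s * A \<omega>)) / (2 * \<i>))"
      by (intro Bochner_Integration.integral_cong refl) (simp add: complex_eq_iff)
    also have "\<dots> = (\<kappa> * char \<nu> s - cnj \<kappa> * char \<nu> s) / (2 * \<i>)"
      by (simp only: integral_divide_zero Bochner_Integration.integral_diff[OF gi cgi] h c1)
    also have "\<dots> = of_real (Im \<kappa>) * char \<nu> s"
      by (simp add: complex_eq_iff)
    finally show ?thesis .
  qed
  have reb: "\<bar>Re (g \<omega>)\<bar> \<le> C" and imb: "\<bar>Im (g \<omega>)\<bar> \<le> C" for \<omega>
    using gb[of \<omega>] abs_Re_le_cmod[of "g \<omega>"] abs_Im_le_cmod[of "g \<omega>"] by linarith+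
  have r: "(LINT \<omega>|M. Re (g \<omega>) * indicator D (A \<omega>)) = Re \<kappa> * measure \<nu> D"
    by (rule char_weighted_real[OF _ reb A law R D]) measurable
  have i: "(LINT \<omega>|M. Im (g \<omega>) * indicator D (A \<omega>)) = Im \<kappa> * measure \<nu> D"
    by (rule char_weighted_real[OF _ imb A law I D]) measurable
  have gDi: "integrable M (\<lambda>\<omega>. g \<omega> * indicator D (A \<omega>))"
  proof (rule integrable_const_bound[where B=C])
    have C0: "0 \<le> C" using gb norm_ge_zero order_trans by blast
    show "AE \<omega> in M. norm (g \<omega> * indicator D (A \<omega>)) \<le> C"
      using gb C0 by (auto simp: norm_mult indicator_def intro!: AE_I2)
    show "(\<lambda>\<omega>. g \<omega> * indicator D (A \<omega>)) \<in> borel_measurable M" using D by measurable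
  qed
  show ?thesis
  proof (rule complex_eqI)
    have "Re (CLINT \<omega>|M. g \<omega> * indicator D (A \<omega>)) = (LINT \<omega>|M. Re (g \<omega> * indicator D (A \<omega>)))"
      by (rule integral_Re[symmetric, OF gDi])
    also have "\<dots> = (LINT \<omega>|M. Re (g \<omega>) * indicator D (A \<omega>))"
      by (intro Bochner_Integration.integral_cong refl) (simp add: indicator_def)
    finally show "Re (CLINT \<omega>|M. g \<omega> * indicator D (A \<omega>)) = Re (\<kappa> * of_real (measure \<nu> D))" using r by simp
    have "Im (CLINT \<omega>|M. g \<omega> * indicator D (A \<omega>)) = (LINT \<omega>|M. Im (g \<omega> * indicator D (A \<omega>)))"
      by (rule integral_Im[symmetric, OF gDi])
    also have "\<dots> = (LINT \<omega>|M. Im (g \<omega>) * indicator D (A \<omega>))"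
      by (intro Bochner_Integration.integral_cong refl) (simp add: indicator_def)
    finally show "Im (CLINT \<omega>|M. g \<omega> * indicator D (A \<omega>)) = Im (\<kappa> * of_real (measure \<nu> D))" using i by simp
  qed
qed

text \<open>Joint law of centred Gaussian variables \<open>\<Delta> j\<close> which are independent of each other and of \<open>G\<close>, expressed
  by characteristic functions so that only linear combinations of the \<open>\<Delta> j\<close> have to be understood.\<close>

definition fresh :: "'a set set \<Rightarrow> (nat \<Rightarrow> 'a \<Rightarrow> real) \<Rightarrow> (nat \<Rightarrow> real) \<Rightarrow> nat list \<Rightarrow> bool" where
  "fresh G \<Delta> \<sigma> js \<longleftrightarrow> sigma_algebra (space M) G \<and> G \<subseteq> events \<and> (\<forall>j\<in>set js. \<Delta> j \<in> borel_measurable M) \<and>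
     (\<forall>E\<in>G. \<forall>c. (CLINT \<omega>|M. indicator E \<omega> * iexp (\<Sum>j\<leftarrow>js. c j * \<Delta> j \<omega>))
        = of_real (prob E) * (\<Prod>j\<leftarrow>js. char (gauss (\<sigma> j)) (c j)))"

text \<open>The sigma-algebra generated by \<open>G\<close> and \<open>A\<close>, presented by a
  family that is intersection-stable when \<open>G\<close> is a sigma-algebra, as the Dynkin
  argument in \<open>fresh_extend\<close> requires.\<close>

definition extend :: "'a set set \<Rightarrow> ('a \<Rightarrow> real) \<Rightarrow> 'a set set" where
  "extend G A = sigma_sets (space M) {E \<inter> (A -` D \<inter> space M) |E D. E \<in> G \<and> D \<in> sets borel}"

text \<open>The whole space as event and coefficients vanishing except at \<open>j\<close> isolate
  the characteristic function of \<open>\<Delta> j\<close>.\<close>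

lemma fresh_law:
  assumes fr: "fresh G \<Delta> \<sigma> (j # js)" and j: "j \<notin> set js" and \<sigma>: "\<And>i. 0 \<le> \<sigma> i"
  shows "distr M borel (\<Delta> j) = gauss (\<sigma> j)"
proof (rule Levy_uniqueness)
  have m: "\<Delta> j \<in> borel_measurable M" using fr by (simp add: fresh_def)
  show "real_distribution (distr M borel (\<Delta> j))" by (rule real_distribution_distr[OF m])
  show "real_distribution (gauss (\<sigma> j))" by (rule real_distribution_gauss[OF \<sigma>])
  show "char (distr M borel (\<Delta> j)) = char (gauss (\<sigma> j))"
  proof (rule ext)
    fix t :: real
    define c where "c = (\<lambda>i. if i = j then t else 0)"
    interpret S: sigma_algebra "space M" G using fr by (simp add: fresh_def)
    have "(\<Sum>i\<leftarrow>js. c i * \<Delta> i \<omega>) = 0" for \<omega>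
      using j by (induction js) (auto simp: c_def)
    moreover have "(\<Prod>i\<leftarrow>js. char (gauss (\<sigma> i)) (c i)) = 1"
      using j \<sigma> by (induction js) (auto simp: c_def char_gauss)
    moreover have "(CLINT \<omega>|M. indicator (space M) \<omega> * iexp (\<Sum>i\<leftarrow>j # js. c i * \<Delta> i \<omega>))
        = of_real (prob (space M)) * (\<Prod>i\<leftarrow>j # js. char (gauss (\<sigma> i)) (c i))"
      using fr S.top unfolding fresh_def by blast
    ultimately have "(CLINT \<omega>|M. indicator (space M) \<omega> * iexp (t * \<Delta> j \<omega>)) = char (gauss (\<sigma> j)) t"
      by (simp add: c_def prob_space)
    moreover have "(CLINT \<omega>|M. indicator (space M) \<omega> * iexp (t * \<Delta> j \<omega>)) = (CLINT \<omega>|M. iexp (t * \<Delta> j \<omega>))"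
      by (intro Bochner_Integration.integral_cong refl) simp
    moreover have "char (distr M borel (\<Delta> j)) t = (CLINT \<omega>|M. iexp (t * \<Delta> j \<omega>))"
      unfolding char_def by (rule integral_distr[OF m]) simp
    ultimately show "char (distr M borel (\<Delta> j)) t = char (gauss (\<sigma> j)) t" by simp
  qed
qed

text \<open>The event and the exponential of the remaining variables form a bounded weight. As a
  function of the coefficient of \<open>j\<close> the weighted integral is a multiple of the
  characteristic function, so \<open>char_weighted\<close> replaces the exponential of
  \<open>\<Delta> j\<close> by an event.\<close>

lemma fresh_peel:
  assumes fr: "fresh G \<Delta> \<sigma> (j # js)" and j: "j \<notin> set js" and \<sigma>: "\<And>i. 0 \<le> \<sigma> i"
    and E: "E \<in> G" and D: "D \<in> sets borel"
  shows "(CLINT \<omega>|M. indicator (E \<inter> (\<Delta> j -` D \<inter> space M)) \<omega> * iexp (\<Sum>i\<leftarrow>js. c i * \<Delta> i \<omega>))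
    = of_real (prob E * measure (gauss (\<sigma> j)) D) * (\<Prod>i\<leftarrow>js. char (gauss (\<sigma> i)) (c i))"
proof -
  let ?S = "\<lambda>\<omega>. \<Sum>i\<leftarrow>js. c i * \<Delta> i \<omega>" and ?P = "\<Prod>i\<leftarrow>js. char (gauss (\<sigma> i)) (c i)"
  have m: "\<Delta> i \<in> borel_measurable M" if "i \<in> set (j # js)" for i using fr that unfolding fresh_def by blast
  have mj: "\<Delta> j \<in> borel_measurable M" using m by simp
  have Sm: "?S \<in> borel_measurable M" by (rule borel_measurable_list_combination) (use m in auto)
  have Ee: "E \<in> events" using fr E by (auto simp: fresh_def)
  have "(CLINT \<omega>|M. indicator E \<omega> * iexp (?S \<omega>) * indicator D (\<Delta> j \<omega>)) = (of_real (prob E) * ?P) * of_real (measure (gauss (\<sigma> j)) D)"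
  proof (rule char_weighted[OF _ _ mj fresh_law[OF fr j \<sigma>] _ D])
    show "(\<lambda>\<omega>. indicator E \<omega> * iexp (?S \<omega>)) \<in> borel_measurable M"
      by (intro borel_measurable_times borel_measurable_indicator Ee measurable_compose[OF Sm iexp_measurable])
    show "norm (indicator E \<omega> * iexp (?S \<omega>)) \<le> 1" for \<omega>
      by (simp add: norm_mult indicator_def)
    show "(CLINT \<omega>|M. indicator E \<omega> * iexp (?S \<omega>) * iexp (s * \<Delta> j \<omega>)) = of_real (prob E) * ?P * char (gauss (\<sigma> j)) s" for s
    proof -
      define c' where "c' = c(j := s)"
      have 1: "(\<Sum>i\<leftarrow>js. c' i * \<Delta> i \<omega>) = ?S \<omega>" for \<omega>
        using j by (intro arg_cong[where f=sum_list] map_cong refl) (auto simp: c'_def)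
      have 2: "(\<Prod>i\<leftarrow>js. char (gauss (\<sigma> i)) (c' i)) = ?P"
        using j by (intro arg_cong[where f=prod_list] map_cong refl) (auto simp: c'_def)
      have "(CLINT \<omega>|M. indicator E \<omega> * iexp (\<Sum>i\<leftarrow>j # js. c' i * \<Delta> i \<omega>))
        = of_real (prob E) * (\<Prod>i\<leftarrow>j # js. char (gauss (\<sigma> i)) (c' i))"
        using fr E unfolding fresh_def by blast
      then have "(CLINT \<omega>|M. indicator E \<omega> * iexp (s * \<Delta> j \<omega> + ?S \<omega>)) = of_real (prob E) * (char (gauss (\<sigma> j)) s * ?P)"
        by (simp add: 1 2) (simp add: c'_def)
      moreover have eq: "(\<lambda>\<omega>. indicator E \<omega> * iexp (?S \<omega>) * iexp (s * \<Delta> j \<omega>)) = (\<lambda>\<omega>. indicator E \<omega> * iexp (s * \<Delta> j \<omega> + ?S \<omega>))"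
        by (rule ext) (simp add: distrib_left exp_add mult_ac)
      ultimately show ?thesis unfolding eq by (simp only: mult_ac)
    qed
  qed
  moreover have "(CLINT \<omega>|M. indicator (E \<inter> (\<Delta> j -` D \<inter> space M)) \<omega> * iexp (?S \<omega>))
     = (CLINT \<omega>|M. indicator E \<omega> * iexp (?S \<omega>) * indicator D (\<Delta> j \<omega>))"
    by (intro Bochner_Integration.integral_cong refl) (auto simp: indicator_def)
  ultimately show ?thesis by (simp add: mult_ac)
qed

lemma fresh_indep:
  assumes fr: "fresh G \<Delta> \<sigma> (j # js)" and j: "j \<notin> set js" and \<sigma>: "\<And>i. 0 \<le> \<sigma> i"
    and E: "E \<in> G" and D: "D \<in> sets borel"
  shows "prob (E \<inter> (\<Delta> j -` D \<inter> space M)) = prob E * measure (gauss (\<sigma> j)) D"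
proof -
  have mj: "\<Delta> j \<in> borel_measurable M" and Ee: "E \<in> events" using fr E by (auto simp: fresh_def)
  have ev: "E \<inter> (\<Delta> j -` D \<inter> space M) \<in> events" using Ee measurable_sets[OF mj D] by auto
  have p1: "(\<Prod>i\<leftarrow>js. char (gauss (\<sigma> i)) 0) = 1"
    using \<sigma> by (induction js) (auto simp: char_gauss)
  have "complex_of_real (prob (E \<inter> (\<Delta> j -` D \<inter> space M))) = (CLINT \<omega>|M. of_real (indicator (E \<inter> (\<Delta> j -` D \<inter> space M)) \<omega>))"
    using ev by (subst integral_complex_of_real) (simp add: integral_indicator)
  also have "\<dots> = (CLINT \<omega>|M. indicator (E \<inter> (\<Delta> j -` D \<inter> space M)) \<omega> * iexp (\<Sum>i\<leftarrow>js. (\<lambda>_. 0) i * \<Delta> i \<omega>))"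
    by (intro Bochner_Integration.integral_cong refl) (simp add: indicator_def)
  also have "\<dots> = of_real (prob E * measure (gauss (\<sigma> j)) D)"
    unfolding fresh_peel[OF fr j \<sigma> E D] by (simp add: p1)
  finally show ?thesis by (simp only: of_real_eq_iff)
qed

text \<open>Once \<open>\<Delta> j\<close> has been used it joins the past. On the generators this
  is \<open>fresh_peel\<close> combined with \<open>fresh_indep\<close>; a Dynkin argument does the
  rest.\<close>

lemma fresh_extend:
  assumes fr: "fresh G \<Delta> \<sigma> (j # js)" and j: "j \<notin> set js" and \<sigma>: "\<And>i. 0 \<le> \<sigma> i"
  shows "fresh (extend G (\<Delta> j)) \<Delta> \<sigma> js"
  unfolding fresh_def
proof (intro conjI ballI allI)
  let ?\<Pi> = "{E \<inter> (\<Delta> j -` D \<inter> space M) |E D. E \<in> G \<and> D \<in> sets borel}"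
  interpret S: sigma_algebra "space M" G using fr by (simp add: fresh_def)
  have m: "\<Delta> i \<in> borel_measurable M" if "i \<in> set (j # js)" for i using fr that unfolding fresh_def by blast
  have mj: "\<Delta> j \<in> borel_measurable M" using m by simp
  have ev: "?\<Pi> \<subseteq> events" using fr measurable_sets[OF mj] by (auto simp: fresh_def)
  show "sigma_algebra (space M) (extend G (\<Delta> j))"
    unfolding extend_def by (rule sigma_algebra_sigma_sets) auto
  show sub: "extend G (\<Delta> j) \<subseteq> events"
    unfolding extend_def by (rule sets.sigma_sets_subset[OF ev])
  show "\<Delta> i \<in> borel_measurable M" if "i \<in> set js" for i using m that by simp
  fix E c assume E: "E \<in> extend G (\<Delta> j)"
  let ?S = "\<lambda>\<omega>. \<Sum>i\<leftarrow>js. c i * \<Delta> i \<omega>" and ?P = "\<Prod>i\<leftarrow>js. char (gauss (\<sigma> i)) (c i)"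
  have Sm: "?S \<in> borel_measurable M" by (rule borel_measurable_list_combination) (use m in auto)
  have ei: "integrable M (\<lambda>\<omega>. iexp (?S \<omega>))"
    by (rule integrable_const_bound[where B=1]) (simp_all add: measurable_compose[OF Sm iexp_measurable])
  have int: "integrable M (\<lambda>\<omega>. indicator B \<omega> * iexp (?S \<omega>))" if "B \<in> events" for B
  proof (rule integrable_const_bound[where B=1])
    show "AE \<omega> in M. norm (indicator B \<omega> * iexp (?S \<omega>)) \<le> 1" by (simp add: norm_mult indicator_def)
    show "(\<lambda>\<omega>. indicator B \<omega> * iexp (?S \<omega>)) \<in> borel_measurable M"
      by (intro borel_measurable_times borel_measurable_indicator that measurable_compose[OF Sm iexp_measurable])
  qed
  let ?R = "\<lambda>E. (CLINT \<omega>|M. indicator E \<omega> * iexp (?S \<omega>)) = of_real (prob E) * ?P"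
  have stable: "Int_stable ?\<Pi>"
  proof (rule Int_stableI)
    fix a b assume "a \<in> ?\<Pi>" "b \<in> ?\<Pi>"
    then obtain E1 D1 E2 D2 where *: "a = E1 \<inter> (\<Delta> j -` D1 \<inter> space M)" "E1 \<in> G" "D1 \<in> sets borel"
      "b = E2 \<inter> (\<Delta> j -` D2 \<inter> space M)" "E2 \<in> G" "D2 \<in> sets borel" by auto
    have "a \<inter> b = (E1 \<inter> E2) \<inter> (\<Delta> j -` (D1 \<inter> D2) \<inter> space M)" using * by auto
    then show "a \<inter> b \<in> ?\<Pi>" using * by blast
  qed
  have top: "?R (space M)"
  proof -
    have "space M \<in> G" by (rule S.top)
    moreover have "space M = space M \<inter> (\<Delta> j -` UNIV \<inter> space M)" by auto
    moreover have "measure (gauss (\<sigma> j)) UNIV = 1"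
      using prob_space.prob_space[OF prob_space_gauss[OF \<sigma>[of j]]] by simp
    ultimately show ?thesis
      using fresh_peel[OF fr j \<sigma> S.top, of UNIV c] prob_space by simp
  qed
  have "?\<Pi> \<subseteq> Pow (space M)" by auto
  from stable this E[unfolded extend_def] show "?R E"
  proof (rule sigma_sets_induct_disjoint[where P="?R"])
    fix A assume "A \<in> ?\<Pi>"
    then obtain E1 D1 where A: "A = E1 \<inter> (\<Delta> j -` D1 \<inter> space M)" "E1 \<in> G" "D1 \<in> sets borel" by auto
    show "?R A"
      unfolding A(1) fresh_peel[OF fr j \<sigma> A(2,3)] fresh_indep[OF fr j \<sigma> A(2,3)] by simp
  next
    show "?R {}" by simp
  next
    fix A assume A: "A \<in> sigma_sets (space M) ?\<Pi>" "?R A"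
    have Ae: "A \<in> events" using A(1) sub by (auto simp: extend_def)
    have "(CLINT \<omega>|M. indicator (space M - A) \<omega> * iexp (?S \<omega>))
        = (CLINT \<omega>|M. indicator (space M) \<omega> * iexp (?S \<omega>) - indicator A \<omega> * iexp (?S \<omega>))"
      using sets.sets_into_space[OF Ae] by (intro Bochner_Integration.integral_cong refl) (auto simp: indicator_def)
    also have "\<dots> = of_real (prob (space M)) * ?P - of_real (prob A) * ?P"
      by (simp only: Bochner_Integration.integral_diff[OF int[OF sets.top] int[OF Ae]] top A(2))
    finally show "?R (space M - A)"
      using prob_compl[OF Ae] prob_space by (simp add: left_diff_distrib)
  next
    fix A :: "nat \<Rightarrow> 'a set"
    assume dis: "disjoint_family A" and rg: "range A \<subseteq> sigma_sets (space M) ?\<Pi>" and R: "\<And>i. ?R (A i)"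
    have Ae: "A i \<in> events" for i using rg sub by (auto simp: extend_def)
    have Ue: "(\<Union>i. A i) \<in> events" using Ae by auto
    have "(\<lambda>n. CLINT \<omega>|M. indicator (\<Union>i<n. A i) \<omega> * iexp (?S \<omega>)) \<longlonglongrightarrow> (CLINT \<omega>|M. indicator (\<Union>i. A i) \<omega> * iexp (?S \<omega>))"
    proof (rule integral_dominated_convergence[where w="\<lambda>_. 1"])
      show "AE \<omega> in M. (\<lambda>n. indicator (\<Union>i<n. A i) \<omega> * iexp (?S \<omega>)) \<longlonglongrightarrow> indicator (\<Union>i. A i) \<omega> * iexp (?S \<omega>)"
        by (intro AE_I2 tendsto_mult tendsto_const LIMSEQ_indicator_UN)
      show "(\<lambda>\<omega>. indicator (\<Union>i<n. A i) \<omega> * iexp (?S \<omega>)) \<in> borel_measurable M" for n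
        using Ae by (intro borel_measurable_times borel_measurable_indicator measurable_compose[OF Sm iexp_measurable]) auto
      show "AE \<omega> in M. norm (indicator (\<Union>i<n. A i) \<omega> * iexp (?S \<omega>)) \<le> 1" for n
        by (simp add: norm_mult indicator_def)
      show "(\<lambda>\<omega>. indicator (\<Union>i. A i) \<omega> * iexp (?S \<omega>)) \<in> borel_measurable M"
        by (intro borel_measurable_times borel_measurable_indicator Ue measurable_compose[OF Sm iexp_measurable])
    qed simp
    moreover have "(CLINT \<omega>|M. indicator (\<Union>i<n. A i) \<omega> * iexp (?S \<omega>)) = of_real (\<Sum>i<n. prob (A i)) * ?P" for n
    proof -
      have ind: "indicator (\<Union>i<n. A i) \<omega> = (\<Sum>i<n. indicator (A i) \<omega> :: complex)" for \<omega>
        using dis by (intro indicator_UN_disjoint) (auto simp: disjoint_family_on_def)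
      have "(CLINT \<omega>|M. indicator (\<Union>i<n. A i) \<omega> * iexp (?S \<omega>)) = (\<Sum>i<n. (CLINT \<omega>|M. indicator (A i) \<omega> * iexp (?S \<omega>)))"
        unfolding ind sum_distrib_right by (rule Bochner_Integration.integral_sum) (rule int[OF Ae])
      then show ?thesis by (simp add: R sum_distrib_right)
    qed
    moreover have "(\<lambda>n. of_real (\<Sum>i<n. prob (A i)) * ?P) \<longlonglongrightarrow> of_real (prob (\<Union>i. A i)) * ?P"
      using finite_measure_UNION[OF _ dis] Ae by (intro tendsto_mult tendsto_of_real tendsto_const) (auto simp: sums_def)
    ultimately show "?R (\<Union>i. A i)" by (simp add: LIMSEQ_unique)
  qed
qed

lemma extend_mono:
  assumes "G \<subseteq> Pow (space M)"
  shows "G \<subseteq> extend G A"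
proof
  fix E assume E: "E \<in> G"
  moreover have "UNIV \<in> sets (borel :: real measure)" by simp
  ultimately have "E \<inter> (A -` UNIV \<inter> space M) \<in> {E \<inter> (A -` D \<inter> space M) |E D. E \<in> G \<and> D \<in> sets borel}"
    by blast
  then have "E \<inter> (A -` UNIV \<inter> space M) \<in> extend G A"
    unfolding extend_def by (rule sigma_sets.Basic)
  moreover have "E \<inter> (A -` UNIV \<inter> space M) = E" using assms E by auto
  ultimately show "E \<in> extend G A" by simp
qed

lemma extend_preimage: "space M \<in> G \<Longrightarrow> D \<in> sets borel \<Longrightarrow> A -` D \<inter> space M \<in> extend G A"
proof -
  assume "space M \<in> G" "D \<in> sets borel"
  then have "space M \<inter> (A -` D \<inter> space M) \<in> {E \<inter> (A -` D \<inter> space M) |E D. E \<in> G \<and> D \<in> sets borel}" by blast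
  then have "space M \<inter> (A -` D \<inter> space M) \<in> extend G A"
    unfolding extend_def by (rule sigma_sets.Basic)
  moreover have "space M \<inter> (A -` D \<inter> space M) = A -` D \<inter> space M" by auto
  ultimately show ?thesis by simp
qed

end

section \<open>The chain driven by Gaussian increments\<close>

text \<open>The seminorm is dominated by a finite sum over coordinates, so the function is
  continuous for the product topology, whose Borel sets are those of the countable product.\<close>

lemma wnorm_lipschitz_measurable:
  assumes L: "L \<ge> 0" "\<And>x y. \<bar>\<phi> x - \<phi> y\<bar> \<le> L * wnorm g I (\<lambda>i. x i - y i)"
  shows "\<phi> \<in> borel_measurable (PiM UNIV (\<lambda>_ :: nat. borel :: real measure))"
proof -
  have "continuous_on UNIV \<phi>"
    unfolding continuous_on_eq_continuous_at[OF open_UNIV]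
  proof
    fix x :: "nat \<Rightarrow> real"
    have c: "continuous (at x) (\<lambda>y. y i)" for i :: nat
    proof -
      have "continuous_on UNIV (\<lambda>y :: nat \<Rightarrow> real. y i)" by (rule continuous_on_product_coordinates)
      then show ?thesis unfolding continuous_on_eq_continuous_at[OF open_UNIV] by blast
    qed
    have "((\<lambda>y. L * (\<Sum>i\<in>I. \<bar>sqrt (g i) * (y i - x i)\<bar>)) \<longlongrightarrow> L * (\<Sum>i\<in>I. \<bar>sqrt (g i) * (x i - x i)\<bar>)) (at x)"
      using c by (intro tendsto_intros) (simp_all add: continuous_at)
    then have z: "((\<lambda>y. L * (\<Sum>i\<in>I. \<bar>sqrt (g i) * (y i - x i)\<bar>)) \<longlongrightarrow> 0) (at x)" by simp
    have le: "norm (\<phi> y - \<phi> x) \<le> L * (\<Sum>i\<in>I. \<bar>sqrt (g i) * (y i - x i)\<bar>)" for y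
      using L(2)[of y x] mult_left_mono[OF L2_set_le_sum_abs[of "\<lambda>i. sqrt (g i) * (y i - x i)" I] L(1)]
      unfolding wnorm_def real_norm_def by linarith
    have "((\<lambda>y. \<phi> y - \<phi> x) \<longlongrightarrow> 0) (at x)"
      by (rule Lim_null_comparison[OF always_eventually z]) (rule allI, rule le)
    then show "isCont \<phi> x" unfolding isCont_def by (rule LIM_zero_cancel)
  qed
  then have "\<phi> \<in> borel_measurable borel" by (rule borel_measurable_continuous_onI)
  then show ?thesis using measurable_cong_sets[OF sets_PiM_equal_borel refl] by blast
qed

lemma blip_measurable:
  "blip (wnorm g I) \<phi> \<Longrightarrow> \<phi> \<in> borel_measurable (PiM UNIV (\<lambda>_ :: nat. borel :: real measure))"
  unfolding blip_def using wnorm_lipschitz_measurable by blast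

context prob_space
begin

text \<open>Independence of \<open>A\<close> from \<open>G\<close> makes the joint law of
  \<open>Y\<close> and \<open>A\<close> a product measure; the inner integral in Fubini's theorem is
  \<open>gop\<close>.\<close>

lemma expectation_gop:
  fixes Y :: "'a \<Rightarrow> nat \<Rightarrow> real"
  assumes I: "finite I" and \<phi>: "blip (wnorm g I) \<phi>" and \<sigma>: "0 \<le> s i" and G: "sigma_algebra (space M) G" "G \<subseteq> events"
    and Y: "\<And>k D. D \<in> sets borel \<Longrightarrow> (\<lambda>\<omega>. Y \<omega> k) -` D \<inter> space M \<in> G"
    and A: "A \<in> borel_measurable M"
    and ind: "\<And>E D. E \<in> G \<Longrightarrow> D \<in> sets borel \<Longrightarrow> prob (E \<inter> (A -` D \<inter> space M)) = prob E * measure (gauss (s i)) D"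
  shows "expectation (\<lambda>\<omega>. \<phi> ((Y \<omega>)(i := Y \<omega> i + A \<omega>))) = expectation (\<lambda>\<omega>. gop s i \<phi> (Y \<omega>))"
proof -
  let ?N = "PiM UNIV (\<lambda>_ :: nat. borel :: real measure)"
  interpret S: sigma_algebra "space M" G by (rule G(1))
  let ?MG = "sigma (space M) G"
  have sMG: "sets ?MG = G" using S.sets_measure_of_eq by simp
  have "Y \<in> ?MG \<rightarrow>\<^sub>M ?N"
    by (rule measurable_PiM_single') (auto intro!: measurableI simp: sMG Y space_measure_of_conv)
  then have YG: "Y -` D \<inter> space M \<in> G" if "D \<in> sets ?N" for D
    using measurable_sets[of Y ?MG ?N D] that by (simp add: sMG space_measure_of_conv)
  have Ym: "Y \<in> M \<rightarrow>\<^sub>M ?N"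
    by (rule measurableI) (use YG G(2) in \<open>auto simp: space_PiM\<close>)
  interpret Gs: prob_space "gauss (s i)" by (rule prob_space_gauss[OF \<sigma>])
  interpret DY: prob_space "distr M ?N Y" by (rule prob_space_distr[OF Ym])
  interpret PP: pair_prob_space "distr M ?N Y" "gauss (s i)" ..
  have pm: "(\<lambda>\<omega>. (Y \<omega>, A \<omega>)) \<in> M \<rightarrow>\<^sub>M ?N \<Otimes>\<^sub>M borel" using Ym A by measurable
  have pd: "distr M ?N Y \<Otimes>\<^sub>M gauss (s i) = distr M (?N \<Otimes>\<^sub>M borel) (\<lambda>\<omega>. (Y \<omega>, A \<omega>))"
  proof (rule pair_measure_eqI)
    show "sigma_finite_measure (distr M ?N Y)" "sigma_finite_measure (gauss (s i))" by unfold_locales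
    show "sets (distr M ?N Y \<Otimes>\<^sub>M gauss (s i)) = sets (distr M (?N \<Otimes>\<^sub>M borel) (\<lambda>\<omega>. (Y \<omega>, A \<omega>)))"
      by (simp only: sets_distr) (rule sets_pair_measure_cong, simp_all)
    fix B D assume BD: "B \<in> sets (distr M ?N Y)" "D \<in> sets (gauss (s i))"
    then have B: "B \<in> sets ?N" and D: "D \<in> sets borel" by simp_all
    have "emeasure (distr M (?N \<Otimes>\<^sub>M borel) (\<lambda>\<omega>. (Y \<omega>, A \<omega>))) (B \<times> D)
       = emeasure M ((\<lambda>\<omega>. (Y \<omega>, A \<omega>)) -` (B \<times> D) \<inter> space M)"
      by (rule emeasure_distr[OF pm]) (use B D in simp)
    also have "(\<lambda>\<omega>. (Y \<omega>, A \<omega>)) -` (B \<times> D) \<inter> space M = (Y -` B \<inter> space M) \<inter> (A -` D \<inter> space M)" by auto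
    also have "emeasure M \<dots> = ennreal (prob (Y -` B \<inter> space M) * measure (gauss (s i)) D)"
      using ind[OF YG[OF B] D] by (simp add: emeasure_eq_measure)
    also have "\<dots> = emeasure (distr M ?N Y) B * emeasure (gauss (s i)) D"
      by (simp add: emeasure_distr[OF Ym B] emeasure_eq_measure Gs.emeasure_eq_measure ennreal_mult)
    finally show "emeasure (distr M ?N Y) B * emeasure (gauss (s i)) D
      = emeasure (distr M (?N \<Otimes>\<^sub>M borel) (\<lambda>\<omega>. (Y \<omega>, A \<omega>))) (B \<times> D)" by simp
  qed
  let ?f = "\<lambda>p. \<phi> ((fst p)(i := fst p i + snd p))"
  have "(\<lambda>p :: (nat \<Rightarrow> real) \<times> real. (fst p)(i := fst p i + snd p)) \<in> ?N \<Otimes>\<^sub>M borel \<rightarrow>\<^sub>M ?N"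
  proof (rule measurable_PiM_single')
    fix k :: nat
    show "(\<lambda>p. ((fst p)(i := fst p i + snd p)) k) \<in> borel_measurable (?N \<Otimes>\<^sub>M (borel :: real measure))"
      by (cases "k = i") simp_all
  qed (simp add: space_PiM)
  then have fm: "?f \<in> borel_measurable (?N \<Otimes>\<^sub>M borel)"
    by (rule measurable_compose[OF _ blip_measurable[OF \<phi>]])
  obtain B where B: "\<And>x. \<bar>\<phi> x\<bar> \<le> B" using \<phi> by (auto simp: blip_def)
  have fi: "integrable (distr M ?N Y \<Otimes>\<^sub>M gauss (s i)) ?f"
  proof (rule PP.P.integrable_const_bound[where B=B])
    show "?f \<in> borel_measurable (distr M ?N Y \<Otimes>\<^sub>M gauss (s i))"
      using fm measurable_cong_sets[OF sets_pair_measure_cong[of "distr M ?N Y" ?N "gauss (s i)" borel] refl] by simp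
  qed (use B in simp)
  have "expectation (\<lambda>\<omega>. \<phi> ((Y \<omega>)(i := Y \<omega> i + A \<omega>))) = (LINT p|distr M (?N \<Otimes>\<^sub>M borel) (\<lambda>\<omega>. (Y \<omega>, A \<omega>)). ?f p)"
    by (subst integral_distr[OF pm fm]) simp
  also have "\<dots> = (LINT p|(distr M ?N Y \<Otimes>\<^sub>M gauss (s i)). ?f p)"
    by (simp only: pd)
  also have "\<dots> = (LINT y|distr M ?N Y. (LINT \<zeta>|gauss (s i). ?f (y, \<zeta>)))"
    by (rule PP.integral_fst'[OF fi, symmetric])
  also have "\<dots> = (LINT y|distr M ?N Y. gop s i \<phi> y)"
    by (simp add: gop_def)
  also have "\<dots> = expectation (\<lambda>\<omega>. gop s i \<phi> (Y \<omega>))"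
    by (rule integral_distr[OF Ym blip_measurable[OF blip_gop[where \<sigma>=s and i=i and \<phi>=\<phi>, OF I \<phi> \<sigma>]]])
  finally show ?thesis .
qed

text \<open>After the first coordinate has moved, the new state is measurable for the extended
  sigma-algebra, with respect to which the remaining increments are still fresh.\<close>

lemma expectation_gops:
  fixes Y :: "'a \<Rightarrow> nat \<Rightarrow> real"
  assumes I: "finite I" and \<phi>: "blip (wnorm g I) \<phi>" and \<sigma>: "\<And>i. 0 \<le> \<sigma> i"
  shows "fresh G \<Delta> \<sigma> js \<Longrightarrow> distinct js \<Longrightarrow> (\<And>k D. D \<in> sets borel \<Longrightarrow> (\<lambda>\<omega>. Y \<omega> k) -` D \<inter> space M \<in> G) \<Longrightarrow>
    expectation (\<lambda>\<omega>. \<phi> (\<lambda>k. Y \<omega> k + (if k \<in> set js then \<Delta> k \<omega> else 0))) = expectation (\<lambda>\<omega>. gops \<sigma> js \<phi> (Y \<omega>))"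
proof (induction js arbitrary: G Y)
  case Nil
  show ?case by simp
next
  case (Cons j js)
  note fr = Cons.prems(1) and Y = Cons.prems(3)
  have j: "j \<notin> set js" "distinct js" using Cons.prems(2) by auto
  have G: "sigma_algebra (space M) G" "G \<subseteq> events" and \<Delta>: "\<Delta> j \<in> borel_measurable M" using fr by (auto simp: fresh_def)
  interpret S: sigma_algebra "space M" G by (rule G(1))
  let ?Y = "\<lambda>\<omega>. (Y \<omega>)(j := Y \<omega> j + \<Delta> j \<omega>)"
  have fe: "fresh (extend G (\<Delta> j)) \<Delta> \<sigma> js" by (rule fresh_extend[OF fr j(1) \<sigma>])
  let ?E = "sigma (space M) (extend G (\<Delta> j))"
  have sE: "sets ?E = extend G (\<Delta> j)"
    using fe sigma_algebra.sets_measure_of_eq[of "space M" "extend G (\<Delta> j)"] by (simp add: fresh_def)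
  have Gsub: "G \<subseteq> extend G (\<Delta> j)" by (rule extend_mono[OF S.space_closed])
  have Ym: "(\<lambda>\<omega>. Y \<omega> k) \<in> borel_measurable ?E" for k
    by (rule measurableI) (use Y Gsub in \<open>auto simp: sE space_measure_of_conv\<close>)
  have Dm: "\<Delta> j \<in> borel_measurable ?E"
    by (rule measurableI) (use extend_preimage[OF S.top] in \<open>auto simp: sE space_measure_of_conv\<close>)
  have Y'm: "(\<lambda>\<omega>. ?Y \<omega> k) \<in> borel_measurable ?E" for k
  proof (cases "k = j")
    case True
    show ?thesis unfolding True fun_upd_same by (rule borel_measurable_add[OF Ym Dm])
  next
    case False
    then have "(\<lambda>\<omega>. ?Y \<omega> k) = (\<lambda>\<omega>. Y \<omega> k)" by simp
    then show ?thesis using Ym[of k] by (simp only:)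
  qed
  have Y': "(\<lambda>\<omega>. ?Y \<omega> k) -` D \<inter> space M \<in> extend G (\<Delta> j)" if "D \<in> sets borel" for k D
    using measurable_sets[OF Y'm[of k] that] by (simp only: sE space_measure_of_conv)
  have "expectation (\<lambda>\<omega>. \<phi> (\<lambda>k. Y \<omega> k + (if k \<in> set (j # js) then \<Delta> k \<omega> else 0)))
      = expectation (\<lambda>\<omega>. \<phi> (\<lambda>k. ?Y \<omega> k + (if k \<in> set js then \<Delta> k \<omega> else 0)))"
    using j by (intro Bochner_Integration.integral_cong refl arg_cong[where f=\<phi>]) (auto simp: fun_eq_iff)
  also have "\<dots> = expectation (\<lambda>\<omega>. gops \<sigma> js \<phi> (?Y \<omega>))"
    using Cons.IH[of "extend G (\<Delta> j)" "?Y", OF fe j(2)] Y' by blast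
  also have "\<dots> = expectation (\<lambda>\<omega>. gop \<sigma> j (gops \<sigma> js \<phi>) (Y \<omega>))"
  proof (rule expectation_gop[where G=G and s=\<sigma> and i=j and Y=Y and A="\<Delta> j" and \<phi>="gops \<sigma> js \<phi>" and I=I and g=g])
    show "finite I" by (rule I)
    show "blip (wnorm g I) (gops \<sigma> js \<phi>)" by (rule blip_gops[OF I \<phi> \<sigma>])
    show "0 \<le> \<sigma> j" by (rule \<sigma>)
    show "sigma_algebra (space M) G" "G \<subseteq> events" by (rule G)+
    show "random_variable borel (\<Delta> j)" by (rule \<Delta>)
    show "(\<lambda>\<omega>. Y \<omega> k) -` D \<inter> space M \<in> G" if "D \<in> sets borel" for k D by (rule Y[OF that])
    show "prob (E \<inter> (\<Delta> j -` D \<inter> space M)) = prob E * measure (gauss (\<sigma> j)) D" if "E \<in> G" "D \<in> sets borel" for E D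
      by (rule fresh_indep[OF fr j(1) \<sigma> that])
  qed
  finally show ?case by simp
qed

end

section \<open>The truncated Galerkin drift\<close>

definition ftil :: "nat \<Rightarrow> real \<Rightarrow> real" where
  "ftil n v = 2 * (\<Sum>k=0..n. v ^ (2 * k + 1) / real (2 * k + 1))"

lemma f_approx_ftil: "f_approx lam n u = - ftil n u + lam * u"
  by (simp add: f_approx_def ftil_def)

lemma ftil_mono: "a \<le> b \<Longrightarrow> ftil n a \<le> ftil n b"
  unfolding ftil_def
  by (intro mult_left_mono sum_mono divide_right_mono power_mono_odd) auto

lemma ftil_minus: "ftil n (- v) = - ftil n v"
  by (simp add: ftil_def power_minus_odd sum_negf)

lemma ftil_0 [simp]: "ftil n 0 = 0"
  by (simp add: ftil_def)

lemma ftil_nonneg: "0 \<le> v \<Longrightarrow> 0 \<le> ftil n v"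
  using ftil_mono[of 0 v n] by simp

lemma abs_ftil: "\<bar>ftil n v\<bar> = ftil n \<bar>v\<bar>"
  using ftil_mono[of 0 v n] ftil_mono[of v 0 n] ftil_minus[of n v] by (cases "0 \<le> v") auto

lemma ftil_ge: assumes "0 \<le> v" shows "2 * v \<le> ftil n v"
proof -
  have "(\<Sum>k\<in>{0}. v ^ (2 * k + 1) / real (2 * k + 1)) \<le> (\<Sum>k=0..n. v ^ (2 * k + 1) / real (2 * k + 1))"
    using assms by (intro sum_mono2) auto
  then show ?thesis by (simp add: ftil_def)
qed

lemma ftil_le: assumes "0 \<le> v" shows "ftil n v \<le> 2 * real (n + 1) * (1 + v) ^ (2 * n + 1)"
proof -
  have "(\<Sum>k=0..n. v ^ (2 * k + 1) / real (2 * k + 1)) \<le> (\<Sum>k=0..n. (1 + v) ^ (2 * n + 1))"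
  proof (rule sum_mono)
    fix k assume "k \<in> {0..n}"
    then have k: "2 * k + 1 \<le> 2 * n + 1" by simp
    have "v ^ (2 * k + 1) / real (2 * k + 1) \<le> v ^ (2 * k + 1) / 1"
      using assms by (intro divide_left_mono) auto
    also have "\<dots> \<le> (1 + v) ^ (2 * k + 1)" using assms by (simp only: div_by_1) (intro power_mono, auto)
    also have "\<dots> \<le> (1 + v) ^ (2 * n + 1)" using assms by (intro power_increasing k) auto
    finally show "v ^ (2 * k + 1) / real (2 * k + 1) \<le> (1 + v) ^ (2 * n + 1)" .
  qed
  then have "2 * (\<Sum>k=0..n. v ^ (2 * k + 1) / real (2 * k + 1)) \<le> 2 * (\<Sum>k=0..n. (1 + v) ^ (2 * n + 1))"
    by (rule mult_left_mono) simp
  moreover have "(\<Sum>k=0..n. (1 + v) ^ (2 * n + 1)) = real (n + 1) * (1 + v) ^ (2 * n + 1)"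
    by simp
  ultimately show ?thesis unfolding ftil_def by (simp only: mult.assoc)
qed

lemma ftil_measurable [measurable]: "ftil n \<in> borel_measurable borel"
  unfolding ftil_def[abs_def] by measurable

text \<open>Truncating the argument keeps the function increasing and makes it bounded and globally
  Lipschitz. The linear term of \<open>f_approx\<close> is left untruncated.\<close>

definition ftr :: "nat \<Rightarrow> nat \<Rightarrow> real \<Rightarrow> real" where
  "ftr n R v = ftil n (max (- real R) (min (real R) v))"

lemma ftr_measurable [measurable]: "ftr n R \<in> borel_measurable borel"
  unfolding ftr_def[abs_def] by measurable

lemma ftr_mono: "a \<le> b \<Longrightarrow> ftr n R a \<le> ftr n R b"
  unfolding ftr_def by (intro ftil_mono max.mono min.mono) auto

lemma abs_ftr_le: "\<bar>ftr n R v\<bar> \<le> ftil n (real R)" "\<bar>ftr n R v\<bar> \<le> ftil n \<bar>v\<bar>"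
  unfolding ftr_def abs_ftil by (rule ftil_mono; linarith)+

lemma ftr_eq: "\<bar>v\<bar> \<le> real R \<Longrightarrow> ftr n R v = ftil n v"
  unfolding ftr_def by (rule arg_cong[where f="ftil n"]) linarith

lemma ftr_lipschitz: "\<exists>L\<ge>0. \<forall>a b. \<bar>ftr n R a - ftr n R b\<bar> \<le> L * \<bar>a - b\<bar>"
proof -
  have pw: "\<exists>L\<ge>0. \<forall>a b. \<bar>a\<bar> \<le> real R \<longrightarrow> \<bar>b\<bar> \<le> real R \<longrightarrow> \<bar>a ^ k - b ^ k\<bar> \<le> L * \<bar>a - b\<bar>" for k
  proof (induction k)
    case 0 show ?case by (intro exI[of _ 0]) simp
  next
    case (Suc k)
    then obtain L where L: "L \<ge> 0" "\<And>a b. \<bar>a\<bar> \<le> real R \<Longrightarrow> \<bar>b\<bar> \<le> real R \<Longrightarrow> \<bar>a ^ k - b ^ k\<bar> \<le> L * \<bar>a - b\<bar>" by blast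
    have "\<bar>a ^ Suc k - b ^ Suc k\<bar> \<le> (real R * L + real R ^ k) * \<bar>a - b\<bar>" if "\<bar>a\<bar> \<le> real R" "\<bar>b\<bar> \<le> real R" for a b
    proof -
      have "a ^ Suc k - b ^ Suc k = a * (a ^ k - b ^ k) + b ^ k * (a - b)" by (simp add: algebra_simps)
      also have "\<bar>\<dots>\<bar> \<le> \<bar>a\<bar> * \<bar>a ^ k - b ^ k\<bar> + \<bar>b\<bar> ^ k * \<bar>a - b\<bar>"
        by (rule order_trans[OF abs_triangle_ineq]) (simp add: abs_mult power_abs)
      also have "\<dots> \<le> real R * (L * \<bar>a - b\<bar>) + real R ^ k * \<bar>a - b\<bar>"
        using that L by (intro add_mono mult_mono power_mono) auto
      finally show ?thesis by (simp add: algebra_simps)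
    qed
    then show ?case using L(1) by (intro exI[of _ "real R * L + real R ^ k"]) auto
  qed
  have "\<exists>L\<ge>0. \<forall>a b. \<bar>a\<bar> \<le> real R \<longrightarrow> \<bar>b\<bar> \<le> real R \<longrightarrow> \<bar>ftil n a - ftil n b\<bar> \<le> L * \<bar>a - b\<bar>"
  proof -
    obtain L where L: "\<And>k. L k \<ge> 0" "\<And>k a b. \<bar>a\<bar> \<le> real R \<Longrightarrow> \<bar>b\<bar> \<le> real R \<Longrightarrow> \<bar>a ^ k - b ^ k\<bar> \<le> L k * \<bar>a - b\<bar>"
      using pw by metis
    have "\<bar>ftil n a - ftil n b\<bar> \<le> (2 * (\<Sum>k=0..n. L (2 * k + 1))) * \<bar>a - b\<bar>" if "\<bar>a\<bar> \<le> real R" "\<bar>b\<bar> \<le> real R" for a b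
    proof -
      have "ftil n a - ftil n b = 2 * (\<Sum>k=0..n. (a ^ (2 * k + 1) - b ^ (2 * k + 1)) / real (2 * k + 1))"
        by (simp only: ftil_def right_diff_distrib[symmetric] sum_subtractf[symmetric] diff_divide_distrib)
      also have "\<bar>\<dots>\<bar> \<le> 2 * (\<Sum>k=0..n. L (2 * k + 1) * \<bar>a - b\<bar>)"
      proof -
        have "\<bar>\<Sum>k=0..n. (a ^ (2 * k + 1) - b ^ (2 * k + 1)) / real (2 * k + 1)\<bar> \<le> (\<Sum>k=0..n. L (2 * k + 1) * \<bar>a - b\<bar>)"
        proof (rule order_trans[OF sum_abs sum_mono])
          fix k
          have "\<bar>(a ^ (2 * k + 1) - b ^ (2 * k + 1)) / real (2 * k + 1)\<bar> = \<bar>a ^ (2 * k + 1) - b ^ (2 * k + 1)\<bar> / real (2 * k + 1)"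
            by (simp only: abs_divide abs_of_nat)
          also have "\<dots> \<le> \<bar>a ^ (2 * k + 1) - b ^ (2 * k + 1)\<bar> / 1"
            by (intro divide_left_mono) auto
          also have "\<dots> \<le> L (2 * k + 1) * \<bar>a - b\<bar>" unfolding div_by_1 by (rule L(2)[OF that])
          finally show "\<bar>(a ^ (2 * k + 1) - b ^ (2 * k + 1)) / real (2 * k + 1)\<bar> \<le> L (2 * k + 1) * \<bar>a - b\<bar>" .
        qed
        then show ?thesis by (simp only: abs_mult abs_numeral mult_le_cancel_left_pos zero_less_numeral)
      qed
      finally show ?thesis by (simp only: sum_distrib_right mult.assoc)
    qed
    moreover have "0 \<le> 2 * (\<Sum>k=0..n. L (2 * k + 1))" using L(1) by (simp add: sum_nonneg)
    ultimately show ?thesis by blast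
  qed
  then obtain L where L: "L \<ge> 0" "\<And>a b. \<bar>a\<bar> \<le> real R \<Longrightarrow> \<bar>b\<bar> \<le> real R \<Longrightarrow> \<bar>ftil n a - ftil n b\<bar> \<le> L * \<bar>a - b\<bar>" by blast
  have "\<bar>ftr n R a - ftr n R b\<bar> \<le> L * \<bar>a - b\<bar>" for a b
  proof -
    have "\<bar>ftr n R a - ftr n R b\<bar> \<le> L * \<bar>max (- real R) (min (real R) a) - max (- real R) (min (real R) b)\<bar>"
      unfolding ftr_def by (rule L(2)) linarith+
    also have "\<dots> \<le> L * \<bar>a - b\<bar>" by (intro mult_left_mono L(1)) linarith
    finally show ?thesis .
  qed
  then show ?thesis using L(1) by blast
qed

text \<open>The monotone part of the drift is tested against \<open>D\<close> instead of \<open>u - V\<close>. The resulting error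
  is absorbed by monotonicity as long as \<open>\<bar>u - V\<bar> \<ge> \<bar>u - V - D\<bar>\<close>, and otherwise \<open>V\<close> is close to \<open>u\<close>.\<close>

lemma monotone_defect:
  fixes u V D lam :: real
  defines "de \<equiv> u - V - D"
  shows "(f_approx lam n u - (- ftr n R V + lam * V)) * D
    \<le> \<bar>ftil n u - ftr n R u\<bar> * \<bar>D\<bar> + (\<bar>lam\<bar> + 1/2) * D\<^sup>2 + (2 + lam\<^sup>2 / 4) * (\<bar>de\<bar> * ftil n (\<bar>u\<bar> + \<bar>de\<bar>))"
proof -
  let ?g = "ftr n R u - ftr n R V" and ?Z = "u - V" and ?F = "ftil n (\<bar>u\<bar> + \<bar>de\<bar>)"
  have F0: "0 \<le> \<bar>de\<bar> * ?F" by (intro mult_nonneg_nonneg ftil_nonneg) auto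
  have "0 \<le> ?g * ?Z"
    using ftr_mono[of u V n R] ftr_mono[of V u n R]
    by (cases "u \<le> V") (auto intro: mult_nonneg_nonneg mult_nonpos_nonpos)
  then have gZ: "\<bar>?g\<bar> * \<bar>?Z\<bar> = ?g * ?Z"
    by (simp only: abs_mult[symmetric] abs_of_nonneg)
  have D: "D = ?Z - de" by (simp add: de_def)
  have mono: "- ?g * D \<le> 2 * (\<bar>de\<bar> * ?F)"
  proof -
    have e: "- ?g * D = ?g * de - \<bar>?g\<bar> * \<bar>?Z\<bar>" unfolding gZ D by (simp add: algebra_simps)
    have "?g * de \<le> \<bar>?g\<bar> * \<bar>de\<bar>" by (simp add: abs_mult[symmetric])
    show ?thesis
    proof (cases "\<bar>de\<bar> \<le> \<bar>?Z\<bar>")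
      case True
      then have "\<bar>?g\<bar> * \<bar>de\<bar> \<le> \<bar>?g\<bar> * \<bar>?Z\<bar>" by (intro mult_left_mono) auto
      then show ?thesis using e \<open>?g * de \<le> \<bar>?g\<bar> * \<bar>de\<bar>\<close> F0 by linarith
    next
      case False
      have "\<bar>ftr n R u\<bar> \<le> ?F" "\<bar>ftr n R V\<bar> \<le> ?F"
        using False by (auto intro!: order_trans[OF abs_ftr_le(2)] ftil_mono)
      then have "\<bar>?g\<bar> \<le> 2 * ?F" by linarith
      then have "\<bar>?g\<bar> * \<bar>de\<bar> \<le> 2 * ?F * \<bar>de\<bar>" by (intro mult_right_mono) auto
      moreover have "0 \<le> \<bar>?g\<bar> * \<bar>?Z\<bar>" by simp
      moreover have "2 * ?F * \<bar>de\<bar> = 2 * (\<bar>de\<bar> * ?F)" by simp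
      ultimately show ?thesis using e \<open>?g * de \<le> \<bar>?g\<bar> * \<bar>de\<bar>\<close> by linarith
    qed
  qed
  have trunc: "- (ftil n u - ftr n R u) * D \<le> \<bar>ftil n u - ftr n R u\<bar> * \<bar>D\<bar>"
    by (simp only: abs_mult[symmetric] minus_mult_left[symmetric] abs_ge_minus_self)
  \<comment> \<open>Since \<open>ftil\<close> grows at least linearly, squares of the defect need no
    error term of their own.\<close>
  have sq: "de\<^sup>2 \<le> 1/2 * (\<bar>de\<bar> * ?F)"
  proof -
    have "2 * (\<bar>u\<bar> + \<bar>de\<bar>) \<le> ?F" by (rule ftil_ge) auto
    then have "\<bar>de\<bar> * (2 * \<bar>de\<bar>) \<le> \<bar>de\<bar> * ?F" by (intro mult_left_mono) auto
    then show ?thesis by (simp add: power2_eq_square)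
  qed
  have lin: "lam * ?Z * D \<le> (\<bar>lam\<bar> + 1/2) * D\<^sup>2 + lam\<^sup>2 / 4 * (\<bar>de\<bar> * ?F)"
  proof -
    have "0 \<le> (D - lam * de)\<^sup>2" by simp
    then have "lam * de * D \<le> 1/2 * D\<^sup>2 + 1/2 * (lam\<^sup>2 * de\<^sup>2)"
      by (simp add: power2_diff power_mult_distrib algebra_simps)
    moreover have "lam * D\<^sup>2 \<le> \<bar>lam\<bar> * D\<^sup>2" by (intro mult_right_mono) auto
    moreover have "lam\<^sup>2 * de\<^sup>2 \<le> lam\<^sup>2 * (1/2 * (\<bar>de\<bar> * ?F))" by (intro mult_left_mono sq) auto
    moreover have "lam * ?Z * D = lam * D\<^sup>2 + lam * de * D" unfolding D by (simp add: power2_eq_square algebra_simps)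
    ultimately show ?thesis by (simp add: algebra_simps)
  qed
  have "(f_approx lam n u - (- ftr n R V + lam * V)) * D = - (ftil n u - ftr n R u) * D + (- ?g * D) + lam * ?Z * D"
    by (simp add: f_approx_ftil algebra_simps)
  then show ?thesis using mono trunc lin by (simp add: algebra_simps)
qed

section \<open>The Galerkin drift and its dissipativity\<close>

definition syn :: "nat \<Rightarrow> real \<Rightarrow> (nat \<Rightarrow> real) \<Rightarrow> real \<Rightarrow> real" where
  "syn m c x \<theta> = c + (\<Sum>i=1..<m. fej m i * x i * eigfun i \<theta>)"

text \<open>\<open>A\<close> acts as \<open>- mu i\<close> on mode \<open>i\<close>, which explains
  the signs. The projection of the nonlinearity carries no Fejer weight; the weights sit in its
  argument and in the norm \<open>gw\<close>.\<close>

definition drift :: "nat \<Rightarrow> nat \<Rightarrow> real \<Rightarrow> nat \<Rightarrow> real \<Rightarrow> (nat \<Rightarrow> real) \<Rightarrow> nat \<Rightarrow> real" where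
  "drift n R lam m c x i = 1/2 * (- (mu i)\<^sup>2 * x i
     + mu i * inner01 (\<lambda>\<theta>. - ftr n R (syn m c x \<theta>) + lam * syn m c x \<theta>) (eigfun i))"

text \<open>The weight \<open>1 / mu i\<close> of the metric times the Fejer weight: the factor
  \<open>mu i\<close> of the drift cancels, and a difference of modes paired with the nonlinearity
  becomes a difference of \<open>syn\<close>, as monotonicity requires.\<close>

definition gw :: "nat \<Rightarrow> nat \<Rightarrow> real" where
  "gw m i = fej m i / mu i"

lemma gw_pos: "i \<in> {1..<m} \<Longrightarrow> 0 < gw m i"
  unfolding gw_def by (intro divide_pos_pos fej_bounds(1) mu_pos) auto

lemma syn_measurable [measurable]: "syn m c x \<in> borel_measurable borel"
  unfolding syn_def[abs_def] by measurable

lemma syn_diff: "syn m c x \<theta> - syn m c y \<theta> = (\<Sum>i=1..<m. fej m i * (x i - y i) * eigfun i \<theta>)"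
  by (simp add: syn_def sum_subtractf[symmetric] algebra_simps)

lemma abs_sum_eigfun_le:
  assumes "\<And>i. i \<in> I \<Longrightarrow> \<bar>a i\<bar> \<le> \<bar>z i\<bar>"
  shows "\<bar>\<Sum>i\<in>I. a i * eigfun i \<theta>\<bar> \<le> 2 * (\<Sum>i\<in>I. \<bar>z i\<bar>)"
proof -
  have "\<bar>\<Sum>i\<in>I. a i * eigfun i \<theta>\<bar> \<le> (\<Sum>i\<in>I. \<bar>a i\<bar> * \<bar>eigfun i \<theta>\<bar>)"
    by (rule order_trans[OF sum_abs]) (simp add: abs_mult)
  also have "\<dots> \<le> (\<Sum>i\<in>I. \<bar>z i\<bar> * 2)"
    using assms abs_eigfun_le2 by (intro sum_mono mult_mono) auto
  finally show ?thesis by (simp add: sum_distrib_right[symmetric] mult.commute)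
qed

lemma abs_fej_mult_le: "i \<in> {1..<m} \<Longrightarrow> \<bar>fej m i * z\<bar> \<le> \<bar>z\<bar>"
  using fej_bounds(1)[of i m] fej_bounds(2)[of m i] by (auto simp: abs_mult intro!: mult_left_le_one_le)

lemma abs_syn_diff_le: "\<bar>syn m c x \<theta> - syn m c y \<theta>\<bar> \<le> 2 * (\<Sum>i=1..<m. \<bar>x i - y i\<bar>)"
  unfolding syn_diff by (rule abs_sum_eigfun_le) (rule abs_fej_mult_le)

lemma abs_syn_le: "\<bar>syn m c x \<theta>\<bar> \<le> \<bar>c\<bar> + 2 * (\<Sum>i=1..<m. \<bar>x i\<bar>)"
  unfolding syn_def
  by (rule order_trans[OF abs_triangle_ineq add_left_mono]) (rule abs_sum_eigfun_le, rule abs_fej_mult_le)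

lemma sum_inner01:
  assumes "integrable leb01 v"
  shows "(\<Sum>i\<in>I. a i * inner01 v (eigfun i)) = (LINT \<theta>|leb01. v \<theta> * (\<Sum>i\<in>I. a i * eigfun i \<theta>))"
    and "integrable leb01 (\<lambda>\<theta>. v \<theta> * (\<Sum>i\<in>I. a i * eigfun i \<theta>))"
proof -
  have *: "(\<lambda>\<theta>. v \<theta> * (\<Sum>i\<in>I. a i * eigfun i \<theta>)) = (\<lambda>\<theta>. \<Sum>i\<in>I. a i * (v \<theta> * eigfun i \<theta>))"
    by (rule ext) (simp add: sum_distrib_left mult.left_commute)
  have i: "integrable leb01 (\<lambda>\<theta>. a i * (v \<theta> * eigfun i \<theta>))" for i
    by (intro integrable_mult_right integrable_eigfun_mult assms)
  show "integrable leb01 (\<lambda>\<theta>. v \<theta> * (\<Sum>i\<in>I. a i * eigfun i \<theta>))"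
    unfolding * by (intro Bochner_Integration.integrable_sum i)
  show "(\<Sum>i\<in>I. a i * inner01 v (eigfun i)) = (LINT \<theta>|leb01. v \<theta> * (\<Sum>i\<in>I. a i * eigfun i \<theta>))"
    unfolding * by (subst Bochner_Integration.integral_sum[OF i]) (simp add: inner01_def)
qed

lemma integrable_sum_eigfun: "integrable leb01 (\<lambda>\<theta>. \<Sum>i\<in>I. a i * eigfun i \<theta>)"
  by (intro Bochner_Integration.integrable_sum integrable_mult_right integrable_eigfun)

lemma inner01_sum_eigfun:
  assumes "finite I"
  shows "inner01 (\<lambda>\<theta>. \<Sum>i\<in>I. a i * eigfun i \<theta>) (eigfun j) = (if j \<in> I then a j else 0)"
proof -
  have "inner01 (\<lambda>\<theta>. \<Sum>i\<in>I. a i * eigfun i \<theta>) (eigfun j) = (LINT \<theta>|leb01. eigfun j \<theta> * (\<Sum>i\<in>I. a i * eigfun i \<theta>))"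
    by (simp add: inner01_def mult.commute)
  also have "\<dots> = (\<Sum>i\<in>I. a i * inner01 (eigfun j) (eigfun i))"
    by (rule sum_inner01(1)[OF integrable_eigfun, symmetric])
  also have "\<dots> = (\<Sum>i\<in>I. if i = j then a j else 0)"
    by (intro sum.cong refl) (auto simp: inner01_eigfun)
  finally show ?thesis using assms by simp
qed

lemma integral_sum_eigfun_sq:
  assumes "finite I"
  shows "(LINT \<theta>|leb01. (\<Sum>i\<in>I. a i * eigfun i \<theta>)\<^sup>2) = (\<Sum>i\<in>I. (a i)\<^sup>2)"
    and "integrable leb01 (\<lambda>\<theta>. (\<Sum>i\<in>I. a i * eigfun i \<theta>)\<^sup>2)"
proof -
  let ?v = "\<lambda>\<theta>. \<Sum>i\<in>I. a i * eigfun i \<theta>"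
  have v: "integrable leb01 ?v" by (rule integrable_sum_eigfun)
  show "integrable leb01 (\<lambda>\<theta>. (?v \<theta>)\<^sup>2)" unfolding power2_eq_square by (rule sum_inner01(2)[OF v])
  have "(LINT \<theta>|leb01. (?v \<theta>)\<^sup>2) = (\<Sum>i\<in>I. a i * inner01 ?v (eigfun i))"
    unfolding power2_eq_square by (rule sum_inner01(1)[OF v, symmetric])
  also have "\<dots> = (\<Sum>i\<in>I. (a i)\<^sup>2)"
    by (intro sum.cong refl) (simp add: inner01_sum_eigfun[OF assms] power2_eq_square)
  finally show "(LINT \<theta>|leb01. (?v \<theta>)\<^sup>2) = (\<Sum>i\<in>I. (a i)\<^sup>2)" .
qed

lemma abs_inner01_eigfun_le:
  assumes "v \<in> borel_measurable borel" "\<And>\<theta>. \<bar>v \<theta>\<bar> \<le> B"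
  shows "\<bar>inner01 v (eigfun i)\<bar> \<le> 2 * B"
proof -
  have v: "integrable leb01 v" by (rule integrable_leb01_bounded[OF assms])
  have B: "0 \<le> B" using assms(2)[of 0] by linarith
  have "\<bar>inner01 v (eigfun i)\<bar> \<le> (LINT \<theta>|leb01. \<bar>v \<theta> * eigfun i \<theta>\<bar>)"
    unfolding inner01_def by (rule integral_abs_bound)
  also have "\<dots> \<le> (LINT \<theta>|leb01. 2 * B)"
  proof (rule integral_mono)
    show "integrable leb01 (\<lambda>\<theta>. \<bar>v \<theta> * eigfun i \<theta>\<bar>)" by (intro integrable_abs integrable_eigfun_mult v)
    show "\<bar>v \<theta> * eigfun i \<theta>\<bar> \<le> 2 * B" for \<theta>
      using mult_mono[OF assms(2)[of \<theta>] abs_eigfun_le2[of i \<theta>] B abs_ge_zero] by (simp add: abs_mult mult.commute)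
  qed simp
  also have "\<dots> = 2 * B" using leb01.prob_space by simp
  finally show ?thesis .
qed

definition fR :: "nat \<Rightarrow> nat \<Rightarrow> real \<Rightarrow> real \<Rightarrow> real" where
  "fR n R lam v = - ftr n R v + lam * v"

lemma fR_syn_bounded: "\<bar>fR n R lam (syn m c x \<theta>)\<bar> \<le> ftil n (real R) + \<bar>lam\<bar> * (\<bar>c\<bar> + 2 * (\<Sum>i=1..<m. \<bar>x i\<bar>))"
proof -
  have "\<bar>fR n R lam (syn m c x \<theta>)\<bar> \<le> \<bar>ftr n R (syn m c x \<theta>)\<bar> + \<bar>lam\<bar> * \<bar>syn m c x \<theta>\<bar>"
    unfolding fR_def by (rule order_trans[OF abs_triangle_ineq]) (simp add: abs_mult)
  also have "\<dots> \<le> ftil n (real R) + \<bar>lam\<bar> * (\<bar>c\<bar> + 2 * (\<Sum>i=1..<m. \<bar>x i\<bar>))"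
    by (intro add_mono abs_ftr_le(1) mult_left_mono abs_syn_le) auto
  finally show ?thesis .
qed

lemma fR_syn_measurable [measurable]: "(\<lambda>\<theta>. fR n R lam (syn m c x \<theta>)) \<in> borel_measurable borel"
  unfolding fR_def[abs_def] by measurable

lemma integrable_fR_syn: "integrable leb01 (\<lambda>\<theta>. fR n R lam (syn m c x \<theta>))"
  by (rule integrable_leb01_bounded[OF _ fR_syn_bounded]) measurable

lemma drift_eq: "drift n R lam m c x i = 1/2 * (- (mu i)\<^sup>2 * x i + mu i * inner01 (\<lambda>\<theta>. fR n R lam (syn m c x \<theta>)) (eigfun i))"
  by (simp add: drift_def fR_def)

lemma inner01_diff:
  assumes "integrable leb01 v" "integrable leb01 w"
  shows "inner01 v (eigfun i) - inner01 w (eigfun i) = inner01 (\<lambda>\<theta>. v \<theta> - w \<theta>) (eigfun i)"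
  unfolding inner01_def left_diff_distrib
  by (rule Bochner_Integration.integral_diff[symmetric]) (intro integrable_eigfun_mult assms)+

lemma drift_diff:
  "drift n R lam m c x i - drift n R lam m c y i = 1/2 * (- (mu i)\<^sup>2 * (x i - y i)
     + mu i * inner01 (\<lambda>\<theta>. fR n R lam (syn m c x \<theta>) - fR n R lam (syn m c y \<theta>)) (eigfun i))"
  unfolding drift_eq inner01_diff[OF integrable_fR_syn integrable_fR_syn, symmetric] by (simp add: algebra_simps)

text \<open>By the choice of \<open>gw\<close> the nonlinear part is the integral of the difference
  of \<open>fR\<close> against the difference of \<open>syn\<close>, to which \<open>ftr\<close>
  contributes with the good sign. The part with \<open>lam\<close> carries squared Fejer weights, at
  most the weights themselves.\<close>

lemma drift_dissipative:
  "(\<Sum>i=1..<m. gw m i * ((x i - y i) * (drift n R lam m c x i - drift n R lam m c y i)))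
    \<le> - 1/2 * (\<Sum>i=1..<m. fej m i * (mu i - max lam 0) * (x i - y i)\<^sup>2)"
proof -
  let ?z = "\<lambda>i. x i - y i" and ?V = "\<lambda>\<theta>. syn m c x \<theta> - syn m c y \<theta>"
  let ?F = "\<lambda>\<theta>. fR n R lam (syn m c x \<theta>) - fR n R lam (syn m c y \<theta>)"
  have F: "integrable leb01 ?F" by (intro Bochner_Integration.integrable_diff integrable_fR_syn)
  have pw: "?F \<theta> * ?V \<theta> \<le> max lam 0 * (?V \<theta>)\<^sup>2" for \<theta>
  proof -
    have "0 \<le> (ftr n R (syn m c x \<theta>) - ftr n R (syn m c y \<theta>)) * ?V \<theta>"
      using ftr_mono[of "syn m c x \<theta>" "syn m c y \<theta>" n R] ftr_mono[of "syn m c y \<theta>" "syn m c x \<theta>" n R]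
      by (cases "syn m c x \<theta> \<le> syn m c y \<theta>") (auto intro: mult_nonneg_nonneg mult_nonpos_nonpos)
    moreover have "lam * (?V \<theta>)\<^sup>2 \<le> max lam 0 * (?V \<theta>)\<^sup>2" by (intro mult_right_mono) auto
    ultimately show ?thesis by (simp add: fR_def power2_eq_square algebra_simps)
  qed
  have "(\<Sum>i=1..<m. (fej m i * ?z i) * inner01 ?F (eigfun i)) = (LINT \<theta>|leb01. ?F \<theta> * ?V \<theta>)"
    unfolding syn_diff by (rule sum_inner01(1)[OF F])
  also have "\<dots> \<le> (LINT \<theta>|leb01. max lam 0 * (?V \<theta>)\<^sup>2)"
  proof (rule integral_mono)
    show "integrable leb01 (\<lambda>\<theta>. ?F \<theta> * ?V \<theta>)" unfolding syn_diff by (rule sum_inner01(2)[OF F])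
    show "integrable leb01 (\<lambda>\<theta>. max lam 0 * (?V \<theta>)\<^sup>2)"
      unfolding syn_diff by (intro integrable_mult_right integral_sum_eigfun_sq(2)) simp
  qed (rule pw)
  also have "\<dots> = max lam 0 * (\<Sum>i=1..<m. (fej m i * ?z i)\<^sup>2)"
    unfolding syn_diff by (simp only: integral_mult_right_zero integral_sum_eigfun_sq(1)[OF finite_atLeastLessThan])
  also have "\<dots> \<le> max lam 0 * (\<Sum>i=1..<m. fej m i * (?z i)\<^sup>2)"
  proof (intro mult_left_mono sum_mono)
    fix i assume i: "i \<in> {1..<m}"
    then have "fej m i * fej m i \<le> fej m i * 1"
      using fej_bounds(1)[of i m] fej_bounds(2)[of m i] by (intro mult_left_mono) auto
    then have "(fej m i * fej m i) * (?z i)\<^sup>2 \<le> fej m i * (?z i)\<^sup>2" by (intro mult_right_mono) auto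
    then show "(fej m i * ?z i)\<^sup>2 \<le> fej m i * (?z i)\<^sup>2" by (simp add: power2_eq_square mult_ac)
  qed simp
  finally have main: "(\<Sum>i=1..<m. (fej m i * ?z i) * inner01 ?F (eigfun i)) \<le> max lam 0 * (\<Sum>i=1..<m. fej m i * (?z i)\<^sup>2)" .
  have "(\<Sum>i=1..<m. gw m i * (?z i * (drift n R lam m c x i - drift n R lam m c y i)))
     = (\<Sum>i=1..<m. 1/2 * (- (fej m i * mu i * (?z i)\<^sup>2) + (fej m i * ?z i) * inner01 ?F (eigfun i)))"
  proof (intro sum.cong refl)
    fix i assume "i \<in> {1..<m}"
    then have "mu i \<noteq> 0" using mu_pos[of i] by simp
    then show "gw m i * (?z i * (drift n R lam m c x i - drift n R lam m c y i))
      = 1/2 * (- (fej m i * mu i * (?z i)\<^sup>2) + (fej m i * ?z i) * inner01 ?F (eigfun i))"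
      unfolding drift_diff gw_def by (simp add: power2_eq_square field_simps)
  qed
  also have "\<dots> = 1/2 * (- (\<Sum>i=1..<m. fej m i * mu i * (?z i)\<^sup>2) + (\<Sum>i=1..<m. (fej m i * ?z i) * inner01 ?F (eigfun i)))"
    by (simp only: sum_distrib_left[symmetric] sum.distrib sum_negf)
  also have "\<dots> \<le> 1/2 * (- (\<Sum>i=1..<m. fej m i * mu i * (?z i)\<^sup>2) + max lam 0 * (\<Sum>i=1..<m. fej m i * (?z i)\<^sup>2))"
    using main by simp
  also have "\<dots> = - 1/2 * (\<Sum>i=1..<m. fej m i * (mu i - max lam 0) * (?z i)\<^sup>2)"
    by (simp add: sum_distrib_left sum_negf[symmetric] sum.distrib[symmetric] sum_subtractf[symmetric] algebra_simps)
  finally show ?thesis .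
qed

text \<open>The constant may depend on \<open>m\<close> and \<open>R\<close>: it serves
  measurability and the choice of the step size, and does not reach the final estimate.\<close>

lemma drift_lipschitz:
  "\<exists>A\<ge>0. \<forall>x y. \<forall>i\<in>{1..<m}. \<bar>drift n R lam m c x i - drift n R lam m c y i\<bar> \<le> A * (\<Sum>j=1..<m. \<bar>x j - y j\<bar>)"
proof -
  obtain L where L: "L \<ge> 0" "\<And>a b. \<bar>ftr n R a - ftr n R b\<bar> \<le> L * \<bar>a - b\<bar>" using ftr_lipschitz[of n R] by blast
  let ?A = "1/2 * ((mu m)\<^sup>2 + mu m * (2 * ((L + \<bar>lam\<bar>) * 2)))"
  have mu0: "0 \<le> mu i" for i by (simp add: mu_def)
  have "\<bar>drift n R lam m c x i - drift n R lam m c y i\<bar> \<le> ?A * (\<Sum>j=1..<m. \<bar>x j - y j\<bar>)" if i: "i \<in> {1..<m}" for x y i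
  proof -
    let ?S = "\<Sum>j=1..<m. \<bar>x j - y j\<bar>"
    have S0: "0 \<le> ?S" by (simp add: sum_nonneg)
    have zi: "\<bar>x i - y i\<bar> \<le> ?S" by (rule member_le_sum[OF i]) auto
    let ?F = "\<lambda>\<theta>. fR n R lam (syn m c x \<theta>) - fR n R lam (syn m c y \<theta>)"
    have Fb: "\<bar>?F \<theta>\<bar> \<le> (L + \<bar>lam\<bar>) * (2 * ?S)" for \<theta>
    proof -
      have "\<bar>?F \<theta>\<bar> = \<bar>- (ftr n R (syn m c x \<theta>) - ftr n R (syn m c y \<theta>)) + lam * (syn m c x \<theta> - syn m c y \<theta>)\<bar>"
        by (simp add: fR_def algebra_simps)
      also have "\<dots> \<le> \<bar>ftr n R (syn m c x \<theta>) - ftr n R (syn m c y \<theta>)\<bar> + \<bar>lam\<bar> * \<bar>syn m c x \<theta> - syn m c y \<theta>\<bar>"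
        by (rule order_trans[OF abs_triangle_ineq]) (simp only: abs_mult abs_minus_cancel order_refl)
      also have "\<dots> \<le> L * \<bar>syn m c x \<theta> - syn m c y \<theta>\<bar> + \<bar>lam\<bar> * \<bar>syn m c x \<theta> - syn m c y \<theta>\<bar>"
        by (intro add_right_mono L(2))
      also have "\<dots> = (L + \<bar>lam\<bar>) * \<bar>syn m c x \<theta> - syn m c y \<theta>\<bar>" by (simp add: algebra_simps)
      also have "\<dots> \<le> (L + \<bar>lam\<bar>) * (2 * ?S)" by (intro mult_left_mono abs_syn_diff_le) (use L in auto)
      finally show ?thesis .
    qed
    have in_: "\<bar>inner01 ?F (eigfun i)\<bar> \<le> 2 * ((L + \<bar>lam\<bar>) * (2 * ?S))"
      by (rule abs_inner01_eigfun_le[OF _ Fb]) measurable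
    have "\<bar>drift n R lam m c x i - drift n R lam m c y i\<bar> \<le> 1/2 * ((mu i)\<^sup>2 * \<bar>x i - y i\<bar> + mu i * \<bar>inner01 ?F (eigfun i)\<bar>)"
      unfolding drift_diff using abs_triangle_ineq[of "- (mu i)\<^sup>2 * (x i - y i)" "mu i * inner01 ?F (eigfun i)"] mu0[of i]
      by (simp add: abs_mult)
    also have "\<dots> \<le> 1/2 * ((mu m)\<^sup>2 * ?S + mu m * (2 * ((L + \<bar>lam\<bar>) * (2 * ?S))))"
      using i mu0 by (intro mult_left_mono add_mono mult_mono power_mono mu_mono zi in_) auto
    finally show ?thesis by (simp add: algebra_simps)
  qed
  moreover have "0 \<le> ?A" using mu0 L by (intro mult_nonneg_nonneg add_nonneg_nonneg) auto
  ultimately show ?thesis by blast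
qed

lemma sum_abs_sq_le:
  fixes g :: "'i \<Rightarrow> real"
  assumes I: "finite I" and g: "\<And>i. i \<in> I \<Longrightarrow> 0 < g i"
  shows "(\<Sum>i\<in>I. \<bar>z i\<bar>)\<^sup>2 \<le> (\<Sum>i\<in>I. 1 / g i) * (\<Sum>i\<in>I. g i * (z i)\<^sup>2)"
proof -
  have "(\<Sum>i\<in>I. \<bar>z i\<bar>) = (\<Sum>i\<in>I. (1 / sqrt (g i)) * (sqrt (g i) * \<bar>z i\<bar>))"
    using g by (intro sum.cong refl) (simp add: less_imp_neq[symmetric])
  then have "(\<Sum>i\<in>I. \<bar>z i\<bar>)\<^sup>2 \<le> (\<Sum>i\<in>I. (1 / sqrt (g i))\<^sup>2) * (\<Sum>i\<in>I. (sqrt (g i) * \<bar>z i\<bar>)\<^sup>2)"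
    using Cauchy_Schwarz_ineq_sum[of "\<lambda>i. 1 / sqrt (g i)" "\<lambda>i. sqrt (g i) * \<bar>z i\<bar>" I] by simp
  also have "\<dots> = (\<Sum>i\<in>I. 1 / g i) * (\<Sum>i\<in>I. g i * (z i)\<^sup>2)"
    using g by (intro arg_cong2[where f="(*)"] sum.cong refl) (auto simp: power_divide power_mult_distrib less_imp_le)
  finally show ?thesis .
qed

section \<open>Increments of the cylindrical Wiener process\<close>

text \<open>For \<open>i \<ge> 1\<close> the image of \<open>eigfun i\<close> under the square root
  of \<open>B\<close>; the noise in mode \<open>i\<close> is \<open>W t (psi b i)\<close>.\<close>

definition psi :: "(nat \<Rightarrow> real) \<Rightarrow> nat \<Rightarrow> real \<Rightarrow> real" where
  "psi b i \<theta> = sqrt (b i) * eigfun i \<theta>"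

lemma L2_01_bounded:
  assumes "v \<in> borel_measurable borel" "\<And>\<theta>. \<bar>v \<theta>\<bar> \<le> B"
  shows "v \<in> L2_01"
proof -
  have "integrable leb01 (\<lambda>\<theta>. (v \<theta>)\<^sup>2)"
  proof (rule integrable_leb01_bounded)
    show "(\<lambda>\<theta>. (v \<theta>)\<^sup>2) \<in> borel_measurable borel" using assms(1) by measurable
    show "\<bar>(v \<theta>)\<^sup>2\<bar> \<le> B\<^sup>2" for \<theta>
      using power_mono[OF assms(2)[of \<theta>], of 2] by simp
  qed
  then show ?thesis using measurable_leb01[OF assms(1)] by (simp add: L2_01_def)
qed

lemma psi_combination_L2: "(\<lambda>\<theta>. \<Sum>i\<leftarrow>js. c i * psi b i \<theta>) \<in> L2_01"
proof (rule L2_01_bounded)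
  show "(\<lambda>\<theta>. \<Sum>i\<leftarrow>js. c i * psi b i \<theta>) \<in> borel_measurable borel"
    by (rule borel_measurable_list_combination) (simp add: psi_def[abs_def])
  show "\<bar>\<Sum>i\<leftarrow>js. c i * psi b i \<theta>\<bar> \<le> (\<Sum>i\<leftarrow>js. \<bar>c i * sqrt (b i)\<bar> * 2)" for \<theta>
  proof (induction js)
    case (Cons i js)
    have "\<bar>c i * psi b i \<theta>\<bar> = \<bar>c i * sqrt (b i)\<bar> * \<bar>eigfun i \<theta>\<bar>" by (simp add: psi_def abs_mult)
    also have "\<dots> \<le> \<bar>c i * sqrt (b i)\<bar> * 2" by (intro mult_left_mono abs_eigfun_le2) simp
    finally have "\<bar>c i * psi b i \<theta>\<bar> \<le> \<bar>c i * sqrt (b i)\<bar> * 2" .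
    then show ?case unfolding list.map sum_list.Cons
      using Cons abs_triangle_ineq[of "c i * psi b i \<theta>" "\<Sum>i\<leftarrow>js. c i * psi b i \<theta>"] by linarith
  qed simp
qed

lemma psi_L2: "psi b i \<in> L2_01"
  using psi_combination_L2[where js="[i]" and c="\<lambda>_. 1"] by simp

lemma inner01_psi_combination:
  assumes "distinct js" "\<And>i. i \<in> set js \<Longrightarrow> 0 \<le> b i"
  shows "inner01 (\<lambda>\<theta>. \<Sum>i\<leftarrow>js. c i * psi b i \<theta>) (\<lambda>\<theta>. \<Sum>i\<leftarrow>js. c i * psi b i \<theta>) = (\<Sum>i\<leftarrow>js. b i * (c i)\<^sup>2)"
proof -
  have e: "(\<Sum>i\<leftarrow>js. c i * psi b i \<theta>) = (\<Sum>i\<in>set js. (c i * sqrt (b i)) * eigfun i \<theta>)" for \<theta>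
    using assms(1) by (simp add: sum_list_distinct_conv_sum_set psi_def mult.assoc)
  have "inner01 (\<lambda>\<theta>. \<Sum>i\<leftarrow>js. c i * psi b i \<theta>) (\<lambda>\<theta>. \<Sum>i\<leftarrow>js. c i * psi b i \<theta>)
      = (LINT \<theta>|leb01. (\<Sum>i\<in>set js. (c i * sqrt (b i)) * eigfun i \<theta>)\<^sup>2)"
    unfolding inner01_def e power2_eq_square ..
  also have "\<dots> = (\<Sum>i\<in>set js. (c i * sqrt (b i))\<^sup>2)"
    by (rule integral_sum_eigfun_sq(1)) simp
  also have "\<dots> = (\<Sum>i\<in>set js. b i * (c i)\<^sup>2)"
    using assms(2) by (intro sum.cong refl) (simp add: power_mult_distrib)
  finally show ?thesis using assms(1) by (simp add: sum_list_distinct_conv_sum_set)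
qed

lemma (in prob_space) indep_integral_iexp:
  assumes sub: "sigma_algebra (space M) G" "sigma_algebra (space M) G'" and ind: "indep_set G G'"
    and E: "E \<in> G" and D: "\<And>B. B \<in> sets borel \<Longrightarrow> D -` B \<inter> space M \<in> G'" and Dm: "D \<in> borel_measurable M"
  shows "(CLINT \<omega>|M. indicator E \<omega> * iexp (D \<omega>)) = of_real (prob E) * (CLINT \<omega>|M. iexp (D \<omega>))"
proof -
  interpret G: sigma_algebra "space M" G by (rule sub(1))
  interpret G': sigma_algebra "space M" G' by (rule sub(2))
  have i2: "G \<subseteq> events" "G' \<subseteq> events" "\<And>a b. a \<in> G \<Longrightarrow> b \<in> G' \<Longrightarrow> prob (a \<inter> b) = prob a * prob b"
    using ind unfolding indep_sets2_eq by auto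
  have Ee: "E \<in> events" using E i2 by auto
  have ie: "(\<lambda>\<omega>. iexp (D \<omega>)) \<in> borel_measurable M" by (rule measurable_compose[OF Dm iexp_measurable])
  have iv: "indep_var borel (indicator E :: 'a \<Rightarrow> complex) borel (\<lambda>\<omega>. iexp (D \<omega>))"
    unfolding indep_var_eq
  proof (intro conjI)
    show "random_variable borel (indicator E :: 'a \<Rightarrow> complex)" using Ee by simp
    show "random_variable borel (\<lambda>\<omega>. iexp (D \<omega>))" by (rule ie)
    have s1: "{(indicator E :: 'a \<Rightarrow> complex) -` A \<inter> space M |A. A \<in> sets borel} \<subseteq> G"
    proof safe
      fix A :: "complex set"
      have "indicator E -` A \<inter> space M = (if 1 \<in> A then E else {}) \<union> (if 0 \<in> A then space M - E else {})"
      proof (rule set_eqI)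
        fix x
        show "x \<in> indicator E -` A \<inter> space M \<longleftrightarrow> x \<in> (if 1 \<in> A then E else {}) \<union> (if 0 \<in> A then space M - E else {})"
          using sets.sets_into_space[OF Ee] by (cases "x \<in> E") auto
      qed
      then show "indicator E -` A \<inter> space M \<in> G" using E by auto
    qed
    have s2: "{(\<lambda>\<omega>. iexp (D \<omega>)) -` A \<inter> space M |A. A \<in> sets borel} \<subseteq> G'"
    proof safe
      fix A :: "complex set" assume "A \<in> sets borel"
      then have "iexp -` A \<inter> space borel \<in> sets borel" by (rule measurable_sets[OF iexp_measurable])
      from D[OF this] show "(\<lambda>\<omega>. iexp (D \<omega>)) -` A \<inter> space M \<in> G'" by (simp add: vimage_def)
    qed
    show "indep_set (sigma_sets (space M) {(indicator E :: 'a \<Rightarrow> complex) -` A \<inter> space M |A. A \<in> sets borel})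
       (sigma_sets (space M) {(\<lambda>\<omega>. iexp (D \<omega>)) -` A \<inter> space M |A. A \<in> sets borel})"
      unfolding indep_sets2_eq using G.sigma_sets_subset[OF s1] G'.sigma_sets_subset[OF s2] i2 by blast
  qed
  have int1: "integrable M (indicator E :: 'a \<Rightarrow> complex)"
    by (rule integrable_const_bound[where B=1]) (use Ee in \<open>auto simp: indicator_def\<close>)
  have int2: "integrable M (\<lambda>\<omega>. iexp (D \<omega>))"
    by (rule integrable_const_bound[where B=1]) (simp_all add: ie)
  have "(CLINT \<omega>|M. indicator E \<omega> * iexp (D \<omega>)) = (CLINT \<omega>|M. indicator E \<omega>) * (CLINT \<omega>|M. iexp (D \<omega>))"
    by (rule indep_var_lebesgue_integral[OF iv int1 int2])
  moreover have "(CLINT \<omega>|M. indicator E \<omega>) = complex_of_real (prob E)"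
  proof -
    have "(CLINT \<omega>|M. indicator E \<omega>) = (CLINT \<omega>|M. complex_of_real (indicator E \<omega>))"
      by (intro Bochner_Integration.integral_cong refl) (simp add: indicator_def)
    also have "\<dots> = complex_of_real (LINT \<omega>|M. indicator E \<omega>)" by (rule integral_complex_of_real)
    finally show ?thesis using Ee by simp
  qed
  ultimately show ?thesis by simp
qed

lemma prod_list_char_gauss:
  assumes "\<And>i. i \<in> set js \<Longrightarrow> 0 \<le> b i" "0 \<le> r"
  shows "(\<Prod>j\<leftarrow>js. char (gauss (sqrt (r * b j))) (c j)) = of_real (exp (- (r * (\<Sum>i\<leftarrow>js. b i * (c i)\<^sup>2)) / 2))"
  using assms
proof (induction js)
  case (Cons j js)
  then have "char (gauss (sqrt (r * b j))) (c j) = of_real (exp (- (r * b j * (c j)\<^sup>2) / 2))"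
    by (subst char_gauss) auto
  then have "(\<Prod>j\<leftarrow>j # js. char (gauss (sqrt (r * b j))) (c j))
     = of_real (exp (- (r * b j * (c j)\<^sup>2) / 2) * exp (- (r * (\<Sum>i\<leftarrow>js. b i * (c i)\<^sup>2)) / 2))"
    using Cons by simp
  also have "exp (- (r * b j * (c j)\<^sup>2) / 2) * exp (- (r * (\<Sum>i\<leftarrow>js. b i * (c i)\<^sup>2)) / 2)
     = exp (- (r * (\<Sum>i\<leftarrow>j # js. b i * (c i)\<^sup>2)) / 2)"
    unfolding exp_add[symmetric] by (rule arg_cong[where f=exp]) (simp add: field_simps)
  finally show ?case .
qed simp

lemma cylindrical_wienerD:
  assumes "cylindrical_wiener M F W"
  shows "0 \<le> t \<Longrightarrow> g \<in> L2_01 \<Longrightarrow> W t g \<in> borel_measurable (F t)"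
    and "0 \<le> t \<Longrightarrow> g \<in> L2_01 \<Longrightarrow> h \<in> L2_01 \<Longrightarrow>
      AE \<omega> in M. W t (\<lambda>\<theta>. r * g \<theta> + q * h \<theta>) \<omega> = r * W t g \<omega> + q * W t h \<omega>"
    and "0 \<le> t \<Longrightarrow> g \<in> L2_01 \<Longrightarrow> inner01 g g = 0 \<Longrightarrow> AE \<omega> in M. W t g \<omega> = 0"
    and "0 \<le> s \<Longrightarrow> s < t \<Longrightarrow> g \<in> L2_01 \<Longrightarrow> inner01 g g > 0 \<Longrightarrow>
      distributed M lborel (\<lambda>\<omega>. W t g \<omega> - W s g \<omega>) (normal_density 0 (sqrt ((t - s) * inner01 g g)))"
    and "0 \<le> s \<Longrightarrow> s < t \<Longrightarrow> g \<in> L2_01 \<Longrightarrow> prob_space.indep_set M (sets (F s))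
      (sets (vimage_algebra (space M) (\<lambda>\<omega>. W t g \<omega> - W s g \<omega>) borel))"
proof -
  note W = assms[unfolded cylindrical_wiener_def]
  note 1 = W[THEN conjunct1] and 4 = W[THEN conjunct2, THEN conjunct2, THEN conjunct2]
  note 5 = 4[THEN conjunct2] note 6 = 5[THEN conjunct2] note 7 = 6[THEN conjunct2]
  show "0 \<le> t \<Longrightarrow> g \<in> L2_01 \<Longrightarrow> W t g \<in> borel_measurable (F t)"
    by (rule 1[rule_format])
  show "0 \<le> t \<Longrightarrow> g \<in> L2_01 \<Longrightarrow> h \<in> L2_01 \<Longrightarrow>
      AE \<omega> in M. W t (\<lambda>\<theta>. r * g \<theta> + q * h \<theta>) \<omega> = r * W t g \<omega> + q * W t h \<omega>"
    by (rule 4[THEN conjunct1, rule_format])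
  show "0 \<le> t \<Longrightarrow> g \<in> L2_01 \<Longrightarrow> inner01 g g = 0 \<Longrightarrow> AE \<omega> in M. W t g \<omega> = 0"
    by (rule 5[THEN conjunct1, rule_format])
  show "0 \<le> s \<Longrightarrow> s < t \<Longrightarrow> g \<in> L2_01 \<Longrightarrow> inner01 g g > 0 \<Longrightarrow>
      distributed M lborel (\<lambda>\<omega>. W t g \<omega> - W s g \<omega>) (normal_density 0 (sqrt ((t - s) * inner01 g g)))"
    by (rule 6[THEN conjunct1, rule_format])
  show "0 \<le> s \<Longrightarrow> s < t \<Longrightarrow> g \<in> L2_01 \<Longrightarrow> prob_space.indep_set M (sets (F s))
      (sets (vimage_algebra (space M) (\<lambda>\<omega>. W t g \<omega> - W s g \<omega>) borel))"
    by (rule 7[rule_format])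
qed

context stochastic_basis
begin

lemma F_measurable_M: "D \<in> borel_measurable (F t) \<Longrightarrow> D \<in> borel_measurable M"
  using filtration_sub[of t] space_F[of t] by (auto simp: measurable_def)

text \<open>Linearity of \<open>W t\<close> is known only almost surely for each pair of functions,
  so a finite combination is assembled term by term.\<close>

lemma wiener_combination:
  assumes W: "cylindrical_wiener M F W" and t: "0 \<le> t"
  shows "AE \<omega> in M. W t (\<lambda>\<theta>. \<Sum>i\<leftarrow>js. c i * psi b i \<theta>) \<omega> = (\<Sum>i\<leftarrow>js. c i * W t (psi b i) \<omega>)"
proof (induction js)
  case Nil
  have "(\<lambda>\<theta>. 0) \<in> L2_01" "inner01 (\<lambda>\<theta>. 0) (\<lambda>\<theta>. 0) = 0"
    using psi_combination_L2[of c b "[]"] by (simp_all add: inner01_def)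
  then have "AE \<omega> in M. W t (\<lambda>\<theta>. 0) \<omega> = 0" by (intro cylindrical_wienerD(3)[OF W t])
  then show ?case by simp
next
  case (Cons i js)
  let ?r = "\<lambda>\<theta>. \<Sum>i\<leftarrow>js. c i * psi b i \<theta>"
  have "AE \<omega> in M. W t (\<lambda>\<theta>. c i * psi b i \<theta> + 1 * ?r \<theta>) \<omega> = c i * W t (psi b i) \<omega> + 1 * W t ?r \<omega>"
    by (rule cylindrical_wienerD(2)[OF W t psi_L2 psi_combination_L2])
  then show ?case using Cons by eventually_elim simp
qed

text \<open>A combination of the increments is the increment of \<open>W\<close> at the single
  function \<open>?g\<close>, whose Gaussian law and independence of the past are given;
  orthonormality of the \<open>eigfun\<close> yields the product form. Zero variance is a separate
  case, since the law then has no density.\<close>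

lemma wiener_fresh:
  assumes W: "cylindrical_wiener M F W" and st: "0 \<le> s" "s < t"
    and js: "distinct js" and b: "\<And>i. i \<in> set js \<Longrightarrow> 0 \<le> b i"
  shows "fresh (sets (F s)) (\<lambda>i \<omega>. W t (psi b i) \<omega> - W s (psi b i) \<omega>) (\<lambda>i. sqrt ((t - s) * b i)) js"
  unfolding fresh_def
proof (intro conjI ballI allI)
  have t0: "0 \<le> t" using st by simp
  have meas: "W r g \<in> borel_measurable (F r)" if "0 \<le> r" "g \<in> L2_01" for r g
    by (rule cylindrical_wienerD(1)[OF W that])
  show sF: "sigma_algebra (space M) (sets (F s))"
    using sets.sigma_algebra_axioms[of "F s"] by (simp add: space_F)
  show "sets (F s) \<subseteq> events" by (rule filtration_sub)
  show "(\<lambda>\<omega>. W t (psi b j) \<omega> - W s (psi b j) \<omega>) \<in> borel_measurable M" for j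
    by (intro borel_measurable_diff F_measurable_M[OF meas] psi_L2 st t0)
  fix E c assume E: "E \<in> sets (F s)"
  let ?g = "\<lambda>\<theta>. \<Sum>i\<leftarrow>js. c i * psi b i \<theta>"
  have g: "?g \<in> L2_01" by (rule psi_combination_L2)
  let ?v = "\<Sum>i\<leftarrow>js. b i * (c i)\<^sup>2"
  have v: "inner01 ?g ?g = ?v" by (rule inner01_psi_combination[OF js b])
  have v0: "0 \<le> ?v" using b by (intro sum_list_nonneg) auto
  let ?D = "\<lambda>\<omega>. W t ?g \<omega> - W s ?g \<omega>" and ?S = "\<lambda>\<omega>. \<Sum>j\<leftarrow>js. c j * (W t (psi b j) \<omega> - W s (psi b j) \<omega>)"
  have Dm: "?D \<in> borel_measurable M" by (intro borel_measurable_diff F_measurable_M[OF meas] g st t0)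
  have Sm: "?S \<in> borel_measurable M"
    by (rule borel_measurable_list_combination) (intro borel_measurable_diff F_measurable_M[OF meas] psi_L2 st t0)
  have Ee: "E \<in> events" using E filtration_sub by auto
  have "AE \<omega> in M. ?S \<omega> = ?D \<omega>"
    using wiener_combination[OF W t0, of c b js] wiener_combination[OF W st(1), of c b js]
  proof eventually_elim
    case (elim \<omega>)
    have "(\<Sum>j\<leftarrow>js. c j * (W t (psi b j) \<omega> - W s (psi b j) \<omega>)) = (\<Sum>i\<leftarrow>js. c i * W t (psi b i) \<omega>) - (\<Sum>i\<leftarrow>js. c i * W s (psi b i) \<omega>)"
      by (simp add: right_diff_distrib sum_list_subtractf)
    then show ?case using elim by simp
  qed
  then have SD: "(CLINT \<omega>|M. indicator E \<omega> * iexp (?S \<omega>)) = (CLINT \<omega>|M. indicator E \<omega> * iexp (?D \<omega>))"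
    by (intro integral_cong_AE borel_measurable_times borel_measurable_indicator Ee
        measurable_compose[OF Sm iexp_measurable] measurable_compose[OF Dm iexp_measurable]) (auto elim!: eventually_mono)
  have P: "(\<Prod>j\<leftarrow>js. char (gauss (sqrt ((t - s) * b j))) (c j)) = of_real (exp (- ((t - s) * ?v) / 2))"
    by (rule prod_list_char_gauss) (use b st in auto)
  show "(CLINT \<omega>|M. indicator E \<omega> * iexp (?S \<omega>)) = of_real (prob E) * (\<Prod>j\<leftarrow>js. char (gauss (sqrt ((t - s) * b j))) (c j))"
  proof (cases "?v = 0")
    case True
    then have z: "AE \<omega> in M. W t ?g \<omega> = 0" "AE \<omega> in M. W s ?g \<omega> = 0"
      using cylindrical_wienerD(3)[OF W t0 g] cylindrical_wienerD(3)[OF W st(1) g] v by simp_all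
    have "(CLINT \<omega>|M. indicator E \<omega> * iexp (?D \<omega>)) = (CLINT \<omega>|M. complex_of_real (indicator E \<omega>))"
    proof (rule integral_cong_AE)
      show "AE \<omega> in M. indicator E \<omega> * iexp (?D \<omega>) = complex_of_real (indicator E \<omega>)"
        using z by eventually_elim (simp add: indicator_def)
      show "(\<lambda>\<omega>. indicator E \<omega> * iexp (?D \<omega>)) \<in> borel_measurable M"
        by (intro borel_measurable_times borel_measurable_indicator Ee measurable_compose[OF Dm iexp_measurable])
      show "(\<lambda>\<omega>. complex_of_real (indicator E \<omega>)) \<in> borel_measurable M" using Ee by simp
    qed
    also have "\<dots> = complex_of_real (LINT \<omega>|M. indicator E \<omega>)" by (rule integral_complex_of_real)
    finally show ?thesis unfolding SD P True using Ee by simp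
  next
    case False
    then have v1: "inner01 ?g ?g > 0" using v v0 by simp
    let ?G' = "sets (vimage_algebra (space M) ?D borel)"
    have ind: "indep_set (sets (F s)) ?G'"
      by (rule cylindrical_wienerD(5)[OF W st g])
    have sG': "sigma_algebra (space M) ?G'"
      using sets.sigma_algebra_axioms[of "vimage_algebra (space M) ?D borel"] by simp
    have pre: "?D -` B \<inter> space M \<in> ?G'" if "B \<in> sets borel" for B
      using that by (rule in_vimage_algebra)
    have "distributed M lborel ?D (normal_density 0 (sqrt ((t - s) * ?v)))"
      using cylindrical_wienerD(4)[OF W st g v1] unfolding v .
    then have "distr M lborel ?D = density lborel (normal_density 0 (sqrt ((t - s) * ?v)))"
      by (rule distributed_distr_eq_density)
    moreover have "sqrt ((t - s) * ?v) \<noteq> 0" using False st by simp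
    moreover have "distr M lborel ?D = distr M borel ?D" by (rule distr_cong) auto
    ultimately have law: "distr M borel ?D = gauss (sqrt ((t - s) * ?v))" by (simp add: gauss_def)
    have "(CLINT \<omega>|M. iexp (?D \<omega>)) = (CLINT x|distr M borel ?D. iexp x)"
      by (rule integral_distr[OF Dm iexp_measurable, symmetric])
    also have "\<dots> = char (gauss (sqrt ((t - s) * ?v))) 1" unfolding law char_def by simp
    also have "\<dots> = of_real (exp (- ((t - s) * ?v) / 2))"
      using v0 st by (subst char_gauss) auto
    finally have ch: "(CLINT \<omega>|M. iexp (?D \<omega>)) = of_real (exp (- ((t - s) * ?v) / 2))" .
    show ?thesis
      unfolding SD P using indep_integral_iexp[OF sF sG' ind E pre Dm] unfolding ch .
  qed
qed

end

section \<open>Space-time integrals\<close>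

text \<open>\<open>path_in_Lp\<close> speaks of the restricted plane measure, Fubini's theorem of
  the product of restricted line measures.\<close>

lemma restrict_lborel_pair:
  fixes A B :: "real set"
  assumes A: "A \<in> sets borel" and B: "B \<in> sets borel"
  shows "restrict_space lborel A \<Otimes>\<^sub>M restrict_space lborel B = restrict_space lborel (A \<times> B)"
proof (rule pair_measure_eqI)
  let ?P = "restrict_space lborel A \<Otimes>\<^sub>M restrict_space lborel B"
  have AB: "A \<times> B \<in> sets (lborel :: (real \<times> real) measure)"
    using pair_measureI[of A lborel B lborel] A B unfolding lborel_prod by simp
  show "sigma_finite_measure (restrict_space lborel A)" "sigma_finite_measure (restrict_space lborel B)"
    using A B by (auto intro!: sigma_finite_measure_restrict_space sigma_finite_lborel)
  show "sets ?P = sets (restrict_space lborel (A \<times> B))"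
  proof (rule antisym)
    have "{a \<times> b |a b. a \<in> sets (restrict_space lborel A) \<and> b \<in> sets (restrict_space lborel B)} \<subseteq> sets (restrict_space lborel (A \<times> B))"
    proof safe
      fix a b assume ab: "a \<in> sets (restrict_space lborel A)" "b \<in> sets (restrict_space lborel B)"
      then have "a \<in> sets borel" "b \<in> sets borel" "a \<subseteq> A" "b \<subseteq> B"
        using A B by (auto simp: sets_restrict_space_iff)
      then have "a \<times> b \<in> sets (lborel :: (real \<times> real) measure)" "a \<times> b \<subseteq> A \<times> B"
        using pair_measureI[of a lborel b lborel] unfolding lborel_prod by auto
      then show "a \<times> b \<in> sets (restrict_space lborel (A \<times> B))"
        using AB by (subst sets_restrict_space_iff) auto
    qed
    then have "sigma_sets (A \<times> B) {a \<times> b |a b. a \<in> sets (restrict_space lborel A) \<and> b \<in> sets (restrict_space lborel B)}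
       \<subseteq> sets (restrict_space lborel (A \<times> B))"
      using sets.sigma_sets_subset[of _ "restrict_space lborel (A \<times> B)"] by (simp add: space_restrict_space)
    then show "sets ?P \<subseteq> sets (restrict_space lborel (A \<times> B))"
      by (simp add: sets_pair_measure space_restrict_space)
    have f: "fst \<in> ?P \<rightarrow>\<^sub>M lborel" "snd \<in> ?P \<rightarrow>\<^sub>M lborel"
      by (rule measurable_compose[OF measurable_fst measurable_restrict_space1[OF measurable_ident_sets[OF refl]]],
          rule measurable_compose[OF measurable_snd measurable_restrict_space1[OF measurable_ident_sets[OF refl]]])
    have "(\<lambda>z. (fst z, snd z)) \<in> ?P \<rightarrow>\<^sub>M lborel \<Otimes>\<^sub>M lborel"
      by (rule measurable_Pair[OF f])
    then have id: "(\<lambda>z. z) \<in> ?P \<rightarrow>\<^sub>M (lborel :: (real \<times> real) measure)" by (simp add: lborel_prod)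
    show "sets (restrict_space lborel (A \<times> B)) \<subseteq> sets ?P"
    proof
      fix S assume "S \<in> sets (restrict_space lborel (A \<times> B))"
      then have S: "S \<in> sets (lborel :: (real \<times> real) measure)" "S \<subseteq> A \<times> B"
        using AB by (auto simp: sets_restrict_space_iff)
      have "(\<lambda>z. z) -` S \<inter> space ?P \<in> sets ?P" by (rule measurable_sets[OF id S(1)])
      moreover have "(\<lambda>z. z) -` S \<inter> space ?P = S"
        using S(2) by (auto simp: space_pair_measure space_restrict_space)
      ultimately show "S \<in> sets ?P" by simp
    qed
  qed
  fix a b assume ab: "a \<in> sets (restrict_space lborel A)" "b \<in> sets (restrict_space lborel B)"
  then have ab': "a \<in> sets borel" "b \<in> sets borel" "a \<subseteq> A" "b \<subseteq> B"
    using A B by (auto simp: sets_restrict_space_iff)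
  have "emeasure (restrict_space lborel (A \<times> B)) (a \<times> b) = emeasure lborel (a \<times> b)"
    using AB ab' by (intro emeasure_restrict_space) auto
  also have "\<dots> = emeasure (lborel \<Otimes>\<^sub>M lborel) (a \<times> b)" by (simp add: lborel_prod)
  also have "\<dots> = emeasure lborel a * emeasure lborel b"
    using ab' by (intro lborel.emeasure_pair_measure_Times) auto
  also have "\<dots> = emeasure (restrict_space lborel A) a * emeasure (restrict_space lborel B) b"
    using A B ab' by (simp add: emeasure_restrict_space)
  finally show "emeasure (restrict_space lborel A) a * emeasure (restrict_space lborel B) b
    = emeasure (restrict_space lborel (A \<times> B)) (a \<times> b)" by simp
qed

abbreviation LT :: "real \<Rightarrow> real measure" where
  "LT T \<equiv> restrict_space lborel {0<..<T}"

lemma finite_measure_LT: "finite_measure (LT T)"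
proof (rule finite_measureI)
  have "emeasure lborel {0<..<T} \<noteq> \<infinity>"
    by (cases "0 \<le> T") simp_all
  then show "emeasure (LT T) (space (LT T)) \<noteq> \<infinity>"
    by (simp add: emeasure_restrict_space space_restrict_space)
qed

lemma set_integral_LT:
  fixes h :: "real \<Rightarrow> real"
  assumes h: "h \<in> borel_measurable (LT T)" and t: "0 \<le> t" "t \<le> T"
  shows "(LINT s:{0..t}|lborel. h s) = (LINT s|LT T. indicator {0<..t} s * h s)"
proof -
  define k where "k s = h s * indicator {0<..<T} s" for s
  have k: "k \<in> borel_measurable borel"
    using h borel_measurable_restrict_space_iff[of "{0<..<T}" lborel h] by (simp add: k_def[abs_def] mult.commute)
  have "(LINT s:{0..t}|lborel. h s) = (LINT s|lborel. indicator {0<..t} s * k s)"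
    unfolding set_lebesgue_integral_def
  proof (rule integral_cong_AE)
    \<comment> \<open>\<open>h\<close> is known to be measurable only on the open interval; the last
      two terms correct the values at the endpoints 0 and \<open>T\<close>.\<close>
    have e: "(\<lambda>s. indicator {0..t} s *\<^sub>R h s) = (\<lambda>s. indicator {0..t} s * k s + indicator ({0..t} \<inter> {0}) s * (h 0 - k 0)
        + indicator ({0..t} \<inter> {T} - {0}) s * (h T - k T))"
      using t by (auto simp: k_def indicator_def fun_eq_iff)
    show "(\<lambda>s. indicator {0..t} s *\<^sub>R h s) \<in> borel_measurable lborel"
      unfolding e using k by simp
    show "(\<lambda>s. indicator {0<..t} s * k s) \<in> borel_measurable lborel" using k by simp
    show "AE s in lborel. indicator {0..t} s *\<^sub>R h s = indicator {0<..t} s * k s"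
      using AE_lborel_singleton[of 0] AE_lborel_singleton[of T]
      by eventually_elim (use t in \<open>auto simp: k_def indicator_def\<close>)
  qed
  also have "\<dots> = (LINT s|lborel. indicator {0<..<T} s *\<^sub>R (indicator {0<..t} s * h s))"
    by (intro Bochner_Integration.integral_cong refl) (simp add: k_def mult_ac)
  also have "\<dots> = (LINT s|LT T. indicator {0<..t} s * h s)"
    by (rule integral_restrict_space[symmetric]) simp
  finally show ?thesis .
qed

lemma integral_LT_indicator:
  assumes "0 \<le> a" "a \<le> b" "b \<le> T"
  shows "(LINT s|LT T. indicator {a<..b} s) = b - a"
proof -
  have "(LINT s|LT T. indicator {a<..b} s) = (LINT s|lborel. indicator {0<..<T} s *\<^sub>R (indicator {a<..b} s :: real))"
    by (rule integral_restrict_space) simp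
  also have "\<dots> = (LINT s|lborel. indicator {a<..b} s)"
  proof (rule integral_cong_AE)
    show "AE s in lborel. indicator {0<..<T} s *\<^sub>R (indicator {a<..b} s :: real) = indicator {a<..b} s"
      using AE_lborel_singleton[of T] by eventually_elim (use assms in \<open>auto simp: indicator_def\<close>)
  qed auto
  also have "\<dots> = b - a" using assms by simp
  finally show ?thesis .
qed

lemma integrable_indicator_mult:
  fixes g :: "real \<Rightarrow> real"
  assumes "integrable (LT T) g" "S \<in> sets borel"
  shows "integrable (LT T) (\<lambda>s. indicator S s * g s)"
proof (rule Bochner_Integration.integrable_bound[OF assms(1)])
  have "indicat_real S \<in> borel_measurable (LT T)" using assms(2) by (intro measurable_restrict_space1) simp
  then show "(\<lambda>s. indicator S s * g s) \<in> borel_measurable (LT T)" using assms(1) by simp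
qed (auto simp: indicator_def)

text \<open>Absolute continuity of the integral: the part above a high level \<open>K\<close> is
  small in total, the part below it is at most \<open>K\<close> times the length.\<close>

lemma integral_small_interval:
  fixes g :: "real \<Rightarrow> real"
  assumes g: "integrable (LT T) g" "\<And>s. 0 \<le> g s" and e: "0 < e"
  shows "\<exists>d>0. \<forall>a b. 0 \<le> a \<longrightarrow> a \<le> b \<longrightarrow> b \<le> T \<longrightarrow> b - a \<le> d \<longrightarrow> (LINT s|LT T. indicator {a<..b} s * g s) \<le> e"
proof -
  interpret finite_measure "LT T" by (rule finite_measure_LT)
  have gm: "g \<in> borel_measurable (LT T)" using g by auto
  have trm: "(\<lambda>s. g s - min (g s) (real K)) \<in> borel_measurable (LT T)" for K using gm by measurable
  have "(\<lambda>K. LINT s|LT T. g s - min (g s) (real K)) \<longlonglongrightarrow> (LINT s|LT T. 0)"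
  proof (rule integral_dominated_convergence[OF _ trm g(1)])
    show "AE s in LT T. (\<lambda>K. g s - min (g s) (real K)) \<longlonglongrightarrow> 0"
    proof (intro AE_I2 tendsto_eventually)
      fix s
      obtain K0 :: nat where K0: "g s \<le> real K0" using real_arch_simple by blast
      show "\<forall>\<^sub>F K in sequentially. g s - min (g s) (real K) = 0"
      proof (rule eventually_sequentiallyI[of K0])
        fix K assume "K \<ge> K0"
        then have "real K0 \<le> real K" by simp
        then show "g s - min (g s) (real K) = 0" using K0 by simp
      qed
    qed
    show "AE s in LT T. norm (g s - min (g s) (real K)) \<le> g s" for K
      by (intro AE_I2) (use g(2) in \<open>simp add: min_def\<close>)
  qed simp
  moreover have e2: "e/2 > 0" using e by simp
  ultimately obtain K where K: "\<forall>n\<ge>K. norm ((LINT s|LT T. g s - min (g s) (real n)) - (LINT s|LT T. 0)) < e/2"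
    using LIMSEQ_D by blast
  have K': "(LINT s|LT T. g s - min (g s) (real K)) < e/2"
    using K[rule_format, of K] by (simp only: Bochner_Integration.integral_zero real_norm_def order_refl diff_0_right abs_less_iff)
  have ki: "integrable (LT T) (\<lambda>s. g s - min (g s) (real K))"
    by (rule Bochner_Integration.integrable_bound[OF g(1) trm]) (use g(2) in \<open>auto simp: min_def\<close>)
  show ?thesis
  proof (intro exI[of _ "e / (2 * (real K + 1))"] conjI allI impI)
    show "0 < e / (2 * (real K + 1))" using e by simp
    fix a b :: real assume ab: "0 \<le> a" "a \<le> b" "b \<le> T" "b - a \<le> e / (2 * (real K + 1))"
    have ii: "integrable (LT T) (indicat_real {a<..b})"
      by (rule integrable_const_bound[where B=1]) (auto intro!: measurable_restrict_space1 simp: indicator_def)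
    have "(LINT s|LT T. indicator {a<..b} s * g s) \<le> (LINT s|LT T. (g s - min (g s) (real K)) + real K * indicator {a<..b} s)"
    proof (rule integral_mono)
      show "integrable (LT T) (\<lambda>s. indicator {a<..b} s * g s)" by (rule integrable_indicator_mult[OF g(1)]) simp
      show "integrable (LT T) (\<lambda>s. (g s - min (g s) (real K)) + real K * indicator {a<..b} s)"
        by (intro Bochner_Integration.integrable_add ki integrable_mult_right ii)
      show "indicator {a<..b} s * g s \<le> (g s - min (g s) (real K)) + real K * indicator {a<..b} s" for s
        using g(2)[of s] by (simp add: indicator_def min_def)
    qed
    also have "\<dots> = (LINT s|LT T. g s - min (g s) (real K)) + real K * (b - a)"
      by (simp only: Bochner_Integration.integral_add[OF ki integrable_mult_right[OF ii]] integral_mult_right_zero integral_LT_indicator[OF ab(1-3)])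
    also have "\<dots> \<le> e/2 + e/2"
    proof (rule add_mono)
      have "real K * (b - a) \<le> (real K + 1) * (e / (2 * (real K + 1)))"
        using ab by (intro mult_mono) auto
      also have "\<dots> = e/2"
      proof -
        have "k \<noteq> 0 \<Longrightarrow> k * (e / (2 * k)) = e/2" for k :: real by simp
        from this[of "real K + 1"] show ?thesis by linarith
      qed
      finally show "real K * (b - a) \<le> e/2" .
    qed (use K' in simp)
    finally show "(LINT s|LT T. indicator {a<..b} s * g s) \<le> e" by simp
  qed
qed

section \<open>Inequalities of Young and Gronwall type\<close>

lemma young_power:
  fixes a b \<epsilon> :: real
  assumes "0 \<le> a" "0 \<le> b" "0 < \<epsilon>"
  shows "a * b ^ p \<le> \<epsilon> * b ^ Suc p + (1 / \<epsilon>) ^ p * a ^ Suc p"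
proof (cases "a \<le> \<epsilon> * b")
  case True
  then have "a * b ^ p \<le> (\<epsilon> * b) * b ^ p" using assms by (intro mult_right_mono) auto
  moreover have "0 \<le> (1 / \<epsilon>) ^ p * a ^ Suc p" using assms by simp
  ultimately show ?thesis by (simp add: mult.assoc)
next
  case False
  then have "b \<le> (1 / \<epsilon>) * a" using assms by (simp add: field_simps)
  then have "a * b ^ p \<le> a * ((1 / \<epsilon>) * a) ^ p" using assms by (intro mult_left_mono power_mono) auto
  also have "\<dots> = (1 / \<epsilon>) ^ p * a ^ Suc p" by (simp only: power_mult_distrib power_Suc mult_ac)
  finally have "a * b ^ p \<le> (1 / \<epsilon>) ^ p * a ^ Suc p" .
  moreover have "0 \<le> \<epsilon> * b ^ Suc p" using assms by simp
  ultimately show ?thesis by linarith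
qed

text \<open>The power of \<open>u\<close> is integrable but not small and receives the factor
  \<open>\<epsilon>\<close>. The Fejer error \<open>d0\<close> and the modulus in time
  \<open>\<eta>\<close> can be made small, so they may carry the large constant
  \<open>(1 / \<epsilon>) ^ (2 * n + 1)\<close>.\<close>

lemma defect_bound:
  fixes u de d0 \<eta> \<epsilon> :: real
  assumes de: "\<bar>de\<bar> \<le> d0 + \<eta>" and d0: "0 \<le> d0" and \<eta>: "0 \<le> \<eta>" "\<eta> \<le> 1" and \<epsilon>: "0 < \<epsilon>"
  shows "\<bar>de\<bar> * ftil n (\<bar>u\<bar> + \<bar>de\<bar>) \<le> 2 * real (n + 1) * 2 ^ (2 * n + 2) *
     (\<epsilon> * (2 + \<bar>u\<bar>) ^ (2 * n + 2) + (\<epsilon> + (1 / \<epsilon>) ^ (2 * n + 1)) * d0 ^ (2 * n + 2) + (1 / \<epsilon>) ^ (2 * n + 1) * \<eta>)"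
proof -
  let ?p = "2 * n + 2" and ?q = "2 * n + 1"
  have sp: "Suc ?q = ?p" by simp
  have "\<bar>de\<bar> * ftil n (\<bar>u\<bar> + \<bar>de\<bar>) \<le> \<bar>de\<bar> * (2 * real (n + 1) * (1 + (\<bar>u\<bar> + \<bar>de\<bar>)) ^ ?q)"
    by (intro mult_left_mono ftil_le) auto
  also have "\<dots> = 2 * real (n + 1) * (\<bar>de\<bar> * (1 + (\<bar>u\<bar> + \<bar>de\<bar>)) ^ ?q)" by simp
  also have "\<dots> \<le> 2 * real (n + 1) * (\<epsilon> * (1 + (\<bar>u\<bar> + \<bar>de\<bar>)) ^ ?p + (1 / \<epsilon>) ^ ?q * \<bar>de\<bar> ^ ?p)"
    using young_power[of "\<bar>de\<bar>" "1 + (\<bar>u\<bar> + \<bar>de\<bar>)" \<epsilon> ?q] \<epsilon> unfolding sp by (intro mult_left_mono) auto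
  also have "\<dots> \<le> 2 * real (n + 1) * (\<epsilon> * (2 ^ ?p * ((2 + \<bar>u\<bar>) ^ ?p + d0 ^ ?p)) + (1 / \<epsilon>) ^ ?q * (2 ^ ?p * (d0 ^ ?p + \<eta>)))"
  proof (intro mult_left_mono add_mono)
    have "(1 + (\<bar>u\<bar> + \<bar>de\<bar>)) ^ ?p \<le> ((2 + \<bar>u\<bar>) + d0) ^ ?p" using de \<eta> by (intro power_mono) auto
    also have "\<dots> \<le> 2 ^ ?p * ((2 + \<bar>u\<bar>) ^ ?p + d0 ^ ?p)" using d0 by (intro power_add_le) auto
    finally show "(1 + (\<bar>u\<bar> + \<bar>de\<bar>)) ^ ?p \<le> 2 ^ ?p * ((2 + \<bar>u\<bar>) ^ ?p + d0 ^ ?p)" .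
    have "\<bar>de\<bar> ^ ?p \<le> (d0 + \<eta>) ^ ?p" using de by (intro power_mono) auto
    also have "\<dots> \<le> 2 ^ ?p * (d0 ^ ?p + \<eta> ^ ?p)" using d0 \<eta> by (intro power_add_le) auto
    also have "\<eta> ^ ?p \<le> \<eta> ^ 1" using \<eta> by (intro power_decreasing) auto
    finally show "\<bar>de\<bar> ^ ?p \<le> 2 ^ ?p * (d0 ^ ?p + \<eta>)" by simp
  qed (use \<epsilon> in auto)
  also have "\<dots> = 2 * real (n + 1) * 2 ^ ?p *
     (\<epsilon> * (2 + \<bar>u\<bar>) ^ ?p + (\<epsilon> + (1 / \<epsilon>) ^ ?q) * d0 ^ ?p + (1 / \<epsilon>) ^ ?q * \<eta>)"
    by (simp only: distrib_left distrib_right mult_ac add_ac)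
  finally show ?thesis .
qed

text \<open>Each \<open>e k\<close> is both a source and a growth rate, so the sum appears as a
  factor and in the exponent.\<close>

lemma discrete_gronwall:
  fixes D e :: "nat \<Rightarrow> real"
  assumes D0: "D 0 = 0" and D: "\<And>k. 0 \<le> D k" and e: "\<And>k. k < J \<Longrightarrow> 0 \<le> e k" and c: "0 \<le> c"
    and step: "\<And>k. k < J \<Longrightarrow> D (Suc k) \<le> D k + c * D k + e k * (1 + D k)"
  shows "D J \<le> exp (real J * c + (\<Sum>k<J. e k)) * (\<Sum>k<J. e k)"
proof -
  have "D k \<le> exp (real k * c + (\<Sum>j<k. e j)) * (\<Sum>j<k. e j)" if "k \<le> J" for k
    using that
  proof (induction k)
    case 0 then show ?case using D0 by simp
  next
    case (Suc k)
    let ?S = "\<Sum>j<k. e j" and ?E = "exp (real k * c + (\<Sum>j<k. e j))"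
    have k: "k < J" using Suc by simp
    have S0: "0 \<le> ?S" using e k by (intro sum_nonneg) auto
    have "D (Suc k) \<le> (1 + (c + e k)) * D k + e k" using step[OF k] by (simp add: algebra_simps)
    also have "\<dots> \<le> exp (c + e k) * (?E * ?S) + exp (c + e k) * ?E * e k"
    proof (rule add_mono)
      show "(1 + (c + e k)) * D k \<le> exp (c + e k) * (?E * ?S)"
        using Suc D e[OF k] c S0 by (intro mult_mono exp_ge_add_one_self) auto
      have "0 \<le> c + e k" "0 \<le> real k * c + ?S" using e[OF k] c S0 by auto
      then have "1 * 1 \<le> exp (c + e k) * ?E" by (intro mult_mono) auto
      then have "1 * e k \<le> exp (c + e k) * ?E * e k" using e[OF k] by (intro mult_right_mono) auto
      then show "e k \<le> exp (c + e k) * ?E * e k" by simp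
    qed
    also have "\<dots> = exp (c + e k) * ?E * (?S + e k)" by (simp add: algebra_simps)
    also have "exp (c + e k) * ?E = exp (real (Suc k) * c + (\<Sum>j<Suc k. e j))"
      unfolding exp_add[symmetric] by (rule arg_cong[where f=exp]) (simp add: algebra_simps)
    finally show ?case by simp
  qed
  then show ?thesis by simp
qed

section \<open>The Euler chain and its pathwise limit\<close>

text \<open>Freezing the coordinates outside \<open>{1..<m}\<close> lets the map act on full
  sequences, although the drift sees only finitely many modes.\<close>

definition emap :: "nat \<Rightarrow> nat \<Rightarrow> real \<Rightarrow> nat \<Rightarrow> real \<Rightarrow> real \<Rightarrow> (nat \<Rightarrow> real) \<Rightarrow> nat \<Rightarrow> real" where
  "emap n R lam m c h x i = (if i \<in> {1..<m} then x i + h * drift n R lam m c x i else x i)"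

primrec chain :: "((nat \<Rightarrow> real) \<Rightarrow> nat \<Rightarrow> real) \<Rightarrow> nat \<Rightarrow> (nat \<Rightarrow> nat \<Rightarrow> real) \<Rightarrow> (nat \<Rightarrow> real) \<Rightarrow> nat \<Rightarrow> nat \<Rightarrow> real" where
  "chain T m \<xi> x 0 = x"
| "chain T m \<xi> x (Suc k) = (\<lambda>i. T (chain T m \<xi> x k) i + (if i \<in> {1..<m} then \<xi> k i else 0))"

lemma inner01_scale: "inner01 v (\<lambda>\<theta>. r * w \<theta>) = r * inner01 v w"
proof -
  have "(\<lambda>\<theta>. v \<theta> * (r * w \<theta>)) = (\<lambda>\<theta>. r * (v \<theta> * w \<theta>))" by (simp add: mult.left_commute)
  then show ?thesis unfolding inner01_def by (simp only: integral_mult_right_zero)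
qed

text \<open>A single sample path. The weak equation holds almost surely for each fixed time, hence
  for countably many times at once; the rational multiples of \<open>T\<close> contain all uniform
  grids. \<open>\<beta>\<close> is the noise in the modes.\<close>

locale galerkin_path =
  fixes T lam c :: real and n :: nat and X :: "real \<Rightarrow> nat \<Rightarrow> real" and u :: "real \<times> real \<Rightarrow> real"
    and \<beta> :: "real \<Rightarrow> nat \<Rightarrow> real"
  assumes T: "0 < T"
    and cont: "\<And>i. continuous_on {0..T} (\<lambda>t. X t i)"
    and Lp: "path_in_Lp (2 * n + 2) T X u"
    and avg: "\<And>q. q \<in> \<rat> \<Longrightarrow> 0 \<le> q \<Longrightarrow> q \<le> 1 \<Longrightarrow> X (T * q) 0 = c"
    and eq: "\<And>q i. q \<in> \<rat> \<Longrightarrow> 0 \<le> q \<Longrightarrow> q \<le> 1 \<Longrightarrow> 1 \<le> i \<Longrightarrow> X (T * q) i + 1/2 * (LINT s:{0..T * q}|lborel.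
        inner01 (\<lambda>\<theta>. u (s, \<theta>)) (\<lambda>\<theta>. eigval i * (eigval i * eigfun i \<theta>)) +
        inner01 (\<lambda>\<theta>. f_approx lam n (u (s, \<theta>))) (\<lambda>\<theta>. eigval i * eigfun i \<theta>)) = X 0 i + \<beta> (T * q) i"
begin

lemma pair_LT: "pair_sigma_finite (LT T) leb01"
  by (intro pair_sigma_finite.intro finite_measure.axioms(1)[OF finite_measure_LT] prob_space_imp_sigma_finite prob_space_leb01)

lemma PM: "restrict_space lborel ({0<..<T} \<times> {0<..<1}) = LT T \<Otimes>\<^sub>M leb01"
  by (rule restrict_lborel_pair[symmetric]) auto

lemma um: "u \<in> borel_measurable (LT T \<Otimes>\<^sub>M leb01)"
  using Lp unfolding path_in_Lp_def PM by blast

text \<open>The 2 in the majorant leaves room for the 1 in the growth bound of \<open>ftil\<close>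
  and for a modulus in time up to 1, see \<open>defect_bound\<close>.\<close>

lemma upi: "integrable (LT T \<Otimes>\<^sub>M leb01) (\<lambda>z. (2 + \<bar>u z\<bar>) ^ (2 * n + 2))"
proof -
  interpret PS: pair_sigma_finite "LT T" leb01 by (rule pair_LT)
  interpret L: finite_measure "LT T" by (rule finite_measure_LT)
  have "emeasure (LT T \<Otimes>\<^sub>M leb01) (space (LT T \<Otimes>\<^sub>M leb01)) = emeasure (LT T) (space (LT T)) * emeasure leb01 (space leb01)"
    unfolding space_pair_measure by (rule leb01.emeasure_pair_measure_Times) (rule sets.top)+
  also have "\<dots> \<noteq> \<infinity>" using L.emeasure_finite leb01.emeasure_space_1 by simp
  finally interpret P: finite_measure "LT T \<Otimes>\<^sub>M leb01" by (rule finite_measureI)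
  have i: "integrable (LT T \<Otimes>\<^sub>M leb01) (\<lambda>z. \<bar>u z\<bar> ^ (2 * n + 2))"
    using Lp unfolding path_in_Lp_def PM by blast
  show ?thesis
  proof (rule Bochner_Integration.integrable_bound)
    show "integrable (LT T \<Otimes>\<^sub>M leb01) (\<lambda>z. 2 ^ (2 * n + 2) * (2 ^ (2 * n + 2) + \<bar>u z\<bar> ^ (2 * n + 2)))"
      by (intro integrable_mult_right Bochner_Integration.integrable_add i P.integrable_const)
    show "(\<lambda>z. (2 + \<bar>u z\<bar>) ^ (2 * n + 2)) \<in> borel_measurable (LT T \<Otimes>\<^sub>M leb01)" using um by measurable
    have "norm ((2 + \<bar>u z\<bar>) ^ (2 * n + 2)) \<le> norm (2 ^ (2 * n + 2) * (2 ^ (2 * n + 2) + \<bar>u z\<bar> ^ (2 * n + 2)))" for z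
      using power_add_le[of 2 "\<bar>u z\<bar>" "2 * n + 2"] unfolding real_norm_def
      by (subst (1 2) abs_of_nonneg) (auto intro!: mult_nonneg_nonneg add_nonneg_nonneg)
    then show "AE z in LT T \<Otimes>\<^sub>M leb01. norm ((2 + \<bar>u z\<bar>) ^ (2 * n + 2)) \<le> norm (2 ^ (2 * n + 2) * (2 ^ (2 * n + 2) + \<bar>u z\<bar> ^ (2 * n + 2)))"
      by (intro AE_I2)
  qed
qed

lemma Xu: "AE s in LT T. \<forall>i. X s i = inner01 (\<lambda>\<theta>. u (s, \<theta>)) (eigfun i)"
proof -
  have "AE s in lborel. 0 < s \<and> s < T \<longrightarrow> (\<forall>i. X s i = inner01 (\<lambda>\<theta>. u (s, \<theta>)) (eigfun i))"
    using Lp unfolding path_in_Lp_def by blast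
  then show ?thesis by (subst AE_restrict_space_iff) auto
qed

text \<open>The majorant is integrable over space-time by \<open>path_in_Lp\<close>.\<close>

definition grow :: "(real \<Rightarrow> real \<Rightarrow> real) \<Rightarrow> bool" where
  "grow g \<longleftrightarrow> (\<lambda>z. g (fst z) (snd z)) \<in> borel_measurable (borel \<Otimes>\<^sub>M borel) \<and> (\<exists>C. \<forall>v \<theta>. \<bar>g v \<theta>\<bar> \<le> C * (2 + \<bar>v\<bar>) ^ (2 * n + 2))"

lemma grow_pair_integrable:
  assumes "grow g"
  shows "integrable (LT T \<Otimes>\<^sub>M leb01) (\<lambda>z. g (u z) (snd z))"
proof -
  obtain C where C: "\<And>v \<theta>. \<bar>g v \<theta>\<bar> \<le> C * (2 + \<bar>v\<bar>) ^ (2 * n + 2)" using assms by (auto simp: grow_def)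
  have s: "snd \<in> LT T \<Otimes>\<^sub>M leb01 \<rightarrow>\<^sub>M borel"
    by (rule measurable_compose[OF measurable_snd measurable_restrict_space1]) simp
  have gm: "(\<lambda>z. g (fst z) (snd z)) \<in> borel_measurable (borel \<Otimes>\<^sub>M borel)" using assms by (simp add: grow_def)
  show ?thesis
  proof (rule Bochner_Integration.integrable_bound[OF integrable_mult_right[OF upi, of C]])
    show "(\<lambda>z. g (u z) (snd z)) \<in> borel_measurable (LT T \<Otimes>\<^sub>M leb01)"
      using measurable_compose[OF measurable_Pair[OF um s] gm] by simp
    show "AE z in LT T \<Otimes>\<^sub>M leb01. norm (g (u z) (snd z)) \<le> norm (C * (2 + \<bar>u z\<bar>) ^ (2 * n + 2))"
      unfolding real_norm_def by (intro AE_I2 order_trans[OF C abs_ge_self])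
  qed
qed

text \<open>Almost every time is of this kind, and the spatial estimates are made at such times
  only.\<close>

definition good :: "real \<Rightarrow> bool" where
  "good s \<longleftrightarrow> (\<lambda>\<theta>. u (s, \<theta>)) \<in> borel_measurable leb01 \<and> integrable leb01 (\<lambda>\<theta>. (2 + \<bar>u (s, \<theta>)\<bar>) ^ (2 * n + 2))
     \<and> (\<forall>i. X s i = inner01 (\<lambda>\<theta>. u (s, \<theta>)) (eigfun i))"

lemma AE_good: "AE s in LT T. good s"
proof -
  interpret PS: pair_sigma_finite "LT T" leb01 by (rule pair_LT)
  have "AE s in LT T. integrable leb01 (\<lambda>\<theta>. (2 + \<bar>u (s, \<theta>)\<bar>) ^ (2 * n + 2))"
    using PS.AE_integrable_fst'[OF upi] .
  moreover have "AE s in LT T. (\<lambda>\<theta>. u (s, \<theta>)) \<in> borel_measurable leb01"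
    by (intro AE_I2) (rule measurable_Pair2[OF um])
  ultimately show ?thesis using Xu by eventually_elim (simp add: good_def)
qed

lemma good_integrable:
  assumes "good s" "grow g"
  shows "integrable leb01 (\<lambda>\<theta>. g (u (s, \<theta>)) \<theta>)"
proof -
  obtain C where C: "\<And>v \<theta>. \<bar>g v \<theta>\<bar> \<le> C * (2 + \<bar>v\<bar>) ^ (2 * n + 2)" using assms by (auto simp: grow_def)
  have gm: "(\<lambda>z. g (fst z) (snd z)) \<in> borel_measurable (borel \<Otimes>\<^sub>M borel)" using assms by (simp add: grow_def)
  have um1: "(\<lambda>\<theta>. u (s, \<theta>)) \<in> borel_measurable leb01" and i: "integrable leb01 (\<lambda>\<theta>. (2 + \<bar>u (s, \<theta>)\<bar>) ^ (2 * n + 2))"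
    using assms(1) by (auto simp: good_def)
  have s: "(\<lambda>\<theta>. \<theta>) \<in> leb01 \<rightarrow>\<^sub>M borel" by (rule measurable_restrict_space1) simp
  show ?thesis
  proof (rule Bochner_Integration.integrable_bound[OF integrable_mult_right[OF i, of C]])
    show "(\<lambda>\<theta>. g (u (s, \<theta>)) \<theta>) \<in> borel_measurable leb01"
      using measurable_compose[OF measurable_Pair[OF um1 s] gm] by simp
    show "AE \<theta> in leb01. norm (g (u (s, \<theta>)) \<theta>) \<le> norm (C * (2 + \<bar>u (s, \<theta>)\<bar>) ^ (2 * n + 2))"
      unfolding real_norm_def by (intro AE_I2 order_trans[OF C abs_ge_self])
  qed
qed

lemma grow_time_integrable:
  assumes "grow g"
  shows "integrable (LT T) (\<lambda>s. LINT \<theta>|leb01. g (u (s, \<theta>)) \<theta>)"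
proof -
  interpret PS: pair_sigma_finite "LT T" leb01 by (rule pair_LT)
  show ?thesis using PS.integrable_fst'[OF grow_pair_integrable[OF assms]] by simp
qed

lemma growI:
  assumes "(\<lambda>z. g (fst z) (snd z)) \<in> borel_measurable (borel \<Otimes>\<^sub>M borel)"
    and "\<And>v \<theta>. \<bar>g v \<theta>\<bar> \<le> C * (2 + \<bar>v\<bar>) ^ (2 * n + 2)"
  shows "grow g"
  using assms unfolding grow_def by blast

lemma le_majorant: "\<bar>v\<bar> \<le> (2 + \<bar>v\<bar>) ^ (2 * n + 2)" "ftil n \<bar>v\<bar> \<le> 2 * real (n + 1) * (2 + \<bar>v\<bar>) ^ (2 * n + 2)"
proof -
  have "(2 + \<bar>v\<bar>) ^ 1 \<le> (2 + \<bar>v\<bar>) ^ (2 * n + 2)" by (rule power_increasing) auto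
  then show "\<bar>v\<bar> \<le> (2 + \<bar>v\<bar>) ^ (2 * n + 2)" by simp
  have "(1 + \<bar>v\<bar>) ^ (2 * n + 1) \<le> (2 + \<bar>v\<bar>) ^ (2 * n + 1)" by (intro power_mono) auto
  also have "\<dots> \<le> (2 + \<bar>v\<bar>) ^ (2 * n + 2)" by (rule power_increasing) auto
  finally have "2 * real (n + 1) * (1 + \<bar>v\<bar>) ^ (2 * n + 1) \<le> 2 * real (n + 1) * (2 + \<bar>v\<bar>) ^ (2 * n + 2)"
    by (intro mult_left_mono) auto
  then show "ftil n \<bar>v\<bar> \<le> 2 * real (n + 1) * (2 + \<bar>v\<bar>) ^ (2 * n + 2)"
    using ftil_le[of "\<bar>v\<bar>" n] by linarith
qed

lemma grow_simps:
  "grow (\<lambda>v \<theta>. v)" "grow (\<lambda>v \<theta>. (2 + \<bar>v\<bar>) ^ (2 * n + 2))" "grow (\<lambda>v \<theta>. ftil n \<bar>v\<bar> + \<bar>v\<bar>)" "grow (\<lambda>v \<theta>. f_approx lam n v)"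
  "grow (\<lambda>v \<theta>. \<bar>ftil n v - ftr n R v\<bar>)"
proof -
  let ?P = "\<lambda>v :: real. (2 + \<bar>v\<bar>) ^ (2 * n + 2)"
  have P0: "0 \<le> ?P v" for v by simp
  show "grow (\<lambda>v \<theta>. v)" by (rule growI[where C=1]) (measurable, simp only: mult_1 le_majorant(1))
  show "grow (\<lambda>v \<theta>. ?P v)" 
  proof (rule growI[where C=1])
    show "\<bar>?P v\<bar> \<le> 1 * ?P v" for v unfolding abs_of_nonneg[OF P0] mult_1 ..
  qed measurable
  show "grow (\<lambda>v \<theta>. ftil n \<bar>v\<bar> + \<bar>v\<bar>)"
  proof (rule growI[where C="2 * real (n + 1) + 1"])
    fix v :: real
    have "\<bar>ftil n \<bar>v\<bar> + \<bar>v\<bar>\<bar> = ftil n \<bar>v\<bar> + \<bar>v\<bar>" using ftil_nonneg[of "\<bar>v\<bar>" n] by simp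
    also have "\<dots> \<le> 2 * real (n + 1) * ?P v + 1 * ?P v" using le_majorant[of v] by linarith
    finally show "\<bar>ftil n \<bar>v\<bar> + \<bar>v\<bar>\<bar> \<le> (2 * real (n + 1) + 1) * ?P v" by (simp only: distrib_right)
  qed measurable
  show "grow (\<lambda>v \<theta>. f_approx lam n v)"
  proof (rule growI[where C="2 * real (n + 1) + \<bar>lam\<bar>"])
    fix v :: real
    have "\<bar>f_approx lam n v\<bar> \<le> \<bar>ftil n v\<bar> + \<bar>lam\<bar> * \<bar>v\<bar>"
      unfolding f_approx_ftil by (rule order_trans[OF abs_triangle_ineq]) (simp add: abs_mult)
    also have "\<dots> \<le> 2 * real (n + 1) * ?P v + \<bar>lam\<bar> * ?P v"
      unfolding abs_ftil by (intro add_mono mult_left_mono le_majorant) auto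
    finally show "\<bar>f_approx lam n v\<bar> \<le> (2 * real (n + 1) + \<bar>lam\<bar>) * ?P v" by (simp only: distrib_right)
  next
    show "(\<lambda>z. f_approx lam n (fst z)) \<in> borel_measurable (borel \<Otimes>\<^sub>M borel)"
      unfolding f_approx_ftil by measurable
  qed
  show "grow (\<lambda>v \<theta>. \<bar>ftil n v - ftr n R v\<bar>)"
  proof (rule growI[where C="2 * real (n + 1) + 2 * real (n + 1)"])
    fix v :: real
    have "\<bar>\<bar>ftil n v - ftr n R v\<bar>\<bar> \<le> \<bar>ftil n v\<bar> + \<bar>ftr n R v\<bar>" by simp
    also have "\<dots> \<le> ftil n \<bar>v\<bar> + ftil n \<bar>v\<bar>" by (intro add_mono abs_ftr_le(2)) (simp add: abs_ftil)
    also have "\<dots> \<le> 2 * real (n + 1) * ?P v + 2 * real (n + 1) * ?P v" by (intro add_mono le_majorant(2))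
    finally show "\<bar>\<bar>ftil n v - ftr n R v\<bar>\<bar> \<le> (2 * real (n + 1) + 2 * real (n + 1)) * ?P v" by (simp only: distrib_right)
  qed measurable
qed

lemma grow_eigfun:
  assumes "grow g"
  shows "grow (\<lambda>v \<theta>. g v \<theta> * eigfun i \<theta>)"
proof -
  obtain C where C: "\<And>v \<theta>. \<bar>g v \<theta>\<bar> \<le> C * (2 + \<bar>v\<bar>) ^ (2 * n + 2)" using assms by (auto simp: grow_def)
  show ?thesis
  proof (rule growI[where C="C * 2"])
    show "(\<lambda>z. g (fst z) (snd z) * eigfun i (snd z)) \<in> borel_measurable (borel \<Otimes>\<^sub>M borel)"
      using assms unfolding grow_def by (intro borel_measurable_times measurable_compose[OF measurable_snd eigfun_measurable]) blast
    fix v \<theta> :: real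
    have "\<bar>g v \<theta>\<bar> * \<bar>eigfun i \<theta>\<bar> \<le> (C * (2 + \<bar>v\<bar>) ^ (2 * n + 2)) * 2"
      using C[of v \<theta>] by (intro mult_mono abs_eigfun_le2) auto
    then show "\<bar>g v \<theta> * eigfun i \<theta>\<bar> \<le> C * 2 * (2 + \<bar>v\<bar>) ^ (2 * n + 2)" by (simp add: abs_mult mult_ac)
  qed
qed

section \<open>Time increments of the modes\<close>

definition Ui :: "nat \<Rightarrow> real \<Rightarrow> real" where "Ui i s = inner01 (\<lambda>\<theta>. u (s, \<theta>)) (eigfun i)"
definition Fi :: "nat \<Rightarrow> real \<Rightarrow> real" where "Fi i s = inner01 (\<lambda>\<theta>. f_approx lam n (u (s, \<theta>))) (eigfun i)"

lemma Ui_integrable: "integrable (LT T) (Ui i)"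
  using grow_time_integrable[OF grow_eigfun[OF grow_simps(1)], of i] by (simp add: Ui_def[abs_def] inner01_def)

lemma Fi_integrable: "integrable (LT T) (Fi i)"
  using grow_time_integrable[OF grow_eigfun[OF grow_simps(4)], of i] by (simp add: Fi_def[abs_def] inner01_def)

lemma increment:
  assumes q: "q \<in> \<rat>" "r \<in> \<rat>" "0 \<le> q" "q \<le> r" "r \<le> 1" and i: "1 \<le> i"
  shows "X (T * r) i - X (T * q) i = 1/2 * (LINT s|LT T. indicator {T * q<..T * r} s * (- (mu i)\<^sup>2 * Ui i s + mu i * Fi i s))
     + (\<beta> (T * r) i - \<beta> (T * q) i)"
proof -
  let ?h = "\<lambda>s. - (mu i)\<^sup>2 * Ui i s + mu i * Fi i s"
  have h: "integrable (LT T) ?h"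
    by (intro Bochner_Integration.integrable_add integrable_mult_right Ui_integrable Fi_integrable)
  have mh: "(\<lambda>s. - ?h s) \<in> borel_measurable (LT T)" by (intro borel_measurable_uminus borel_measurable_integrable h)
  have e: "inner01 (\<lambda>\<theta>. u (s, \<theta>)) (\<lambda>\<theta>. eigval i * (eigval i * eigfun i \<theta>)) +
      inner01 (\<lambda>\<theta>. f_approx lam n (u (s, \<theta>))) (\<lambda>\<theta>. eigval i * eigfun i \<theta>) = - ?h s" for s
    by (simp only: inner01_scale Ui_def Fi_def eigval_mu) (simp add: power2_eq_square)
  have hi: "integrable (LT T) (\<lambda>s. indicator S s * ?h s)" if "S \<in> sets borel" for S
    by (rule integrable_indicator_mult[OF h that])
  have a: "X (T * v) i = X 0 i + \<beta> (T * v) i + 1/2 * (LINT s|LT T. indicator {0<..T * v} s * ?h s)"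
    if v: "v \<in> \<rat>" "0 \<le> v" "v \<le> 1" for v
  proof -
    have "T * v \<le> T * 1" using T v by (intro mult_left_mono) auto
    then have "(LINT s:{0..T * v}|lborel. - ?h s) = (LINT s|LT T. indicator {0<..T * v} s * - ?h s)"
      using T v by (intro set_integral_LT[OF mh]) auto
    also have "\<dots> = - (LINT s|LT T. indicator {0<..T * v} s * ?h s)"
      by (simp only: mult_minus_right Bochner_Integration.integral_minus)
    finally show ?thesis using eq[OF v i] unfolding e by simp
  qed
  have "T * q \<le> T * r" "0 \<le> T * q" using T q by auto
  then have ind: "indicat_real {0<..T * r} s = indicator {0<..T * q} s + indicator {T * q<..T * r} s" for s
    by (auto simp: indicator_def)
  have "(LINT s|LT T. indicator {0<..T * r} s * ?h s)
     = (LINT s|LT T. indicator {0<..T * q} s * ?h s) + (LINT s|LT T. indicator {T * q<..T * r} s * ?h s)"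
    unfolding ind distrib_right[of "indicator _ _"] by (rule Bochner_Integration.integral_add) (rule hi, simp)+
  then show ?thesis using a[of r] a[of q] q by linarith
qed

text \<open>\<open>FA\<close> controls the speed of every mode, \<open>rR\<close> is the truncation
  error, \<open>A2\<close> the majorant that will receive the factor \<open>\<epsilon>\<close>, and
  \<open>G2\<close> the Fejer error.\<close>

definition FA :: "real \<Rightarrow> real" where "FA s = (LINT \<theta>|leb01. ftil n \<bar>u (s, \<theta>)\<bar> + \<bar>u (s, \<theta>)\<bar>)"
definition rR :: "nat \<Rightarrow> real \<Rightarrow> real" where "rR R s = (LINT \<theta>|leb01. \<bar>ftil n (u (s, \<theta>)) - ftr n R (u (s, \<theta>))\<bar>)"
definition A2 :: "real \<Rightarrow> real" where "A2 s = (LINT \<theta>|leb01. (2 + \<bar>u (s, \<theta>)\<bar>) ^ (2 * n + 2))"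
definition G2 :: "nat \<Rightarrow> real \<Rightarrow> real" where
  "G2 m s = (LINT \<theta>|leb01. \<bar>u (s, \<theta>) - fmean m (\<lambda>\<theta>. u (s, \<theta>)) \<theta>\<bar> ^ (2 * n + 2))"

lemma time_integrable: "integrable (LT T) FA" "integrable (LT T) (rR R)" "integrable (LT T) A2"
  using grow_time_integrable[OF grow_simps(3)] grow_time_integrable[OF grow_simps(5)] grow_time_integrable[OF grow_simps(2)]
  by (simp_all add: FA_def[abs_def] rR_def[abs_def] A2_def[abs_def])

lemma time_nonneg: "0 \<le> FA s" "0 \<le> rR R s" "0 \<le> A2 s" "0 \<le> G2 m s"
  unfolding FA_def rR_def A2_def G2_def
  by (intro integral_nonneg_AE AE_I2 add_nonneg_nonneg ftil_nonneg abs_ge_zero zero_le_power; simp)+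

lemma good_u: "good s \<Longrightarrow> (\<lambda>\<theta>. u (s, \<theta>)) \<in> borel_measurable leb01" "good s \<Longrightarrow> integrable leb01 (\<lambda>\<theta>. u (s, \<theta>))"
  "good s \<Longrightarrow> integrable leb01 (\<lambda>\<theta>. \<bar>u (s, \<theta>)\<bar> ^ Suc (2 * n + 1))"
proof -
  assume g: "good s"
  show "(\<lambda>\<theta>. u (s, \<theta>)) \<in> borel_measurable leb01" using g by (simp add: good_def)
  show "integrable leb01 (\<lambda>\<theta>. u (s, \<theta>))" by (rule good_integrable[OF g grow_simps(1)])
  have "grow (\<lambda>v \<theta>. \<bar>v\<bar> ^ Suc (2 * n + 1))"
  proof (rule growI[where C=1])
    show "\<bar>\<bar>v\<bar> ^ Suc (2 * n + 1)\<bar> \<le> 1 * (2 + \<bar>v\<bar>) ^ (2 * n + 2)" for v :: real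
      using power_mono[of "\<bar>v\<bar>" "2 + \<bar>v\<bar>" "2 * n + 2"] by (simp add: power_abs)
  qed measurable
  from good_integrable[OF g this] show "integrable leb01 (\<lambda>\<theta>. \<bar>u (s, \<theta>)\<bar> ^ Suc (2 * n + 1))" .
qed

lemma G2_integrable_theta:
  assumes "good s" "m \<ge> 1"
  shows "integrable leb01 (\<lambda>\<theta>. \<bar>u (s, \<theta>) - fmean m (\<lambda>\<theta>. u (s, \<theta>)) \<theta>\<bar> ^ (2 * n + 2))"
  using integral_abs_fmean_diff_power_le(1)[OF assms(2) good_u(1,3)[OF assms(1)]] by simp

lemma G2_le:
  assumes "good s" "m \<ge> 1"
  shows "G2 m s \<le> 2 ^ (2 * n + 3) * A2 s"
proof -
  have "G2 m s \<le> 2 ^ (2 * n + 1 + 2) * (LINT \<theta>|leb01. \<bar>u (s, \<theta>)\<bar> ^ Suc (2 * n + 1))"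
    using integral_abs_fmean_diff_power_le(2)[OF assms(2) good_u(1,3)[OF assms(1)]] by (simp add: G2_def)
  also have "\<dots> \<le> 2 ^ (2 * n + 1 + 2) * A2 s"
    unfolding A2_def
  proof (intro mult_left_mono integral_mono good_u(3)[OF assms(1)] good_integrable[OF assms(1) grow_simps(2)])
    show "\<bar>u (s, \<theta>)\<bar> ^ Suc (2 * n + 1) \<le> (2 + \<bar>u (s, \<theta>)\<bar>) ^ (2 * n + 2)" for \<theta>
      using power_mono[of "\<bar>u (s, \<theta>)\<bar>" "2 + \<bar>u (s, \<theta>)\<bar>" "2 * n + 2"] by simp
  qed simp
  finally show ?thesis by (simp add: numeral_eq_Suc)
qed

lemma G2_measurable: "G2 m \<in> borel_measurable (LT T)"
proof -
  have fm: "(\<lambda>z. fmean m (\<lambda>\<theta>. u (fst z, \<theta>)) (snd z)) \<in> borel_measurable (LT T \<Otimes>\<^sub>M leb01)"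
  proof -
    have e: "(\<lambda>z. fmean m (\<lambda>\<theta>. u (fst z, \<theta>)) (snd z)) = (\<lambda>z. \<Sum>i<m. fej m i * Ui i (fst z) * eigfun i (snd z))"
      by (simp add: fmean_def Ui_def)
    have U: "(\<lambda>z. Ui i (fst z)) \<in> borel_measurable (LT T \<Otimes>\<^sub>M leb01)" for i
      by (rule measurable_compose[OF measurable_fst borel_measurable_integrable[OF Ui_integrable]])
    have E: "(\<lambda>z. eigfun i (snd z)) \<in> borel_measurable (LT T \<Otimes>\<^sub>M leb01)" for i
      by (rule measurable_compose[OF measurable_snd measurable_leb01[OF eigfun_measurable]])
    show ?thesis unfolding e by (intro borel_measurable_sum borel_measurable_times U E borel_measurable_const)
  qed
  have "(\<lambda>z. \<bar>u z - fmean m (\<lambda>\<theta>. u (fst z, \<theta>)) (snd z)\<bar> ^ (2 * n + 2)) \<in> borel_measurable (LT T \<Otimes>\<^sub>M leb01)"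
    by (intro borel_measurable_power borel_measurable_abs borel_measurable_diff um fm)
  then have "(\<lambda>(s, \<theta>). \<bar>u (s, \<theta>) - fmean m (\<lambda>\<theta>. u (s, \<theta>)) \<theta>\<bar> ^ (2 * n + 2)) \<in> borel_measurable (LT T \<Otimes>\<^sub>M leb01)"
    by (simp add: case_prod_beta')
  from leb01.borel_measurable_lebesgue_integral[OF this] show ?thesis by (simp add: G2_def[abs_def])
qed

lemma G2_integrable:
  assumes "m \<ge> 1"
  shows "integrable (LT T) (G2 m)"
proof (rule Bochner_Integration.integrable_bound[OF integrable_mult_right[OF time_integrable(3), of "2 ^ (2 * n + 3)"] G2_measurable])
  show "AE s in LT T. norm (G2 m s) \<le> norm (2 ^ (2 * n + 3) * A2 s)"
    using AE_good
  proof eventually_elim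
    case (elim s)
    show ?case using G2_le[OF elim assms] time_nonneg(4)[of m s] by simp
  qed
qed

text \<open>Fejer convergence holds on almost every time slice, and \<open>G2_le\<close> supplies a
  majorant independent of \<open>m\<close>.\<close>

lemma G2_tendsto: "(\<lambda>m. LINT s|LT T. G2 m s) \<longlonglongrightarrow> 0"
proof -
  have "(\<lambda>m. LINT s|LT T. G2 (Suc m) s) \<longlonglongrightarrow> (LINT s|LT T. 0)"
  proof (rule integral_dominated_convergence[OF _ G2_measurable integrable_mult_right[OF time_integrable(3), of "2 ^ (2 * n + 3)"]])
    show "AE s in LT T. (\<lambda>m. G2 (Suc m) s) \<longlonglongrightarrow> 0"
      using AE_good
    proof eventually_elim
      case (elim s)
      have "(\<lambda>m. G2 m s) \<longlonglongrightarrow> 0"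
        using fmean_tendsto_power[OF good_u(1,3)[OF elim]] by (simp add: G2_def)
      then show ?case by (rule LIMSEQ_Suc)
    qed
    show "AE s in LT T. norm (G2 (Suc m) s) \<le> 2 ^ (2 * n + 3) * A2 s" for m
      using AE_good
    proof eventually_elim
      case (elim s)
      show ?case using G2_le[OF elim, of "Suc m"] time_nonneg(4)[of "Suc m" s] by simp
    qed
  qed simp
  then show ?thesis unfolding Bochner_Integration.integral_zero by (rule LIMSEQ_imp_Suc)
qed

text \<open>At each point the truncation is exact once \<open>R\<close> exceeds
  \<open>\<bar>u z\<bar>\<close>, and the error is dominated by the growth bound.\<close>

lemma rR_tendsto: "(\<lambda>R. LINT s|LT T. rR R s) \<longlonglongrightarrow> 0"
proof -
  interpret PS: pair_sigma_finite "LT T" leb01 by (rule pair_LT)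
  have e: "(LINT s|LT T. rR R s) = (LINT z|(LT T \<Otimes>\<^sub>M leb01). \<bar>ftil n (u z) - ftr n R (u z)\<bar>)" for R
    using PS.integral_fst'[OF grow_pair_integrable[OF grow_simps(5)], of R] by (simp add: rR_def)
  have "(\<lambda>R. LINT z|(LT T \<Otimes>\<^sub>M leb01). \<bar>ftil n (u z) - ftr n R (u z)\<bar>) \<longlonglongrightarrow> (LINT z|(LT T \<Otimes>\<^sub>M leb01). 0)"
  proof (rule integral_dominated_convergence)
    show "integrable (LT T \<Otimes>\<^sub>M leb01) (\<lambda>z. 2 * (ftil n \<bar>u z\<bar> + \<bar>u z\<bar>))"
      by (rule integrable_mult_right[OF grow_pair_integrable[OF grow_simps(3)]])
    show "(\<lambda>z. \<bar>ftil n (u z) - ftr n R (u z)\<bar>) \<in> borel_measurable (LT T \<Otimes>\<^sub>M leb01)" for R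
      using grow_pair_integrable[OF grow_simps(5)] by (rule borel_measurable_integrable)
    show "AE z in LT T \<Otimes>\<^sub>M leb01. (\<lambda>R. \<bar>ftil n (u z) - ftr n R (u z)\<bar>) \<longlonglongrightarrow> 0"
    proof (intro AE_I2 tendsto_eventually)
      fix z
      obtain K0 :: nat where K0: "\<bar>u z\<bar> \<le> real K0" using real_arch_simple by blast
      show "\<forall>\<^sub>F R in sequentially. \<bar>ftil n (u z) - ftr n R (u z)\<bar> = 0"
      proof (rule eventually_sequentiallyI[of K0])
        fix R assume "K0 \<le> R"
        then have "\<bar>u z\<bar> \<le> real R" using K0 by linarith
        then show "\<bar>ftil n (u z) - ftr n R (u z)\<bar> = 0" by (simp add: ftr_eq)
      qed
    qed
    show "AE z in LT T \<Otimes>\<^sub>M leb01. norm \<bar>ftil n (u z) - ftr n R (u z)\<bar> \<le> 2 * (ftil n \<bar>u z\<bar> + \<bar>u z\<bar>)" for R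
    proof (rule AE_I2)
      fix z
      have "\<bar>ftil n (u z)\<bar> = ftil n \<bar>u z\<bar>" "\<bar>ftr n R (u z)\<bar> \<le> ftil n \<bar>u z\<bar>" by (rule abs_ftil, rule abs_ftr_le(2))
      then show "norm \<bar>ftil n (u z) - ftr n R (u z)\<bar> \<le> 2 * (ftil n \<bar>u z\<bar> + \<bar>u z\<bar>)" by simp
    qed
  qed simp
  then show ?thesis by (simp add: e)
qed

text \<open>\<open>kap\<close> multiplies the constants of \<open>monotone_defect\<close> and
  \<open>defect_bound\<close>; \<open>ce\<close> is the large Young constant.\<close>

definition kap :: real where "kap = (2 + lam\<^sup>2 / 4) * (2 * real (n + 1) * 2 ^ (2 * n + 2))"
definition ce :: "real \<Rightarrow> real" where "ce \<epsilon> = (1 / \<epsilon>) ^ (2 * n + 1)"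

lemma kap_nonneg: "0 \<le> kap" and ce_nonneg: "0 < \<epsilon> \<Longrightarrow> 0 \<le> ce \<epsilon>"
  by (simp_all add: kap_def ce_def)

lemma abs_fmean_syn_diff_le:
  assumes s: "good s" and m: "1 \<le> m" and c: "X t 0 = c" and \<omega>: "\<And>i. i < m \<Longrightarrow> \<bar>X s i - X t i\<bar> \<le> \<omega>"
  shows "\<bar>fmean m (\<lambda>\<theta>. u (s, \<theta>)) \<theta> - syn m c (X t) \<theta>\<bar> \<le> 2 * real m * \<omega>"
proof -
  have iv: "{..<m} = insert 0 {1..<m}" using m by auto
  have "syn m c (X t) \<theta> = (\<Sum>i<m. fej m i * X t i * eigfun i \<theta>)"
    unfolding syn_def iv using c m by (simp add: fej_def eigfun_def)
  moreover have "fmean m (\<lambda>\<theta>. u (s, \<theta>)) \<theta> = (\<Sum>i<m. fej m i * X s i * eigfun i \<theta>)"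
    using s unfolding fmean_def good_def by simp
  ultimately have "fmean m (\<lambda>\<theta>. u (s, \<theta>)) \<theta> - syn m c (X t) \<theta> = (\<Sum>i<m. fej m i * (X s i - X t i) * eigfun i \<theta>)"
    by (simp add: sum_subtractf[symmetric] algebra_simps)
  also have "\<bar>\<dots>\<bar> \<le> 2 * (\<Sum>i<m. \<bar>X s i - X t i\<bar>)"
  proof (rule abs_sum_eigfun_le)
    fix i assume "i \<in> {..<m}"
    then have "0 \<le> fej m i" "fej m i \<le> 1" using fej_bounds(1)[of i m] fej_bounds(2)[of m i] by auto
    then show "\<bar>fej m i * (X s i - X t i)\<bar> \<le> \<bar>X s i - X t i\<bar>"
      by (simp add: abs_mult mult_left_le_one_le)
  qed
  also have "\<dots> \<le> 2 * (\<Sum>i<m. \<omega>)" using \<omega> by (intro mult_left_mono sum_mono) auto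
  finally show ?thesis by simp
qed

lemma defect_sum:
  fixes x :: "nat \<Rightarrow> real"
  assumes s: "good s" and m: "1 \<le> m" and c: "X t 0 = c" and \<omega>: "\<And>i. i < m \<Longrightarrow> \<bar>X s i - X t i\<bar> \<le> \<omega>"
    and \<omega>1: "2 * real m * \<omega> \<le> 1" and \<epsilon>: "0 < \<epsilon>"
  shows "(\<Sum>i=1..<m. fej m i * (X t i - x i) * (Fi i s - inner01 (\<lambda>\<theta>. fR n R lam (syn m c x \<theta>)) (eigfun i)))
    \<le> 2 * (\<Sum>i=1..<m. \<bar>X t i - x i\<bar>) * rR R s + (\<bar>lam\<bar> + 1/2) * (\<Sum>i=1..<m. (fej m i * (X t i - x i))\<^sup>2)
      + kap * (\<epsilon> * A2 s + (\<epsilon> + ce \<epsilon>) * G2 m s + ce \<epsilon> * (2 * real m * \<omega>))"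
proof -
  define D where "D \<theta> = (\<Sum>i=1..<m. (fej m i * (X t i - x i)) * eigfun i \<theta>)" for \<theta>
  define v where "v \<theta> = f_approx lam n (u (s, \<theta>)) - fR n R lam (syn m c x \<theta>)" for \<theta>
  define d1 where "d1 = (\<Sum>i=1..<m. \<bar>X t i - x i\<bar>)"
  define G where "G \<theta> = \<bar>u (s, \<theta>) - fmean m (\<lambda>\<theta>. u (s, \<theta>)) \<theta>\<bar>" for \<theta>
  have \<omega>0: "0 \<le> 2 * real m * \<omega>" using \<omega>[of 0] m by auto
  have fi: "integrable leb01 (\<lambda>\<theta>. f_approx lam n (u (s, \<theta>)))"
    by (rule good_integrable[OF s grow_simps(4)])
  have vi: "integrable leb01 v" unfolding v_def by (intro Bochner_Integration.integrable_diff fi integrable_fR_syn)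
  have "(\<Sum>i=1..<m. fej m i * (X t i - x i) * (Fi i s - inner01 (\<lambda>\<theta>. fR n R lam (syn m c x \<theta>)) (eigfun i)))
     = (\<Sum>i=1..<m. fej m i * (X t i - x i) * inner01 v (eigfun i))"
    unfolding Fi_def inner01_diff[OF fi integrable_fR_syn] v_def ..
  also have "\<dots> = (LINT \<theta>|leb01. v \<theta> * D \<theta>)" unfolding D_def by (rule sum_inner01(1)[OF vi])
  also have "\<dots> \<le> (LINT \<theta>|leb01. 2 * d1 * \<bar>ftil n (u (s, \<theta>)) - ftr n R (u (s, \<theta>))\<bar> + (\<bar>lam\<bar> + 1/2) * (D \<theta>)\<^sup>2
     + kap * (\<epsilon> * (2 + \<bar>u (s, \<theta>)\<bar>) ^ (2 * n + 2) + (\<epsilon> + ce \<epsilon>) * G \<theta> ^ (2 * n + 2) + ce \<epsilon> * (2 * real m * \<omega>)))"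
  proof (rule integral_mono)
    show "integrable leb01 (\<lambda>\<theta>. v \<theta> * D \<theta>)" unfolding D_def by (rule sum_inner01(2)[OF vi])
    show "integrable leb01 (\<lambda>\<theta>. 2 * d1 * \<bar>ftil n (u (s, \<theta>)) - ftr n R (u (s, \<theta>))\<bar> + (\<bar>lam\<bar> + 1/2) * (D \<theta>)\<^sup>2
     + kap * (\<epsilon> * (2 + \<bar>u (s, \<theta>)\<bar>) ^ (2 * n + 2) + (\<epsilon> + ce \<epsilon>) * G \<theta> ^ (2 * n + 2) + ce \<epsilon> * (2 * real m * \<omega>)))"
      unfolding D_def G_def
      by (intro Bochner_Integration.integrable_add integrable_mult_right good_integrable[OF s grow_simps(5)]
          good_integrable[OF s grow_simps(2)] G2_integrable_theta[OF s m] integral_sum_eigfun_sq(2) leb01.integrable_const) simp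
    fix \<theta>
    have sd: "syn m c (X t) \<theta> - syn m c x \<theta> = D \<theta>" unfolding syn_diff D_def ..
    have "v \<theta> * D \<theta> \<le> \<bar>ftil n (u (s, \<theta>)) - ftr n R (u (s, \<theta>))\<bar> * \<bar>D \<theta>\<bar> + (\<bar>lam\<bar> + 1/2) * (D \<theta>)\<^sup>2
       + (2 + lam\<^sup>2 / 4) * (\<bar>u (s, \<theta>) - syn m c x \<theta> - D \<theta>\<bar> * ftil n (\<bar>u (s, \<theta>)\<bar> + \<bar>u (s, \<theta>) - syn m c x \<theta> - D \<theta>\<bar>))"
      unfolding v_def fR_def by (rule monotone_defect)
    also have "\<dots> \<le> \<bar>ftil n (u (s, \<theta>)) - ftr n R (u (s, \<theta>))\<bar> * (2 * d1) + (\<bar>lam\<bar> + 1/2) * (D \<theta>)\<^sup>2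
       + (2 + lam\<^sup>2 / 4) * (2 * real (n + 1) * 2 ^ (2 * n + 2) *
           (\<epsilon> * (2 + \<bar>u (s, \<theta>)\<bar>) ^ (2 * n + 2) + (\<epsilon> + (1 / \<epsilon>) ^ (2 * n + 1)) * G \<theta> ^ (2 * n + 2) + (1 / \<epsilon>) ^ (2 * n + 1) * (2 * real m * \<omega>)))"
    proof (intro add_mono mult_left_mono order_refl)
      show "\<bar>D \<theta>\<bar> \<le> 2 * d1" using abs_syn_diff_le[of m c "X t" \<theta> x] unfolding sd d1_def .
      show "\<bar>u (s, \<theta>) - syn m c x \<theta> - D \<theta>\<bar> * ftil n (\<bar>u (s, \<theta>)\<bar> + \<bar>u (s, \<theta>) - syn m c x \<theta> - D \<theta>\<bar>)
        \<le> 2 * real (n + 1) * 2 ^ (2 * n + 2) *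
           (\<epsilon> * (2 + \<bar>u (s, \<theta>)\<bar>) ^ (2 * n + 2) + (\<epsilon> + (1 / \<epsilon>) ^ (2 * n + 1)) * G \<theta> ^ (2 * n + 2) + (1 / \<epsilon>) ^ (2 * n + 1) * (2 * real m * \<omega>))"
      proof (rule defect_bound[OF _ _ \<omega>0 \<omega>1 \<epsilon>])
        show "\<bar>u (s, \<theta>) - syn m c x \<theta> - D \<theta>\<bar> \<le> G \<theta> + 2 * real m * \<omega>"
          using abs_fmean_syn_diff_le[OF s m c \<omega>, of \<theta>] unfolding sd[symmetric] G_def by linarith
      qed (simp add: G_def)
    qed auto
    finally show "v \<theta> * D \<theta> \<le> 2 * d1 * \<bar>ftil n (u (s, \<theta>)) - ftr n R (u (s, \<theta>))\<bar> + (\<bar>lam\<bar> + 1/2) * (D \<theta>)\<^sup>2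
     + kap * (\<epsilon> * (2 + \<bar>u (s, \<theta>)\<bar>) ^ (2 * n + 2) + (\<epsilon> + ce \<epsilon>) * G \<theta> ^ (2 * n + 2) + ce \<epsilon> * (2 * real m * \<omega>))"
      unfolding kap_def ce_def by (simp only: mult_ac)
  qed
  also have "\<dots> = 2 * d1 * rR R s + (\<bar>lam\<bar> + 1/2) * (LINT \<theta>|leb01. (D \<theta>)\<^sup>2)
     + kap * (\<epsilon> * A2 s + (\<epsilon> + ce \<epsilon>) * (LINT \<theta>|leb01. G \<theta> ^ (2 * n + 2)) + ce \<epsilon> * (2 * real m * \<omega>))"
  proof -
    have i: "integrable leb01 (\<lambda>\<theta>. \<bar>ftil n (u (s, \<theta>)) - ftr n R (u (s, \<theta>))\<bar>)" "integrable leb01 (\<lambda>\<theta>. (D \<theta>)\<^sup>2)"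
      "integrable leb01 (\<lambda>\<theta>. (2 + \<bar>u (s, \<theta>)\<bar>) ^ (2 * n + 2))" "integrable leb01 (\<lambda>\<theta>. G \<theta> ^ (2 * n + 2))"
      unfolding D_def G_def
      by (rule good_integrable[OF s grow_simps(5)] integral_sum_eigfun_sq(2) good_integrable[OF s grow_simps(2)] G2_integrable_theta[OF s m]; simp)+
    have k: "(LINT \<theta>|leb01. r) = r" for r :: real using prob_leb01 by simp
    show ?thesis
      unfolding rR_def A2_def
      by (simp only: Bochner_Integration.integral_add Bochner_Integration.integrable_add integrable_mult_right i leb01.integrable_const
          integral_mult_right_zero k)
  qed
  also have "(LINT \<theta>|leb01. (D \<theta>)\<^sup>2) = (\<Sum>i=1..<m. (fej m i * (X t i - x i))\<^sup>2)"
    unfolding D_def by (rule integral_sum_eigfun_sq(1)) simp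
  also have "(LINT \<theta>|leb01. G \<theta> ^ (2 * n + 2)) = G2 m s" unfolding G_def G2_def ..
  finally show ?thesis unfolding d1_def .
qed

text \<open>The L2 term left by \<open>defect_sum\<close> is stronger than the norm in use. It is
  absorbed by the dissipation of the squared Laplacian through
  \<open>l * mu i \<le> (mu i)\<^sup>2 + l\<^sup>2 / 4\<close>, which leaves a multiple of the
  weighted norm.\<close>

lemma pairing_bound:
  fixes x :: "nat \<Rightarrow> real"
  assumes s: "good s" and m: "1 \<le> m" and c: "X t 0 = c" and \<omega>: "\<And>i. i < m \<Longrightarrow> \<bar>X s i - X t i\<bar> \<le> \<omega>"
    and \<omega>1: "2 * real m * \<omega> \<le> 1" and \<epsilon>: "0 < \<epsilon>"
  shows "(\<Sum>i=1..<m. gw m i * ((X t i - x i) * (- (mu i)\<^sup>2 * (Ui i s - x i)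
        + mu i * (Fi i s - inner01 (\<lambda>\<theta>. fR n R lam (syn m c x \<theta>)) (eigfun i)))))
    \<le> (\<bar>lam\<bar> + 1/2)\<^sup>2 / 4 * (\<Sum>i=1..<m. gw m i * (X t i - x i)\<^sup>2)
      + (\<Sum>i=1..<m. \<bar>X t i - x i\<bar>) * (2 * rR R s + mu m * \<omega>)
      + kap * (\<epsilon> * A2 s + (\<epsilon> + ce \<epsilon>) * G2 m s + ce \<epsilon> * (2 * real m * \<omega>))"
proof -
  define l where "l = \<bar>lam\<bar> + 1/2"
  let ?f = "\<lambda>i. Fi i s - inner01 (\<lambda>\<theta>. fR n R lam (syn m c x \<theta>)) (eigfun i)"
  have "(\<Sum>i=1..<m. gw m i * ((X t i - x i) * (- (mu i)\<^sup>2 * (Ui i s - x i) + mu i * ?f i)))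
     \<le> (\<Sum>i=1..<m. (l\<^sup>2 / 4 * (gw m i * (X t i - x i)\<^sup>2) + mu m * \<omega> * \<bar>X t i - x i\<bar> - l * (fej m i * (X t i - x i))\<^sup>2)
         + fej m i * (X t i - x i) * ?f i)"
  proof (rule sum_mono)
    fix i assume i: "i \<in> {1..<m}"
    define d where "d = X t i - x i"
    define r where "r = X s i - X t i"
    have mi: "0 < mu i" "mu i \<le> mu m" using i by (auto intro!: mu_pos mu_mono)
    have f: "0 \<le> fej m i" "fej m i \<le> 1" using fej_bounds(1)[of i m] fej_bounds(2)[of m i] i by auto
    have r: "\<bar>r\<bar> \<le> \<omega>" using \<omega>[of i] i by (simp add: r_def)
    have U: "Ui i s - x i = d + r" using s by (simp add: Ui_def good_def d_def r_def)
    have gm: "gw m i * (mu i)\<^sup>2 = fej m i * mu i" "gw m i * mu i = fej m i"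
      using mi by (simp_all add: gw_def power2_eq_square)
    have e: "gw m i * (d * (- (mu i)\<^sup>2 * (d + r) + mu i * ?f i)) = - ((gw m i * (mu i)\<^sup>2) * (d * (d + r))) + (gw m i * mu i) * d * ?f i"
      by (simp add: algebra_simps)
    have "- (fej m i * mu i * (d * r)) \<le> mu m * \<omega> * \<bar>d\<bar>"
    proof -
      have "\<bar>fej m i * mu i * (d * r)\<bar> = fej m i * mu i * (\<bar>d\<bar> * \<bar>r\<bar>)" using f mi by (simp add: abs_mult)
      also have "\<dots> \<le> 1 * mu m * (\<bar>d\<bar> * \<omega>)" using f mi r by (intro mult_mono) auto
      finally show ?thesis by (simp add: mult_ac abs_le_iff)
    qed
    moreover have "- (fej m i * mu i * d\<^sup>2) \<le> l\<^sup>2 / 4 * (gw m i * d\<^sup>2) - l * (fej m i * d)\<^sup>2"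
    proof -
      have "0 \<le> (mu i - l / 2)\<^sup>2" by simp
      then have "l * mu i \<le> (mu i)\<^sup>2 + l\<^sup>2 / 4" by (simp add: power2_eq_square algebra_simps)
      then have "l \<le> mu i + l\<^sup>2 / 4 / mu i" using mi by (simp add: field_simps power2_eq_square)
      then have "fej m i * d\<^sup>2 * l \<le> fej m i * d\<^sup>2 * (mu i + l\<^sup>2 / 4 / mu i)" using f by (intro mult_left_mono) auto
      moreover have "l * (fej m i * d)\<^sup>2 \<le> fej m i * d\<^sup>2 * l"
      proof -
        have "l * (fej m i * d)\<^sup>2 = fej m i * (fej m i * d\<^sup>2 * l)" by (simp add: power2_eq_square)
        also have "\<dots> \<le> 1 * (fej m i * d\<^sup>2 * l)" using f by (intro mult_right_mono) (auto simp: l_def)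
        finally show ?thesis by simp
      qed
      moreover have "fej m i * d\<^sup>2 * (mu i + l\<^sup>2 / 4 / mu i) = fej m i * mu i * d\<^sup>2 + l\<^sup>2 / 4 * (gw m i * d\<^sup>2)"
        by (simp add: gw_def field_simps)
      ultimately show ?thesis by linarith
    qed
    moreover have "fej m i * mu i * (d * (d + r)) = fej m i * mu i * d\<^sup>2 + fej m i * mu i * (d * r)"
      by (simp add: algebra_simps power2_eq_square)
    ultimately have "gw m i * (d * (- (mu i)\<^sup>2 * (d + r) + mu i * ?f i))
      \<le> (l\<^sup>2 / 4 * (gw m i * d\<^sup>2) + mu m * \<omega> * \<bar>d\<bar> - l * (fej m i * d)\<^sup>2) + fej m i * d * ?f i"
      unfolding e gm by linarith
    then show "gw m i * ((X t i - x i) * (- (mu i)\<^sup>2 * (Ui i s - x i) + mu i * ?f i))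
      \<le> (l\<^sup>2 / 4 * (gw m i * (X t i - x i)\<^sup>2) + mu m * \<omega> * \<bar>X t i - x i\<bar> - l * (fej m i * (X t i - x i))\<^sup>2)
         + fej m i * (X t i - x i) * ?f i"
      unfolding U d_def .
  qed
  also have "\<dots> = l\<^sup>2 / 4 * (\<Sum>i=1..<m. gw m i * (X t i - x i)\<^sup>2) + mu m * \<omega> * (\<Sum>i=1..<m. \<bar>X t i - x i\<bar>)
     - l * (\<Sum>i=1..<m. (fej m i * (X t i - x i))\<^sup>2) + (\<Sum>i=1..<m. fej m i * (X t i - x i) * ?f i)"
    by (simp only: sum.distrib sum_subtractf sum_distrib_left)
  also have "\<dots> \<le> l\<^sup>2 / 4 * (\<Sum>i=1..<m. gw m i * (X t i - x i)\<^sup>2) + mu m * \<omega> * (\<Sum>i=1..<m. \<bar>X t i - x i\<bar>)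
      + 2 * (\<Sum>i=1..<m. \<bar>X t i - x i\<bar>) * rR R s + kap * (\<epsilon> * A2 s + (\<epsilon> + ce \<epsilon>) * G2 m s + ce \<epsilon> * (2 * real m * \<omega>))"
    using defect_sum[OF s m c \<omega> \<omega>1 \<epsilon>, of x R] unfolding l_def by linarith
  also have "\<dots> = l\<^sup>2 / 4 * (\<Sum>i=1..<m. gw m i * (X t i - x i)\<^sup>2)
      + (\<Sum>i=1..<m. \<bar>X t i - x i\<bar>) * (2 * rR R s + mu m * \<omega>)
      + kap * (\<epsilon> * A2 s + (\<epsilon> + ce \<epsilon>) * G2 m s + ce \<epsilon> * (2 * real m * \<omega>))"
    by (simp add: algebra_simps)
  finally show ?thesis unfolding l_def .
qed

section \<open>One Euler step against one increment of the solution\<close>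

definition It :: "real \<Rightarrow> real \<Rightarrow> (real \<Rightarrow> real) \<Rightarrow> real" where
  "It a b g = (LINT s|LT T. indicator {a<..b} s * g s)"

lemma It_integrable: "integrable (LT T) g \<Longrightarrow> integrable (LT T) (\<lambda>s. indicator {a<..b} s * g s)" for g :: "real \<Rightarrow> real" and a b :: real
  by (rule integrable_indicator_mult[OF _ greaterThanAtMost_borel])

lemma const_integrable: "integrable (LT T) (\<lambda>_. r :: real)"
  by (rule finite_measure.integrable_const[OF finite_measure_LT])

lemma It_add: "integrable (LT T) g \<Longrightarrow> integrable (LT T) h \<Longrightarrow> It a b (\<lambda>s. g s + h s) = It a b g + It a b h"
  unfolding It_def distrib_left by (intro Bochner_Integration.integral_add It_integrable)

lemma It_cmult: "It a b (\<lambda>s. r * g s) = r * It a b g"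
  unfolding It_def mult.left_commute[of _ r] by (rule integral_mult_right_zero)

lemma It_const: "0 \<le> a \<Longrightarrow> a \<le> b \<Longrightarrow> b \<le> T \<Longrightarrow> It a b (\<lambda>s. r) = r * (b - a)"
  unfolding It_def mult.commute[of _ r] by (simp only: integral_mult_right_zero integral_LT_indicator)

lemma It_mono:
  assumes "integrable (LT T) g" "integrable (LT T) h" "\<And>s. good s \<Longrightarrow> a < s \<Longrightarrow> s \<le> b \<Longrightarrow> g s \<le> h s"
  shows "It a b g \<le> It a b h"
  unfolding It_def
proof (rule integral_mono_AE)
  show "AE s in LT T. indicator {a<..b} s * g s \<le> indicator {a<..b} s * h s"
    using AE_good by eventually_elim (use assms(3) in \<open>auto simp: indicator_def\<close>)
qed (intro It_integrable assms(1,2))+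

lemma It_sum: "(\<And>i. i \<in> I \<Longrightarrow> integrable (LT T) (g i)) \<Longrightarrow> It a b (\<lambda>s. \<Sum>i\<in>I. g i s) = (\<Sum>i\<in>I. It a b (g i))"
  unfolding It_def sum_distrib_left by (intro Bochner_Integration.integral_sum It_integrable)

lemma It_nonneg: "(\<And>s. 0 \<le> g s) \<Longrightarrow> 0 \<le> It a b g"
  unfolding It_def by (intro integral_nonneg_AE AE_I2 mult_nonneg_nonneg) auto

lemma abs_It_le:
  assumes "integrable (LT T) g" "integrable (LT T) h" "\<And>s. good s \<Longrightarrow> \<bar>g s\<bar> \<le> h s"
  shows "\<bar>It a b g\<bar> \<le> It a b h"
proof -
  have "It a b g \<le> It a b h" by (intro It_mono assms(1,2)) (use assms(3) in fastforce)
  moreover have "It a b (\<lambda>s. - 1 * g s) \<le> It a b h"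
    by (intro It_mono assms(2) integrable_mult_right assms(1)) (use assms(3) in fastforce)
  ultimately show ?thesis unfolding It_cmult by linarith
qed

lemma It_linear:
  fixes g :: "real \<Rightarrow> real"
  assumes g: "integrable (LT T) g" and t: "0 \<le> a" "a \<le> b" "b \<le> T"
  shows "It a b (\<lambda>s. r * g s + C) = r * It a b g + C * (b - a)"
  by (simp only: It_add[OF integrable_mult_right[OF g] const_integrable] It_cmult[of _ _ r g] It_const[OF t])

lemma It_linear3:
  fixes g1 g2 g3 :: "real \<Rightarrow> real"
  assumes t: "0 \<le> a" "a \<le> b" "b \<le> T" and g: "integrable (LT T) g1" "integrable (LT T) g2" "integrable (LT T) g3"
  shows "It a b (\<lambda>s. C + (r1 * g1 s + (r2 * g2 s + r3 * g3 s))) = C * (b - a) + (r1 * It a b g1 + (r2 * It a b g2 + r3 * It a b g3))"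
proof -
  note i = integrable_mult_right[OF g(1), of r1] integrable_mult_right[OF g(2), of r2] integrable_mult_right[OF g(3), of r3]
  note ii = Bochner_Integration.integrable_add[OF i(2,3)]
  have "It a b (\<lambda>s. C + (r1 * g1 s + (r2 * g2 s + r3 * g3 s))) = It a b (\<lambda>s. C) + It a b (\<lambda>s. r1 * g1 s + (r2 * g2 s + r3 * g3 s))"
    by (rule It_add[OF const_integrable Bochner_Integration.integrable_add[OF i(1) ii]])
  also have "It a b (\<lambda>s. r1 * g1 s + (r2 * g2 s + r3 * g3 s)) = It a b (\<lambda>s. r1 * g1 s) + It a b (\<lambda>s. r2 * g2 s + r3 * g3 s)"
    by (rule It_add[OF i(1) ii])
  also have "It a b (\<lambda>s. r2 * g2 s + r3 * g3 s) = It a b (\<lambda>s. r2 * g2 s) + It a b (\<lambda>s. r3 * g3 s)"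
    by (rule It_add[OF i(2,3)])
  finally show ?thesis unfolding It_cmult[of _ _ r1 g1] It_cmult[of _ _ r2 g2] It_cmult[of _ _ r3 g3] It_const[OF t] .
qed

lemma abs_Ui_Fi_le:
  assumes "good s"
  shows "\<bar>Ui i s\<bar> \<le> 2 * FA s" "\<bar>Fi i s\<bar> \<le> 2 * (1 + \<bar>lam\<bar>) * FA s"
proof -
  have I: "integrable leb01 (\<lambda>\<theta>. ftil n \<bar>u (s, \<theta>)\<bar> + \<bar>u (s, \<theta>)\<bar>)" by (rule good_integrable[OF assms grow_simps(3)])
  have *: "\<bar>inner01 w (eigfun i)\<bar> \<le> K * FA s"
    if w: "integrable leb01 (\<lambda>\<theta>. w \<theta> * eigfun i \<theta>)" "\<And>\<theta>. \<bar>w \<theta>\<bar> * 2 \<le> K * (ftil n \<bar>u (s, \<theta>)\<bar> + \<bar>u (s, \<theta>)\<bar>)" for w K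
  proof -
    have "\<bar>inner01 w (eigfun i)\<bar> \<le> (LINT \<theta>|leb01. \<bar>w \<theta> * eigfun i \<theta>\<bar>)" unfolding inner01_def by (rule integral_abs_bound)
    also have "\<dots> \<le> (LINT \<theta>|leb01. K * (ftil n \<bar>u (s, \<theta>)\<bar> + \<bar>u (s, \<theta>)\<bar>))"
    proof (rule integral_mono)
      show "integrable leb01 (\<lambda>\<theta>. \<bar>w \<theta> * eigfun i \<theta>\<bar>)" using w(1) by (rule integrable_abs)
      show "integrable leb01 (\<lambda>\<theta>. K * (ftil n \<bar>u (s, \<theta>)\<bar> + \<bar>u (s, \<theta>)\<bar>))" by (rule integrable_mult_right[OF I])
      fix \<theta>
      have "\<bar>w \<theta> * eigfun i \<theta>\<bar> \<le> \<bar>w \<theta>\<bar> * 2" unfolding abs_mult by (intro mult_left_mono abs_eigfun_le2) auto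
      then show "\<bar>w \<theta> * eigfun i \<theta>\<bar> \<le> K * (ftil n \<bar>u (s, \<theta>)\<bar> + \<bar>u (s, \<theta>)\<bar>)" using w(2)[of \<theta>] by linarith
    qed
    also have "\<dots> = K * FA s" unfolding FA_def by (rule integral_mult_right_zero)
    finally show ?thesis .
  qed
  show "\<bar>Ui i s\<bar> \<le> 2 * FA s"
    unfolding Ui_def
  proof (rule *)
    show "integrable leb01 (\<lambda>\<theta>. u (s, \<theta>) * eigfun i \<theta>)" by (rule good_integrable[OF assms grow_eigfun[OF grow_simps(1)]])
    show "\<bar>u (s, \<theta>)\<bar> * 2 \<le> 2 * (ftil n \<bar>u (s, \<theta>)\<bar> + \<bar>u (s, \<theta>)\<bar>)" for \<theta> using ftil_nonneg[of "\<bar>u (s, \<theta>)\<bar>" n] by simp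
  qed
  show "\<bar>Fi i s\<bar> \<le> 2 * (1 + \<bar>lam\<bar>) * FA s"
    unfolding Fi_def
  proof (rule *)
    show "integrable leb01 (\<lambda>\<theta>. f_approx lam n (u (s, \<theta>)) * eigfun i \<theta>)" by (rule good_integrable[OF assms grow_eigfun[OF grow_simps(4)]])
    fix \<theta>
    let ?u = "u (s, \<theta>)"
    have f0: "0 \<le> ftil n \<bar>?u\<bar>" by (rule ftil_nonneg) simp
    have "\<bar>f_approx lam n ?u\<bar> \<le> ftil n \<bar>?u\<bar> + \<bar>lam\<bar> * \<bar>?u\<bar>"
      unfolding f_approx_ftil by (rule order_trans[OF abs_triangle_ineq]) (simp add: abs_mult abs_ftil)
    also have "\<dots> \<le> (ftil n \<bar>?u\<bar> + \<bar>lam\<bar> * \<bar>?u\<bar>) + (\<bar>lam\<bar> * ftil n \<bar>?u\<bar> + \<bar>?u\<bar>)" using f0 by simp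
    also have "\<dots> = (1 + \<bar>lam\<bar>) * (ftil n \<bar>?u\<bar> + \<bar>?u\<bar>)" by (simp add: algebra_simps)
    finally show "\<bar>f_approx lam n ?u\<bar> * 2 \<le> 2 * (1 + \<bar>lam\<bar>) * (ftil n \<bar>?u\<bar> + \<bar>?u\<bar>)" unfolding mult.assoc by linarith
  qed
qed

text \<open>A crude bound on the speed of the error. It may grow with \<open>m\<close>,
  \<open>R\<close> and \<open>K\<close>, since it enters with the factor \<open>\<eta>\<close>,
  which is chosen after them.\<close>

definition qc :: "nat \<Rightarrow> nat \<Rightarrow> real \<Rightarrow> real" where
  "qc m R K = (2 * (mu m)\<^sup>2 + 2 * mu m * (1 + \<bar>lam\<bar>)) + ((mu m)\<^sup>2 + 4 * mu m * \<bar>lam\<bar>)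
     + ((mu m)\<^sup>2 * K + 2 * mu m * (ftil n (real R) + \<bar>lam\<bar> * \<bar>c\<bar> + 2 * \<bar>lam\<bar> * real m * K))"

lemma mu_nonneg: "0 \<le> mu m" by (simp add: mu_def)

lemma integrand_bound:
  fixes x y :: "nat \<Rightarrow> real"
  assumes s: "good s" and i: "i \<in> {1..<m}" and K: "\<And>j. j < m \<Longrightarrow> \<bar>y j\<bar> \<le> K" and K0: "0 \<le> K"
  shows "\<bar>- (mu i)\<^sup>2 * (Ui i s - x i) + mu i * (Fi i s - inner01 (\<lambda>\<theta>. fR n R lam (syn m c x \<theta>)) (eigfun i))\<bar>
    \<le> qc m R K * FA s + qc m R K * (1 + (\<Sum>j=1..<m. \<bar>y j - x j\<bar>))"
proof -
  define d1 where "d1 = (\<Sum>j=1..<m. \<bar>y j - x j\<bar>)"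
  define f where "f = inner01 (\<lambda>\<theta>. fR n R lam (syn m c x \<theta>)) (eigfun i)"
  define a where "a = (mu m)\<^sup>2" define b where "b = mu m"
  have mi: "0 \<le> mu i" "mu i \<le> b" using i by (auto intro!: mu_nonneg mu_mono simp: b_def)
  have a0: "0 \<le> a" "0 \<le> b" "(mu i)\<^sup>2 \<le> a" using mi by (auto simp: a_def b_def mu_nonneg intro!: power_mono)
  have d0: "0 \<le> d1" unfolding d1_def by (intro sum_nonneg) auto
  have "\<bar>y i - x i\<bar> \<le> d1" unfolding d1_def using i by (intro member_le_sum) auto
  moreover have "\<bar>y i\<bar> \<le> K" using K i by simp
  ultimately have xi: "\<bar>x i\<bar> \<le> d1 + K" by linarith
  have sx: "(\<Sum>j=1..<m. \<bar>x j\<bar>) \<le> d1 + real m * K"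
  proof -
    have "(\<Sum>j=1..<m. \<bar>x j\<bar>) \<le> (\<Sum>j=1..<m. \<bar>y j - x j\<bar> + K)"
    proof (rule sum_mono)
      fix j assume "j \<in> {1..<m}"
      then show "\<bar>x j\<bar> \<le> \<bar>y j - x j\<bar> + K" using K[of j] by auto
    qed
    also have "\<dots> = d1 + real (m - 1) * K" by (simp add: sum.distrib d1_def)
    also have "\<dots> \<le> d1 + real m * K" using K0 by (intro add_left_mono mult_right_mono) auto
    finally show ?thesis .
  qed
  have "\<bar>f\<bar> \<le> 2 * (ftil n (real R) + \<bar>lam\<bar> * (\<bar>c\<bar> + 2 * (\<Sum>j=1..<m. \<bar>x j\<bar>)))"
    unfolding f_def by (rule abs_inner01_eigfun_le[OF fR_syn_measurable fR_syn_bounded])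
  also have "\<dots> \<le> 2 * (ftil n (real R) + \<bar>lam\<bar> * (\<bar>c\<bar> + 2 * (d1 + real m * K)))"
    by (intro mult_left_mono add_left_mono sx) auto
  finally have f: "\<bar>f\<bar> \<le> 2 * (ftil n (real R) + \<bar>lam\<bar> * (\<bar>c\<bar> + 2 * (d1 + real m * K)))" .
  have fR0: "0 \<le> ftil n (real R)" by (rule ftil_nonneg) simp
  have F0: "0 \<le> FA s" by (rule time_nonneg)
  have "\<bar>- (mu i)\<^sup>2 * (Ui i s - x i) + mu i * (Fi i s - f)\<bar> \<le> (mu i)\<^sup>2 * \<bar>Ui i s - x i\<bar> + mu i * \<bar>Fi i s - f\<bar>"
    by (rule order_trans[OF abs_triangle_ineq]) (use mi in \<open>simp add: abs_mult\<close>)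
  also have "\<dots> \<le> a * (2 * FA s + (d1 + K)) + b * (2 * (1 + \<bar>lam\<bar>) * FA s + 2 * (ftil n (real R) + \<bar>lam\<bar> * (\<bar>c\<bar> + 2 * (d1 + real m * K))))"
  proof (intro add_mono mult_mono a0 mi)
    show "\<bar>Ui i s - x i\<bar> \<le> 2 * FA s + (d1 + K)" using abs_Ui_Fi_le(1)[OF s, of i] xi by linarith
    show "\<bar>Fi i s - f\<bar> \<le> 2 * (1 + \<bar>lam\<bar>) * FA s + 2 * (ftil n (real R) + \<bar>lam\<bar> * (\<bar>c\<bar> + 2 * (d1 + real m * K)))"
      using abs_Ui_Fi_le(2)[OF s, of i] f by linarith
  qed auto
  also have "\<dots> = (2 * a + 2 * b * (1 + \<bar>lam\<bar>)) * FA s + (a + 4 * b * \<bar>lam\<bar>) * d1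
     + (a * K + 2 * b * (ftil n (real R) + \<bar>lam\<bar> * \<bar>c\<bar> + 2 * \<bar>lam\<bar> * real m * K)) * 1"
    by (simp add: algebra_simps)
  also have "\<dots> \<le> qc m R K * FA s + qc m R K * d1 + qc m R K * 1"
  proof -
    have "0 \<le> 2 * a + 2 * b * (1 + \<bar>lam\<bar>)" "0 \<le> a + 4 * b * \<bar>lam\<bar>"
      "0 \<le> a * K + 2 * b * (ftil n (real R) + \<bar>lam\<bar> * \<bar>c\<bar> + 2 * \<bar>lam\<bar> * real m * K)"
      using a0 K0 fR0 by simp_all
    moreover have "qc m R K = (2 * a + 2 * b * (1 + \<bar>lam\<bar>)) + (a + 4 * b * \<bar>lam\<bar>)
        + (a * K + 2 * b * (ftil n (real R) + \<bar>lam\<bar> * \<bar>c\<bar> + 2 * \<bar>lam\<bar> * real m * K))"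
      by (simp only: qc_def a_def b_def)
    ultimately have "2 * a + 2 * b * (1 + \<bar>lam\<bar>) \<le> qc m R K" "a + 4 * b * \<bar>lam\<bar> \<le> qc m R K"
      "a * K + 2 * b * (ftil n (real R) + \<bar>lam\<bar> * \<bar>c\<bar> + 2 * \<bar>lam\<bar> * real m * K) \<le> qc m R K"
      by linarith+
    then show ?thesis by (intro add_mono mult_right_mono F0 d0) auto
  qed
  finally show ?thesis unfolding f_def d1_def by (simp add: algebra_simps)
qed

text \<open>The noise cancels, because scheme and solution use the same increments. Expanding the
  square leaves a cross term, bounded by integrating \<open>pairing_bound\<close>, and the square of
  an integral over a short interval, which gains the factor \<open>\<eta>\<close>.\<close>

lemma one_step:
  fixes x :: "nat \<Rightarrow> real" and m R :: nat
  defines "D \<equiv> (\<lambda>z :: nat \<Rightarrow> real. \<Sum>i=1..<m. gw m i * (z i)\<^sup>2)" and "S \<equiv> (\<Sum>i=1..<m. 1 / gw m i)"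
  assumes q: "q \<in> \<rat>" "r \<in> \<rat>" "0 \<le> q" "q \<le> r" "r \<le> 1" and m: "1 \<le> m"
    and \<omega>: "\<And>s i. T * q \<le> s \<Longrightarrow> s \<le> T * r \<Longrightarrow> i < m \<Longrightarrow> \<bar>X s i - X (T * q) i\<bar> \<le> \<omega>"
    and \<omega>1: "2 * real m * \<omega> \<le> 1" and \<epsilon>: "0 < \<epsilon>"
    and K: "\<And>j. j < m \<Longrightarrow> \<bar>X (T * q) j\<bar> \<le> K" and K0: "0 \<le> K"
    and h: "h = T * r - T * q" and \<eta>: "h \<le> \<eta>" "It (T * q) (T * r) FA \<le> \<eta>"
    and Q: "Q = (\<Sum>i=1..<m. gw m i) * ((qc m R K)\<^sup>2 * (1 + S))"
  shows "D (\<lambda>i. X (T * r) i - (emap n R lam m c h x i + (\<beta> (T * r) i - \<beta> (T * q) i)))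
    \<le> D (\<lambda>i. X (T * q) i - x i) + h * ((\<bar>lam\<bar> + 1/2)\<^sup>2 / 4) * D (\<lambda>i. X (T * q) i - x i)
      + (2 * (1 + S) * It (T * q) (T * r) (rR R) + kap * \<epsilon> * It (T * q) (T * r) A2 + kap * (\<epsilon> + ce \<epsilon>) * It (T * q) (T * r) (G2 m)
         + Q * \<eta> * It (T * q) (T * r) FA + ((1 + S) * (mu m * \<omega>) + kap * ce \<epsilon> * (2 * real m * \<omega>) + Q * \<eta>) * h)
        * (1 + D (\<lambda>i. X (T * q) i - x i))"
proof -
  let ?t = "T * q" and ?t' = "T * r"
  let ?I = "It ?t ?t'"
  define d where "d i = X ?t i - x i" for i
  define d1 where "d1 = (\<Sum>i=1..<m. \<bar>d i\<bar>)"
  define f where "f i = inner01 (\<lambda>\<theta>. fR n R lam (syn m c x \<theta>)) (eigfun i)" for i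
  define v where "v i s = - (mu i)\<^sup>2 * (Ui i s - x i) + mu i * (Fi i s - f i)" for i s
  \<comment> \<open>\<open>w\<close> is the drift increment of the solution minus that of the Euler
    step.\<close>
  define w where "w i = 1/2 * ?I (v i)" for i
  define l where "l = (\<bar>lam\<bar> + 1/2)\<^sup>2 / 4"
  have t: "0 \<le> ?t" "?t \<le> ?t'" "?t' \<le> T" and h0: "0 \<le> h"
  proof -
    show "0 \<le> ?t" "?t \<le> ?t'" using T q by auto
    then show "0 \<le> h" by (simp add: h)
    have "T * r \<le> T * 1" using T q by (intro mult_left_mono) auto
    then show "?t' \<le> T" by simp
  qed
  have \<omega>0: "0 \<le> \<omega>" using \<omega>[of ?t 0] t m by simp
  have gp: "0 < gw m i" if "i \<in> {1..<m}" for i using that by (rule gw_pos)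
  have S0: "0 \<le> S" unfolding S_def using gp by (intro sum_nonneg) (auto intro: less_imp_le)
  have D0: "0 \<le> D z" for z unfolding D_def using gp by (intro sum_nonneg mult_nonneg_nonneg) (auto intro: less_imp_le)
  have vi: "integrable (LT T) (v i)" for i
    unfolding v_def by (intro Bochner_Integration.integrable_add integrable_mult_right Bochner_Integration.integrable_diff Ui_integrable Fi_integrable const_integrable)
  have c: "X ?t 0 = c" using avg[of q] q by simp
  have diff: "X ?t' i - (emap n R lam m c h x i + (\<beta> ?t' i - \<beta> ?t i)) = d i + w i" if i: "i \<in> {1..<m}" for i
  proof -
    have "?I (\<lambda>s. (- (mu i)\<^sup>2 * Ui i s + mu i * Fi i s)) = ?I (\<lambda>s. v i s + 2 * drift n R lam m c x i)"
      unfolding drift_eq v_def f_def by (simp add: algebra_simps)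
    also have "\<dots> = ?I (v i) + 2 * drift n R lam m c x i * h"
      unfolding It_add[OF vi const_integrable] It_const[OF t] h ..
    finally have "1/2 * ?I (\<lambda>s. (- (mu i)\<^sup>2 * Ui i s + mu i * Fi i s)) = w i + h * drift n R lam m c x i"
      by (simp add: w_def)
    moreover have "X ?t' i - X ?t i = 1/2 * ?I (\<lambda>s. (- (mu i)\<^sup>2 * Ui i s + mu i * Fi i s)) + (\<beta> ?t' i - \<beta> ?t i)"
      unfolding It_def using increment[OF q, of i] i by simp
    moreover have "emap n R lam m c h x i = x i + h * drift n R lam m c x i" using i by (simp add: emap_def)
    ultimately show ?thesis unfolding d_def by linarith
  qed
  have "D (\<lambda>i. X ?t' i - (emap n R lam m c h x i + (\<beta> ?t' i - \<beta> ?t i))) = (\<Sum>i=1..<m. gw m i * (d i + w i)\<^sup>2)"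
    unfolding D_def by (intro sum.cong refl) (simp only: diff)
  also have "\<dots> = D d + 2 * (\<Sum>i=1..<m. gw m i * (d i * w i)) + D w"
    unfolding D_def sum_distrib_left sum.distrib[symmetric] by (intro sum.cong refl) (simp add: power2_eq_square algebra_simps)
  finally have expand: "D (\<lambda>i. X ?t' i - (emap n R lam m c h x i + (\<beta> ?t' i - \<beta> ?t i)))
    = D d + 2 * (\<Sum>i=1..<m. gw m i * (d i * w i)) + D w" .
  have "2 * (\<Sum>i=1..<m. gw m i * (d i * w i)) = ?I (\<lambda>s. \<Sum>i=1..<m. gw m i * (d i * v i s))"
  proof -
    have "?I (\<lambda>s. \<Sum>i=1..<m. gw m i * (d i * v i s)) = (\<Sum>i=1..<m. ?I (\<lambda>s. gw m i * (d i * v i s)))"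
      by (intro It_sum integrable_mult_right vi)
    then show ?thesis unfolding It_cmult w_def sum_distrib_left by (simp add: mult_ac)
  qed
  also have "\<dots> \<le> ?I (\<lambda>s. (l * D d + d1 * (mu m * \<omega>) + kap * ce \<epsilon> * (2 * real m * \<omega>)) + (2 * d1 * rR R s + (kap * \<epsilon> * A2 s + kap * (\<epsilon> + ce \<epsilon>) * G2 m s)))"
  proof (rule It_mono)
    show "integrable (LT T) (\<lambda>s. \<Sum>i=1..<m. gw m i * (d i * v i s))"
      by (intro Bochner_Integration.integrable_sum integrable_mult_right vi)
    show "integrable (LT T) (\<lambda>s. (l * D d + d1 * (mu m * \<omega>) + kap * ce \<epsilon> * (2 * real m * \<omega>)) + (2 * d1 * rR R s + (kap * \<epsilon> * A2 s + kap * (\<epsilon> + ce \<epsilon>) * G2 m s)))"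
      by (intro Bochner_Integration.integrable_add integrable_mult_right time_integrable G2_integrable[OF m] const_integrable)
    fix s assume s: "good s" "?t < s" "s \<le> ?t'"
    have "(\<Sum>i=1..<m. gw m i * (d i * v i s))
      \<le> l * D d + d1 * (2 * rR R s + mu m * \<omega>) + kap * (\<epsilon> * A2 s + (\<epsilon> + ce \<epsilon>) * G2 m s + ce \<epsilon> * (2 * real m * \<omega>))"
      unfolding d_def v_def f_def l_def D_def d1_def
      by (rule pairing_bound[OF s(1) m c _ \<omega>1 \<epsilon>]) (use \<omega> s in auto)
    also have "\<dots> = (l * D d + d1 * (mu m * \<omega>) + kap * ce \<epsilon> * (2 * real m * \<omega>)) + (2 * d1 * rR R s + (kap * \<epsilon> * A2 s + kap * (\<epsilon> + ce \<epsilon>) * G2 m s))"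
      by (simp add: algebra_simps)
    finally show "(\<Sum>i=1..<m. gw m i * (d i * v i s)) \<le> \<dots>" .
  qed
  also have "\<dots> = (l * D d + d1 * (mu m * \<omega>) + kap * ce \<epsilon> * (2 * real m * \<omega>)) * h + (2 * d1 * ?I (rR R) + (kap * \<epsilon> * ?I A2 + kap * (\<epsilon> + ce \<epsilon>) * ?I (G2 m)))"
    unfolding h by (rule It_linear3[OF t time_integrable(2,3) G2_integrable[OF m]])
  finally have main: "D (\<lambda>i. X ?t' i - (emap n R lam m c h x i + (\<beta> ?t' i - \<beta> ?t i)))
    \<le> D d + ((l * D d + d1 * (mu m * \<omega>) + kap * ce \<epsilon> * (2 * real m * \<omega>)) * h + (2 * d1 * ?I (rR R) + (kap * \<epsilon> * ?I A2 + kap * (\<epsilon> + ce \<epsilon>) * ?I (G2 m)))) + D w"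
    using expand by linarith
  \<comment> \<open>The sum of absolute errors is traded for the weighted square norm at the price
    of \<open>1 + S\<close>, a constant depending on \<open>m\<close>.\<close>
  have d1: "d1 \<le> (1 + S) * (1 + D d)" "(1 + d1)\<^sup>2 \<le> 2 * ((1 + S) * (1 + D d))"
  proof -
    have "d1\<^sup>2 \<le> S * D d" unfolding d1_def S_def D_def by (rule sum_abs_sq_le) (auto intro: gw_pos)
    then have 1: "1 + d1\<^sup>2 \<le> (1 + S) * (1 + D d)" using S0 D0[of d] by (simp add: algebra_simps)
    have "0 \<le> (d1 - 1/2)\<^sup>2" "0 \<le> (d1 - 1)\<^sup>2" by simp_all
    then have "d1 \<le> 1 + d1\<^sup>2" "(1 + d1)\<^sup>2 \<le> 2 * (1 + d1\<^sup>2)" by (simp_all add: power2_eq_square algebra_simps)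
    moreover have "2 * (1 + d1\<^sup>2) \<le> 2 * ((1 + S) * (1 + D d))" by (rule mult_left_mono[OF 1]) simp
    ultimately show "d1 \<le> (1 + S) * (1 + D d)" "(1 + d1)\<^sup>2 \<le> 2 * ((1 + S) * (1 + D d))"
      using order_trans[OF _ 1] order_trans by blast+
  qed
  have d10: "0 \<le> d1" unfolding d1_def by (intro sum_nonneg) auto
  have I0: "0 \<le> ?I FA" "0 \<le> ?I (rR R)" "0 \<le> ?I A2" "0 \<le> ?I (G2 m)" by (intro It_nonneg time_nonneg)+
  have mum: "0 \<le> mu m" by (rule mu_nonneg)
  have SD: "1 \<le> (1 + S) * (1 + D d)" "1 \<le> 1 + D d" using mult_mono[of 1 "1 + S" 1 "1 + D d"] S0 D0[of d] by auto
  have "D w \<le> Q * \<eta> * (?I FA + h) * (1 + D d)"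
  proof -
    let ?q = "qc m R K"
    have "(w i)\<^sup>2 \<le> ?q\<^sup>2 * ((1 + S) * (1 + D d)) * (\<eta> * (?I FA + h))" if i: "i \<in> {1..<m}" for i
    proof -
      have "\<bar>?I (v i)\<bar> \<le> ?I (\<lambda>s. ?q * FA s + ?q * (1 + d1))"
        unfolding v_def f_def d1_def d_def
        by (rule abs_It_le[OF vi[unfolded v_def f_def] _ integrand_bound[OF _ i K K0]])
          (intro Bochner_Integration.integrable_add integrable_mult_right time_integrable const_integrable)
      also have "\<dots> = ?q * ?I FA + ?q * (1 + d1) * h"
        unfolding It_linear[OF time_integrable(1) t] h ..
      finally have a: "\<bar>?I (v i)\<bar> \<le> ?q * ?I FA + ?q * (1 + d1) * h" .
      have "(w i)\<^sup>2 = 1/4 * \<bar>?I (v i)\<bar>\<^sup>2" by (simp add: w_def power2_eq_square)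
      also have "\<dots> \<le> 1/4 * (?q * ?I FA + ?q * (1 + d1) * h)\<^sup>2" using a by (intro mult_left_mono power_mono) auto
      also have "\<dots> \<le> 1/4 * (2 * (?q * ?I FA)\<^sup>2 + 2 * (?q * (1 + d1) * h)\<^sup>2)"
      proof (intro mult_left_mono)
        show "(a + b)\<^sup>2 \<le> 2 * a\<^sup>2 + 2 * b\<^sup>2" for a b :: real
          using zero_le_power2[of "a - b"] by (simp add: power2_eq_square algebra_simps)
      qed simp
      also have "\<dots> = 1/2 * (?q\<^sup>2 * (1 * (?I FA)\<^sup>2 + (1 + d1)\<^sup>2 * h\<^sup>2))"
        by (simp add: power2_eq_square algebra_simps)
      also have "\<dots> \<le> 1/2 * (?q\<^sup>2 * (2 * ((1 + S) * (1 + D d)) * (\<eta> * ?I FA) + 2 * ((1 + S) * (1 + D d)) * (\<eta> * h)))"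
      proof (intro mult_left_mono add_mono mult_mono)
        \<comment> \<open>One factor of each square is replaced by \<open>\<eta>\<close>; what
          remains is linear in the integral and in the step, so it can be summed over the
          grid.\<close>
        show "(?I FA)\<^sup>2 \<le> \<eta> * ?I FA" "h\<^sup>2 \<le> \<eta> * h"
          unfolding power2_eq_square using \<eta> I0 h0 by (auto intro!: mult_right_mono)
      qed (use d1 SD I0 h0 S0 D0[of d] in auto)
      also have "\<dots> = ?q\<^sup>2 * ((1 + S) * (1 + D d)) * (\<eta> * (?I FA + h))" by (simp add: algebra_simps)
      finally show ?thesis .
    qed
    then have "D w \<le> (\<Sum>i=1..<m. gw m i * (?q\<^sup>2 * ((1 + S) * (1 + D d)) * (\<eta> * (?I FA + h))))"
      unfolding D_def using gp by (intro sum_mono mult_left_mono) (auto intro: less_imp_le)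
    also have "\<dots> = Q * \<eta> * (?I FA + h) * (1 + D d)"
      unfolding sum_distrib_right[symmetric] Q by (simp only: mult_ac)
    finally show ?thesis .
  qed
  moreover have "d1 * (mu m * \<omega>) * h \<le> (1 + S) * (1 + D d) * (mu m * \<omega>) * h"
    using d1(1) mum \<omega>0 h0 by (intro mult_right_mono) auto
  moreover have "2 * d1 * ?I (rR R) \<le> 2 * ((1 + S) * (1 + D d)) * ?I (rR R)"
    using d1(1) I0 by (intro mult_right_mono) auto
  moreover have "(kap * \<epsilon> * ?I A2 + kap * (\<epsilon> + ce \<epsilon>) * ?I (G2 m) + kap * ce \<epsilon> * (2 * real m * \<omega>) * h) * 1
     \<le> (kap * \<epsilon> * ?I A2 + kap * (\<epsilon> + ce \<epsilon>) * ?I (G2 m) + kap * ce \<epsilon> * (2 * real m * \<omega>) * h) * (1 + D d)"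
    using SD(2) kap_nonneg ce_nonneg[OF \<epsilon>] \<epsilon> I0 \<omega>0 h0 by (intro mult_left_mono add_nonneg_nonneg mult_nonneg_nonneg) auto
  ultimately have "D (\<lambda>i. X ?t' i - (emap n R lam m c h x i + (\<beta> ?t' i - \<beta> ?t i)))
    \<le> D d + l * D d * h + (1 + S) * (1 + D d) * (mu m * \<omega>) * h + 2 * ((1 + S) * (1 + D d)) * ?I (rR R)
      + (kap * \<epsilon> * ?I A2 + kap * (\<epsilon> + ce \<epsilon>) * ?I (G2 m) + kap * ce \<epsilon> * (2 * real m * \<omega>) * h) * (1 + D d)
      + Q * \<eta> * (?I FA + h) * (1 + D d)"
    using main by (simp add: distrib_right)
  also have "\<dots> = D d + h * l * D d
      + (2 * (1 + S) * ?I (rR R) + kap * \<epsilon> * ?I A2 + kap * (\<epsilon> + ce \<epsilon>) * ?I (G2 m)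
         + Q * \<eta> * ?I FA + ((1 + S) * (mu m * \<omega>) + kap * ce \<epsilon> * (2 * real m * \<omega>) + Q * \<eta>) * h) * (1 + D d)"
    by (simp only: distrib_left distrib_right mult_ac add_ac mult_1_left mult_1_right)
  finally show ?thesis unfolding l_def d_def .
qed

end

lemma gw_nonneg: "Suc 0 \<le> i \<Longrightarrow> i < m \<Longrightarrow> 0 \<le> gw m i"
  using gw_pos[of i m] by simp

definition grid_noise :: "real \<Rightarrow> (real \<Rightarrow> nat \<Rightarrow> real) \<Rightarrow> nat \<Rightarrow> nat \<Rightarrow> nat \<Rightarrow> real" where
  "grid_noise T \<beta> J k i = \<beta> (T * (real (Suc k) / real J)) i - \<beta> (T * (real k / real J)) i"

context galerkin_path
begin

section \<open>Summation over the grid\<close>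

lemma It_join:
  fixes g :: "real \<Rightarrow> real"
  assumes g: "integrable (LT T) g" and "a \<le> b" "b \<le> d"
  shows "It a d g = It a b g + It b d g"
proof -
  have "(\<lambda>s. indicator {a<..d} s * g s) = (\<lambda>s. indicator {a<..b} s * g s + indicator {b<..d} s * g s)"
    using assms by (auto simp: indicator_def fun_eq_iff)
  then show ?thesis unfolding It_def
    by (simp only: Bochner_Integration.integral_add[OF It_integrable[OF g] It_integrable[OF g]])
qed

lemma sum_It_le:
  fixes g :: "real \<Rightarrow> real"
  assumes g: "integrable (LT T) g" "\<And>s. 0 \<le> g s"
  shows "(\<Sum>k<K. It (T * (real k / real J)) (T * (real (Suc k) / real J)) g) \<le> (LINT s|LT T. g s)"
proof -
  have le: "T * (real k / real J) \<le> T * (real (Suc k) / real J)" "0 \<le> T * (real k / real J)" for k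
    using T by (auto intro!: mult_left_mono divide_right_mono)
  have "(\<Sum>k<K. It (T * (real k / real J)) (T * (real (Suc k) / real J)) g) = It 0 (T * (real K / real J)) g"
  proof (induction K)
    case 0 then show ?case by (simp add: It_def)
  next
    case (Suc K)
    then show ?case using It_join[OF g(1) le(2)[of K] le(1)[of K]] by simp
  qed
  also have "\<dots> \<le> (LINT s|LT T. g s)"
    unfolding It_def by (intro integral_mono It_integrable g(1)) (use g(2) in \<open>auto simp: indicator_def\<close>)
  finally show ?thesis .
qed

lemma modes_uniform:
  assumes "0 < \<omega>"
  obtains \<delta> where "0 < \<delta>" "\<And>i s t. i < m \<Longrightarrow> s \<in> {0..T} \<Longrightarrow> t \<in> {0..T} \<Longrightarrow> \<bar>s - t\<bar> < \<delta> \<Longrightarrow> \<bar>X s i - X t i\<bar> \<le> \<omega>"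
proof -
  have "\<exists>\<delta>>0. \<forall>s\<in>{0..T}. \<forall>t\<in>{0..T}. \<bar>s - t\<bar> < \<delta> \<longrightarrow> \<bar>X s i - X t i\<bar> \<le> \<omega>" for i
    using compact_uniformly_continuous[OF cont compact_Icc, of i] assms
    unfolding uniformly_continuous_on_def dist_real_def by (metis less_imp_le)
  then obtain d where d: "\<And>i. 0 < d i" "\<And>i s t. s \<in> {0..T} \<Longrightarrow> t \<in> {0..T} \<Longrightarrow> \<bar>s - t\<bar> < d i \<Longrightarrow> \<bar>X s i - X t i\<bar> \<le> \<omega>"
    by metis
  show thesis
  proof
    show "0 < Min (insert 1 (d ` {..<m}))" using d(1) by (subst Min_gr_iff) auto
    fix i s t assume a: "i < m" "s \<in> {0..T}" "t \<in> {0..T}" "\<bar>s - t\<bar> < Min (insert 1 (d ` {..<m}))"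
    have "Min (insert 1 (d ` {..<m})) \<le> d i" using a(1) by (intro Min_le) auto
    then show "\<bar>X s i - X t i\<bar> \<le> \<omega>" using a d(2)[of s t i] by linarith
  qed
qed

lemma modes_bounded:
  obtains K where "0 \<le> K" "\<And>i t. i < m \<Longrightarrow> t \<in> {0..T} \<Longrightarrow> \<bar>X t i\<bar> \<le> K"
proof -
  have "\<exists>K. \<forall>t\<in>{0..T}. \<bar>X t i\<bar> \<le> K" for i
    using compact_imp_bounded[OF compact_continuous_image[OF cont compact_Icc, of i]]
    unfolding bounded_iff by auto
  then obtain K where K: "\<And>i t. t \<in> {0..T} \<Longrightarrow> \<bar>X t i\<bar> \<le> K i" by metis
  show thesis
  proof
    show "0 \<le> (\<Sum>i<m. \<bar>K i\<bar>)" by (intro sum_nonneg) auto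
    fix i t assume "i < m" "t \<in> {0..T}"
    then show "\<bar>X t i\<bar> \<le> (\<Sum>i<m. \<bar>K i\<bar>)"
      using K[of t i] member_le_sum[of i "{..<m}" "\<lambda>i. \<bar>K i\<bar>"] by fastforce
  qed
qed

text \<open>\<open>E\<close> bounds the summed one-step errors; its terms stem from the truncation,
  the Young parameter, the Fejer means and the mesh.\<close>

lemma chain_error:
  fixes m R J :: nat
  defines "S \<equiv> (\<Sum>i=1..<m. 1 / gw m i)"
  assumes m: "1 \<le> m" and J: "1 \<le> J" and \<epsilon>: "0 < \<epsilon>" and \<omega>0: "0 < \<omega>" and \<omega>1: "2 * real m * \<omega> \<le> 1"
    and \<omega>: "\<And>i s t. i < m \<Longrightarrow> s \<in> {0..T} \<Longrightarrow> t \<in> {0..T} \<Longrightarrow> \<bar>s - t\<bar> \<le> T / real J \<Longrightarrow> \<bar>X s i - X t i\<bar> \<le> \<omega>"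
    and K: "0 \<le> K" "\<And>i t. i < m \<Longrightarrow> t \<in> {0..T} \<Longrightarrow> \<bar>X t i\<bar> \<le> K"
    and \<eta>: "T / real J \<le> \<eta>" "\<And>a b. 0 \<le> a \<Longrightarrow> a \<le> b \<Longrightarrow> b \<le> T \<Longrightarrow> b - a \<le> T / real J \<Longrightarrow> It a b FA \<le> \<eta>"
    and Q: "Q = (\<Sum>i=1..<m. gw m i) * ((qc m R K)\<^sup>2 * (1 + S))"
    and E: "2 * (1 + S) * (LINT s|LT T. rR R s) + kap * \<epsilon> * (LINT s|LT T. A2 s) + kap * (\<epsilon> + ce \<epsilon>) * (LINT s|LT T. G2 m s)
         + Q * \<eta> * (LINT s|LT T. FA s) + ((1 + S) * (mu m * \<omega>) + kap * ce \<epsilon> * (2 * real m * \<omega>) + Q * \<eta>) * T \<le> E"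
  shows "(\<Sum>i=1..<m. gw m i * (X T i - chain (emap n R lam m c (T / real J)) m (grid_noise T \<beta> J) (X 0) J i)\<^sup>2)
     \<le> exp (T * ((\<bar>lam\<bar> + 1/2)\<^sup>2 / 4) + E) * E"
proof -
  define x where "x = chain (emap n R lam m c (T / real J)) m (grid_noise T \<beta> J) (X 0)"
  define D where "D k = (\<Sum>i=1..<m. gw m i * (X (T * (real k / real J)) i - x k i)\<^sup>2)" for k
  let ?I = "\<lambda>k. It (T * (real k / real J)) (T * (real (Suc k) / real J))"
  define h where "h = T / real J"
  define l where "l = (\<bar>lam\<bar> + 1/2)\<^sup>2 / 4"
  define r where "r = (1 + S) * (mu m * \<omega>) + kap * ce \<epsilon> * (2 * real m * \<omega>) + Q * \<eta>"
  define e where "e k = 2 * (1 + S) * ?I k (rR R) + kap * \<epsilon> * ?I k A2 + kap * (\<epsilon> + ce \<epsilon>) * ?I k (G2 m)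
         + Q * \<eta> * ?I k FA + r * h" for k
  have S0: "0 \<le> S" unfolding S_def by (intro sum_nonneg) (auto simp: gw_nonneg)
  have h0: "0 \<le> h" using T by (simp add: h_def)
  have \<eta>0: "0 \<le> \<eta>" using \<eta>(1) h0 by (simp add: h_def)
  have Q0: "0 \<le> Q" unfolding Q using S0 by (intro mult_nonneg_nonneg sum_nonneg) (auto simp: gw_nonneg)
  have r0: "0 \<le> r" unfolding r_def
    using S0 Q0 \<eta>0 \<omega>0 kap_nonneg ce_nonneg[OF \<epsilon>] mu_nonneg[of m] by (intro add_nonneg_nonneg mult_nonneg_nonneg) auto
  have co: "0 \<le> 2 * (1 + S)" "0 \<le> kap * \<epsilon>" "0 \<le> kap * (\<epsilon> + ce \<epsilon>)" "0 \<le> Q * \<eta>"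
    using S0 Q0 \<eta>0 kap_nonneg ce_nonneg[OF \<epsilon>] \<epsilon> by auto
  have e0: "0 \<le> e k" for k
    unfolding e_def by (intro add_nonneg_nonneg mult_nonneg_nonneg[OF co(1)] mult_nonneg_nonneg[OF co(2)] mult_nonneg_nonneg[OF co(3)]
        mult_nonneg_nonneg[OF co(4)] mult_nonneg_nonneg[OF r0 h0] It_nonneg time_nonneg)
  have step: "D (Suc k) \<le> D k + h * l * D k + e k * (1 + D k)" if k: "k < J" for k
  proof -
    have "real (Suc k) / real J \<le> 1" using k by simp
    have t: "T * (real (Suc k) / real J) - T * (real k / real J) = h" by (simp add: h_def add_divide_distrib distrib_left)
    have rng: "0 \<le> T * (real k / real J)" "T * (real k / real J) \<le> T * (real (Suc k) / real J)" "T * (real (Suc k) / real J) \<le> T"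
    proof -
      show "0 \<le> T * (real k / real J)" using T by simp
      show "T * (real k / real J) \<le> T * (real (Suc k) / real J)" using t h0 by linarith
      have "T * (real (Suc k) / real J) \<le> T * 1" using T \<open>real (Suc k) / real J \<le> 1\<close> by (intro mult_left_mono) auto
      then show "T * (real (Suc k) / real J) \<le> T" by simp
    qed
    have "D (Suc k) = (\<Sum>i=1..<m. gw m i * (X (T * (real (Suc k) / real J)) i - (emap n R lam m c h (x k) i
       + (\<beta> (T * (real (Suc k) / real J)) i - \<beta> (T * (real k / real J)) i)))\<^sup>2)"
      unfolding D_def x_def h_def by (intro sum.cong refl) (simp add: grid_noise_def)
    also have "\<dots> \<le> D k + h * l * D k + e k * (1 + D k)"
      unfolding D_def l_def e_def r_def S_def
    proof (rule one_step)
      show "real k / real J \<in> \<rat>" "real (Suc k) / real J \<in> \<rat>" by simp_all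
      show "0 \<le> real k / real J" by simp
      show "real (Suc k) / real J \<le> 1" "1 \<le> m" "0 \<le> K" by fact+
      show "real k / real J \<le> real (Suc k) / real J" by (intro divide_right_mono) auto
      show "\<bar>X s i - X (T * (real k / real J)) i\<bar> \<le> \<omega>" if "T * (real k / real J) \<le> s" "s \<le> T * (real (Suc k) / real J)" "i < m" for s i
        using that rng t by (intro \<omega>) (auto simp: h_def)
      show "\<bar>X (T * (real k / real J)) j\<bar> \<le> K" if "j < m" for j using rng that by (intro K(2)) auto
      show "h = T * (real (Suc k) / real J) - T * (real k / real J)" by (rule t[symmetric])
      show "h \<le> \<eta>" using \<eta>(1) by (simp add: h_def)
      show "?I k FA \<le> \<eta>" using rng t by (intro \<eta>(2)) (auto simp: h_def)
      show "Q = (\<Sum>i=1..<m. gw m i) * ((qc m R K)\<^sup>2 * (1 + (\<Sum>i=1..<m. 1 / gw m i)))" using Q by (simp only: S_def)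
    qed (fact \<omega>1 \<epsilon>)+
    finally show ?thesis .
  qed
  have "(\<Sum>k<J. e k) = 2 * (1 + S) * (\<Sum>k<J. ?I k (rR R)) + kap * \<epsilon> * (\<Sum>k<J. ?I k A2) + kap * (\<epsilon> + ce \<epsilon>) * (\<Sum>k<J. ?I k (G2 m))
         + Q * \<eta> * (\<Sum>k<J. ?I k FA) + r * (real J * h)"
    unfolding e_def sum.distrib sum_distrib_left[symmetric] by simp
  also have "\<dots> \<le> 2 * (1 + S) * (LINT s|LT T. rR R s) + kap * \<epsilon> * (LINT s|LT T. A2 s) + kap * (\<epsilon> + ce \<epsilon>) * (LINT s|LT T. G2 m s)
         + Q * \<eta> * (LINT s|LT T. FA s) + r * T"
  proof (intro add_mono mult_left_mono[OF _ co(1)] mult_left_mono[OF _ co(2)] mult_left_mono[OF _ co(3)] mult_left_mono[OF _ co(4)]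
      sum_It_le time_integrable G2_integrable[OF m] time_nonneg)
    show "r * (real J * h) \<le> r * T" using J by (simp add: h_def)
  qed
  also have "\<dots> \<le> E" using E unfolding r_def .
  finally have sE: "(\<Sum>k<J. e k) \<le> E" .
  have se0: "0 \<le> (\<Sum>k<J. e k)" by (intro sum_nonneg e0)
  have "D J \<le> exp (real J * (h * l) + (\<Sum>k<J. e k)) * (\<Sum>k<J. e k)"
  proof (rule discrete_gronwall)
    show "D 0 = 0" by (simp add: D_def x_def)
    show "0 \<le> D k" for k unfolding D_def by (intro sum_nonneg mult_nonneg_nonneg) (auto simp: gw_nonneg)
    show "0 \<le> h * l" using h0 by (simp add: l_def)
  qed (rule e0, rule step)
  also have "real J * (h * l) = T * l" using J by (simp add: h_def)
  also have "exp (T * l + (\<Sum>k<J. e k)) * (\<Sum>k<J. e k) \<le> exp (T * l + E) * E"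
    using sE se0 by (intro mult_mono) auto
  finally have "D J \<le> exp (T * l + E) * E" .
  then show ?thesis using J by (simp add: D_def x_def l_def)
qed

text \<open>The order of choices is forced: \<open>\<epsilon>\<close> against \<open>A2\<close>;
  \<open>m\<close> against the constant \<open>ce \<epsilon>\<close>; \<open>R\<close> against
  \<open>S\<close>, which depends on \<open>m\<close>; finally \<open>\<eta>\<close>,
  \<open>\<omega>\<close> and the mesh against constants depending on all of these. Each of the five
  contributions is at most \<open>E / 5\<close>.\<close>

proposition chain_converges:
  assumes e: "0 < e"
  shows "\<exists>m0. \<forall>m\<ge>m0. \<exists>R0. \<forall>R\<ge>R0. \<exists>J0. \<forall>J\<ge>J0.
    (\<Sum>i=1..<m. gw m i * (X T i - chain (emap n R lam m c (T / real J)) m (grid_noise T \<beta> J) (X 0) J i)\<^sup>2) \<le> e"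
proof -
  define l where "l = (\<bar>lam\<bar> + 1/2)\<^sup>2 / 4"
  \<comment> \<open>The cap at 1 bounds the exponent of the Gronwall factor.\<close>
  define E where "E = min 1 (e / exp (T * l + 1))"
  have E0: "0 < E" using e by (simp add: E_def)
  have Ee: "exp (T * l + E) * E \<le> e"
  proof -
    have "exp (T * l + E) * E \<le> exp (T * l + 1) * (e / exp (T * l + 1))"
      using E0 e by (intro mult_mono) (auto simp: E_def)
    then show ?thesis by simp
  qed
  have small: "\<exists>z>0. a * z \<le> b" if "0 \<le> a" "0 < b" for a b :: real
    using that by (intro exI[of _ "b / (a + 1)"]) (simp add: field_simps)
  have IA: "0 \<le> (LINT s|LT T. A2 s)" "0 \<le> (LINT s|LT T. FA s)"
    by (intro integral_nonneg_AE AE_I2 time_nonneg)+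
  obtain \<epsilon> where \<epsilon>: "0 < \<epsilon>" "kap * (LINT s|LT T. A2 s) * \<epsilon> \<le> E / 5"
    using small[of "kap * (LINT s|LT T. A2 s)" "E / 5"] kap_nonneg IA E0 by auto
  have kc0: "0 \<le> kap * (\<epsilon> + ce \<epsilon>)" using kap_nonneg ce_nonneg[OF \<epsilon>(1)] \<epsilon>(1) by auto
  obtain g where g: "0 < g" "kap * (\<epsilon> + ce \<epsilon>) * g \<le> E / 5" using small[OF kc0, of "E / 5"] E0 by auto
  obtain m1 where m1: "\<And>m. m \<ge> m1 \<Longrightarrow> (LINT s|LT T. G2 m s) < g"
    using LIMSEQ_D[OF G2_tendsto g(1)] by (metis abs_less_iff diff_zero real_norm_def)
  show ?thesis
  proof (rule exI[of _ "max 1 m1"], intro allI impI)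
    fix m assume "max 1 m1 \<le> m"
    then have m: "1 \<le> m" "m1 \<le> m" by auto
    have G: "kap * (\<epsilon> + ce \<epsilon>) * (LINT s|LT T. G2 m s) \<le> E / 5"
      using mult_left_mono[OF less_imp_le[OF m1[OF m(2)]] kc0] g(2) by linarith
    define S where "S = (\<Sum>i=1..<m. 1 / gw m i)"
    have S0: "0 \<le> S" unfolding S_def by (intro sum_nonneg) (auto simp: gw_nonneg)
    obtain \<rho> where \<rho>: "0 < \<rho>" "2 * (1 + S) * \<rho> \<le> E / 5" using small[of "2 * (1 + S)" "E / 5"] S0 E0 by auto
    obtain R0 where R0: "\<And>R. R \<ge> R0 \<Longrightarrow> (LINT s|LT T. rR R s) < \<rho>"
      using LIMSEQ_D[OF rR_tendsto \<rho>(1)] by (metis abs_less_iff diff_zero real_norm_def)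
    show "\<exists>R0. \<forall>R\<ge>R0. \<exists>J0. \<forall>J\<ge>J0. (\<Sum>i=1..<m. gw m i * (X T i - chain (emap n R lam m c (T / real J)) m (grid_noise T \<beta> J) (X 0) J i)\<^sup>2) \<le> e"
    proof (rule exI[of _ R0], intro allI impI)
      fix R assume "R0 \<le> R"
      then have "2 * (1 + S) * (LINT s|LT T. rR R s) \<le> 2 * (1 + S) * \<rho>"
        using R0 S0 by (intro mult_left_mono) (auto intro: less_imp_le)
      then have rr: "2 * (1 + S) * (LINT s|LT T. rR R s) \<le> E / 5" using \<rho> by linarith
      obtain K where K: "0 \<le> K" "\<And>i t. i < m \<Longrightarrow> t \<in> {0..T} \<Longrightarrow> \<bar>X t i\<bar> \<le> K" using modes_bounded[of m] by metis
      define Q where "Q = (\<Sum>i=1..<m. gw m i) * ((qc m R K)\<^sup>2 * (1 + S))"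
      have Q0: "0 \<le> Q" unfolding Q_def using S0 by (intro mult_nonneg_nonneg sum_nonneg) (auto simp: gw_nonneg)
      obtain \<eta> where \<eta>: "0 < \<eta>" "Q * ((LINT s|LT T. FA s) + T) * \<eta> \<le> E / 5"
        using small[of "Q * ((LINT s|LT T. FA s) + T)" "E / 5"] Q0 IA T E0 by auto
      define z where "z = ((1 + S) * mu m + kap * ce \<epsilon> * (2 * real m)) * T"
      have z0: "0 \<le> z" unfolding z_def
        using S0 kap_nonneg ce_nonneg[OF \<epsilon>(1)] mu_nonneg[of m] T by (intro mult_nonneg_nonneg add_nonneg_nonneg) auto
      obtain \<omega>' where \<omega>': "0 < \<omega>'" "z * \<omega>' \<le> E / 5" using small[OF z0, of "E / 5"] E0 by auto
      define \<omega> where "\<omega> = min \<omega>' (1 / (2 * real m))"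
      have \<omega>: "0 < \<omega>" "2 * real m * \<omega> \<le> 1" "z * \<omega> \<le> E / 5"
      proof -
        show "0 < \<omega>" using \<omega>' m by (simp add: \<omega>_def)
        have "2 * real m * \<omega> \<le> 2 * real m * (1 / (2 * real m))" by (intro mult_left_mono) (auto simp: \<omega>_def)
        then show "2 * real m * \<omega> \<le> 1" using m by simp
        have "z * \<omega> \<le> z * \<omega>'" using z0 by (intro mult_left_mono) (auto simp: \<omega>_def)
        then show "z * \<omega> \<le> E / 5" using \<omega>' by linarith
      qed
      obtain \<delta> where \<delta>: "0 < \<delta>" "\<And>i s t. i < m \<Longrightarrow> s \<in> {0..T} \<Longrightarrow> t \<in> {0..T} \<Longrightarrow> \<bar>s - t\<bar> < \<delta> \<Longrightarrow> \<bar>X s i - X t i\<bar> \<le> \<omega>"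
        using modes_uniform[OF \<omega>(1), of m] by metis
      obtain d where d: "0 < d" "\<And>a b. 0 \<le> a \<Longrightarrow> a \<le> b \<Longrightarrow> b \<le> T \<Longrightarrow> b - a \<le> d \<Longrightarrow> It a b FA \<le> \<eta>"
        using integral_small_interval[OF time_integrable(1) time_nonneg(1) \<eta>(1)] unfolding It_def by blast
      define hh where "hh = min (min (\<delta> / 2) d) \<eta>"
      have hh: "0 < hh" "hh < \<delta>" "hh \<le> d" "hh \<le> \<eta>" using \<delta> d \<eta> by (auto simp: hh_def)
      obtain J1 :: nat where J1: "T / hh < real J1" using reals_Archimedean2 by blast
      show "\<exists>J0. \<forall>J\<ge>J0. (\<Sum>i=1..<m. gw m i * (X T i - chain (emap n R lam m c (T / real J)) m (grid_noise T \<beta> J) (X 0) J i)\<^sup>2) \<le> e"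
      proof (rule exI[of _ "max 1 J1"], intro allI impI)
        fix J assume "max 1 J1 \<le> J"
        then have J: "1 \<le> J" "real J1 \<le> real J" by auto
        have TJ: "T / real J \<le> hh"
        proof -
          have "T < real J1 * hh" using J1 hh(1) by (simp add: pos_divide_less_eq)
          also have "\<dots> \<le> real J * hh" using J hh(1) by (intro mult_right_mono) auto
          finally have "T < real J * hh" .
          then show ?thesis using J by (simp add: field_simps)
        qed
        have "(\<Sum>i=1..<m. gw m i * (X T i - chain (emap n R lam m c (T / real J)) m (grid_noise T \<beta> J) (X 0) J i)\<^sup>2)
          \<le> exp (T * ((\<bar>lam\<bar> + 1/2)\<^sup>2 / 4) + E) * E"
        proof (rule chain_error[OF m(1) J(1) \<epsilon>(1) \<omega>(1,2) _ K _ _ Q_def[unfolded S_def], of \<eta> E])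
          show "\<bar>X s i - X t i\<bar> \<le> \<omega>" if "i < m" "s \<in> {0..T}" "t \<in> {0..T}" "\<bar>s - t\<bar> \<le> T / real J" for i s t
            using that TJ hh by (intro \<delta>(2)) auto
          show "T / real J \<le> \<eta>" using TJ hh by linarith
          show "It a b FA \<le> \<eta>" if "0 \<le> a" "a \<le> b" "b \<le> T" "b - a \<le> T / real J" for a b
            using that TJ hh by (intro d(2)) auto
          have "2 * (1 + S) * (LINT s|LT T. rR R s) + kap * \<epsilon> * (LINT s|LT T. A2 s) + kap * (\<epsilon> + ce \<epsilon>) * (LINT s|LT T. G2 m s)
            + Q * \<eta> * (LINT s|LT T. FA s) + ((1 + S) * (mu m * \<omega>) + kap * ce \<epsilon> * (2 * real m * \<omega>) + Q * \<eta>) * T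
            = 2 * (1 + S) * (LINT s|LT T. rR R s) + kap * (LINT s|LT T. A2 s) * \<epsilon> + kap * (\<epsilon> + ce \<epsilon>) * (LINT s|LT T. G2 m s)
            + Q * ((LINT s|LT T. FA s) + T) * \<eta> + z * \<omega>"
            by (simp add: z_def algebra_simps)
          also have "\<dots> \<le> E" using rr \<epsilon>(2) G \<eta>(2) \<omega>(3) by linarith
          finally show "2 * (1 + (\<Sum>i=1..<m. 1 / gw m i)) * (LINT s|LT T. rR R s) + kap * \<epsilon> * (LINT s|LT T. A2 s) + kap * (\<epsilon> + ce \<epsilon>) * (LINT s|LT T. G2 m s)
            + Q * \<eta> * (LINT s|LT T. FA s) + ((1 + (\<Sum>i=1..<m. 1 / gw m i)) * (mu m * \<omega>) + kap * ce \<epsilon> * (2 * real m * \<omega>) + Q * \<eta>) * T \<le> E"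
            unfolding S_def .
        qed
        also have "\<dots> \<le> e" using Ee by (simp only: l_def)
        finally show "(\<Sum>i=1..<m. gw m i * (X T i - chain (emap n R lam m c (T / real J)) m (grid_noise T \<beta> J) (X 0) J i)\<^sup>2) \<le> e" .
      qed
    qed
  qed
qed

end

section \<open>The control\<close>

locale degenerate_noise =
  fixes b :: "nat \<Rightarrow> real" and lam :: real and N :: nat
  assumes b: "\<And>k. 0 \<le> b k" and bN: "\<And>k. 1 \<le> k \<Longrightarrow> k \<le> N \<Longrightarrow> 0 < b k" and lam: "lam < (real N + 1)\<^sup>2 / 2"
begin

text \<open>\<open>gap\<close> belongs to the first mode without control. The parabola
  \<open>\<mu> * (\<mu> - max lam 0)\<close> never falls below
  \<open>- (max lam 0)\<^sup>2 / 4\<close>, so feedback with \<open>gain\<close> lifts the lower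
  modes to \<open>gap\<close> as well. Half of \<open>gap\<close> is kept as \<open>rate\<close>,
  the other half pays for the second order of the Euler step; \<open>energy\<close> is the entropy
  cost in units of \<open>rate\<close>.\<close>

definition gap :: real where "gap = mu (Suc N) * (mu (Suc N) - max lam 0)"
definition gain :: real where "gain = (max lam 0)\<^sup>2 / 8 + gap / 2"
definition rate :: real where "rate = gap / 2"
definition energy :: real where "energy = gain\<^sup>2 * (\<Sum>k=1..N. mu k / b k) / rate"

text \<open>The threshold \<open>(real N + 1)\<^sup>2 / 2\<close> lies below the eigenvalue
  \<open>mu (Suc N)\<close>, which has the further factor \<open>pi\<^sup>2\<close>.\<close>

lemma lam_less_mu: "max lam 0 < mu (Suc N)"
proof -
  have "(real N + 1)\<^sup>2 / 2 \<le> (real N + 1)\<^sup>2 * pi\<^sup>2"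
  proof -
    have "1 \<le> pi\<^sup>2" using pi_ge_two power_mono[of 1 pi 2] by simp
    then have "(real N + 1)\<^sup>2 * 1 \<le> (real N + 1)\<^sup>2 * pi\<^sup>2" by (intro mult_left_mono) auto
    then show ?thesis using zero_le_power2[of "real N + 1"] by linarith
  qed
  also have "\<dots> = mu (Suc N)" by (simp add: mu_def power_mult_distrib)
  finally show ?thesis using lam mu_pos[of "Suc N"] by simp
qed

lemma gap_pos: "0 < gap"
  unfolding gap_def using lam_less_mu by (intro mult_pos_pos mu_pos) auto

lemma rate_pos: "0 < rate" and gain_nonneg: "0 \<le> gain"
  using gap_pos by (auto simp: rate_def gain_def)

lemma energy_nonneg: "0 \<le> energy"
proof -
  have "0 \<le> mu k / b k" for k by (intro divide_nonneg_nonneg b) (simp add: mu_def)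
  then have "0 \<le> (\<Sum>k=1..N. mu k / b k)" by (intro sum_nonneg)
  then show ?thesis unfolding energy_def using rate_pos by simp
qed

text \<open>The gain lifts the spectrum on the modes up to \<open>N\<close>; above \<open>N\<close> the linear part dominates.\<close>

lemma gap_le:
  assumes "1 \<le> i"
  shows "gap \<le> mu i * (mu i - max lam 0) + (if i \<le> N then 2 * gain else 0)"
proof (cases "i \<le> N")
  case True
  have "0 \<le> (mu i - max lam 0 / 2)\<^sup>2" by simp
  then have "- ((max lam 0)\<^sup>2 / 4) \<le> mu i * (mu i - max lam 0)" by (simp add: power2_eq_square algebra_simps)
  then show ?thesis using True unfolding gain_def by simp
next
  case False
  then have "mu (Suc N) \<le> mu i" by (intro mu_mono) simp
  then have "mu (Suc N) * (mu (Suc N) - max lam 0) \<le> mu i * (mu i - max lam 0)"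
    using lam_less_mu by (intro mult_mono) auto
  then show ?thesis using False by (simp add: gap_def)
qed

text \<open>Proportional to the time step, like a drift: against noise of variance
  \<open>h * b i\<close> its entropy is then of order \<open>h\<close>.\<close>

definition control :: "real \<Rightarrow> (nat \<Rightarrow> real) \<Rightarrow> nat \<Rightarrow> real" where
  "control h z i = (if 1 \<le> i \<and> i \<le> N then h * gain * z i else 0)"

lemma half_le_fej: "2 * l \<le> m \<Longrightarrow> i < l \<Longrightarrow> 1/2 \<le> fej m i"
  by (simp add: fej_def field_simps)

lemma emap_lipschitz:
  assumes A: "0 \<le> A" "\<forall>x y. \<forall>i\<in>{1..<m}. \<bar>drift n R lam m c x i - drift n R lam m c y i\<bar> \<le> A * (\<Sum>j=1..<m. \<bar>x j - y j\<bar>)"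
    and h: "0 \<le> h" and i: "i \<in> {1..<m}"
  shows "\<bar>emap n R lam m c h x i - emap n R lam m c h y i\<bar> \<le> (1 + h * A) * (\<Sum>j=1..<m. \<bar>x j - y j\<bar>)"
proof -
  have "\<bar>x i - y i\<bar> \<le> (\<Sum>j=1..<m. \<bar>x j - y j\<bar>)" using i by (intro member_le_sum) auto
  moreover have "h * \<bar>drift n R lam m c x i - drift n R lam m c y i\<bar> \<le> h * (A * (\<Sum>j=1..<m. \<bar>x j - y j\<bar>))"
    using A(2) i h by (intro mult_left_mono) auto
  moreover have "emap n R lam m c h x i - emap n R lam m c h y i = (x i - y i) + h * (drift n R lam m c x i - drift n R lam m c y i)"
    using i by (simp add: emap_def algebra_simps)
  moreover have "\<bar>h * (drift n R lam m c x i - drift n R lam m c y i)\<bar> = h * \<bar>drift n R lam m c x i - drift n R lam m c y i\<bar>"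
    using h by (simp add: abs_mult)
  ultimately show ?thesis by (simp add: distrib_right mult.assoc)
qed

lemma wnorm_le_sum:
  assumes "\<And>i. i \<in> {1..<m} \<Longrightarrow> \<bar>w i\<bar> \<le> B * (\<Sum>j=1..<m. \<bar>z j\<bar>)" "0 \<le> B"
  shows "(wnorm (gw m) {1..<m} w)\<^sup>2 \<le> (\<Sum>i=1..<m. gw m i) * (B\<^sup>2 * (\<Sum>i=1..<m. 1 / gw m i)) * (wnorm (gw m) {1..<m} z)\<^sup>2"
proof -
  let ?s = "\<Sum>j=1..<m. \<bar>z j\<bar>"
  have "(wnorm (gw m) {1..<m} w)\<^sup>2 = (\<Sum>i=1..<m. gw m i * (w i)\<^sup>2)" by (rule wnorm_sq) (auto simp: gw_nonneg)
  also have "\<dots> \<le> (\<Sum>i=1..<m. gw m i * (B\<^sup>2 * ?s\<^sup>2))"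
  proof (intro sum_mono mult_left_mono)
    fix i assume "i \<in> {1..<m}"
    then have "\<bar>w i\<bar>\<^sup>2 \<le> (B * ?s)\<^sup>2" using assms by (intro power_mono) auto
    then show "(w i)\<^sup>2 \<le> B\<^sup>2 * ?s\<^sup>2" by (simp add: power_mult_distrib)
  qed (auto simp: gw_nonneg)
  also have "\<dots> = (\<Sum>i=1..<m. gw m i) * (B\<^sup>2 * ?s\<^sup>2)" by (rule sum_distrib_right[symmetric])
  also have "\<dots> \<le> (\<Sum>i=1..<m. gw m i) * (B\<^sup>2 * ((\<Sum>i=1..<m. 1 / gw m i) * (\<Sum>i=1..<m. gw m i * (z i)\<^sup>2)))"
    by (intro mult_left_mono sum_abs_sq_le sum_nonneg) (auto simp: gw_nonneg intro!: gw_pos)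
  also have "(\<Sum>i=1..<m. gw m i * (z i)\<^sup>2) = (wnorm (gw m) {1..<m} z)\<^sup>2" by (rule wnorm_sq[symmetric]) (auto simp: gw_nonneg)
  finally show ?thesis by (simp only: mult.assoc)
qed

text \<open>The first order in \<open>h\<close> gives \<open>- gap\<close>, by dissipativity and
  feedback. The step restriction bounds the second order by \<open>h * rate\<close>, and
  \<open>gap - rate\<close> is \<open>rate\<close>.\<close>

lemma controlled_step:
  assumes A: "0 \<le> A" "\<forall>x y. \<forall>i\<in>{1..<m}. \<bar>drift n R lam m c x i - drift n R lam m c y i\<bar> \<le> A * (\<Sum>j=1..<m. \<bar>x j - y j\<bar>)"
    and h: "0 < h" "h * ((\<Sum>i=1..<m. gw m i) * ((A + gain)\<^sup>2 * (\<Sum>i=1..<m. 1 / gw m i))) \<le> rate"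
  shows "(wnorm (gw m) {1..<m} (\<lambda>i. emap n R lam m c h x i - emap n R lam m c h y i - control h (\<lambda>i. x i - y i) i))\<^sup>2
     \<le> (1 - h * rate) * (wnorm (gw m) {1..<m} (\<lambda>i. x i - y i))\<^sup>2"
proof -
  define z where "z i = x i - y i" for i
  define \<Delta> where "\<Delta> i = drift n R lam m c x i - drift n R lam m c y i" for i
  define k where "k i = (if 1 \<le> i \<and> i \<le> N then gain * z i else 0)" for i
  let ?n = "\<lambda>z. (wnorm (gw m) {1..<m} z)\<^sup>2"
  have W: "?n z = (\<Sum>i=1..<m. gw m i * (z i)\<^sup>2)" for z by (rule wnorm_sq) (auto simp: gw_nonneg)
  have "?n (\<lambda>i. emap n R lam m c h x i - emap n R lam m c h y i - control h z i) = (\<Sum>i=1..<m. gw m i * (z i + h * (\<Delta> i - k i))\<^sup>2)"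
    unfolding W by (intro sum.cong refl) (auto simp: emap_def control_def z_def \<Delta>_def k_def algebra_simps)
  also have "\<dots> = ?n z + h * (2 * (\<Sum>i=1..<m. gw m i * (z i * \<Delta> i)) - (\<Sum>i=1..<m. gw m i * (2 * (z i * k i)))) + h\<^sup>2 * ?n (\<lambda>i. \<Delta> i - k i)"
    unfolding W sum_distrib_left right_diff_distrib sum_subtractf[symmetric] sum.distrib[symmetric]
    by (intro sum.cong refl) (simp add: power2_eq_square algebra_simps)
  also have "\<dots> \<le> ?n z + h * (- gap * ?n z) + h * (rate * ?n z)"
  proof (intro add_mono mult_left_mono order_refl)
    have "2 * (\<Sum>i=1..<m. gw m i * (z i * \<Delta> i)) \<le> - (\<Sum>i=1..<m. fej m i * (mu i - max lam 0) * (z i)\<^sup>2)"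
      using drift_dissipative[of m x y n R lam c] unfolding z_def \<Delta>_def by linarith
    moreover have "(\<Sum>i=1..<m. gap * (gw m i * (z i)\<^sup>2)) \<le> (\<Sum>i=1..<m. fej m i * (mu i - max lam 0) * (z i)\<^sup>2 + gw m i * (2 * (z i * k i)))"
    proof (rule sum_mono)
      fix i assume i: "i \<in> {1..<m}"
      have "gap * (gw m i * (z i)\<^sup>2) \<le> (mu i * (mu i - max lam 0) + (if i \<le> N then 2 * gain else 0)) * (gw m i * (z i)\<^sup>2)"
        using i by (intro mult_right_mono gap_le mult_nonneg_nonneg) (auto simp: gw_nonneg)
      also have "\<dots> = fej m i * (mu i - max lam 0) * (z i)\<^sup>2 + gw m i * (2 * (z i * k i))"
      proof -
        have "fej m i = gw m i * mu i" using i mu_pos[of i] by (simp add: gw_def)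
        then show ?thesis using i by (simp add: k_def algebra_simps power2_eq_square)
      qed
      finally show "gap * (gw m i * (z i)\<^sup>2) \<le> fej m i * (mu i - max lam 0) * (z i)\<^sup>2 + gw m i * (2 * (z i * k i))" .
    qed
    ultimately show "2 * (\<Sum>i=1..<m. gw m i * (z i * \<Delta> i)) - (\<Sum>i=1..<m. gw m i * (2 * (z i * k i))) \<le> - gap * ?n z"
      unfolding W sum.distrib sum_distrib_left[symmetric] by linarith
    have "?n (\<lambda>i. \<Delta> i - k i) \<le> (\<Sum>i=1..<m. gw m i) * ((A + gain)\<^sup>2 * (\<Sum>i=1..<m. 1 / gw m i)) * ?n z"
    proof (rule wnorm_le_sum)
      fix i assume i: "i \<in> {1..<m}"
      have "\<bar>\<Delta> i\<bar> \<le> A * (\<Sum>j=1..<m. \<bar>z j\<bar>)" using A(2) i by (simp add: \<Delta>_def z_def)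
      moreover have "\<bar>k i\<bar> \<le> gain * (\<Sum>j=1..<m. \<bar>z j\<bar>)"
      proof -
        have "\<bar>k i\<bar> \<le> gain * \<bar>z i\<bar>" using gain_nonneg by (simp add: k_def abs_mult)
        also have "\<dots> \<le> gain * (\<Sum>j=1..<m. \<bar>z j\<bar>)" using i gain_nonneg by (intro mult_left_mono member_le_sum) auto
        finally show ?thesis .
      qed
      ultimately show "\<bar>\<Delta> i - k i\<bar> \<le> (A + gain) * (\<Sum>j=1..<m. \<bar>z j\<bar>)" by (simp add: distrib_right)
    qed (use A gain_nonneg in simp)
    then have "h\<^sup>2 * ?n (\<lambda>i. \<Delta> i - k i) \<le> h\<^sup>2 * ((\<Sum>i=1..<m. gw m i) * ((A + gain)\<^sup>2 * (\<Sum>i=1..<m. 1 / gw m i)) * ?n z)"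
      by (intro mult_left_mono) auto
    also have "\<dots> = h * (h * ((\<Sum>i=1..<m. gw m i) * ((A + gain)\<^sup>2 * (\<Sum>i=1..<m. 1 / gw m i)))) * ?n z"
      by (simp only: power2_eq_square mult.assoc)
    also have "\<dots> \<le> h * rate * ?n z" using h by (intro mult_right_mono mult_left_mono) auto
    finally show "h\<^sup>2 * ?n (\<lambda>i. \<Delta> i - k i) \<le> h * (rate * ?n z)" by (simp only: mult.assoc)
  qed (use h in auto)
  also have "\<dots> = (1 - h * rate) * ?n z" by (simp add: rate_def algebra_simps)
  finally show ?thesis unfolding z_def .
qed

text \<open>The condition on \<open>m\<close> makes the Fejer weights up to \<open>N\<close> at
  least 1/2, so \<open>gw m i\<close> dominates \<open>1 / (2 * mu i)\<close> there and the bound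
  does not depend on \<open>m\<close>. The 1/2 matches the one in the Gaussian entropy.\<close>

lemma control_cost:
  assumes m: "2 * (N + 1) \<le> m" and h: "0 < h"
  shows "(\<Sum>i=1..<m. (control h z i)\<^sup>2 / (2 * (sqrt (h * b i))\<^sup>2)) \<le> energy * (h * rate) * (wnorm (gw m) {1..<m} z)\<^sup>2"
proof -
  have W: "(wnorm (gw m) {1..<m} z)\<^sup>2 = (\<Sum>i=1..<m. gw m i * (z i)\<^sup>2)" by (rule wnorm_sq) (auto simp: gw_nonneg)
  have er: "energy * (h * rate) = h * (gain\<^sup>2 * (\<Sum>k=1..N. mu k / b k))" using rate_pos by (simp add: energy_def)
  have nn: "0 \<le> mu k / b k" for k by (intro divide_nonneg_nonneg b) (simp add: mu_def)
  show ?thesis unfolding W er sum_distrib_left[of _ _ "{1..<m}"]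
  proof (rule sum_mono)
    fix i assume i: "i \<in> {1..<m}"
    show "(control h z i)\<^sup>2 / (2 * (sqrt (h * b i))\<^sup>2) \<le> h * (gain\<^sup>2 * (\<Sum>k=1..N. mu k / b k)) * (gw m i * (z i)\<^sup>2)"
    proof (cases "i \<le> N")
      case False
      then show ?thesis using h i nn by (auto simp: control_def gw_nonneg intro!: mult_nonneg_nonneg sum_nonneg)
    next
      case True
      then have bi: "0 < b i" "0 < mu i" using bN i by (auto intro: mu_pos)
      have f: "1/2 \<le> fej m i" using True by (intro half_le_fej[OF m]) simp
      have "(control h z i)\<^sup>2 / (2 * (sqrt (h * b i))\<^sup>2) = h * (gain\<^sup>2 * (mu i / b i)) * ((1/2) / mu i * (z i)\<^sup>2)"
        using True i h bi by (simp add: control_def power_mult_distrib power2_eq_square field_simps)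
      also have "\<dots> \<le> h * (gain\<^sup>2 * (\<Sum>k=1..N. mu k / b k)) * (gw m i * (z i)\<^sup>2)"
      proof (intro mult_mono mult_left_mono mult_right_mono)
        show "mu i / b i \<le> (\<Sum>k=1..N. mu k / b k)" using True i nn by (intro member_le_sum) auto
        show "1 / 2 / mu i \<le> gw m i" unfolding gw_def using f bi by (intro divide_right_mono) auto
      qed (use h nn bi i gw_nonneg[of i m] in \<open>auto intro!: mult_nonneg_nonneg sum_nonneg\<close>)
      finally show ?thesis .
    qed
  qed
qed

text \<open>The threshold \<open>h0\<close> and the Lipschitz constant \<open>K\<close> may depend
  on \<open>n\<close>, \<open>R\<close> and \<open>m\<close>; the contraction factor and
  \<open>energy\<close> do not.\<close>

lemma controlled_chain_emap:
  assumes m: "2 * (N + 1) \<le> m"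
  shows "\<exists>h0>0. \<forall>h. 0 < h \<longrightarrow> h \<le> h0 \<longrightarrow> (\<exists>K. controlled_chain (emap n R lam m c h) (\<lambda>i. sqrt (h * b i)) [1..<m] (gw m) {1..<m}
      (control h) (1 - h * rate) energy K)"
proof -
  obtain A where A: "0 \<le> A" "\<forall>x y. \<forall>i\<in>{1..<m}. \<bar>drift n R lam m c x i - drift n R lam m c y i\<bar> \<le> A * (\<Sum>j=1..<m. \<bar>x j - y j\<bar>)"
    using drift_lipschitz[of m n R lam c] by blast
  define G where "G = (\<Sum>i=1..<m. gw m i)" define S where "S = (\<Sum>i=1..<m. 1 / gw m i)"
  define L where "L = G * ((A + gain)\<^sup>2 * S)"
  have GS: "0 \<le> G" "0 \<le> S" unfolding G_def S_def by (auto intro!: sum_nonneg simp: gw_nonneg)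
  then have L: "0 \<le> L" by (simp add: L_def)
  \<comment> \<open>The first bound absorbs the second order of the step, the second keeps
    \<open>1 - h * rate\<close> nonnegative.\<close>
  define h0 where "h0 = min (rate / (L + 1)) (1 / rate)"
  have h0: "0 < h0" using rate_pos L by (simp add: h0_def)
  show ?thesis
  proof (rule exI[of _ h0], intro conjI allI impI h0)
    fix h assume h: "0 < h" "h \<le> h0"
    have "h * L \<le> rate / (L + 1) * (L + 1)" using h L by (intro mult_mono) (auto simp: h0_def)
    then have hL: "h * L \<le> rate" using L by simp
    have "h * rate \<le> 1 / rate * rate" using h rate_pos by (intro mult_right_mono) (auto simp: h0_def)
    then have hr: "h * rate \<le> 1" using rate_pos by simp
    have "controlled_chain (emap n R lam m c h) (\<lambda>i. sqrt (h * b i)) [1..<m] (gw m) {1..<m}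
      (control h) (1 - h * rate) energy (sqrt (G * ((1 + h * A)\<^sup>2 * S)))"
    proof
      show "finite {1..<m}" "distinct [1..<m]" "set [1..<m] = {1..<m}" by auto
      show "0 \<le> gw m i" if "i \<in> {1..<m}" for i using that by (simp add: gw_nonneg)
      show "0 \<le> sqrt (h * b i)" for i using h b[of i] by simp
      show "control h z i = 0" if "sqrt (h * b i) = 0" for i z
        using that h bN[of i] by (auto simp: control_def)
      show "0 \<le> 1 - h * rate" "1 - h * rate \<le> 1" using hr h rate_pos by auto
      show "0 \<le> energy" by (rule energy_nonneg)
      show "0 \<le> sqrt (G * ((1 + h * A)\<^sup>2 * S))" using GS by simp
      fix x y :: "nat \<Rightarrow> real"
      have "(wnorm (gw m) {1..<m} (\<lambda>i. emap n R lam m c h x i - emap n R lam m c h y i))\<^sup>2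
        \<le> G * ((1 + h * A)\<^sup>2 * S) * (wnorm (gw m) {1..<m} (\<lambda>i. x i - y i))\<^sup>2"
        unfolding G_def S_def using A h by (intro wnorm_le_sum emap_lipschitz[OF A]) auto
      from real_sqrt_le_mono[OF this]
      show "wnorm (gw m) {1..<m} (\<lambda>i. emap n R lam m c h x i - emap n R lam m c h y i)
        \<le> sqrt (G * ((1 + h * A)\<^sup>2 * S)) * wnorm (gw m) {1..<m} (\<lambda>i. x i - y i)"
        by (simp only: real_sqrt_mult[of _ "_\<^sup>2"] real_sqrt_abs abs_of_nonneg[OF wnorm_nonneg])
      show "(wnorm (gw m) {1..<m} (\<lambda>i. emap n R lam m c h x i - emap n R lam m c h y i - control h (\<lambda>i. x i - y i) i))\<^sup>2
         \<le> (1 - h * rate) * (wnorm (gw m) {1..<m} (\<lambda>i. x i - y i))\<^sup>2"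
        using hL unfolding L_def G_def S_def by (rule controlled_step[OF A h(1)])
    next
      fix z :: "nat \<Rightarrow> real"
      show "(\<Sum>i\<in>{1..<m}. (control h z i)\<^sup>2 / (2 * (sqrt (h * b i))\<^sup>2)) \<le> energy * (1 - (1 - h * rate)) * (wnorm (gw m) {1..<m} z)\<^sup>2"
        using control_cost[OF m h(1), of z] by simp
    qed
    then show "\<exists>K. controlled_chain (emap n R lam m c h) (\<lambda>i. sqrt (h * b i)) [1..<m] (gw m) {1..<m}
      (control h) (1 - h * rate) energy K" by blast
  qed
qed

lemma rate_power: "0 < J \<Longrightarrow> T / real J * rate \<le> 1 \<Longrightarrow> sqrt (1 - T / real J * rate) ^ J \<le> exp (- (rate * T / 2))"
proof -
  assume J: "0 < J" and le: "T / real J * rate \<le> 1"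
  let ?q = "T / real J * rate"
  have "1 - ?q \<le> exp (- ?q)" using exp_ge_add_one_self[of "- ?q"] by simp
  also have "\<dots> = (exp (- ?q / 2))\<^sup>2" by (simp add: power2_eq_square exp_add[symmetric])
  finally have "sqrt (1 - ?q) \<le> exp (- ?q / 2)" by (intro real_le_lsqrt) auto
  then have "sqrt (1 - ?q) ^ J \<le> exp (- ?q / 2) ^ J" using le by (intro power_mono) auto
  also have "\<dots> = exp (real J * (- ?q / 2))" by (rule exp_of_nat_mult[symmetric])
  also have "real J * (- ?q / 2) = - (rate * T / 2)" using J by simp
  finally show ?thesis .
qed

end

section \<open>The law of the Euler chain\<close>

lemma (in stochastic_basis) F_mono_measurable:
  assumes "D \<in> borel_measurable (F s)" "s \<le> t"
  shows "D \<in> borel_measurable (F t)"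
  using assms(1) sets_F_mono[OF assms(2)] by (auto simp: measurable_def space_F)

context degenerate_noise
begin

lemma emap_measurable:
  assumes "0 \<le> h"
  shows "(\<lambda>x. emap n R lam m c h x i) \<in> borel_measurable (PiM UNIV (\<lambda>_. borel))"
proof (cases "i \<in> {1..<m}")
  case False
  then have "(\<lambda>x. emap n R lam m c h x i) = (\<lambda>x. x i)" by (auto simp: emap_def)
  moreover have "(\<lambda>x. x i) \<in> borel_measurable (PiM UNIV (\<lambda>_. borel :: real measure))"
    by (rule measurable_component_singleton) simp
  ultimately show ?thesis by simp
next
  case True
  obtain A where A: "0 \<le> A" "\<forall>x y. \<forall>i\<in>{1..<m}. \<bar>drift n R lam m c x i - drift n R lam m c y i\<bar> \<le> A * (\<Sum>j=1..<m. \<bar>x j - y j\<bar>)"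
    using drift_lipschitz[of m n R lam c] by blast
  define S where "S = (\<Sum>i=1..<m. 1 / gw m i)"
  have S: "0 \<le> S" unfolding S_def by (auto intro!: sum_nonneg simp: gw_nonneg)
  have le: "(\<Sum>j=1..<m. \<bar>z j\<bar>) \<le> sqrt S * wnorm (gw m) {1..<m} z" for z
  proof -
    have "(\<Sum>j=1..<m. \<bar>z j\<bar>)\<^sup>2 \<le> S * (\<Sum>i=1..<m. gw m i * (z i)\<^sup>2)"
      unfolding S_def by (rule sum_abs_sq_le) (auto intro!: gw_pos)
    also have "(\<Sum>i=1..<m. gw m i * (z i)\<^sup>2) = (wnorm (gw m) {1..<m} z)\<^sup>2" by (rule wnorm_sq[symmetric]) (auto simp: gw_nonneg)
    finally have "(\<Sum>j=1..<m. \<bar>z j\<bar>) \<le> sqrt (S * (wnorm (gw m) {1..<m} z)\<^sup>2)" by (rule real_le_rsqrt)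
    then show ?thesis by (simp add: real_sqrt_mult)
  qed
  show ?thesis
  proof (rule wnorm_lipschitz_measurable[where L="(1 + h * A) * sqrt S" and g="gw m" and I="{1..<m}"])
    show "0 \<le> (1 + h * A) * sqrt S" using S A assms by simp
    fix x y
    have "\<bar>emap n R lam m c h x i - emap n R lam m c h y i\<bar> \<le> (1 + h * A) * (\<Sum>j=1..<m. \<bar>x j - y j\<bar>)"
      by (rule emap_lipschitz[OF A assms True])
    also have "\<dots> \<le> (1 + h * A) * (sqrt S * wnorm (gw m) {1..<m} (\<lambda>i. x i - y i))"
      using A assms by (intro mult_left_mono le) auto
    finally show "\<bar>emap n R lam m c h x i - emap n R lam m c h y i\<bar> \<le> (1 + h * A) * sqrt S * wnorm (gw m) {1..<m} (\<lambda>i. x i - y i)"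
      by (simp only: mult.assoc)
  qed
qed

context
  fixes M :: "'w measure" and F W and T c :: real and J m n R :: nat and x :: "nat \<Rightarrow> real"
  assumes sb: "stochastic_basis M F" and W: "cylindrical_wiener M F W" and T: "0 < T" and J: "1 \<le> J"
begin

interpretation stochastic_basis M F by (rule sb)

abbreviation "euler \<equiv> emap n R lam m c (T / real J)"
abbreviation "euler_chain k \<omega> \<equiv> chain euler m (grid_noise T (\<lambda>t i. W t (psi b i) \<omega>) J) x k"

lemma euler_adapted: "(\<lambda>\<omega>. euler_chain k \<omega> i) \<in> borel_measurable (F (T * (real k / real J)))"
proof (induction k arbitrary: i)
  case 0
  show ?case by simp
next
  case (Suc k)
  let ?s = "T * (real k / real J)" and ?t = "T * (real (Suc k) / real J)"
  have st: "0 \<le> ?s" "?s \<le> ?t" using T by (auto intro!: mult_left_mono divide_right_mono)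
  have "(\<lambda>\<omega> i. euler_chain k \<omega> i) \<in> F ?s \<rightarrow>\<^sub>M PiM UNIV (\<lambda>_. borel)"
    by (rule measurable_PiM_single'[OF Suc]) simp
  then have "(\<lambda>\<omega>. euler (euler_chain k \<omega>) i) \<in> borel_measurable (F ?s)"
    by (rule measurable_compose[OF _ emap_measurable]) (use T in simp)
  then have e: "(\<lambda>\<omega>. euler (euler_chain k \<omega>) i) \<in> borel_measurable (F ?t)" by (rule F_mono_measurable) (rule st)
  have "W ?s (psi b i) \<in> borel_measurable (F ?t)"
    by (rule F_mono_measurable[OF cylindrical_wienerD(1)[OF W st(1) psi_L2] st(2)])
  moreover have "W ?t (psi b i) \<in> borel_measurable (F ?t)"
    by (rule cylindrical_wienerD(1)[OF W order_trans[OF st] psi_L2])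
  ultimately have "(\<lambda>\<omega>. W ?t (psi b i) \<omega> - W ?s (psi b i) \<omega>) \<in> borel_measurable (F ?t)"
    by (intro borel_measurable_diff)
  then have "(\<lambda>\<omega>. euler (euler_chain k \<omega>) i + (if i \<in> {1..<m} then W ?t (psi b i) \<omega> - W ?s (psi b i) \<omega> else 0)) \<in> borel_measurable (F ?t)"
    using e by (cases "i \<in> {1..<m}") (simp_all only: if_True if_False borel_measurable_add borel_measurable_const)
  then show ?case by (simp only: chain.simps grid_noise_def[of T _ J k i])
qed

text \<open>The last step is removed first: its noise is fresh with respect to the past, and
  averaging over it turns \<open>\<phi>\<close> into another admissible test function. Hence the
  induction runs over all \<open>\<phi>\<close>.\<close>

lemma euler_law:
  assumes cc: "controlled_chain euler (\<lambda>i. sqrt (T / real J * b i)) [1..<m] (gw m) {1..<m} s a C K"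
    and \<phi>: "blip (wnorm (gw m) {1..<m}) \<phi>"
  shows "(LINT \<omega>|M. \<phi> (euler_chain k \<omega>)) = (qop euler (\<lambda>i. sqrt (T / real J * b i)) [1..<m] ^^ k) \<phi> x"
  using \<phi>
proof (induction k arbitrary: \<phi>)
  case 0
  show ?case using prob_space by simp
next
  case (Suc k)
  let ?s = "T * (real k / real J)" and ?t = "T * (real (Suc k) / real J)"
  let ?\<sigma> = "\<lambda>i. sqrt (T / real J * b i)"
  have st: "0 \<le> ?s" "?s < ?t" using T J by (auto intro!: mult_strict_left_mono divide_strict_right_mono)
  have d: "?t - ?s = T / real J" by (simp add: add_divide_distrib distrib_left)
  have \<sigma>: "0 \<le> ?\<sigma> i" for i using T b[of i] by simp
  have fr: "fresh (sets (F ?s)) (\<lambda>i \<omega>. W ?t (psi b i) \<omega> - W ?s (psi b i) \<omega>) ?\<sigma> [1..<m]"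
    using wiener_fresh[OF W st, of "[1..<m]" b] b unfolding d by simp
  have e: "(\<lambda>\<omega>. euler (euler_chain k \<omega>) i) \<in> borel_measurable (F ?s)" for i
  proof -
    have "(\<lambda>\<omega> i. euler_chain k \<omega> i) \<in> F ?s \<rightarrow>\<^sub>M PiM UNIV (\<lambda>_. borel)"
      by (rule measurable_PiM_single'[OF euler_adapted]) simp
    then show ?thesis by (rule measurable_compose[OF _ emap_measurable]) (use T in simp)
  qed
  have "(LINT \<omega>|M. \<phi> (euler_chain (Suc k) \<omega>))
    = (LINT \<omega>|M. \<phi> (\<lambda>i. euler (euler_chain k \<omega>) i + (if i \<in> set [1..<m] then W ?t (psi b i) \<omega> - W ?s (psi b i) \<omega> else 0)))"
    by (simp only: chain.simps grid_noise_def set_upt)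
  also have "\<dots> = (LINT \<omega>|M. gops ?\<sigma> [1..<m] \<phi> (euler (euler_chain k \<omega>)))"
  proof (rule expectation_gops[OF _ Suc.prems \<sigma> fr])
    show "(\<lambda>\<omega>. euler (euler_chain k \<omega>) i) -` D \<inter> space M \<in> sets (F ?s)" if "D \<in> sets borel" for i D
      using measurable_sets[OF e that, of i] by (simp add: space_F)
  qed auto
  also have "\<dots> = (LINT \<omega>|M. qop euler ?\<sigma> [1..<m] \<phi> (euler_chain k \<omega>))" by (simp only: qop_def)
  also have "\<dots> = (qop euler ?\<sigma> [1..<m] ^^ k) (qop euler ?\<sigma> [1..<m] \<phi>) x"
    by (rule Suc.IH[OF controlled_chain.blip_Q[OF cc Suc.prems]])
  also have "\<dots> = (qop euler ?\<sigma> [1..<m] ^^ Suc k) \<phi> x" by (simp only: funpow_Suc_right comp_def)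
  finally show ?case .
qed

lemma euler_measurable: "(\<lambda>\<omega>. euler_chain k \<omega>) \<in> M \<rightarrow>\<^sub>M PiM UNIV (\<lambda>_. borel)"
  by (rule measurable_PiM_single'[OF F_measurable_M[OF euler_adapted]]) simp

end

end

section \<open>State spaces\<close>

lemma metric_lipschitz_continuous_map:
  fixes f :: "'a \<Rightarrow> real"
  assumes "Metric_space S d" and L: "0 \<le> L" "\<And>x y. x \<in> S \<Longrightarrow> y \<in> S \<Longrightarrow> \<bar>f x - f y\<bar> \<le> L * d x y"
  shows "continuous_map (Metric_space.mtopology S d) euclideanreal f"
proof -
  interpret Metric_space S d by fact
  have "continuous_map mtopology Met_TC.mtopology f"
    unfolding Met_TC.continuous_map_to_metric
  proof (intro ballI allI impI)
    fix x \<epsilon> assume x: "x \<in> topspace mtopology" and \<epsilon>: "(0::real) < \<epsilon>"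
    have "f y \<in> Met_TC.mball (f x) \<epsilon>" if y: "y \<in> mball x (\<epsilon> / (L + 1))" for y
    proof -
      have "\<bar>f x - f y\<bar> \<le> L * d x y" using y x by (intro L) auto
      also have "\<dots> \<le> (L + 1) * d x y" by (simp add: distrib_right)
      also have "\<dots> < (L + 1) * (\<epsilon> / (L + 1))" using y L by (intro mult_strict_left_mono) auto
      finally show ?thesis using L by (simp add: dist_real_def)
    qed
    then show "\<exists>U. openin mtopology U \<and> x \<in> U \<and> (\<forall>y\<in>U. f y \<in> Met_TC.mball (f x) \<epsilon>)"
      using x \<epsilon> L by (intro exI[of _ "mball x (\<epsilon> / (L + 1))"]) auto
  qed
  then show ?thesis by simp
qed

lemma space_borel_of: "space (borel_of E) = topspace E"
  unfolding borel_of_def by (rule space_measure_of) (auto dest: openin_subset)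

lemma continuous_map_borel_measurable:
  fixes f :: "'a \<Rightarrow> real"
  assumes "continuous_map E euclideanreal f"
  shows "f \<in> borel_measurable (borel_of E)"
proof (rule borel_measurableI)
  fix S :: "real set" assume "open S"
  then have "openin E {x \<in> topspace E. f x \<in> S}" by (intro openin_continuous_map_preimage[OF assms]) auto
  then have "{x \<in> topspace E. f x \<in> S} \<in> sets (borel_of E)"
    unfolding borel_of_def by (subst sets_measure_of) (auto dest: openin_subset)
  moreover have "f -` S \<inter> space (borel_of E) = {x \<in> topspace E. f x \<in> S}" by (auto simp: space_borel_of)
  ultimately show "f -` S \<inter> space (borel_of E) \<in> sets (borel_of E)" by simp
qed

lemma topspace_H: "topspace top_H = H" and topspace_Hc: "topspace (top_Hc c) = Hc c"
  unfolding top_H_def top_Hc_def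
  by (rule Metric_space.topspace_mtopology[OF Metric_space_H], rule Metric_space.topspace_mtopology[OF Metric_space_Hc])

lemma eigval_powr: "i \<in> {1..} \<Longrightarrow> (- eigval i) powr (-1) * t = t / mu i"
  using mu_pos[of i] by (simp add: eigval_mu powr_minus_divide)

lemma H_iff: "z \<in> H \<longleftrightarrow> (\<lambda>i. (z i)\<^sup>2 / mu i) summable_on {1..}"
  unfolding V_def mem_Collect_eq by (rule summable_on_cong) (rule eigval_powr)

lemma seminorm_H: "seminorm_V (-1) z = sqrt (\<Sum>\<^sub>\<infinity>i\<in>{1..}. (z i)\<^sup>2 / mu i)"
  unfolding seminorm_V_def by (rule arg_cong[where f=sqrt], rule infsum_cong) (rule eigval_powr)

lemma seminorm_H_sq: "(seminorm_V (-1) z)\<^sup>2 = (\<Sum>\<^sub>\<infinity>i\<in>{1..}. (z i)\<^sup>2 / mu i)"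
  unfolding seminorm_H by (rule real_sqrt_pow2) (auto intro!: infsum_nonneg divide_nonneg_nonneg simp: mu_def)

lemma finite_sum_le_seminorm:
  assumes "z \<in> H" "finite A" "A \<subseteq> {1..}"
  shows "(\<Sum>i\<in>A. (z i)\<^sup>2 / mu i) \<le> (seminorm_V (-1) z)\<^sup>2"
  unfolding seminorm_H_sq by (rule finite_sum_le_infsum) (use assms H_iff in \<open>auto simp: mu_def\<close>)

lemma coordinate_lipschitz:
  assumes "x \<in> H" "y \<in> H"
  shows "\<bar>x i - y i\<bar> \<le> max 1 (sqrt (mu i)) * dist_H x y"
proof -
  let ?s = "seminorm_V (-1) (\<lambda>i. x i - y i)"
  have dn: "0 \<le> dist_H x y" by (rule Metric_space.nonneg[OF Metric_space_H])
  have d2: "(dist_H x y)\<^sup>2 = ?s\<^sup>2 + (x 0 - y 0)\<^sup>2" by (simp add: dist_H_def norm_V_def)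
  show ?thesis
  proof (cases "i = 0")
    case True
    have "(x 0 - y 0)\<^sup>2 \<le> (dist_H x y)\<^sup>2" unfolding d2 by simp
    then have "\<bar>x 0 - y 0\<bar> \<le> dist_H x y" using dn abs_le_square_iff[of "x 0 - y 0" "dist_H x y"] by simp
    also have "\<dots> \<le> max 1 (sqrt (mu i)) * dist_H x y" using dn mult_right_mono[of 1 "max 1 (sqrt (mu i))" "dist_H x y"] by simp
    finally show ?thesis using True by simp
  next
    case False
    then have mi: "0 < mu i" by (intro mu_pos) simp
    have "(\<Sum>j\<in>{i}. (x j - y j)\<^sup>2 / mu j) \<le> ?s\<^sup>2"
      using False by (intro finite_sum_le_seminorm V_diff assms) auto
    also have "\<dots> \<le> (dist_H x y)\<^sup>2" unfolding d2 by simp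
    finally have "(x i - y i)\<^sup>2 \<le> mu i * (dist_H x y)\<^sup>2" using mi by (simp add: field_simps)
    also have "\<dots> = (sqrt (mu i) * dist_H x y)\<^sup>2" using mi by (simp add: power_mult_distrib)
    finally have "\<bar>x i - y i\<bar> \<le> sqrt (mu i) * dist_H x y"
      using dn mi abs_le_square_iff[of "x i - y i" "sqrt (mu i) * dist_H x y"] by simp
    also have "\<dots> \<le> max 1 (sqrt (mu i)) * dist_H x y" using dn by (intro mult_right_mono) auto
    finally show ?thesis .
  qed
qed

lemma continuous_map_coordinate: "continuous_map top_H euclideanreal (\<lambda>z. z i)"
  unfolding top_H_def by (rule metric_lipschitz_continuous_map[OF Metric_space_H _ coordinate_lipschitz]) auto

section \<open>Testing the equation with eigenfunctions\<close>

lemma dual_pair_eigfun: "dual_pair z (eigfun i) = z i"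
proof -
  have "(\<lambda>j. z j * inner01 (eigfun i) (eigfun j)) = (\<lambda>j. if j = i then z j else 0)" by (auto simp: inner01_eigfun)
  then show ?thesis unfolding dual_pair_def using sums_single[of i z] by (simp add: sums_iff)
qed

lemma neumann_laplacian_scale:
  assumes "neumann_laplacian h g"
  shows "neumann_laplacian (\<lambda>\<theta>. r * h \<theta>) (\<lambda>\<theta>. r * g \<theta>)"
proof -
  obtain h' where g: "g \<in> L2_01" and h': "\<forall>\<theta>\<in>{0..1}. (h has_real_derivative h' \<theta>) (at \<theta> within {0..1})"
    "\<forall>\<theta>\<in>{0..1}. h' \<theta> = h' 0 + (LINT s:{0..\<theta>}|lborel. g s)" "h' 0 = 0" "h' 1 = 0"
    using assms unfolding neumann_laplacian_def by blast
  show ?thesis unfolding neumann_laplacian_def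
  proof (intro conjI exI[of _ "\<lambda>\<theta>. r * h' \<theta>"] ballI)
    have "integrable leb01 (\<lambda>\<theta>. r\<^sup>2 * (g \<theta>)\<^sup>2)" using g by (simp add: L2_01_def)
    moreover have "(\<lambda>\<theta>. r * g \<theta>) \<in> borel_measurable leb01" using g by (intro borel_measurable_times) (auto simp: L2_01_def)
    ultimately show "(\<lambda>\<theta>. r * g \<theta>) \<in> L2_01" by (simp add: L2_01_def power_mult_distrib)
    fix \<theta> :: real assume \<theta>: "\<theta> \<in> {0..1}"
    show "((\<lambda>\<theta>. r * h \<theta>) has_real_derivative r * h' \<theta>) (at \<theta> within {0..1})"
      by (rule DERIV_cmult[OF h'(1)[rule_format, OF \<theta>]])
    show "r * h' \<theta> = r * h' 0 + (LINT s:{0..\<theta>}|lborel. r * g s)"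
      using h'(2)[rule_format, OF \<theta>] by (simp add: distrib_left)
  qed (use h' in auto)
qed

lemma diag_op_eigfun: "diag_op a (eigfun i) (\<lambda>\<theta>. (if i = 0 then 0 else a i) * eigfun i \<theta>)"
  unfolding diag_op_def
proof (intro conjI)
  show "eigfun i \<in> L2_01" by (rule L2_01_bounded[OF eigfun_measurable abs_eigfun_le2])
  show "(\<lambda>\<theta>. (if i = 0 then 0 else a i) * eigfun i \<theta>) \<in> L2_01"
  proof (rule L2_01_bounded)
    show "(\<lambda>\<theta>. (if i = 0 then 0 else a i) * eigfun i \<theta>) \<in> borel_measurable borel"
      by (intro borel_measurable_times eigfun_measurable) simp
    show "\<bar>(if i = 0 then 0 else a i) * eigfun i \<theta>\<bar> \<le> \<bar>a i\<bar> * 2" for \<theta>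
      unfolding abs_mult by (intro mult_mono abs_eigfun_le2) auto
  qed
  show "(\<lambda>m. LINT \<theta>|leb01. ((if i = 0 then 0 else a i) * eigfun i \<theta> - (\<Sum>k=1..m. a k * inner01 (eigfun i) (eigfun k) * eigfun k \<theta>))\<^sup>2) \<longlonglongrightarrow> 0"
  proof (intro tendsto_eventually eventually_sequentiallyI[of i])
    fix m assume m: "i \<le> m"
    have "(\<Sum>k=1..m. a k * inner01 (eigfun i) (eigfun k) * eigfun k \<theta>) = (\<Sum>k=1..m. if k = i then a i * eigfun i \<theta> else 0)" for \<theta>
      by (intro sum.cong refl) (simp add: inner01_eigfun)
    then have "(\<Sum>k=1..m. a k * inner01 (eigfun i) (eigfun k) * eigfun k \<theta>) = (if i = 0 then 0 else a i) * eigfun i \<theta>" for \<theta>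
      using m by simp
    then show "(LINT \<theta>|leb01. ((if i = 0 then 0 else a i) * eigfun i \<theta> - (\<Sum>k=1..m. a k * inner01 (eigfun i) (eigfun k) * eigfun k \<theta>))\<^sup>2) = 0"
      by simp
  qed
qed

text \<open>Testing with \<open>eigfun i\<close> gives the equation of mode \<open>i\<close>. For
  \<open>i = 0\<close> eigenvalue and noise vanish, so the average is conserved. Rational times and
  modes are countable, which collects the exceptional null sets into one.\<close>

proposition AE_galerkin_path:
  assumes sb: "stochastic_basis M F" and W: "cylindrical_wiener M F W"
    and sol: "approx_solution M F W b lam n x X" and T: "0 < T" and x: "x \<in> Hc c"
  shows "AE \<omega> in M. X 0 \<omega> = x \<and> (\<exists>u. galerkin_path T lam c n (\<lambda>t. X t \<omega>) u (\<lambda>t i. W t (psi b i) \<omega>))"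
proof -
  obtain u where X0: "AE \<omega> in M. X 0 \<omega> = x"
    and path: "AE \<omega> in M. \<forall>T>0. continuous_map (top_of_set {0..T}) top_H (\<lambda>t. X t \<omega>) \<and> path_in_Lp (2 * n + 2) T (\<lambda>t. X t \<omega>) (u \<omega>)"
    and eqn: "\<And>h Ah AAh \<psi> t. 0 \<le> t \<Longrightarrow> neumann_laplacian h Ah \<and> neumann_laplacian Ah AAh \<and> diag_op (\<lambda>k. sqrt (b k)) h \<psi> \<Longrightarrow>
        (AE \<omega> in M. dual_pair (X t \<omega>) h + 1/2 * (LINT s:{0..t}|lborel. inner01 (\<lambda>\<theta>. u \<omega> (s, \<theta>)) AAh +
            inner01 (\<lambda>\<theta>. f_approx lam n (u \<omega> (s, \<theta>))) Ah) = dual_pair x h + W t \<psi> \<omega>)"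
    using sol unfolding approx_solution_def by blast
  let ?\<psi> = "\<lambda>i \<theta>. (if i = 0 then 0 else sqrt (b i)) * eigfun i \<theta>"
  have mode: "AE \<omega> in M. X t \<omega> i + 1/2 * (LINT s:{0..t}|lborel. inner01 (\<lambda>\<theta>. u \<omega> (s, \<theta>)) (\<lambda>\<theta>. eigval i * (eigval i * eigfun i \<theta>)) +
            inner01 (\<lambda>\<theta>. f_approx lam n (u \<omega> (s, \<theta>))) (\<lambda>\<theta>. eigval i * eigfun i \<theta>)) = x i + W t (?\<psi> i) \<omega>"
    if "0 \<le> t" for t i
    using eqn[OF that, of "eigfun i" "\<lambda>\<theta>. eigval i * eigfun i \<theta>" "\<lambda>\<theta>. eigval i * (eigval i * eigfun i \<theta>)" "?\<psi> i"]
      neumann_laplacian_eigfun[of i] neumann_laplacian_scale[OF neumann_laplacian_eigfun, of "eigval i" i] diag_op_eigfun[of "\<lambda>k. sqrt (b k)" i]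
    unfolding dual_pair_eigfun by blast
  have W0: "AE \<omega> in M. W t (?\<psi> 0) \<omega> = 0" if "0 \<le> t" for t
    using cylindrical_wienerD(3)[OF W that, of "?\<psi> 0"] L2_01_bounded[of "?\<psi> 0" 0] by (simp add: inner01_def)
  define Q where "Q = {q :: real. q \<in> \<rat> \<and> 0 \<le> q \<and> q \<le> 1}"
  have Q: "countable Q" unfolding Q_def using countable_rat by (rule countable_subset[rotated]) auto
  have Tq: "0 \<le> T * q" if "q \<in> Q" for q using that T by (simp add: Q_def)
  have modes: "AE \<omega> in M. \<forall>q\<in>Q. \<forall>i. X (T * q) \<omega> i + 1/2 * (LINT s:{0..T * q}|lborel. inner01 (\<lambda>\<theta>. u \<omega> (s, \<theta>)) (\<lambda>\<theta>. eigval i * (eigval i * eigfun i \<theta>)) +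
            inner01 (\<lambda>\<theta>. f_approx lam n (u \<omega> (s, \<theta>))) (\<lambda>\<theta>. eigval i * eigfun i \<theta>)) = x i + W (T * q) (?\<psi> i) \<omega>"
    unfolding AE_ball_countable[OF Q] AE_all_countable using mode Tq by blast
  have zero: "AE \<omega> in M. \<forall>q\<in>Q. W (T * q) (?\<psi> 0) \<omega> = 0"
    unfolding AE_ball_countable[OF Q] using W0 Tq by blast
  show ?thesis
    using X0 path modes zero
  proof eventually_elim
    case (elim \<omega>)
    have "galerkin_path T lam c n (\<lambda>t. X t \<omega>) (u \<omega>) (\<lambda>t i. W t (psi b i) \<omega>)"
    proof
      show "0 < T" by (rule T)
      show "continuous_on {0..T} (\<lambda>t. X t \<omega> i)" for i
      proof -
        have "continuous_map (top_of_set {0..T}) top_H (\<lambda>t. X t \<omega>)" using elim(2) T by blast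
        from continuous_map_compose[OF this continuous_map_coordinate, of i] show ?thesis by (simp add: comp_def)
      qed
      show "path_in_Lp (2 * n + 2) T (\<lambda>t. X t \<omega>) (u \<omega>)" using elim(2) T by blast
      fix q :: real assume q: "q \<in> \<rat>" "0 \<le> q" "q \<le> 1"
      then have qQ: "q \<in> Q" by (simp add: Q_def)
      show "X (T * q) \<omega> 0 = c"
        using elim(3)[rule_format, OF qQ, of 0] elim(4)[rule_format, OF qQ] x by (simp add: eigval_def inner01_def Hc_def)
      fix i :: nat assume i: "1 \<le> i"
      have "?\<psi> i = psi b i" using i by (auto simp: psi_def)
      then show "X (T * q) \<omega> i + 1/2 * (LINT s:{0..T * q}|lborel. inner01 (\<lambda>\<theta>. u \<omega> (s, \<theta>)) (\<lambda>\<theta>. eigval i * (eigval i * eigfun i \<theta>)) +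
            inner01 (\<lambda>\<theta>. f_approx lam n (u \<omega> (s, \<theta>))) (\<lambda>\<theta>. eigval i * eigfun i \<theta>)) = X 0 \<omega> i + W (T * q) (psi b i) \<omega>"
        using elim(3)[rule_format, OF qQ, of i] elim(1) by simp
    qed
    then show ?case using elim(1) by blast
  qed
qed

section \<open>Passing to the limit\<close>

lemma (in prob_space) nn_integral_eventually_less:
  fixes v :: "nat \<Rightarrow> 'a \<Rightarrow> ennreal" and B e :: ennreal
  assumes v: "\<And>k. v k \<in> borel_measurable M" "\<And>k \<omega>. v k \<omega> \<le> B" "B < \<infinity>" and e: "(\<integral>\<^sup>+\<omega>. limsup (\<lambda>k. v k \<omega>) \<partial>M) < e"
  shows "\<exists>k0. \<forall>k\<ge>k0. (\<integral>\<^sup>+\<omega>. v k \<omega> \<partial>M) < e"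
proof -
  have "limsup (\<lambda>k. \<integral>\<^sup>+\<omega>. v k \<omega> \<partial>M) \<le> (\<integral>\<^sup>+\<omega>. limsup (\<lambda>k. v k \<omega>) \<partial>M)"
    by (rule nn_integral_limsup[where w="\<lambda>_. B"]) (use v emeasure_space_1 in auto)
  also note e
  finally have "\<forall>\<^sub>F k in sequentially. (\<integral>\<^sup>+\<omega>. v k \<omega> \<partial>M) < e" by (rule Limsup_lessD)
  then show ?thesis unfolding eventually_sequentially .
qed

text \<open>The thresholds depend on \<open>\<omega>\<close> and on the earlier indices, so
  dominated convergence along a single sequence does not apply. Nested upper limits are measurable,
  and the reversed Fatou lemma is used once for each of the three limits.\<close>

lemma (in prob_space) iterated_limit_expectation:
  fixes f :: "nat \<Rightarrow> nat \<Rightarrow> nat \<Rightarrow> 'a \<Rightarrow> real"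
  assumes meas: "\<And>m R J. f m R J \<in> borel_measurable M" and f: "\<And>m R J \<omega>. 0 \<le> f m R J \<omega>" "\<And>m R J \<omega>. f m R J \<omega> \<le> B"
    and lim: "AE \<omega> in M. \<forall>e>0. \<exists>m0. \<forall>m\<ge>m0. \<exists>R0. \<forall>R\<ge>R0. \<exists>J0. \<forall>J\<ge>J0. f m R J \<omega> \<le> e"
    and e: "0 < e"
  shows "\<exists>m0. \<forall>m\<ge>m0. \<exists>R0. \<forall>R\<ge>R0. \<exists>J0. \<forall>J\<ge>J0. (LINT \<omega>|M. f m R J \<omega>) < e"
proof -
  define v1 where "v1 m R \<omega> = limsup (\<lambda>J. ennreal (f m R J \<omega>))" for m R \<omega>
  define v2 where "v2 m \<omega> = limsup (\<lambda>R. v1 m R \<omega>)" for m \<omega>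
  have v0m: "(\<lambda>\<omega>. ennreal (f m R J \<omega>)) \<in> borel_measurable M" for m R J using meas by measurable
  have v1m: "v1 m R \<in> borel_measurable M" for m R unfolding v1_def[abs_def] using v0m by (intro borel_measurable_limsup)
  have v2m: "v2 m \<in> borel_measurable M" for m unfolding v2_def[abs_def] using v1m by (intro borel_measurable_limsup)
  have b0: "ennreal (f m R J \<omega>) \<le> ennreal B" for m R J \<omega> using f(2) by (rule ennreal_leI)
  have b1: "v1 m R \<omega> \<le> ennreal B" for m R \<omega> unfolding v1_def by (rule Limsup_bounded) (simp add: b0)
  have b2: "v2 m \<omega> \<le> ennreal B" for m \<omega> unfolding v2_def by (rule Limsup_bounded) (simp add: b1)
  have "AE \<omega> in M. limsup (\<lambda>m. v2 m \<omega>) \<le> 0"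
    using lim
  proof eventually_elim
    case (elim \<omega>)
    show ?case
    proof (rule ennreal_le_epsilon)
      fix r :: real assume "0 < r"
      then obtain m0 where m0: "\<forall>m\<ge>m0. \<exists>R0. \<forall>R\<ge>R0. \<exists>J0. \<forall>J\<ge>J0. f m R J \<omega> \<le> r" using elim by blast
      have "limsup (\<lambda>m. v2 m \<omega>) \<le> ennreal r"
      proof (rule Limsup_bounded, rule eventually_sequentiallyI[of m0])
        fix m assume "m0 \<le> m"
        then obtain R0 where R0: "\<forall>R\<ge>R0. \<exists>J0. \<forall>J\<ge>J0. f m R J \<omega> \<le> r" using m0 by blast
        show "v2 m \<omega> \<le> ennreal r"
          unfolding v2_def
        proof (rule Limsup_bounded, rule eventually_sequentiallyI[of R0])
          fix R assume "R0 \<le> R"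
          then obtain J0 where J0: "\<forall>J\<ge>J0. f m R J \<omega> \<le> r" using R0 by blast
          show "v1 m R \<omega> \<le> ennreal r"
            unfolding v1_def by (rule Limsup_bounded, rule eventually_sequentiallyI[of J0]) (use J0 in \<open>auto intro: ennreal_leI\<close>)
        qed
      qed
      then show "limsup (\<lambda>m. v2 m \<omega>) \<le> 0 + ennreal r" by simp
    qed
  qed
  then have "(\<integral>\<^sup>+\<omega>. limsup (\<lambda>m. v2 m \<omega>) \<partial>M) \<le> (\<integral>\<^sup>+\<omega>. 0 \<partial>M)" by (rule nn_integral_mono_AE)
  then have "(\<integral>\<^sup>+\<omega>. limsup (\<lambda>m. v2 m \<omega>) \<partial>M) < ennreal e" using e by simp
  from nn_integral_eventually_less[OF v2m b2 _ this] obtain m0 where m0: "\<And>m. m \<ge> m0 \<Longrightarrow> (\<integral>\<^sup>+\<omega>. v2 m \<omega> \<partial>M) < ennreal e" by auto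
  show ?thesis
  proof (rule exI[of _ m0], intro allI impI)
    fix m assume "m0 \<le> m"
    from nn_integral_eventually_less[OF v1m b1 _ m0[OF this, unfolded v2_def]]
    obtain R0 where R0: "\<And>R. R \<ge> R0 \<Longrightarrow> (\<integral>\<^sup>+\<omega>. v1 m R \<omega> \<partial>M) < ennreal e" by auto
    show "\<exists>R0. \<forall>R\<ge>R0. \<exists>J0. \<forall>J\<ge>J0. (LINT \<omega>|M. f m R J \<omega>) < e"
    proof (rule exI[of _ R0], intro allI impI)
      fix R assume "R0 \<le> R"
      from nn_integral_eventually_less[OF v0m b0 _ R0[OF this, unfolded v1_def]]
      obtain J0 where J0: "\<And>J. J \<ge> J0 \<Longrightarrow> (\<integral>\<^sup>+\<omega>. ennreal (f m R J \<omega>) \<partial>M) < ennreal e" by auto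
      show "\<exists>J0. \<forall>J\<ge>J0. (LINT \<omega>|M. f m R J \<omega>) < e"
      proof (rule exI[of _ J0], intro allI impI)
        fix J assume "J0 \<le> J"
        have "integrable M (f m R J)" by (rule integrable_const_bound[where B=B]) (use f meas in auto)
        then have "(\<integral>\<^sup>+\<omega>. ennreal (f m R J \<omega>) \<partial>M) = ennreal (LINT \<omega>|M. f m R J \<omega>)" using f by (intro nn_integral_eq_integral) auto
        then show "(LINT \<omega>|M. f m R J \<omega>) < e" using J0[OF \<open>J0 \<le> J\<close>] f e by (simp add: ennreal_less_iff)
      qed
    qed
  qed
qed

text \<open>A projection into \<open>Hc c\<close> defined on all sequences. It turns a test function
  on \<open>Hc c\<close> into a function of finitely many modes, for which the Fejer weights are at
  least 1/2 when \<open>m\<close> is large.\<close>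

definition low_modes :: "real \<Rightarrow> nat \<Rightarrow> (nat \<Rightarrow> real) \<Rightarrow> nat \<Rightarrow> real" where
  "low_modes c l z i = (if i = 0 then c else if i < l then z i else 0)"

lemma low_modes_Hc: "low_modes c l z \<in> Hc c"
proof -
  have "(\<lambda>i. (low_modes c l z i)\<^sup>2 / mu i) summable_on {1..} \<longleftrightarrow> (\<lambda>i. (low_modes c l z i)\<^sup>2 / mu i) summable_on {1..<l}"
    by (rule summable_on_cong_neutral) (auto simp: low_modes_def)
  then show ?thesis by (simp add: Hc_def H_iff low_modes_def)
qed

lemma dist_Hc_nonneg: "0 \<le> dist_Hc x y"
  by (rule Metric_space.nonneg[OF Metric_space_Hc])

text \<open>The factor \<open>sqrt 2\<close> compensates Fejer weights that are at least 1/2 below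
  index \<open>l\<close>.\<close>

lemma dist_low_modes_le:
  assumes m: "2 * l \<le> m"
  shows "dist_Hc (low_modes c l z) (low_modes c l w) \<le> sqrt 2 * wnorm (gw m) {1..<m} (\<lambda>i. z i - w i)"
proof (rule power2_le_imp_le)
  let ?d = "\<lambda>i. low_modes c l z i - low_modes c l w i"
  have "(dist_Hc (low_modes c l z) (low_modes c l w))\<^sup>2 = (\<Sum>\<^sub>\<infinity>i\<in>{1..}. (?d i)\<^sup>2 / mu i)"
    unfolding dist_Hc_def by (rule seminorm_H_sq)
  also have "\<dots> = (\<Sum>\<^sub>\<infinity>i\<in>{1..<l}. (?d i)\<^sup>2 / mu i)" by (rule infsum_cong_neutral) (auto simp: low_modes_def)
  also have "\<dots> = (\<Sum>i=1..<l. (?d i)\<^sup>2 / mu i)" by simp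
  also have "\<dots> \<le> (\<Sum>i=1..<l. 2 * (gw m i * (z i - w i)\<^sup>2))"
  proof (rule sum_mono)
    fix i assume i: "i \<in> {1..<l}"
    have "1/2 \<le> fej m i" using i m by (simp add: fej_def field_simps)
    then have "1 \<le> 2 * fej m i" by simp
    then have "1 * ((z i - w i)\<^sup>2 / mu i) \<le> 2 * fej m i * ((z i - w i)\<^sup>2 / mu i)"
      by (intro mult_right_mono) (auto simp: mu_def)
    then show "(?d i)\<^sup>2 / mu i \<le> 2 * (gw m i * (z i - w i)\<^sup>2)" using i by (simp add: low_modes_def gw_def)
  qed
  also have "\<dots> \<le> (\<Sum>i=1..<m. 2 * (gw m i * (z i - w i)\<^sup>2))"
    using m by (intro sum_mono2) (auto simp: gw_nonneg)
  also have "\<dots> = 2 * (wnorm (gw m) {1..<m} (\<lambda>i. z i - w i))\<^sup>2"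
    by (subst wnorm_sq) (auto simp: gw_nonneg sum_distrib_left)
  also have "\<dots> = (sqrt 2 * wnorm (gw m) {1..<m} (\<lambda>i. z i - w i))\<^sup>2" by (simp add: power_mult_distrib)
  finally show "(dist_Hc (low_modes c l z) (low_modes c l w))\<^sup>2 \<le> (sqrt 2 * wnorm (gw m) {1..<m} (\<lambda>i. z i - w i))\<^sup>2" .
qed simp

lemma wnorm_le_dist_Hc:
  assumes "x \<in> Hc c" "y \<in> Hc c"
  shows "wnorm (gw m) {1..<m} (\<lambda>i. x i - y i) \<le> dist_Hc x y"
proof (rule power2_le_imp_le)
  have "(wnorm (gw m) {1..<m} (\<lambda>i. x i - y i))\<^sup>2 = (\<Sum>i=1..<m. gw m i * (x i - y i)\<^sup>2)"
    by (rule wnorm_sq) (auto simp: gw_nonneg)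
  also have "\<dots> \<le> (\<Sum>i=1..<m. (x i - y i)\<^sup>2 / mu i)"
  proof (rule sum_mono)
    fix i
    have "fej m i * ((x i - y i)\<^sup>2 / mu i) \<le> 1 * ((x i - y i)\<^sup>2 / mu i)"
      using fej_bounds(2) by (intro mult_right_mono) (auto simp: mu_def)
    then show "gw m i * (x i - y i)\<^sup>2 \<le> (x i - y i)\<^sup>2 / mu i" by (simp add: gw_def)
  qed
  also have "\<dots> \<le> (dist_Hc x y)\<^sup>2"
    unfolding dist_Hc_def using assms by (intro finite_sum_le_seminorm V_diff) (auto simp: Hc_def)
  finally show "(wnorm (gw m) {1..<m} (\<lambda>i. x i - y i))\<^sup>2 \<le> (dist_Hc x y)\<^sup>2" .
qed (rule dist_Hc_nonneg)

text \<open>The squared distance is the tail of a convergent series.\<close>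

lemma low_modes_tendsto:
  assumes "z \<in> Hc c"
  shows "(\<lambda>l. dist_Hc (low_modes c l z) z) \<longlonglongrightarrow> 0"
proof -
  define g where "g i = (if i = 0 then 0 else (z i)\<^sup>2 / mu i)" for i
  have "(\<lambda>i. (z i)\<^sup>2 / mu i) summable_on {1..}" using assms by (simp add: Hc_def H_iff)
  also have "?this \<longleftrightarrow> g summable_on UNIV" by (rule summable_on_cong_neutral) (auto simp: g_def)
  finally have gs: "g summable_on UNIV" .
  define S where "S = infsum g UNIV"
  have hs: "(g has_sum S) UNIV" using gs by (simp add: S_def)
  have e: "(dist_Hc (low_modes c l z) z)\<^sup>2 = S - (\<Sum>i<l. g i)" for l
  proof -
    have "((\<lambda>i. if i < l then - g i else 0) has_sum (\<Sum>i<l. - g i)) UNIV"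
      by (rule has_sum_finite_neutralI[of "{..<l}"]) auto
    from has_sum_add[OF hs this]
    have "((\<lambda>i. g i + (if i < l then - g i else 0)) has_sum (S - (\<Sum>i<l. g i))) UNIV"
      by (simp add: sum_negf)
    moreover have "(\<Sum>\<^sub>\<infinity>i\<in>{1..}. (low_modes c l z i - z i)\<^sup>2 / mu i) = (\<Sum>\<^sub>\<infinity>i\<in>UNIV. g i + (if i < l then - g i else 0))"
      by (rule infsum_cong_neutral) (auto simp: g_def low_modes_def)
    ultimately show ?thesis unfolding dist_Hc_def seminorm_H_sq by (simp add: infsumI)
  qed
  have "(\<lambda>l. S - (\<Sum>i<l. g i)) \<longlonglongrightarrow> S - S"
    using has_sum_imp_sums[OF hs] by (intro tendsto_intros) (simp add: sums_def)
  then have "(\<lambda>l. sqrt ((dist_Hc (low_modes c l z) z)\<^sup>2)) \<longlonglongrightarrow> sqrt 0"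
    unfolding e by (intro tendsto_real_sqrt) simp
  then show ?thesis by (simp add: dist_Hc_nonneg)
qed

lemma solution_measurable:
  assumes sb: "stochastic_basis M F" and sol: "approx_solution M F W b lam n x X" and T: "0 \<le> T"
  shows "X T \<in> M \<rightarrow>\<^sub>M PiM UNIV (\<lambda>_. borel)" and "\<And>\<omega>. \<omega> \<in> space M \<Longrightarrow> X T \<omega> \<in> H"
proof -
  interpret stochastic_basis M F by fact
  have X: "X T \<in> F T \<rightarrow>\<^sub>M borel_of top_H" using sol T unfolding approx_solution_def by blast
  have "(\<lambda>\<omega>. X T \<omega> i) \<in> borel_measurable M" for i
    by (rule F_measurable_M[OF measurable_compose[OF X continuous_map_borel_measurable[OF continuous_map_coordinate]]])
  then have "(\<lambda>\<omega> i. X T \<omega> i) \<in> M \<rightarrow>\<^sub>M PiM UNIV (\<lambda>_. borel)" by (rule measurable_PiM_single') simp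
  then show "X T \<in> M \<rightarrow>\<^sub>M PiM UNIV (\<lambda>_. borel)" by simp
  show "X T \<omega> \<in> H" if "\<omega> \<in> space M" for \<omega>
    using measurable_space[OF X, of \<omega>] that by (simp add: space_F space_borel_of topspace_H)
qed

context degenerate_noise
begin

context
  fixes M :: "'w measure" and F W and T c L :: real and n :: nat and \<phi> :: "(nat \<Rightarrow> real) \<Rightarrow> real"
  assumes sb: "stochastic_basis M F" and W: "cylindrical_wiener M F W" and T: "0 < T"
    and \<phi>: "\<And>z. z \<in> Hc c \<Longrightarrow> \<bar>\<phi> z\<bar> \<le> 1" "\<And>z w. z \<in> Hc c \<Longrightarrow> w \<in> Hc c \<Longrightarrow> \<bar>\<phi> z - \<phi> w\<bar> \<le> L * dist_Hc z w" and L: "0 \<le> L"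
begin

interpretation stochastic_basis M F by (rule sb)

lemma low_modes_test:
  shows "\<bar>\<phi> (low_modes c l z)\<bar> \<le> 1"
    and "2 * l \<le> m \<Longrightarrow> \<bar>\<phi> (low_modes c l z) - \<phi> (low_modes c l w)\<bar> \<le> sqrt 2 * L * wnorm (gw m) {1..<m} (\<lambda>i. z i - w i)"
    and "(\<lambda>z. \<phi> (low_modes c l z)) \<in> borel_measurable (PiM UNIV (\<lambda>_. borel))"
proof -
  show "\<bar>\<phi> (low_modes c l z)\<bar> \<le> 1" by (rule \<phi>(1)[OF low_modes_Hc])
  have lip: "\<bar>\<phi> (low_modes c l z) - \<phi> (low_modes c l w)\<bar> \<le> sqrt 2 * L * wnorm (gw m) {1..<m} (\<lambda>i. z i - w i)" if "2 * l \<le> m" for z w m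
  proof -
    have "\<bar>\<phi> (low_modes c l z) - \<phi> (low_modes c l w)\<bar> \<le> L * dist_Hc (low_modes c l z) (low_modes c l w)"
      by (rule \<phi>(2)[OF low_modes_Hc low_modes_Hc])
    also have "\<dots> \<le> L * (sqrt 2 * wnorm (gw m) {1..<m} (\<lambda>i. z i - w i))"
      by (rule mult_left_mono[OF dist_low_modes_le[OF that] L])
    finally show ?thesis by (simp only: mult_ac)
  qed
  show "2 * l \<le> m \<Longrightarrow> \<bar>\<phi> (low_modes c l z) - \<phi> (low_modes c l w)\<bar> \<le> sqrt 2 * L * wnorm (gw m) {1..<m} (\<lambda>i. z i - w i)"
    by (rule lip)
  show "(\<lambda>z. \<phi> (low_modes c l z)) \<in> borel_measurable (PiM UNIV (\<lambda>_. borel))"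
    by (rule wnorm_lipschitz_measurable[OF _ lip[OF order_refl]]) (use L in simp)
qed

lemma euler_expectation_converges:
  assumes sol: "approx_solution M F W b lam n x X" and x: "x \<in> Hc c" and e: "0 < e"
  shows "\<exists>m0. \<forall>m\<ge>m0. \<exists>R0. \<forall>R\<ge>R0. \<exists>J0. \<forall>J\<ge>J0.
     \<bar>(LINT \<omega>|M. \<phi> (low_modes c l (X T \<omega>)))
       - (LINT \<omega>|M. \<phi> (low_modes c l (chain (emap n R lam m c (T / real J)) m (grid_noise T (\<lambda>t i. W t (psi b i) \<omega>) J) x J)))\<bar> < e"
proof -
  let ?\<phi> = "\<lambda>z. \<phi> (low_modes c l z)"
  let ?Y = "\<lambda>m R J \<omega>. chain (emap n R lam m c (T / real J)) m (grid_noise T (\<lambda>t i. W t (psi b i) \<omega>) J) x J"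
  \<comment> \<open>Measurability of the chain is available for \<open>J \<ge> 1\<close> only; at
    \<open>J = 0\<close> there is no grid and 0 is a placeholder.\<close>
  define f where "f m R J \<omega> = (if J = 0 then 0 else \<bar>?\<phi> (X T \<omega>) - ?\<phi> (?Y m R J \<omega>)\<bar>)" for m R J \<omega>
  have mX: "(\<lambda>\<omega>. ?\<phi> (X T \<omega>)) \<in> borel_measurable M"
    by (rule measurable_compose[OF solution_measurable(1)[OF sb sol less_imp_le[OF T]] low_modes_test(3)])
  have mY: "(\<lambda>\<omega>. ?\<phi> (?Y m R J \<omega>)) \<in> borel_measurable M" if "1 \<le> J" for m R J
    by (rule measurable_compose[OF euler_measurable[OF sb W T that] low_modes_test(3)])
  have iX: "integrable M (\<lambda>\<omega>. ?\<phi> (X T \<omega>))"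
    by (rule integrable_const_bound[where B=1]) (use low_modes_test(1) mX in auto)
  have iY: "integrable M (\<lambda>\<omega>. ?\<phi> (?Y m R J \<omega>))" if "1 \<le> J" for m R J
    by (rule integrable_const_bound[where B=1]) (use low_modes_test(1) mY[OF that] in auto)
  have "\<exists>m0. \<forall>m\<ge>m0. \<exists>R0. \<forall>R\<ge>R0. \<exists>J0. \<forall>J\<ge>J0. (LINT \<omega>|M. f m R J \<omega>) < e"
  proof (rule iterated_limit_expectation[where B=2, OF _ _ _ _ e])
    show "f m R J \<in> borel_measurable M" for m R J
    proof (cases "J = 0")
      case False
      then have "f m R J = (\<lambda>\<omega>. \<bar>?\<phi> (X T \<omega>) - ?\<phi> (?Y m R J \<omega>)\<bar>)" by (auto simp: f_def)
      moreover have "(\<lambda>\<omega>. \<bar>?\<phi> (X T \<omega>) - ?\<phi> (?Y m R J \<omega>)\<bar>) \<in> borel_measurable M"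
        using False by (intro borel_measurable_abs borel_measurable_diff mX mY) simp
      ultimately show ?thesis by simp
    qed (simp add: f_def[abs_def])
    show "0 \<le> f m R J \<omega>" for m R J \<omega> by (simp add: f_def)
    show "f m R J \<omega> \<le> 2" for m R J \<omega>
      using low_modes_test(1)[of l "X T \<omega>"] low_modes_test(1)[of l "?Y m R J \<omega>"]
        abs_triangle_ineq4[of "?\<phi> (X T \<omega>)" "?\<phi> (?Y m R J \<omega>)"] unfolding f_def by simp
    show "AE \<omega> in M. \<forall>e>0. \<exists>m0. \<forall>m\<ge>m0. \<exists>R0. \<forall>R\<ge>R0. \<exists>J0. \<forall>J\<ge>J0. f m R J \<omega> \<le> e"
      using AE_galerkin_path[OF sb W sol T x]
    proof eventually_elim
      case (elim \<omega>)
      then obtain u where X0: "X 0 \<omega> = x" and gp: "galerkin_path T lam c n (\<lambda>t. X t \<omega>) u (\<lambda>t i. W t (psi b i) \<omega>)" by blast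
      show ?case
      proof (intro allI impI)
        fix r :: real assume r: "0 < r"
        \<comment> \<open>The summand 1 keeps the divisor positive when
          \<open>L = 0\<close>.\<close>
        let ?K = "sqrt 2 * L + 1"
        have K: "0 < ?K" using L by (intro add_nonneg_pos) auto
        then have "0 < (r / ?K)\<^sup>2" using r by simp
        from galerkin_path.chain_converges[OF gp this, unfolded X0]
        obtain m0 where m0: "\<forall>m\<ge>m0. \<exists>R0. \<forall>R\<ge>R0. \<exists>J0. \<forall>J\<ge>J0. (\<Sum>i=1..<m. gw m i * (X T \<omega> i - ?Y m R J \<omega> i)\<^sup>2) \<le> (r / ?K)\<^sup>2"
          by blast
        have small: "f m R J \<omega> \<le> r" if m: "2 * l \<le> m" and s: "(\<Sum>i=1..<m. gw m i * (X T \<omega> i - ?Y m R J \<omega> i)\<^sup>2) \<le> (r / ?K)\<^sup>2" for m R J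
        proof -
          have "(wnorm (gw m) {1..<m} (\<lambda>i. X T \<omega> i - ?Y m R J \<omega> i))\<^sup>2 \<le> (r / ?K)\<^sup>2"
            using s by (subst wnorm_sq) (auto simp: gw_nonneg)
          then have w: "wnorm (gw m) {1..<m} (\<lambda>i. X T \<omega> i - ?Y m R J \<omega> i) \<le> r / ?K"
            by (rule power2_le_imp_le) (use r K in simp)
          have "f m R J \<omega> \<le> \<bar>?\<phi> (X T \<omega>) - ?\<phi> (?Y m R J \<omega>)\<bar>" by (simp add: f_def)
          also have "\<dots> \<le> sqrt 2 * L * wnorm (gw m) {1..<m} (\<lambda>i. X T \<omega> i - ?Y m R J \<omega> i)" by (rule low_modes_test(2)[OF m])
          also have "\<dots> \<le> ?K * (r / ?K)" using w L by (intro mult_mono) auto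
          also have "\<dots> = r" using K by simp
          finally show ?thesis .
        qed
        show "\<exists>m0. \<forall>m\<ge>m0. \<exists>R0. \<forall>R\<ge>R0. \<exists>J0. \<forall>J\<ge>J0. f m R J \<omega> \<le> r"
        proof (rule exI[of _ "max m0 (2 * l)"], intro allI impI)
          fix m assume "max m0 (2 * l) \<le> m"
          then have m: "m0 \<le> m" "2 * l \<le> m" by auto
          show "\<exists>R0. \<forall>R\<ge>R0. \<exists>J0. \<forall>J\<ge>J0. f m R J \<omega> \<le> r" using m0[rule_format, OF m(1)] small[OF m(2)] by meson
        qed
      qed
    qed
  qed
  then obtain m0 where m0: "\<forall>m\<ge>m0. \<exists>R0. \<forall>R\<ge>R0. \<exists>J0. \<forall>J\<ge>J0. (LINT \<omega>|M. f m R J \<omega>) < e" by blast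
  have step: "\<bar>(LINT \<omega>|M. ?\<phi> (X T \<omega>)) - (LINT \<omega>|M. ?\<phi> (?Y m R J \<omega>))\<bar> < e" if J: "1 \<le> J" and f: "(LINT \<omega>|M. f m R J \<omega>) < e" for m R J
  proof -
    have "\<bar>(LINT \<omega>|M. ?\<phi> (X T \<omega>)) - (LINT \<omega>|M. ?\<phi> (?Y m R J \<omega>))\<bar> = \<bar>LINT \<omega>|M. ?\<phi> (X T \<omega>) - ?\<phi> (?Y m R J \<omega>)\<bar>"
      by (simp only: Bochner_Integration.integral_diff[OF iX iY[OF J]])
    also have "\<dots> \<le> (LINT \<omega>|M. \<bar>?\<phi> (X T \<omega>) - ?\<phi> (?Y m R J \<omega>)\<bar>)" by (rule integral_abs_bound)
    also have "\<dots> = (LINT \<omega>|M. f m R J \<omega>)" using J by (simp add: f_def)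
    finally show ?thesis using f by linarith
  qed
  have "\<exists>R0. \<forall>R\<ge>R0. \<exists>J0. \<forall>J\<ge>J0. \<bar>(LINT \<omega>|M. ?\<phi> (X T \<omega>)) - (LINT \<omega>|M. ?\<phi> (?Y m R J \<omega>))\<bar> < e" if m: "m0 \<le> m" for m
  proof -
    obtain R0 where R0: "\<forall>R\<ge>R0. \<exists>J0. \<forall>J\<ge>J0. (LINT \<omega>|M. f m R J \<omega>) < e" using m0 m by blast
    have "\<exists>J0. \<forall>J\<ge>J0. \<bar>(LINT \<omega>|M. ?\<phi> (X T \<omega>)) - (LINT \<omega>|M. ?\<phi> (?Y m R J \<omega>))\<bar> < e" if R: "R0 \<le> R" for R
    proof -
      obtain J0 where "\<forall>J\<ge>J0. (LINT \<omega>|M. f m R J \<omega>) < e" using R0 R by blast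
      then show ?thesis by (intro exI[of _ "max 1 J0"]) (auto intro!: step)
    qed
    then show ?thesis by blast
  qed
  then show ?thesis by blast
qed

text \<open>Both solutions are replaced by chains with the same \<open>m\<close>, \<open>R\<close>
  and \<open>J\<close>, at the price \<open>e / 2\<close> each. The bound for the chains is
  independent of these parameters, so \<open>e\<close> may tend to 0.\<close>

lemma low_modes_gradient:
  assumes sol: "approx_solution M F W b lam n x X" "approx_solution M F W b lam n y Y" and xy: "x \<in> Hc c" "y \<in> Hc c"
    and \<epsilon>: "dist_Hc x y \<le> \<epsilon>" "0 < \<epsilon>" "\<epsilon> \<le> 1"
  shows "(LINT \<omega>|M. \<phi> (low_modes c l (Y T \<omega>))) - (LINT \<omega>|M. \<phi> (low_modes c l (X T \<omega>)))
    \<le> (1 + energy + sqrt 2 * L * exp (- (rate * T / 2))) * \<epsilon>"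
proof (rule field_le_epsilon)
  fix e :: real assume e: "0 < e"
  then have e2: "0 < e / 2" by simp
  let ?\<phi> = "\<lambda>z. \<phi> (low_modes c l z)"
  let ?Z = "\<lambda>x m R J \<omega>. chain (emap n R lam m c (T / real J)) m (grid_noise T (\<lambda>t i. W t (psi b i) \<omega>) J) x J"
  obtain m1 where m1: "\<forall>m\<ge>m1. \<exists>R0. \<forall>R\<ge>R0. \<exists>J0. \<forall>J\<ge>J0. \<bar>(LINT \<omega>|M. ?\<phi> (X T \<omega>)) - (LINT \<omega>|M. ?\<phi> (?Z x m R J \<omega>))\<bar> < e / 2"
    using euler_expectation_converges[OF sol(1) xy(1) e2] by blast
  obtain m2 where m2: "\<forall>m\<ge>m2. \<exists>R0. \<forall>R\<ge>R0. \<exists>J0. \<forall>J\<ge>J0. \<bar>(LINT \<omega>|M. ?\<phi> (Y T \<omega>)) - (LINT \<omega>|M. ?\<phi> (?Z y m R J \<omega>))\<bar> < e / 2"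
    using euler_expectation_converges[OF sol(2) xy(2) e2] by blast
  \<comment> \<open>\<open>2 * l\<close> makes the test function Lipschitz for the weighted norm,
    \<open>2 * (N + 1)\<close> is what the control requires.\<close>
  define m where "m = m1 + m2 + 2 * l + 2 * (N + 1)"
  have m: "m1 \<le> m" "m2 \<le> m" "2 * l \<le> m" "2 * (N + 1) \<le> m" by (auto simp: m_def)
  obtain R1 where R1: "\<forall>R\<ge>R1. \<exists>J0. \<forall>J\<ge>J0. \<bar>(LINT \<omega>|M. ?\<phi> (X T \<omega>)) - (LINT \<omega>|M. ?\<phi> (?Z x m R J \<omega>))\<bar> < e / 2"
    using m1 m(1) by blast
  obtain R2 where R2: "\<forall>R\<ge>R2. \<exists>J0. \<forall>J\<ge>J0. \<bar>(LINT \<omega>|M. ?\<phi> (Y T \<omega>)) - (LINT \<omega>|M. ?\<phi> (?Z y m R J \<omega>))\<bar> < e / 2"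
    using m2 m(2) by blast
  define R where "R = R1 + R2"
  obtain J1 where J1: "\<forall>J\<ge>J1. \<bar>(LINT \<omega>|M. ?\<phi> (X T \<omega>)) - (LINT \<omega>|M. ?\<phi> (?Z x m R J \<omega>))\<bar> < e / 2"
    using R1 le_add1[of R1 R2] unfolding R_def by blast
  obtain J2 where J2: "\<forall>J\<ge>J2. \<bar>(LINT \<omega>|M. ?\<phi> (Y T \<omega>)) - (LINT \<omega>|M. ?\<phi> (?Z y m R J \<omega>))\<bar> < e / 2"
    using R2 le_add2[of R2 R1] unfolding R_def by blast
  obtain h0 where h0: "0 < h0" "\<forall>h. 0 < h \<longrightarrow> h \<le> h0 \<longrightarrow> (\<exists>K. controlled_chain (emap n R lam m c h) (\<lambda>i. sqrt (h * b i)) [1..<m] (gw m) {1..<m}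
      (control h) (1 - h * rate) energy K)"
    using controlled_chain_emap[OF m(4), of n R c] by blast
  obtain J3 :: nat where J3: "T / h0 < real J3" using reals_Archimedean2 by blast
  define J where "J = Suc (J1 + J2 + J3)"
  have J: "1 \<le> J" "J1 \<le> J" "J2 \<le> J" "real J3 \<le> real J" by (auto simp: J_def)
  let ?h = "T / real J"
  have h: "0 < ?h" "?h \<le> h0"
  proof -
    show "0 < ?h" using T J by simp
    have "T < real J3 * h0" using J3 h0 by (simp add: pos_divide_less_eq)
    also have "\<dots> \<le> real J * h0" using J h0 by (intro mult_right_mono) auto
    finally show "?h \<le> h0" using J by (simp add: field_simps)
  qed
  obtain K where cc: "controlled_chain (emap n R lam m c ?h) (\<lambda>i. sqrt (?h * b i)) [1..<m] (gw m) {1..<m} (control ?h) (1 - ?h * rate) energy K"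
    using h0(2) h by blast
  have bl: "blip (wnorm (gw m) {1..<m}) ?\<phi>"
    unfolding blip_def using low_modes_test(1) low_modes_test(2)[OF m(3)] L
    by (intro conjI exI[of _ "1::real"] exI[of _ "sqrt 2 * L"]) auto
  have "(LINT \<omega>|M. ?\<phi> (?Z y m R J \<omega>)) - (LINT \<omega>|M. ?\<phi> (?Z x m R J \<omega>))
    = (qop (emap n R lam m c ?h) (\<lambda>i. sqrt (?h * b i)) [1..<m] ^^ J) ?\<phi> y - (qop (emap n R lam m c ?h) (\<lambda>i. sqrt (?h * b i)) [1..<m] ^^ J) ?\<phi> x"
    unfolding euler_law[OF sb W T J(1) cc bl] ..
  also have "\<dots> \<le> (1 + energy + sqrt 2 * L * sqrt (1 - ?h * rate) ^ J) * \<epsilon>"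
    by (rule controlled_chain.Qpow_diff_le[OF cc low_modes_test(1) low_modes_test(2)[OF m(3)] _ order_trans[OF wnorm_le_dist_Hc[OF xy] \<epsilon>(1)] \<epsilon>(2,3)])
      (use L in simp)
  also have "\<dots> \<le> (1 + energy + sqrt 2 * L * exp (- (rate * T / 2))) * \<epsilon>"
  proof (intro mult_right_mono add_left_mono mult_left_mono)
    show "sqrt (1 - ?h * rate) ^ J \<le> exp (- (rate * T / 2))" by (rule rate_power) (use J controlled_chain.a[OF cc] in linarith)+
  qed (use L \<epsilon> in simp_all)
  finally show "(LINT \<omega>|M. ?\<phi> (Y T \<omega>)) - (LINT \<omega>|M. ?\<phi> (X T \<omega>)) \<le> (1 + energy + sqrt 2 * L * exp (- (rate * T / 2))) * \<epsilon> + e"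
    using J1[rule_format, OF J(2)] J2[rule_format, OF J(3)] by linarith
qed

text \<open>Dominated convergence. The final time is the case \<open>q = 1\<close> of the conserved
  average, so the solution lies in \<open>Hc c\<close> almost surely and the default value 0 occurs
  only on a null set.\<close>

lemma low_modes_expectation_tendsto:
  assumes sol: "approx_solution M F W b lam n x X" and x: "x \<in> Hc c"
  shows "(\<lambda>l. LINT \<omega>|M. \<phi> (low_modes c l (X T \<omega>))) \<longlonglongrightarrow> (LINT \<omega>|M. (if X T \<omega> \<in> Hc c then \<phi> (X T \<omega>) else 0))"
proof -
  have T0: "0 \<le> T" using T by simp
  note XT = solution_measurable[OF sb sol T0]
  have m: "(\<lambda>\<omega>. \<phi> (low_modes c l (X T \<omega>))) \<in> borel_measurable M" for l
    by (rule measurable_compose[OF XT(1) low_modes_test(3)])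
  have conv: "(\<lambda>l. \<phi> (low_modes c l z)) \<longlonglongrightarrow> \<phi> z" if "z \<in> Hc c" for z
  proof (rule LIM_zero_cancel, rule Lim_null_comparison)
    show "(\<lambda>l. L * dist_Hc (low_modes c l z) z) \<longlonglongrightarrow> 0" using tendsto_mult_right_zero[OF low_modes_tendsto[OF that]] .
    show "\<forall>\<^sub>F l in sequentially. norm (\<phi> (low_modes c l z) - \<phi> z) \<le> L * dist_Hc (low_modes c l z) z"
      using \<phi>(2)[OF low_modes_Hc that] by (intro always_eventually) simp
  qed
  let ?f = "\<lambda>\<omega>. if X T \<omega> \<in> Hc c then \<phi> (X T \<omega>) else 0"
  have "?f \<in> borel_measurable M"
  proof (rule borel_measurable_LIMSEQ_real)
    have "(\<lambda>\<omega>. X T \<omega> 0) \<in> borel_measurable M"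
      by (rule measurable_compose[OF XT(1) measurable_component_singleton]) simp
    then have "{\<omega> \<in> space M. X T \<omega> 0 = c} \<in> events" by measurable
    then show "(\<lambda>\<omega>. if X T \<omega> 0 = c then \<phi> (low_modes c l (X T \<omega>)) else 0) \<in> borel_measurable M" for l
      by (intro measurable_If m) auto
    show "(\<lambda>l. if X T \<omega> 0 = c then \<phi> (low_modes c l (X T \<omega>)) else 0) \<longlonglongrightarrow> ?f \<omega>" if "\<omega> \<in> space M" for \<omega>
      using XT(2)[OF that] conv[of "X T \<omega>"] by (auto simp: Hc_def)
  qed
  then show ?thesis
  proof (rule integral_dominated_convergence[OF _ m, where w="\<lambda>_. 1"])
    show "AE \<omega> in M. (\<lambda>l. \<phi> (low_modes c l (X T \<omega>))) \<longlonglongrightarrow> ?f \<omega>"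
      using AE_galerkin_path[OF sb W sol T x] AE_space
    proof eventually_elim
      case (elim \<omega>)
      then obtain u where gp: "galerkin_path T lam c n (\<lambda>t. X t \<omega>) u (\<lambda>t i. W t (psi b i) \<omega>)" by blast
      have "X T \<omega> \<in> Hc c" using galerkin_path.avg[OF gp, of 1] XT(2)[OF elim(2)] by (simp add: Hc_def)
      then show ?case using conv by simp
    qed
  qed (use low_modes_test(1) in auto)
qed

end

proposition approx_semigroup_gradient:
  assumes sb: "stochastic_basis M F" and W: "cylindrical_wiener M F W" and T: "0 < T"
    and \<phi>: "\<And>z. z \<in> Hc c \<Longrightarrow> \<bar>\<phi> z\<bar> \<le> 1" "\<And>z w. z \<in> Hc c \<Longrightarrow> w \<in> Hc c \<Longrightarrow> \<bar>\<phi> z - \<phi> w\<bar> \<le> L * dist_Hc z w" and L: "0 \<le> L"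
    and sol: "approx_solution M F W b lam n x (X n x)" "approx_solution M F W b lam n y (X n y)" and xy: "x \<in> Hc c" "y \<in> Hc c"
    and \<epsilon>: "dist_Hc x y \<le> \<epsilon>" "0 < \<epsilon>" "\<epsilon> \<le> 1"
  shows "approx_semigroup M X n c T \<phi> y - approx_semigroup M X n c T \<phi> x \<le> (1 + energy + sqrt 2 * L * exp (- (rate * T / 2))) * \<epsilon>"
proof (rule LIMSEQ_le_const2)
  note ctx = sb W T \<phi> L
  show "(\<lambda>l. (LINT \<omega>|M. \<phi> (low_modes c l (X n y T \<omega>))) - (LINT \<omega>|M. \<phi> (low_modes c l (X n x T \<omega>))))
    \<longlonglongrightarrow> approx_semigroup M X n c T \<phi> y - approx_semigroup M X n c T \<phi> x"
    unfolding approx_semigroup_def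
    by (intro tendsto_diff low_modes_expectation_tendsto[OF ctx sol(2) xy(2)] low_modes_expectation_tendsto[OF ctx sol(1) xy(1)])
  show "\<exists>l0. \<forall>l\<ge>l0. (LINT \<omega>|M. \<phi> (low_modes c l (X n y T \<omega>))) - (LINT \<omega>|M. \<phi> (low_modes c l (X n x T \<omega>)))
    \<le> (1 + energy + sqrt 2 * L * exp (- (rate * T / 2))) * \<epsilon>"
    using low_modes_gradient[OF ctx sol xy \<epsilon>] by blast
qed

end

section \<open>The asymptotic strong Feller property\<close>

text \<open>For distinct points the value is exactly 1 as soon as \<open>n\<close> reaches the
  reciprocal of their distance.\<close>

lemma totally_separating_dist_Hc: "totally_separating (top_Hc c) (\<lambda>n x y. min 1 (real n * dist_Hc x y))"
proof -
  interpret Metric_space "Hc c" dist_Hc by (rule Metric_space_Hc)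
  have cont: "continuous_map (prod_topology (top_Hc c) (top_Hc c)) euclideanreal (\<lambda>(x, y). dist_Hc x y)"
    using continuous_map_metric[of "metric (Hc c, dist_Hc)"] by (simp add: top_Hc_def)
  show ?thesis
    unfolding totally_separating_def pseudo_metric_def topspace_Hc
  proof (intro conjI ballI allI impI)
    fix n
    have "continuous_map euclideanreal euclideanreal (\<lambda>t. min 1 (real n * t))"
      by (simp add: continuous_intros)
    from continuous_map_compose[OF cont this]
    show "continuous_map (prod_topology (top_Hc c) (top_Hc c)) euclideanreal (\<lambda>(x, y). min 1 (real n * dist_Hc x y))"
      by (simp add: comp_def case_prod_beta')
    fix x y assume xy: "x \<in> Hc c" "y \<in> Hc c"
    show "0 \<le> min 1 (real n * dist_Hc x y)" by (simp add: dist_Hc_nonneg)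
    show "min 1 (real n * dist_Hc x y) = min 1 (real n * dist_Hc y x)" by (simp only: commute)
    fix z assume z: "z \<in> Hc c"
    have "real n * dist_Hc x z \<le> real n * dist_Hc x y + real n * dist_Hc y z"
      unfolding distrib_left[symmetric] by (intro mult_left_mono triangle xy z) simp
    moreover have "min 1 s \<le> min 1 p + min 1 q" if "s \<le> p + q" "0 \<le> p" "0 \<le> q" for s p q :: real
      using that by linarith
    ultimately show "min 1 (real n * dist_Hc x z) \<le> min 1 (real n * dist_Hc x y) + min 1 (real n * dist_Hc y z)"
      by (simp add: dist_Hc_nonneg)
  next
    fix x assume "x \<in> Hc c"
    then show "min 1 (real n * dist_Hc x x) = 0" for n by simp
  next
    fix x y assume xy: "x \<in> Hc c" "y \<in> Hc c"
    show "incseq (\<lambda>n. min 1 (real n * dist_Hc x y))"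
      by (intro incseq_SucI min.mono order_refl mult_right_mono) (auto simp: dist_Hc_nonneg)
    assume "x \<noteq> y"
    then have d: "0 < dist_Hc x y" using xy by simp
    obtain n0 :: nat where n0: "1 / dist_Hc x y < real n0" using reals_Archimedean2 by blast
    show "(\<lambda>n. min 1 (real n * dist_Hc x y)) \<longlonglongrightarrow> 1"
    proof (intro tendsto_eventually eventually_sequentiallyI[of n0])
      fix n assume "n0 \<le> n"
      then have "1 / dist_Hc x y \<le> real n" using n0 by linarith
      then have "1 \<le> real n * dist_Hc x y" using d by (simp add: field_simps)
      then show "min 1 (real n * dist_Hc x y) = 1" by simp
    qed
  qed
qed

lemma limit_semigroup_prob:
  assumes "limit_semigroup M X c P" "0 \<le> t" "x \<in> Hc c"
  shows "prob_space (P t x)" "sets (P t x) = sets (borel_of (top_Hc c))"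
proof -
  have "P t \<in> borel_of (top_Hc c) \<rightarrow>\<^sub>M prob_algebra (borel_of (top_Hc c))"
    using assms unfolding limit_semigroup_def markov_semigroup_def by blast
  from measurable_space[OF this, of x] have "P t x \<in> space (prob_algebra (borel_of (top_Hc c)))"
    using assms by (simp add: space_borel_of topspace_Hc)
  then show "prob_space (P t x)" "sets (P t x) = sets (borel_of (top_Hc c))" by (auto simp: space_prob_algebra)
qed

lemma lipschitz_borel_measurable:
  assumes "0 \<le> L" "\<And>z w. z \<in> Hc c \<Longrightarrow> w \<in> Hc c \<Longrightarrow> \<bar>\<phi> z - \<phi> w\<bar> \<le> L * dist_Hc z w"
  shows "\<phi> \<in> borel_measurable (borel_of (top_Hc c))"
  unfolding top_Hc_def by (rule continuous_map_borel_measurable[OF metric_lipschitz_continuous_map[OF Metric_space_Hc assms]])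

context degenerate_noise
begin

text \<open>A bound without \<open>n\<close> survives the passage to the limit along any
  subsequence.\<close>

lemma limit_semigroup_gradient:
  assumes sb: "stochastic_basis M F" and W: "cylindrical_wiener M F W" and sol: "\<And>n x. x \<in> H \<Longrightarrow> approx_solution M F W b lam n x (X n x)"
    and P: "limit_semigroup M X c P" and T: "0 < T"
    and \<phi>: "\<And>z. z \<in> Hc c \<Longrightarrow> \<bar>\<phi> z\<bar> \<le> 1" "\<And>z w. z \<in> Hc c \<Longrightarrow> w \<in> Hc c \<Longrightarrow> \<bar>\<phi> z - \<phi> w\<bar> \<le> L * dist_Hc z w" and L: "0 \<le> L"
    and xy: "x \<in> Hc c" "y \<in> Hc c" and \<epsilon>: "dist_Hc x y \<le> \<epsilon>" "0 < \<epsilon>" "\<epsilon> \<le> 1"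
  shows "(LINT z|P T y. \<phi> z) - (LINT z|P T x. \<phi> z) \<le> (1 + energy + sqrt 2 * L * exp (- (rate * T / 2))) * \<epsilon>"
proof -
  have "\<phi> \<in> bounded_borel (top_Hc c)"
    unfolding bounded_borel_def topspace_Hc using lipschitz_borel_measurable[OF L \<phi>(2)] \<phi>(1)
    by (auto intro!: boundedI[where B=1])
  then obtain r :: "nat \<Rightarrow> nat" where r: "\<And>x. x \<in> Hc c \<Longrightarrow> (\<lambda>k. approx_semigroup M X (r k) c T \<phi> x) \<longlonglongrightarrow> (LINT z|P T x. \<phi> z)"
    using P T unfolding limit_semigroup_def by (metis less_imp_le)
  have H: "x \<in> H" "y \<in> H" using xy by (auto simp: Hc_def)
  show ?thesis
  proof (rule LIMSEQ_le_const2[OF tendsto_diff[OF r[OF xy(2)] r[OF xy(1)]]])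
    show "\<exists>k0. \<forall>k\<ge>k0. approx_semigroup M X (r k) c T \<phi> y - approx_semigroup M X (r k) c T \<phi> x
      \<le> (1 + energy + sqrt 2 * L * exp (- (rate * T / 2))) * \<epsilon>"
    proof (intro exI allI impI)
      show "approx_semigroup M X (r k) c T \<phi> y - approx_semigroup M X (r k) c T \<phi> x
        \<le> (1 + energy + sqrt 2 * L * exp (- (rate * T / 2))) * \<epsilon>" for k
        by (rule approx_semigroup_gradient[OF sb W T _ _ L sol[OF H(1)] sol[OF H(2)] xy \<epsilon>]) (fact \<phi>)+
    qed
  qed
qed

text \<open>The time grows linearly in \<open>n\<close>, so that the decay
  \<open>exp (- (real n + 1))\<close> outweighs the Lipschitz constant \<open>n\<close> of the test
  functions.\<close>

lemma wasserstein_le: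
  assumes sb: "stochastic_basis M F" and W: "cylindrical_wiener M F W" and sol: "\<And>n x. x \<in> H \<Longrightarrow> approx_solution M F W b lam n x (X n x)"
    and P: "limit_semigroup M X c P" and xy: "x \<in> Hc c" "y \<in> Hc c" and r: "dist_Hc x y \<le> r" "0 < r" "r \<le> 1"
    and T: "T = (real n + 1) * 2 / rate"
  shows "wasserstein (top_Hc c) (\<lambda>x y. min 1 (real n * dist_Hc x y)) (P T x) (P T y) \<le> ereal ((1 + energy + sqrt 2) * r)"
  unfolding wasserstein_def
proof (rule SUP_least)
  fix \<psi> :: "(nat \<Rightarrow> real) \<Rightarrow> real"
  assume "\<psi> \<in> {\<psi>. \<forall>x\<in>topspace (top_Hc c). \<forall>y\<in>topspace (top_Hc c). \<bar>\<psi> x - \<psi> y\<bar> \<le> min 1 (real n * dist_Hc x y)}"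
  then have \<psi>: "\<bar>\<psi> z - \<psi> w\<bar> \<le> min 1 (real n * dist_Hc z w)" if "z \<in> Hc c" "w \<in> Hc c" for z w
    using that by (auto simp: topspace_Hc)
  \<comment> \<open>Subtracting the value at \<open>x\<close> changes no difference of integrals
    against probability measures, and it yields the bound 1 because the pseudo-metric is
    capped.\<close>
  define \<phi> where "\<phi> z = \<psi> z - \<psi> x" for z
  have \<phi>: "\<bar>\<phi> z\<bar> \<le> 1" "\<bar>\<phi> z - \<phi> w\<bar> \<le> real n * dist_Hc z w" if "z \<in> Hc c" "w \<in> Hc c" for z w
    using \<psi>[OF that(1) xy(1)] \<psi>[OF that] by (auto simp: \<phi>_def)
  have T0: "0 < T" unfolding T using rate_pos by (intro divide_pos_pos mult_pos_pos) auto
  have int: "(LINT z|P T w. \<psi> z) = (LINT z|P T w. \<phi> z) + \<psi> x" if w: "w \<in> Hc c" for w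
  proof -
    note Pw = limit_semigroup_prob[OF P less_imp_le[OF T0] w]
    interpret prob_space "P T w" by (rule Pw(1))
    have "\<phi> \<in> borel_measurable (borel_of (top_Hc c))" by (rule lipschitz_borel_measurable[OF _ \<phi>(2)]) auto
    then have m: "\<phi> \<in> borel_measurable (P T w)" using measurable_cong_sets[OF Pw(2) refl] by blast
    have "space (P T w) = Hc c" using sets_eq_imp_space_eq[OF Pw(2)] by (simp add: space_borel_of topspace_Hc)
    then have "integrable (P T w) \<phi>"
      using \<phi>(1) m by (intro integrable_const_bound[where B=1]) (auto intro!: AE_I2)
    then have "(LINT z|P T w. \<phi> z + \<psi> x) = (LINT z|P T w. \<phi> z) + \<psi> x" using prob_space by simp
    then show ?thesis by (simp add: \<phi>_def)
  qed
  have "(LINT z|P T x. \<psi> z) - (LINT z|P T y. \<psi> z) = (LINT z|P T x. \<phi> z) - (LINT z|P T y. \<phi> z)"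
    unfolding int[OF xy(1)] int[OF xy(2)] by simp
  also have "\<dots> \<le> (1 + energy + sqrt 2 * real n * exp (- (rate * T / 2))) * r"
  proof (rule limit_semigroup_gradient[OF sb W sol P T0 _ _ _ xy(2,1) _ r(2,3)])
    show "dist_Hc y x \<le> r" using r(1) Metric_space.commute[OF Metric_space_Hc, of y x] by simp
  qed (use \<phi> in auto)
  also have "\<dots> \<le> (1 + energy + sqrt 2) * r"
  proof (intro mult_right_mono add_left_mono)
    have "rate * T / 2 = real n + 1" using rate_pos by (simp add: T)
    moreover have "real n * exp (- (real n + 1)) \<le> 1"
    proof -
      have "real n \<le> exp (real n + 1)" using exp_ge_add_one_self[of "real n + 1"] by linarith
      then have "real n * exp (- (real n + 1)) \<le> exp (real n + 1) * exp (- (real n + 1))" by (intro mult_right_mono) auto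
      then show ?thesis by (simp only: exp_add[symmetric] add.right_inverse exp_zero)
    qed
    ultimately have "real n * exp (- (rate * T / 2)) \<le> 1" by (simp only:)
    then have "sqrt 2 * (real n * exp (- (rate * T / 2))) \<le> sqrt 2 * 1" by (intro mult_left_mono) simp_all
    then show "sqrt 2 * real n * exp (- (rate * T / 2)) \<le> sqrt 2" by (simp only: mult.assoc mult_1_right)
  qed (use r in simp)
  finally show "ereal ((LINT z|P T x. \<psi> z) - (LINT z|P T y. \<psi> z)) \<le> ereal ((1 + energy + sqrt 2) * r)" by simp
qed

proposition asymptotically_strong_feller_limit:
  assumes sb: "stochastic_basis M F" and W: "cylindrical_wiener M F W" and sol: "\<And>n x. x \<in> H \<Longrightarrow> approx_solution M F W b lam n x (X n x)"
    and P: "limit_semigroup M X c P"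
  shows "asymptotically_strong_feller (top_Hc c) P"
  unfolding asymptotically_strong_feller_def
proof
  fix x assume "x \<in> topspace (top_Hc c)"
  then have x: "x \<in> Hc c" by (simp add: topspace_Hc)
  define d where "d n x y = min 1 (real n * dist_Hc x y)" for n :: nat and x y
  define t where "t n = (real n + 1) * 2 / rate" for n :: nat
  define K where "K = 1 + energy + sqrt 2"
  have K: "0 < K" unfolding K_def using energy_nonneg by (intro add_nonneg_pos) auto
  let ?G = "\<lambda>U. limsup (\<lambda>n. SUP y\<in>U. wasserstein (top_Hc c) (d n) (P (t n) x) (P (t n) y))"
  have "(INF U\<in>{U. openin (top_Hc c) U \<and> x \<in> U}. ?G U) = 0"
  proof (rule antisym)
    show "(INF U\<in>{U. openin (top_Hc c) U \<and> x \<in> U}. ?G U) \<le> 0"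
    proof (rule ereal_le_epsilon2)
      fix e :: real assume e: "0 < e"
      define r where "r = min 1 (e / K)"
      have r: "0 < r" "r \<le> 1" "K * r \<le> e"
      proof -
        show "0 < r" "r \<le> 1" using e K by (auto simp: r_def)
        have "K * r \<le> K * (e / K)" using K by (intro mult_left_mono) (auto simp: r_def)
        then show "K * r \<le> e" using K by simp
      qed
      interpret Metric_space "Hc c" dist_Hc by (rule Metric_space_Hc)
      have "(INF U\<in>{U. openin (top_Hc c) U \<and> x \<in> U}. ?G U) \<le> ?G (mball x r)"
        by (rule INF_lower) (use x r in \<open>simp add: top_Hc_def\<close>)
      also have "\<dots> \<le> ereal (K * r)"
      proof (rule Limsup_bounded, rule always_eventually, intro allI SUP_least)
        fix n y assume "y \<in> mball x r"
        then have "y \<in> Hc c" "dist_Hc x y \<le> r" by auto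
        then show "wasserstein (top_Hc c) (d n) (P (t n) x) (P (t n) y) \<le> ereal (K * r)"
          unfolding d_def K_def t_def by (intro wasserstein_le[OF sb W sol P x _ _ r(1,2) refl])
      qed
      also have "\<dots> \<le> 0 + ereal e" using r by simp
      finally show "(INF U\<in>{U. openin (top_Hc c) U \<and> x \<in> U}. ?G U) \<le> 0 + ereal e" .
    qed
    \<comment> \<open>Every neighbourhood contains \<open>x\<close> itself, where the test function
      0 already gives the value 0.\<close>
    show "0 \<le> (INF U\<in>{U. openin (top_Hc c) U \<and> x \<in> U}. ?G U)"
    proof (rule INF_greatest)
      fix U assume "U \<in> {U. openin (top_Hc c) U \<and> x \<in> U}"
      then have U: "x \<in> U" by simp
      show "0 \<le> ?G U"
      proof (rule le_Limsup[OF sequentially_bot always_eventually], rule allI, rule SUP_upper2[OF U])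
        fix n
        show "0 \<le> wasserstein (top_Hc c) (d n) (P (t n) x) (P (t n) x)"
          unfolding wasserstein_def
          by (rule SUP_upper2[of "\<lambda>_. 0"]) (auto simp: d_def dist_Hc_nonneg)
      qed
    qed
  qed
  moreover have "totally_separating (top_Hc c) d" unfolding d_def[abs_def] by (rule totally_separating_dist_Hc)
  moreover have "\<forall>n. 0 < t n" unfolding t_def using rate_pos by (intro allI divide_pos_pos mult_pos_pos) auto
  ultimately show "\<exists>d t. totally_separating (top_Hc c) d \<and> (\<forall>n. t n > 0) \<and>
        (INF U\<in>{U. openin (top_Hc c) U \<and> x \<in> U}. limsup (\<lambda>n :: nat. SUP y\<in>U. wasserstein (top_Hc c) (d n) (P (t n) x) (P (t n) y))) = 0"
    by blast
qed

end

lemma diag_op_cong: "(\<And>k. 1 \<le> k \<Longrightarrow> a k = a' k) \<Longrightarrow> diag_op a = diag_op a'"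
  unfolding diag_op_def by (intro ext arg_cong2[where f="(\<and>)"] refl) simp

theorem proposition3p3:
  fixes M :: "'w measure" and F :: "real \<Rightarrow> 'w measure"
    and W :: "real \<Rightarrow> (real \<Rightarrow> real) \<Rightarrow> 'w \<Rightarrow> real"
    and b :: "nat \<Rightarrow> real" and lam c :: real and N :: nat
    and X :: "nat \<Rightarrow> (nat \<Rightarrow> real) \<Rightarrow> real \<Rightarrow> 'w \<Rightarrow> nat \<Rightarrow> real"
    and P :: "real \<Rightarrow> (nat \<Rightarrow> real) \<Rightarrow> (nat \<Rightarrow> real) measure"
  assumes "stochastic_basis M F"
    and "cylindrical_wiener M F W"
    and "\<forall>k\<ge>1. b k \<ge> 0"
    and "finite_trace_minus1 b"
    and "\<forall>n. \<forall>x\<in>H. approx_solution M F W b lam n x (X n x)"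
    and "\<forall>k\<in>{1..N}. b k > 0"
    and "1/2 * (real N + 1)\<^sup>2 - lam > 0"
    and "c \<in> {-1<..<1}"
    and "limit_semigroup M X c P"
  shows "asymptotically_strong_feller (top_Hc c) P"
proof -
  \<comment> \<open>No sign is prescribed for \<open>b 0\<close>. Setting this entry to 0 makes all
    entries nonnegative, and the series in \<open>diag_op\<close> starts at index 1, so the operator
    stays the same.\<close>
  define a where "a k = (if k = 0 then 0 else b k)" for k
  interpret degenerate_noise a lam N
  proof
    show "0 \<le> a k" for k using assms(3) by (simp add: a_def)
    show "0 < a k" if "1 \<le> k" "k \<le> N" for k using assms(6) that by (simp add: a_def)
    show "lam < (real N + 1)\<^sup>2 / 2" using assms(7) by simp
  qed
  have "diag_op (\<lambda>k. sqrt (b k)) = diag_op (\<lambda>k. sqrt (a k))" by (rule diag_op_cong) (simp add: a_def)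
  then have "approx_solution M F W a lam n x (X n x)" if "x \<in> H" for n x
    using assms(5) that unfolding approx_solution_def by simp
  then show ?thesis by (rule asymptotically_strong_feller_limit[OF assms(1,2) _ assms(9)])
qed

end
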